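(* Let $n_1,n_2,n_3\ge 0$ be integers, let $X=\mathbb{P}^{n_1}\times\mathbb{P}^{n_2}\times\mathbb{P}^{n_3}$ (over $\mathbb{C}$), and let $r$ be a positive integer with $$r\le\min\{(n_1+1)(n_2+1),\ (n_1+1)(n_3+1),\ (n_2+1)(n_3+1)\}.$$ Let $[I]\in\mathrm{Hilb}_{S[X]}^{h_{r,X}}$ and let $K=I+(S[X]_{(1,0,0)})^s+(S[X]_{(0,1,0)})^t+(S[X]_{(0,0,1)})^u$ for positive integers $s,t,u$. If $[I]\in\mathrm{Slip}_{r,X}$ and $s,t,u\ge 2$, then $$\dim_{\mathbb{C}}\mathrm{Hom}_{S[X]}(K,S[X]/K)_{\mathbf{0}}\ \ge\ \dim\mathrm{Slip}_{r,X}=r(n_1+n_2+n_3).$$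
   Context: $S[X]=\mathbb{C}[\alpha_0,\dots,\alpha_{n_1},\beta_0,\dots,\beta_{n_2},\gamma_0,\dots,\gamma_{n_3}]$ is the $\mathbb{Z}^3$-graded Cox ring of $X$ with $\deg\alpha_i=(1,0,0)$, $\deg\beta_j=(0,1,0)$, $\deg\gamma_k=(0,0,1)$. For a graded piece $S[X]_{\mathbf u}$, $(S[X]_{\mathbf u})$ denotes the ideal it generates, and $(S[X]_{\mathbf u})^s$ its $s$-th power. $B_X=(S[X]_{(1,1,1)})$ is the irrelevant ideal; an ideal $J$ is $B_X$-saturated if $(J:B_X)=J$. The Hilbert function of a $\mathbb{Z}^3$-graded module $M$ is $H_M(\mathbf u)=\dim_{\mathbb{C}}M_{\mathbf u}$. Put $h_{r,X}(\mathbf u)=\min\{r,\dim_{\mathbb{C}}S[X]_{\mathbf u}\}$. For $h:\mathbb{Z}^3\to\mathbb{N}$, $\mathrm{Hilb}_{S[X]}^{h}$ is the multigraded Hilbert scheme of Haiman–Sturmfels: the projective scheme representing the functor sending a $\mathbb{C}$-algebra $R$ to the set of homogeneous ideals $I\subseteq R\otimes_{\mathbb{C}}S[X]$ such that each $(R\otimes S[X]/I)_{\mathbf u}$ is locally free of rank $h(\mathbf u)$ over $R$. Its closed points $[I]$ correspond to $\mathbb{Z}^3$-homogeneous ideals $I\subseteq S[X]$ with $H_{S[X]/I}=h$. $\mathrm{Slip}_{r,X}$ is the Zariski closure in $\mathrm{Hilb}_{S[X]}^{h_{r,X}}$ of the set of points $[I]$ such that $I$ is radical and $B_X$-saturated.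 $\mathrm{Hom}_{S[X]}(K,S[X]/K)_{\mathbf 0}$ is the space of $S[X]$-module homomorphisms $K\to S[X]/K$ that preserve the $\mathbb{Z}^3$-degree. *)

theory Defs
  imports
    "HOL-Analysis.Abstract_Topology"
    "HOL-Library.Poly_Mapping"
    "HOL-Library.Set_Algebras"
    "HOL-Library.Function_Algebras"
    "HOL-Library.Extended_Real"
    "HOL-Library.Cardinality"
begin

text \<open>In a commutative ring, \<open>ideal.subspace\<close> and \<open>ideal.span\<close> are \<open>is an ideal\<close> and
  \<open>ideal generated by\<close>.\<close>

global_interpretation ideal: module "(*) :: 'a::comm_ring_1 \<Rightarrow> 'a \<Rightarrow> 'a"
  by unfold_locales (simp_all add: algebra_simps)

text \<open>\<open>J ^ s\<close> is taken in the multiplicative monoid of subsets: the set of all products of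
  \<open>s\<close> elements of \<open>J\<close>.\<close>

definition ideal_power :: "'a::comm_ring_1 set \<Rightarrow> nat \<Rightarrow> 'a set" where
  "ideal_power J s = ideal.span (J ^ s)"

definition ideal_colon :: "'a::comm_ring_1 set \<Rightarrow> 'a set \<Rightarrow> 'a set" where
  "ideal_colon J B = {f. \<forall>b\<in>B. f * b \<in> J}"

definition radical_ideal :: "'a::comm_ring_1 set \<Rightarrow> bool" where
  "radical_ideal J \<longleftrightarrow> ideal.subspace J \<and> (\<forall>f n. f ^ n \<in> J \<longrightarrow> f \<in> J)"

text \<open>The dimension of \<open>V / (V \<inter> W)\<close>, for subspaces \<open>V\<close> and \<open>W\<close> of one complex vector space, as
  the supremum of the lengths of families in \<open>V\<close> that are linearly independent modulo \<open>W\<close>.\<close>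

definition dim_quotient ::
    "(complex \<Rightarrow> 'v \<Rightarrow> 'v) \<Rightarrow> 'v::comm_monoid_add set \<Rightarrow> 'v set \<Rightarrow> enat" where
  "dim_quotient scale V W = Sup {enat n | n. \<exists>v :: nat \<Rightarrow> 'v. (\<forall>i<n. v i \<in> V) \<and>
     (\<forall>c. (\<Sum>i<n. scale (c i) (v i)) \<in> W \<longrightarrow> (\<forall>i<n. c i = 0))}"

datatype ('a, 'b, 'c) var = Alpha 'a | Beta 'b | Gamma 'c

text \<open>\<open>('a, 'b, 'c, 'r) cox\<close> is the polynomial ring over \<open>'r\<close> in the variables
  \<open>\<alpha>\<^sub>i\<close>, \<open>\<beta>\<^sub>j\<close>, \<open>\<gamma>\<^sub>k\<close>, indexed by the finite types \<open>'a\<close>, \<open>'b\<close>, \<open>'c\<close>; so \<open>S[X]\<close> for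
  \<open>X = \<P>\<^sup>n\<^sup>1 \<times> \<P>\<^sup>n\<^sup>2 \<times> \<P>\<^sup>n\<^sup>3\<close> is the case \<open>'r = complex\<close> with \<open>n1 + 1\<close>, \<open>n2 + 1\<close>, \<open>n3 + 1\<close>
  elements in these types.\<close>

type_synonym ('a, 'b, 'c) monom = "('a, 'b, 'c) var \<Rightarrow>\<^sub>0 nat"
type_synonym ('a, 'b, 'c, 'r) cox = "('a, 'b, 'c) monom \<Rightarrow>\<^sub>0 'r"
type_synonym ('a, 'b, 'c) coxC = "('a, 'b, 'c, complex) cox"
type_synonym degree = "int \<times> int \<times> int"

definition mdeg :: "('a::finite, 'b::finite, 'c::finite) monom \<Rightarrow> degree" where
  "mdeg m = (\<Sum>i\<in>UNIV. int (Poly_Mapping.lookup m (Alpha i)),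
             \<Sum>j\<in>UNIV. int (Poly_Mapping.lookup m (Beta j)),
             \<Sum>k\<in>UNIV. int (Poly_Mapping.lookup m (Gamma k)))"

definition piece :: "degree \<Rightarrow> ('a::finite, 'b::finite, 'c::finite, 'r::zero) cox set" where
  "piece u = {f. \<forall>m\<in>Poly_Mapping.keys f. mdeg m = u}"

definition homogeneous_ideal ::
    "('a::finite, 'b::finite, 'c::finite, 'r::comm_ring_1) cox set \<Rightarrow> bool" where
  "homogeneous_ideal I \<longleftrightarrow> (\<exists>G. (\<forall>g\<in>G. \<exists>u. g \<in> piece u) \<and> I = ideal.span G)"

definition const_poly :: "'r \<Rightarrow> 'm::zero \<Rightarrow>\<^sub>0 'r::zero" where
  "const_poly c = Poly_Mapping.single 0 c"

definition cox_scale :: "complex \<Rightarrow> ('a, 'b, 'c) coxC \<Rightarrow> ('a, 'b, 'c) coxC" where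
  "cox_scale c f = const_poly c * f"

global_interpretation cox: vector_space cox_scale
proof
  fix c d :: complex and f g :: "('a, 'b, 'c) coxC"
  show "cox_scale c (f + g) = cox_scale c f + cox_scale c g"
    by (simp only: cox_scale_def distrib_left)
  show "cox_scale (c + d) f = cox_scale c f + cox_scale d f"
    by (simp only: cox_scale_def const_poly_def single_add distrib_right)
  show "cox_scale c (cox_scale d f) = cox_scale (c * d) f"
    by (simp only: cox_scale_def const_poly_def mult_single mult.assoc[symmetric] add_0)
  show "cox_scale 1 f = f"
    by (simp only: cox_scale_def const_poly_def single_one mult_1)
qed

definition irrelevant_ideal :: "('a::finite, 'b::finite, 'c::finite) coxC set" where
  "irrelevant_ideal = ideal.span (piece (1, 1, 1))"

definition saturated :: "('a::finite, 'b::finite, 'c::finite) coxC set \<Rightarrow> bool" where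
  "saturated J \<longleftrightarrow> ideal_colon J irrelevant_ideal = J"

definition hilbert_function ::
    "('a::finite, 'b::finite, 'c::finite) coxC set \<Rightarrow> degree \<Rightarrow> enat" where
  "hilbert_function I u = dim_quotient cox_scale (piece u) I"

definition generic_hf ::
    "('a::finite, 'b::finite, 'c::finite) var itself \<Rightarrow> nat \<Rightarrow> degree \<Rightarrow> nat" where
  "generic_hf _ r u = min r (cox.dim (piece u :: ('a, 'b, 'c) coxC set))"

text \<open>The closed points \<open>[I]\<close> of the multigraded Hilbert scheme.\<close>

definition hilb :: "(degree \<Rightarrow> nat) \<Rightarrow> ('a::finite, 'b::finite, 'c::finite) coxC set set" where
  "hilb h = {I. homogeneous_ideal I \<and> (\<forall>u. hilbert_function I u = enat (h u))}"

text \<open>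
  The Zariski topology on the closed points is read off from the functor that the scheme \<open>H\<close>
  represents. A set \<open>U\<close> of closed points of a scheme of finite type over \<open>\<complex>\<close> is open iff, for every
  finitely generated \<open>\<complex>\<close>-algebra \<open>R\<close> and every morphism from \<open>Spec R\<close> to \<open>H\<close>, the closed points
  of \<open>Spec R\<close> that are mapped into \<open>U\<close> form an open set (for the nontrivial direction, use the
  inclusions of an affine open cover of \<open>H\<close>). By representability, the morphisms from \<open>Spec R\<close> to \<open>H\<close>
  are the homogeneous ideals of \<open>R \<otimes> S[X]\<close> with locally free quotients of ranks \<open>h\<close>, and the
  morphism sends a closed point to the fibre of the ideal.

  The algebra \<open>R\<close> is given by a presentation \<open>R = \<complex>[x\<^sub>0, x\<^sub>1, \<dots>] / J\<close>, where \<open>J\<close> contains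
  all but finitely many of the variables; ideals of \<open>R \<otimes> S[X]\<close> are given by their preimages in
  \<open>\<complex>[x\<^sub>0, x\<^sub>1, \<dots>] \<otimes> S[X]\<close>. By the Nullstellensatz the closed points of \<open>Spec R\<close> are the common
  zeros of \<open>J\<close>.
\<close>

type_synonym base_poly = "(nat \<Rightarrow>\<^sub>0 nat) \<Rightarrow>\<^sub>0 complex"

definition poly_eval :: "(nat \<Rightarrow> complex) \<Rightarrow> base_poly \<Rightarrow> complex" where
  "poly_eval x g = (\<Sum>m\<in>Poly_Mapping.keys g. Poly_Mapping.lookup g m *
     (\<Prod>i\<in>Poly_Mapping.keys m. x i ^ Poly_Mapping.lookup m i))"

definition base_var :: "nat \<Rightarrow> base_poly" where
  "base_var i = Poly_Mapping.single (Poly_Mapping.single i 1) 1"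

definition base_ideal :: "base_poly set \<Rightarrow> bool" where
  "base_ideal J \<longleftrightarrow> ideal.subspace J \<and> (\<exists>N. \<forall>i\<ge>N. base_var i \<in> J)"

definition base_points :: "base_poly set \<Rightarrow> (nat \<Rightarrow> complex) set" where
  "base_points J = {x. \<forall>g\<in>J. poly_eval x g = 0}"

text \<open>For \<open>M = (R \<otimes> S[X] / I)\<^sub>u\<close>, with \<open>R = \<complex>[x\<^sub>0, x\<^sub>1, \<dots>] / J\<close>: the localization \<open>M\<^sub>f\<close>
  is a free \<open>R\<^sub>f\<close>-module of rank \<open>n\<close>. Clearing denominators, a basis can be taken from the image of
  \<open>M\<close>; the last two conjuncts say that it spans and that it is independent.\<close>

definition free_after_localization :: "base_poly set \<Rightarrow>
    ('a::finite, 'b::finite, 'c::finite, base_poly) cox set \<Rightarrow> degree \<Rightarrow> nat \<Rightarrow> base_poly \<Rightarrow> bool" where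
  "free_after_localization J I u n f \<longleftrightarrow> (\<exists>q :: nat \<Rightarrow> ('a, 'b, 'c, base_poly) cox.
     (\<forall>j<n. q j \<in> piece u) \<and>
     (\<forall>v\<in>piece u. \<exists>k c. const_poly (f ^ k) * v - (\<Sum>j<n. const_poly (c j) * q j) \<in> I) \<and>
     (\<forall>c. (\<Sum>j<n. const_poly (c j) * q j) \<in> I \<longrightarrow> (\<forall>j<n. \<exists>k. f ^ k * c j \<in> J)))"

text \<open>Local freeness: the basic open sets \<open>D(f)\<close> on which the module is free cover \<open>Spec R\<close>,
  i.e. these \<open>f\<close> generate the unit ideal of \<open>R\<close>.\<close>

definition locally_free :: "base_poly set \<Rightarrow>
    ('a::finite, 'b::finite, 'c::finite, base_poly) cox set \<Rightarrow> degree \<Rightarrow> nat \<Rightarrow> bool" where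
  "locally_free J I u n \<longleftrightarrow> ideal.span (J \<union> {f. free_after_localization J I u n f}) = UNIV"

text \<open>The value of the Hilbert functor at \<open>R = \<complex>[x\<^sub>0, x\<^sub>1, \<dots>] / J\<close>.\<close>

definition hilb_family :: "(degree \<Rightarrow> nat) \<Rightarrow> base_poly set \<Rightarrow>
    ('a::finite, 'b::finite, 'c::finite, base_poly) cox set \<Rightarrow> bool" where
  "hilb_family h J I \<longleftrightarrow> homogeneous_ideal I \<and> const_poly ` J \<subseteq> I \<and> (\<forall>u. locally_free J I u (h u))"

definition fibre :: "('a, 'b, 'c, base_poly) cox set \<Rightarrow> (nat \<Rightarrow> complex) \<Rightarrow> ('a, 'b, 'c) coxC set" where
  "fibre I x = Poly_Mapping.map (poly_eval x) ` I"

definition hilb_open ::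
    "(degree \<Rightarrow> nat) \<Rightarrow> ('a::finite, 'b::finite, 'c::finite) coxC set set \<Rightarrow> bool" where
  "hilb_open h U \<longleftrightarrow> U \<subseteq> hilb h \<and>
     (\<forall>J I. base_ideal J \<and> hilb_family h J I \<longrightarrow>
       (\<exists>G. {x \<in> base_points J. fibre I x \<in> U} = {x \<in> base_points J. \<exists>g\<in>G. poly_eval x g \<noteq> 0}))"

definition hilb_topology ::
    "(degree \<Rightarrow> nat) \<Rightarrow> ('a::finite, 'b::finite, 'c::finite) coxC set topology" where
  "hilb_topology h = topology (hilb_open h)"

lemma poly_eval_superset:
  assumes "finite A" "Poly_Mapping.keys g \<subseteq> A"
  shows "poly_eval x g = (\<Sum>m\<in>A. Poly_Mapping.lookup g m *
     (\<Prod>i\<in>Poly_Mapping.keys m. x i ^ Poly_Mapping.lookup m i))"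
  unfolding poly_eval_def
  by (rule sum.mono_neutral_left) (use assms in \<open>auto simp: in_keys_iff\<close>)

lemma poly_eval_add: "poly_eval x (f + g) = poly_eval x f + poly_eval x g"
proof -
  let ?A = "Poly_Mapping.keys f \<union> Poly_Mapping.keys g"
  have fin: "finite ?A" by simp
  show ?thesis
    unfolding poly_eval_superset[OF fin Poly_Mapping.keys_add]
      poly_eval_superset[OF fin Un_upper1] poly_eval_superset[OF fin Un_upper2]
    by (simp add: lookup_add distrib_right sum.distrib)
qed

lemma poly_eval_zero: "poly_eval x 0 = 0"
  by (simp add: poly_eval_def)

lemma poly_eval_single:
  "poly_eval x (Poly_Mapping.single m c) =
     c * (\<Prod>i\<in>Poly_Mapping.keys m. x i ^ Poly_Mapping.lookup m i)"
  by (simp add: poly_eval_def)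

lemma monom_eval_superset:
  assumes "finite A" "Poly_Mapping.keys m \<subseteq> A"
  shows "(\<Prod>i\<in>Poly_Mapping.keys m. (x::nat \<Rightarrow> complex) i ^ Poly_Mapping.lookup m i) =
    (\<Prod>i\<in>A. x i ^ Poly_Mapping.lookup m i)"
  by (rule prod.mono_neutral_left) (use assms in \<open>auto simp: in_keys_iff\<close>)

lemma monom_eval_add:
  fixes m n :: "nat \<Rightarrow>\<^sub>0 nat" and x :: "nat \<Rightarrow> complex"
  shows "(\<Prod>i\<in>Poly_Mapping.keys (m + n). x i ^ Poly_Mapping.lookup (m + n) i) =
    (\<Prod>i\<in>Poly_Mapping.keys m. x i ^ Poly_Mapping.lookup m i) *
    (\<Prod>i\<in>Poly_Mapping.keys n. x i ^ Poly_Mapping.lookup n i)"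
proof -
  let ?A = "Poly_Mapping.keys m \<union> Poly_Mapping.keys n"
  have fin: "finite ?A" by simp
  show ?thesis
    unfolding monom_eval_superset[OF fin Poly_Mapping.keys_add]
      monom_eval_superset[OF fin Un_upper1] monom_eval_superset[OF fin Un_upper2]
    by (simp add: lookup_add power_add prod.distrib)
qed

lemma poly_eval_sum: "poly_eval x (sum F A) = (\<Sum>a\<in>A. poly_eval x (F a))"
  by (induction A rule: infinite_finite_induct) (simp_all add: poly_eval_zero poly_eval_add)

lemma poly_eval_mult: "poly_eval x (f * g) = poly_eval x f * poly_eval x g"
proof -
  let ?e = "\<lambda>m. \<Prod>i\<in>Poly_Mapping.keys m. x i ^ Poly_Mapping.lookup m i"
  have expand: "(\<Sum>m\<in>Poly_Mapping.keys p. Poly_Mapping.single m (Poly_Mapping.lookup p m)) = p"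
    for p :: base_poly
  proof (rule poly_mapping_eqI)
    fix k
    have "Poly_Mapping.lookup (\<Sum>m\<in>Poly_Mapping.keys p.
        Poly_Mapping.single m (Poly_Mapping.lookup p m)) k =
      (\<Sum>m\<in>Poly_Mapping.keys p. if m = k then Poly_Mapping.lookup p m else 0)"
      by (simp only: lookup_sum lookup_single when_def)
    also have "\<dots> = Poly_Mapping.lookup p k"
      using not_in_keys_iff_lookup_eq_zero[of k p]
      by (simp only: sum.delta finite_keys if_True split: if_split) metis
    finally show "Poly_Mapping.lookup (\<Sum>m\<in>Poly_Mapping.keys p.
        Poly_Mapping.single m (Poly_Mapping.lookup p m)) k = Poly_Mapping.lookup p k" .
  qed
  have "f * g = (\<Sum>m\<in>Poly_Mapping.keys f. \<Sum>n\<in>Poly_Mapping.keys g.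
      Poly_Mapping.single m (Poly_Mapping.lookup f m) *
      Poly_Mapping.single n (Poly_Mapping.lookup g n))"
    unfolding sum_product[symmetric] expand ..
  then have "poly_eval x (f * g) = (\<Sum>m\<in>Poly_Mapping.keys f. \<Sum>n\<in>Poly_Mapping.keys g.
      Poly_Mapping.lookup f m * Poly_Mapping.lookup g n * (?e m * ?e n))"
    by (simp only: poly_eval_sum mult_single poly_eval_single monom_eval_add)
  also have "\<dots> = (\<Sum>m\<in>Poly_Mapping.keys f. Poly_Mapping.lookup f m * ?e m) *
      (\<Sum>n\<in>Poly_Mapping.keys g. Poly_Mapping.lookup g n * ?e n)"
    unfolding sum_product by (simp only: mult_ac)
  finally show ?thesis
    unfolding poly_eval_def .
qed

lemma istopology_hilb_open: "istopology (hilb_open h)"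
  unfolding istopology_def
proof (intro conjI allI impI)
  fix S T :: "('a::finite, 'b::finite, 'c::finite) coxC set set"
  assume S: "hilb_open h S" and T: "hilb_open h T"
  show "hilb_open h (S \<inter> T)"
    unfolding hilb_open_def
  proof (intro conjI allI impI)
    show "S \<inter> T \<subseteq> hilb h" using S by (auto simp: hilb_open_def)
    fix J and I :: "('a, 'b, 'c, base_poly) cox set"
    assume JI: "base_ideal J \<and> hilb_family h J I"
    obtain G where G: "{x \<in> base_points J. fibre I x \<in> S} =
        {x \<in> base_points J. \<exists>g\<in>G. poly_eval x g \<noteq> 0}"
      using S JI unfolding hilb_open_def by blast
    obtain G' where G': "{x \<in> base_points J. fibre I x \<in> T} =
        {x \<in> base_points J. \<exists>g\<in>G'. poly_eval x g \<noteq> 0}"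
      using T JI unfolding hilb_open_def by blast
    have "{x \<in> base_points J. fibre I x \<in> S \<inter> T} =
        {x \<in> base_points J. fibre I x \<in> S} \<inter> {x \<in> base_points J. fibre I x \<in> T}"
      by auto
    also have "\<dots> = {x \<in> base_points J. \<exists>g\<in>{g * g' | g g'. g \<in> G \<and> g' \<in> G'}. poly_eval x g \<noteq> 0}"
      unfolding G G' by (fastforce simp: poly_eval_mult)
    finally show "\<exists>G. {x \<in> base_points J. fibre I x \<in> S \<inter> T} =
        {x \<in> base_points J. \<exists>g\<in>G. poly_eval x g \<noteq> 0}" by blast
  qed
next
  fix K :: "('a::finite, 'b::finite, 'c::finite) coxC set set set"
  assume K: "\<forall>S\<in>K. hilb_open h S"
  show "hilb_open h (\<Union>K)"
    unfolding hilb_open_def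
  proof (intro conjI allI impI)
    show "\<Union>K \<subseteq> hilb h" using K by (auto simp: hilb_open_def)
    fix J and I :: "('a, 'b, 'c, base_poly) cox set"
    assume JI: "base_ideal J \<and> hilb_family h J I"
    then have "\<forall>S\<in>K. \<exists>G. {x \<in> base_points J. fibre I x \<in> S} =
        {x \<in> base_points J. \<exists>g\<in>G. poly_eval x g \<noteq> 0}"
      using K unfolding hilb_open_def by blast
    from bchoice[OF this] obtain G where G: "\<forall>S\<in>K. {x \<in> base_points J. fibre I x \<in> S} =
        {x \<in> base_points J. \<exists>g\<in>G S. poly_eval x g \<noteq> 0}" ..
    have "{x \<in> base_points J. fibre I x \<in> \<Union>K} = (\<Union>S\<in>K. {x \<in> base_points J. fibre I x \<in> S})"
      by auto
    also have "\<dots> = (\<Union>S\<in>K. {x \<in> base_points J. \<exists>g\<in>G S. poly_eval x g \<noteq> 0})"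
      using G by simp
    also have "\<dots> = {x \<in> base_points J. \<exists>g\<in>\<Union>(G ` K). poly_eval x g \<noteq> 0}"
      by auto
    finally show "\<exists>G. {x \<in> base_points J. fibre I x \<in> \<Union>K} =
        {x \<in> base_points J. \<exists>g\<in>G. poly_eval x g \<noteq> 0}" by blast
  qed
qed

lemma openin_hilb_topology: "openin (hilb_topology h) = hilb_open h"
  by (simp add: hilb_topology_def istopology_hilb_open)

definition slip :: "nat \<Rightarrow> ('a::finite, 'b::finite, 'c::finite) coxC set set" where
  "slip r = (let h = generic_hf TYPE(('a, 'b, 'c) var) r in
     hilb_topology h closure_of {I \<in> hilb h. radical_ideal I \<and> saturated I})"

definition irreducible_closedin :: "'x topology \<Rightarrow> 'x set \<Rightarrow> bool" where
  "irreducible_closedin T C \<longleftrightarrow> closedin T C \<and> C \<noteq> {} \<and>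
     (\<forall>A B. closedin T A \<and> closedin T B \<and> C \<subseteq> A \<union> B \<longrightarrow> C \<subseteq> A \<or> C \<subseteq> B)"

text \<open>Supremum of the lengths of chains of irreducible closed subsets; the empty space has
  dimension \<open>-\<infinity>\<close>. For a scheme of finite type over \<open>\<complex>\<close>, its space of closed points has
  the same dimension as the scheme.\<close>

definition krull_dim :: "'x topology \<Rightarrow> ereal" where
  "krull_dim T = Sup {ereal (real n) | n. \<exists>C :: nat \<Rightarrow> 'x set.
     (\<forall>i\<le>n. irreducible_closedin T (C i)) \<and> (\<forall>i<n. C i \<subset> C (Suc i))}"

definition slip_topology :: "nat \<Rightarrow> ('a::finite, 'b::finite, 'c::finite) coxC set topology" where
  "slip_topology r = subtopology (hilb_topology (generic_hf TYPE(('a, 'b, 'c) var) r)) (slip r)"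

text \<open>A homomorphism from \<open>K\<close> to \<open>S[X]/K\<close> is represented by a map \<open>\<phi>\<close> that picks a representative
  of each value. Values outside \<open>K\<close> are irrelevant, and two maps represent the same
  homomorphism iff their difference sends \<open>K\<close> into \<open>K\<close>.\<close>

definition hom0_lifts ::
    "('a::finite, 'b::finite, 'c::finite) coxC set \<Rightarrow> (('a, 'b, 'c) coxC \<Rightarrow> ('a, 'b, 'c) coxC) set" where
  "hom0_lifts K = {\<phi>.
     (\<forall>f\<in>K. \<forall>g\<in>K. \<phi> (f + g) - (\<phi> f + \<phi> g) \<in> K) \<and>
     (\<forall>a. \<forall>f\<in>K. \<phi> (a * f) - a * \<phi> f \<in> K) \<and>
     (\<forall>u. \<forall>f\<in>K \<inter> piece u. \<phi> f \<in> piece u + K)}"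

definition dim_hom0 :: "('a::finite, 'b::finite, 'c::finite) coxC set \<Rightarrow> enat" where
  "dim_hom0 K = dim_quotient (\<lambda>c \<phi> f. cox_scale c (\<phi> f)) (hom0_lifts K) {\<phi>. \<forall>f\<in>K. \<phi> f \<in> K}"

end

theory Submission
  imports Defs "HOL-Computational_Algebra.Fundamental_Theorem_Algebra" "HOL-Library.Product_Order"
    "HOL-Analysis.Continuum_Not_Denumerable"
begin

text \<open>
  The closed points of the Hilbert scheme near \<open>I\<close> have a common monomial basis \<open>B\<close> of the quotients
  in all degrees of a large box. The coefficients \<open>x\<^bsub>m,b\<^esub>\<close> of the relations \<open>m - \<Sum>\<^sub>b x\<^bsub>m,b\<^esub> b\<close> in these
  degrees are coordinates on an open set, as a relation in a large degree is a consequence of those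
  in the box.

  A radical and saturated point of the Hilbert scheme is the ideal of \<open>r\<close> points of \<open>X\<close>, so the
  configurations of points in general position are dense in the slip component, and in a chart the
  coordinates of their ideals are rational functions of the \<open>d = r (n1 + n2 + n3)\<close> affine coordinates
  of the points. Functions that separate the members of a chain of irreducible closed sets are
  algebraically independent, so a chain has length at most \<open>d\<close>. Keeping some of the affine coordinates
  fixed and closing up gives a chain of length \<open>d\<close>.

  In degrees below \<open>(s, t, u)\<close> the ideals \<open>K\<close> and \<open>I\<close> agree, and in all other degrees \<open>K\<close> is everything.
  Hence each solution of the linearized chart equations in these degrees, that is, each tangent
  vector at \<open>I\<close> truncated to them, defines a homomorphism \<open>K \<rightarrow> S[X] / K\<close> of degree \<open>0\<close>. The
  dimension of the space of solutions is upper semicontinuous on the chart, so it suffices to find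
  \<open>d\<close> independent solutions at a general configuration. They come from moving one of the points along
  one of its affine coordinates. Their independence is visible in degree \<open>(1, 1, 1)\<close>, which is
  below \<open>(s, t, u)\<close>: the hypothesis on \<open>r\<close> gives \<open>r + n1 + n2 + n3 \<le> (n1 + 1) (n2 + 1) (n3 + 1)\<close>, and
  therefore the forms of this degree separate the first-order jets at one point from the values at
  the other points.
\<close>

section \<open>Evaluation of polynomials\<close>

text \<open>Open and closed sets of the Hilbert scheme are defined only through families over affine
  bases, and membership in the functor is a statement about modules over quotient rings. The proof
  works with the fibres at closed points instead. Gaussian elimination over the base ring spreads a
  statement from one point to a neighbourhood, and the Nullstellensatz turns such neighbourhoods
  into a cover, which yields local freeness.

  The tangent space at \<open>I\<close> maps to the homomorphisms
  \<open>K \<rightarrow> S[X] / K\<close>, but the map need not be injective, and the rank of a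
  truncation can drop under specialization. Therefore the linearized equations, and not their
  solutions, are restricted to the degrees below \<open>(s, t, u)\<close>: a solution at
  \<open>I\<close> need not extend to a tangent vector of the Hilbert scheme, but the solution space
  can only grow under specialization. At a general configuration its dimension is bounded below by
  truncating genuine tangent vectors.\<close>

abbreviation lookup :: "('k \<Rightarrow>\<^sub>0 'r::zero) \<Rightarrow> 'k \<Rightarrow> 'r" where "lookup \<equiv> Poly_Mapping.lookup"
abbreviation keys :: "('k \<Rightarrow>\<^sub>0 'r::zero) \<Rightarrow> 'k set" where "keys \<equiv> Poly_Mapping.keys"
abbreviation single :: "'k \<Rightarrow> 'r \<Rightarrow> 'k \<Rightarrow>\<^sub>0 'r::zero" where "single \<equiv> Poly_Mapping.single"
abbreviation mono :: "'k \<Rightarrow> 'k \<Rightarrow>\<^sub>0 'r::zero_neq_one" where "mono m \<equiv> single m 1"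

text \<open>The coefficient ring is arbitrary because points with polynomial coordinates, such as
  the universal configuration \<open>cfgP\<close>, are evaluated at as well.\<close>

definition mon_ev :: "('v \<Rightarrow> 'r::comm_ring_1) \<Rightarrow> ('v \<Rightarrow>\<^sub>0 nat) \<Rightarrow> 'r" where
  "mon_ev p m = (\<Prod>v\<in>keys m. p v ^ lookup m v)"

definition pev :: "('v \<Rightarrow> 'r::comm_ring_1) \<Rightarrow> (('v \<Rightarrow>\<^sub>0 nat) \<Rightarrow>\<^sub>0 'r) \<Rightarrow> 'r" where
  "pev p f = (\<Sum>m\<in>keys f. lookup f m * mon_ev p m)"

lemma poly_eval_eq_pev: "poly_eval = pev"
  by (simp add: fun_eq_iff poly_eval_def pev_def mon_ev_def)

lemma mon_ev_superset:
  assumes "finite A" "keys m \<subseteq> A"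
  shows "mon_ev p m = (\<Prod>v\<in>A. p v ^ lookup m v)"
  unfolding mon_ev_def by (rule prod.mono_neutral_left) (use assms in \<open>auto simp: in_keys_iff\<close>)

lemma mon_ev_UNIV: "mon_ev p m = (\<Prod>v\<in>UNIV. p v ^ lookup m v)"
  for m :: "'v::finite \<Rightarrow>\<^sub>0 nat"
  by (rule mon_ev_superset) auto

lemma mon_ev_0 [simp]: "mon_ev p 0 = 1"
  by (simp add: mon_ev_def)

lemma mon_ev_add: "mon_ev p (m + n) = mon_ev p m * mon_ev p n"
proof -
  let ?A = "keys m \<union> keys n"
  have fin: "finite ?A" by simp
  show ?thesis
    unfolding mon_ev_superset[OF fin Poly_Mapping.keys_add]
      mon_ev_superset[OF fin Un_upper1] mon_ev_superset[OF fin Un_upper2]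
    by (simp add: lookup_add power_add prod.distrib)
qed

lemma mon_ev_single [simp]: "mon_ev p (single v k) = p v ^ k"
  by (cases "k = 0") (simp_all add: mon_ev_def)

lemma mon_ev_mult: "mon_ev (\<lambda>v. p v * q v) m = mon_ev p m * mon_ev q m"
  by (simp add: mon_ev_def power_mult_distrib prod.distrib)

lemma mon_ev_cong: "(\<And>v. v \<in> keys m \<Longrightarrow> p v = q v) \<Longrightarrow> mon_ev p m = mon_ev q m"
  by (simp add: mon_ev_def)

lemma pev_superset:
  assumes "finite A" "keys f \<subseteq> A"
  shows "pev p f = (\<Sum>m\<in>A. lookup f m * mon_ev p m)"
  unfolding pev_def by (rule sum.mono_neutral_left) (use assms in \<open>auto simp: in_keys_iff\<close>)

lemma pev_add: "pev p (f + g) = pev p f + pev p g"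
proof -
  let ?A = "keys f \<union> keys g"
  have fin: "finite ?A" by simp
  show ?thesis
    unfolding pev_superset[OF fin Poly_Mapping.keys_add]
      pev_superset[OF fin Un_upper1] pev_superset[OF fin Un_upper2]
    by (simp add: lookup_add distrib_right sum.distrib)
qed

lemma pev_0 [simp]: "pev p 0 = 0"
  by (simp add: pev_def)

lemma pev_single [simp]: "pev p (single m c) = c * mon_ev p m"
  by (simp add: pev_def)

lemma pev_1 [simp]: "pev p 1 = 1"
  using pev_single[of p 0 1] by (simp del: pev_single)

lemma pev_const [simp]: "pev p (const_poly c) = c"
  by (simp add: const_poly_def)

lemma pev_sum: "pev p (sum F A) = (\<Sum>a\<in>A. pev p (F a))"
  by (induction A rule: infinite_finite_induct) (simp_all add: pev_add)

lemma pev_diff: "pev p (f - g) = pev p f - pev p g"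
  by (metis diff_add_cancel eq_diff_eq pev_add)

lemma poly_expand_superset:
  assumes "finite A" "keys p \<subseteq> A"
  shows "p = (\<Sum>m\<in>A. single m (lookup p m))"
proof (rule poly_mapping_eqI)
  fix k
  have "lookup (\<Sum>m\<in>A. single m (lookup p m)) k = (\<Sum>m\<in>A. if m = k then lookup p m else 0)"
    by (simp add: lookup_sum lookup_single when_def)
  also have "\<dots> = lookup p k"
    using assms by (auto simp: in_keys_iff)
  finally show "lookup p k = lookup (\<Sum>m\<in>A. single m (lookup p m)) k" ..
qed

lemma poly_expand: "p = (\<Sum>m\<in>keys p. single m (lookup p m))"
  by (rule poly_expand_superset) auto

lemma pev_mult: "pev p (f * g) = pev p f * pev p g"
proof -
  have "f * g = (\<Sum>m\<in>keys f. \<Sum>n\<in>keys g. single m (lookup f m) * single n (lookup g n))"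
    unfolding sum_product[symmetric] poly_expand[symmetric] ..
  then have "pev p (f * g) =
      (\<Sum>m\<in>keys f. \<Sum>n\<in>keys g. lookup f m * lookup g n * (mon_ev p m * mon_ev p n))"
    by (simp add: pev_sum mult_single mon_ev_add)
  also have "\<dots> = pev p f * pev p g"
    unfolding pev_def sum_product by (simp only: mult_ac)
  finally show ?thesis .
qed

lemma pev_power: "pev p (f ^ n) = pev p f ^ n"
  by (induction n) (simp_all add: pev_mult)

lemma pev_prod: "pev p (prod F A) = (\<Prod>a\<in>A. pev p (F a))"
  by (induction A rule: infinite_finite_induct) (simp_all add: pev_mult)

lemma pev_mon_ev: "pev x (mon_ev P m) = mon_ev (\<lambda>v. pev x (P v)) m"
  by (simp add: mon_ev_def pev_prod pev_power)

lemma pev_base_var [simp]: "pev x (base_var i) = x i"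
  by (simp add: base_var_def)

lemma pev_cong:
  assumes "\<And>m v. m \<in> keys f \<Longrightarrow> v \<in> keys m \<Longrightarrow> p v = q v"
  shows "pev p f = pev q f"
  unfolding pev_def by (intro sum.cong refl arg_cong2[where f = "(*)"] mon_ev_cong assms) auto

lemma const_poly_0 [simp]: "const_poly 0 = 0"
  by (simp add: const_poly_def)

lemma const_poly_1 [simp]: "const_poly 1 = 1"
  by (simp add: const_poly_def)

lemma const_poly_add: "const_poly (a + b) = const_poly a + const_poly b"
  by (simp add: const_poly_def single_add)

lemma const_poly_diff: "const_poly (a - b) = const_poly a - (const_poly b :: 'm::zero \<Rightarrow>\<^sub>0 'r::ab_group_add)"
  by (simp add: const_poly_def single_diff)

lemma const_poly_uminus: "const_poly (- b) = - (const_poly b :: 'm::zero \<Rightarrow>\<^sub>0 'r::ab_group_add)"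
  by (simp add: const_poly_def single_uminus)

lemma const_poly_mult:
  "const_poly (a * b) = const_poly a * (const_poly b :: 'm::monoid_add \<Rightarrow>\<^sub>0 'r::semiring_0)"
  by (simp add: const_poly_def mult_single)

lemma const_poly_sum: "const_poly (sum f A) = (\<Sum>a\<in>A. const_poly (f a))"
  by (induction A rule: infinite_finite_induct) (simp_all add: const_poly_add)

lemma const_poly_mult_single [simp]:
  "const_poly c * single m a = (single m (c * a) :: 'm::monoid_add \<Rightarrow>\<^sub>0 'r::semiring_0)"
  by (simp add: const_poly_def mult_single)

lemma lookup_const_poly_mult [simp]:
  fixes f :: "'m::comm_monoid_add \<Rightarrow>\<^sub>0 'r::comm_ring_1"
  shows "lookup (const_poly c * f) m = c * lookup f m"
proof -
  have "const_poly c * f = Poly_Mapping.map ((*) c) f"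
    by (simp add: const_poly_def mult_map_scale_conv_mult)
  then show ?thesis by (simp add: Poly_Mapping.map.rep_eq when_def)
qed

lemma keys_const_poly_mult:
  fixes f :: "'m::comm_monoid_add \<Rightarrow>\<^sub>0 'r::comm_ring_1"
  shows "keys (const_poly c * f) \<subseteq> keys f"
  by (auto simp: in_keys_iff)

lemma monom_induct [case_names zero add]:
  assumes "P 0" "\<And>m v. P m \<Longrightarrow> P (single v 1 + m)"
  shows "P (m :: 'v \<Rightarrow>\<^sub>0 nat)"
proof (induction "\<Sum>v\<in>keys m. lookup m v" arbitrary: m)
  case 0
  then have "\<forall>v\<in>keys m. lookup m v = 0" by simp
  then have "m = 0" by (metis lookup_not_eq_zero_eq_in_keys poly_mapping_eqI lookup_zero)
  then show ?case using assms(1) by simp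
next
  case (Suc n)
  then have "keys m \<noteq> {}" by (metis Zero_neq_Suc sum.empty)
  then obtain v where v: "v \<in> keys m" by blast
  define m' where "m' = m - single v 1"
  have lm': "lookup m' w = (if w = v then lookup m w - 1 else lookup m w)" for w
    by (simp add: m'_def lookup_minus lookup_single when_def)
  have m: "m = single v 1 + m'"
    using v by (intro poly_mapping_eqI) (auto simp: lookup_add lm' lookup_single when_def in_keys_iff)
  have sub: "keys m' \<subseteq> keys m" by (auto simp: in_keys_iff lm' split: if_splits)
  have "(\<Sum>w\<in>keys m'. lookup m' w) = (\<Sum>w\<in>keys m. lookup m' w)"
    by (rule sum.mono_neutral_left) (use sub in \<open>auto simp: in_keys_iff\<close>)
  moreover have "(\<Sum>w\<in>keys m. lookup m w) = 1 + (\<Sum>w\<in>keys m. lookup m' w)"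
    using v by (subst (1 2) sum.remove[of _ v]) (auto simp: lm' in_keys_iff)
  ultimately have "n = (\<Sum>w\<in>keys m'. lookup m' w)" using Suc(2) by simp
  then show ?case using Suc(1) assms(2) m by metis
qed

lemma mono_add: "mono (m + n) = mono m * (mono n :: 'm::monoid_add \<Rightarrow>\<^sub>0 'r::semiring_1)"
  by (simp add: mult_single)

lemma single_eq_const_mono: "single m c = const_poly c * (mono m :: 'm::monoid_add \<Rightarrow>\<^sub>0 'r::semiring_1)"
  by simp

text \<open>Dedekind's independence of characters, for a set that is merely closed under an
  operation. It separates monomials by their values (\<open>pev_eq_0_imp\<close>) and degrees by the
  torus action (\<open>torus_vanish\<close>).\<close>

lemma characters_independent:
  fixes \<chi> :: "'i \<Rightarrow> 's \<Rightarrow> complex"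
  assumes "finite F" and S: "e \<in> S" "\<And>s t. s \<in> S \<Longrightarrow> t \<in> S \<Longrightarrow> op s t \<in> S"
    and hom: "\<And>i s t. i \<in> F \<Longrightarrow> s \<in> S \<Longrightarrow> t \<in> S \<Longrightarrow> \<chi> i (op s t) = \<chi> i s * \<chi> i t"
    and one: "\<And>i. i \<in> F \<Longrightarrow> \<chi> i e \<noteq> 0"
    and dist: "\<And>i j. i \<in> F \<Longrightarrow> j \<in> F \<Longrightarrow> i \<noteq> j \<Longrightarrow> \<exists>s\<in>S. \<chi> i s \<noteq> \<chi> j s"
    and eq0: "\<And>s. s \<in> S \<Longrightarrow> (\<Sum>i\<in>F. c i * \<chi> i s) = 0"
  shows "\<forall>i\<in>F. c i = 0"
  using assms(1) hom one dist eq0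
proof (induction F arbitrary: c rule: finite_induct)
  case empty
  then show ?case by simp
next
  case (insert j F)
  have F: "c i * (\<chi> i s - \<chi> j s) = 0" if "i \<in> F" "s \<in> S" for i s
  proof -
    have "\<forall>i\<in>F. c i * (\<chi> i s - \<chi> j s) = 0"
    proof (rule insert.IH)
      fix t assume t: "t \<in> S"
      \<comment> \<open>The relation at \<open>op s t\<close> minus \<open>\<chi> j s\<close> times
        the relation at \<open>t\<close> no longer involves \<open>j\<close>.\<close>
      have "(\<Sum>i\<in>insert j F. c i * \<chi> i (op s t)) - \<chi> j s * (\<Sum>i\<in>insert j F. c i * \<chi> i t) = 0"
        using insert.prems(4) t \<open>s \<in> S\<close> S by simp
      also have "(\<Sum>i\<in>insert j F. c i * \<chi> i (op s t)) - \<chi> j s * (\<Sum>i\<in>insert j F. c i * \<chi> i t) =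
          (\<Sum>i\<in>insert j F. c i * (\<chi> i s - \<chi> j s) * \<chi> i t)"
        unfolding sum_distrib_left sum_subtractf[symmetric]
      proof (rule sum.cong[OF refl])
        fix i assume "i \<in> insert j F"
        then have "\<chi> i (op s t) = \<chi> i s * \<chi> i t" using insert.prems(1) t \<open>s \<in> S\<close> by blast
        then show "c i * \<chi> i (op s t) - \<chi> j s * (c i * \<chi> i t) = c i * (\<chi> i s - \<chi> j s) * \<chi> i t"
          by (simp only: left_diff_distrib right_diff_distrib mult_ac)
      qed
      finally show "(\<Sum>i\<in>F. c i * (\<chi> i s - \<chi> j s) * \<chi> i t) = 0"
        using insert.hyps by simp
    qed (use insert.prems in auto)
    then show ?thesis using that by blast
  qed
  have cF: "c i = 0" if iF: "i \<in> F" for i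
  proof -
    obtain s where "s \<in> S" "\<chi> i s \<noteq> \<chi> j s"
      using insert.prems(3)[of i j] insert.hyps iF by blast
    then show ?thesis using F[OF iF] by auto
  qed
  then have "c j * \<chi> j e = 0"
    using insert.prems(4)[OF S(1)] insert.hyps by simp
  then show ?case using cF insert.prems(2)[of j] by simp
qed

text \<open>Monomials are pairwise different characters of the multiplicative monoid of all points;
  a point with one coordinate 2 and all others 1 tells two of them apart.\<close>

lemma pev_eq_0_imp:
  fixes f :: "('v \<Rightarrow>\<^sub>0 nat) \<Rightarrow>\<^sub>0 complex"
  assumes "\<And>p. pev p f = 0"
  shows "f = 0"
proof -
  have "\<forall>m\<in>keys f. lookup f m = 0"
  proof (rule characters_independent[where e = "\<lambda>_. 1" and S = UNIV and op = "\<lambda>p q v. p v * q v"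
        and \<chi> = "\<lambda>m p. mon_ev p m"])
    fix m n :: "'v \<Rightarrow>\<^sub>0 nat" assume "m \<noteq> n"
    then obtain v where v: "lookup m v \<noteq> lookup n v" using poly_mapping_eqI by metis
    let ?p = "\<lambda>w. if w = v then 2 else (1 :: complex)"
    have *: "mon_ev ?p k = 2 ^ lookup k v" for k
    proof -
      have "mon_ev ?p k = (\<Prod>w\<in>insert v (keys k). ?p w ^ lookup k w)"
        by (rule mon_ev_superset) auto
      also have "\<dots> = (\<Prod>w\<in>insert v (keys k). if w = v then 2 ^ lookup k v else 1)"
        by (rule prod.cong) auto
      also have "\<dots> = 2 ^ lookup k v" by (subst prod.delta) auto
      finally show ?thesis .
    qed
    have "(2::complex) ^ a \<noteq> 2 ^ b" if "a \<noteq> b" for a b :: nat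
    proof
      assume "(2::complex) ^ a = 2 ^ b"
      then have "norm ((2::complex) ^ a) = norm ((2::complex) ^ b)" by simp
      then have "(2::real) ^ a = 2 ^ b" by (simp add: norm_power)
      then show False using that by simp
    qed
    then have "mon_ev ?p m \<noteq> mon_ev ?p n" using v * by metis
    then show "\<exists>p\<in>UNIV. mon_ev p m \<noteq> (mon_ev p n :: complex)" by blast
  qed (use assms in \<open>auto simp: mon_ev_mult pev_def mon_ev_def[of "\<lambda>_. 1"]\<close>)
  then show ?thesis by (metis in_keys_iff poly_mapping_eqI lookup_zero)
qed

lemma pev_on_line:
  fixes f :: "('v \<Rightarrow>\<^sub>0 nat) \<Rightarrow>\<^sub>0 complex"
  shows "\<exists>q. \<forall>t. pev (\<lambda>v. x v + t * (y v - x v)) f = poly q t"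
proof -
  define q where "q = (\<Sum>m\<in>keys f. smult (lookup f m) (\<Prod>v\<in>keys m. [:x v, y v - x v:] ^ lookup m v))"
  have "\<forall>t. pev (\<lambda>v. x v + t * (y v - x v)) f = poly q t"
    by (simp add: q_def pev_def mon_ev_def poly_sum poly_prod poly_power algebra_simps)
  then show ?thesis ..
qed

text \<open>On the line through \<open>x\<close> and \<open>y\<close> both polynomials become
  nonzero polynomials in one variable, with finitely many zeros altogether. Coordinates in which
  \<open>x\<close> and \<open>y\<close> agree are constant on the line; this keeps \<open>z\<close>
  inside coordinate subspaces and is the form in which irreducibility of affine spaces is used
  throughout.\<close>

lemma common_nonzero:
  fixes f g :: "('v \<Rightarrow>\<^sub>0 nat) \<Rightarrow>\<^sub>0 complex"
  assumes "pev x f \<noteq> 0" "pev y g \<noteq> 0"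
  shows "\<exists>z. pev z f \<noteq> 0 \<and> pev z g \<noteq> 0 \<and> (\<forall>v. x v = y v \<longrightarrow> z v = x v)"
proof -
  obtain q where q: "\<And>t. pev (\<lambda>v. x v + t * (y v - x v)) f = poly q t" using pev_on_line by metis
  obtain q' where q': "\<And>t. pev (\<lambda>v. x v + t * (y v - x v)) g = poly q' t" using pev_on_line by metis
  have "poly q 0 \<noteq> 0" "poly q' 1 \<noteq> 0" using assms q[of 0] q'[of 1] by auto
  then have "q * q' \<noteq> 0" by auto
  then have "finite {t. poly (q * q') t = 0}" by (rule poly_roots_finite)
  then obtain t where "poly (q * q') t \<noteq> 0"
    by (metis (mono_tags, lifting) UNIV_I finite_subset infinite_UNIV_char_0 mem_Collect_eq subsetI)
  then have "pev (\<lambda>v. x v + t * (y v - x v)) f \<noteq> 0" "pev (\<lambda>v. x v + t * (y v - x v)) g \<noteq> 0"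
    unfolding q q' by auto
  then show ?thesis by (intro exI[of _ "\<lambda>v. x v + t * (y v - x v)"]) auto
qed

lemma common_nonzero_finite:
  fixes f :: "'i \<Rightarrow> ('v \<Rightarrow>\<^sub>0 nat) \<Rightarrow>\<^sub>0 complex"
  assumes "finite A" "\<And>i. i \<in> A \<Longrightarrow> \<exists>x. pev x (f i) \<noteq> 0 \<and> (\<forall>v\<in>V. x v = a v)"
  shows "\<exists>x. (\<forall>i\<in>A. pev x (f i) \<noteq> 0) \<and> (\<forall>v\<in>V. x v = a v)"
  using assms
proof (induction A rule: finite_induct)
  case (insert i A)
  obtain x where x: "\<forall>i\<in>A. pev x (f i) \<noteq> 0" "\<forall>v\<in>V. x v = a v" using insert by auto
  obtain y where y: "pev y (f i) \<noteq> 0" "\<forall>v\<in>V. y v = a v" using insert.prems by blast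
  have "pev x (prod f A) \<noteq> 0" using x insert.hyps by (simp add: pev_prod)
  from common_nonzero[OF this y(1)] obtain z where
    "pev z (prod f A) \<noteq> 0" "pev z (f i) \<noteq> 0" "\<forall>v. x v = y v \<longrightarrow> z v = x v" by blast
  then show ?case using x y insert.hyps by (intro exI[of _ z]) (auto simp: pev_prod)
qed auto

lemma poly_subst:
  fixes \<sigma> :: "'v \<Rightarrow> ('w \<Rightarrow>\<^sub>0 nat) \<Rightarrow>\<^sub>0 'r::comm_ring_1"
  shows "\<exists>g'. \<forall>y. pev y g' = pev (\<lambda>v. pev y (\<sigma> v)) g"
proof
  show "\<forall>y. pev y (\<Sum>m\<in>keys g. const_poly (lookup g m) * mon_ev \<sigma> m) = pev (\<lambda>v. pev y (\<sigma> v)) g"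
    by (simp add: pev_sum pev_mult pev_mon_ev) (simp add: pev_def)
qed

text \<open>All coordinates have the same denominator \<open>pev y f\<close>; its power
  \<open>k\<close> clears every monomial of \<open>g\<close>, as \<open>k\<close> is at least the
  degree of each.\<close>

lemma poly_subst_frac:
  fixes c :: "'v \<Rightarrow> ('w \<Rightarrow>\<^sub>0 nat) \<Rightarrow>\<^sub>0 'r::field"
  shows "\<exists>k g'. \<forall>y. pev y f \<noteq> 0 \<longrightarrow> pev (\<lambda>v. pev y (c v) / pev y f) g * pev y f ^ k = pev y g'"
proof -
  define s where "s m = (\<Sum>v\<in>keys m. lookup m v)" for m :: "'v \<Rightarrow>\<^sub>0 nat"
  define k where "k = (\<Sum>m\<in>keys g. s m)"
  define g' where "g' = (\<Sum>m\<in>keys g. const_poly (lookup g m) * mon_ev c m * f ^ (k - s m))"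
  have le: "s m \<le> k" if "m \<in> keys g" for m
    unfolding k_def using that by (intro member_le_sum) auto
  have "pev (\<lambda>v. pev y (c v) / pev y f) g * pev y f ^ k = pev y g'" if y: "pev y f \<noteq> 0" for y
  proof -
    have m: "mon_ev (\<lambda>v. pev y (c v) / pev y f) m * pev y f ^ k =
        mon_ev (\<lambda>v. pev y (c v)) m * pev y f ^ (k - s m)" if "m \<in> keys g" for m
    proof -
      have "mon_ev (\<lambda>v. pev y (c v) / pev y f) m = mon_ev (\<lambda>v. pev y (c v)) m / pev y f ^ s m"
        by (simp add: mon_ev_def power_divide prod_dividef s_def power_sum)
      then show ?thesis using y le[OF that] by (simp add: power_diff)
    qed
    show ?thesis
      unfolding g'_def pev_sum pev_def[of "\<lambda>v. pev y (c v) / pev y f"] sum_distrib_right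
    proof (rule sum.cong[OF refl])
      fix n assume "n \<in> keys g"
      from m[OF this] show "lookup g n * mon_ev (\<lambda>v. pev y (c v) / pev y f) n * pev y f ^ k =
          pev y (const_poly (lookup g n) * mon_ev c n * f ^ (k - s n))"
        by (simp only: pev_mult pev_power pev_mon_ev pev_const mult.assoc)
    qed
  qed
  then show ?thesis by blast
qed

section \<open>Specialization of the coefficients at a point of the base\<close>

definition spec :: "(nat \<Rightarrow> complex) \<Rightarrow> ('m \<Rightarrow>\<^sub>0 base_poly) \<Rightarrow> ('m \<Rightarrow>\<^sub>0 complex)" where
  "spec x F = Poly_Mapping.map (poly_eval x) F"

lemma fibre_eq_spec: "fibre I x = spec x ` I"
  by (simp add: fibre_def spec_def)

lemma lookup_spec [simp]: "lookup (spec x F) m = pev x (lookup F m)"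
  by (simp add: spec_def Poly_Mapping.map.rep_eq when_def poly_eval_eq_pev)

lemma keys_spec: "keys (spec x F) \<subseteq> keys F"
  by (auto simp: in_keys_iff)

lemma spec_add: "spec x (F + G) = spec x F + spec x G"
  by (rule poly_mapping_eqI) (simp add: lookup_add pev_add)

lemma spec_0 [simp]: "spec x 0 = 0"
  by (rule poly_mapping_eqI) simp

lemma spec_diff: "spec x (F - G) = spec x F - spec x G"
  by (rule poly_mapping_eqI) (simp add: lookup_minus pev_diff)

lemma spec_sum: "spec x (sum F A) = (\<Sum>a\<in>A. spec x (F a))"
  by (induction A rule: infinite_finite_induct) (simp_all add: spec_add)

lemma spec_single [simp]: "spec x (single m c) = single m (pev x c)"
  by (rule poly_mapping_eqI) (simp add: lookup_single when_def)

lemma spec_const [simp]: "spec x (const_poly c) = const_poly (pev x c)"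
  by (simp add: const_poly_def)

lemma spec_mult: "spec x (F * G) = spec x F * spec x (G :: 'm::comm_monoid_add \<Rightarrow>\<^sub>0 base_poly)"
proof -
  have "F * G = (\<Sum>m\<in>keys F. \<Sum>n\<in>keys G. single m (lookup F m) * single n (lookup G n))"
    unfolding sum_product[symmetric] poly_expand[symmetric] ..
  then have "spec x (F * G) =
      (\<Sum>m\<in>keys F. \<Sum>n\<in>keys G. spec x (single m (lookup F m)) * spec x (single n (lookup G n)))"
    by (simp add: spec_sum mult_single pev_mult)
  also have "\<dots> = spec x F * spec x G"
    unfolding sum_product[symmetric] spec_sum[symmetric] poly_expand[symmetric] ..
  finally show ?thesis .
qed

definition lift_const :: "('m \<Rightarrow>\<^sub>0 complex) \<Rightarrow> ('m \<Rightarrow>\<^sub>0 base_poly)" where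
  "lift_const f = Poly_Mapping.map const_poly f"

lemma lookup_lift_const [simp]: "lookup (lift_const f) m = const_poly (lookup f m)"
  by (simp add: lift_const_def Poly_Mapping.map.rep_eq when_def)

lemma spec_lift_const [simp]: "spec x (lift_const f) = f"
  by (rule poly_mapping_eqI) simp

lemma keys_lift_const: "keys (lift_const f) \<subseteq> keys f"
  by (auto simp: in_keys_iff)

section \<open>Linear algebra\<close>

lemma homogeneous_system:
  fixes G :: "'a \<Rightarrow> 'b \<Rightarrow> 'f::field"
  assumes "finite B" "finite A" "card B < card A"
  shows "\<exists>c. (\<exists>a\<in>A. c a \<noteq> 0) \<and> (\<forall>b\<in>B. (\<Sum>a\<in>A. c a * G a b) = 0)"
  using assms
proof (induction B arbitrary: A G rule: finite_induct)
  case empty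
  then have "A \<noteq> {}" by auto
  then show ?case by (intro exI[of _ "\<lambda>_. 1"]) auto
next
  case (insert b B)
  show ?case
  proof (cases "\<forall>a\<in>A. G a b = 0")
    case True
    obtain c where "\<exists>a\<in>A. c a \<noteq> 0" "\<forall>b\<in>B. (\<Sum>a\<in>A. c a * G a b) = 0"
      using insert.IH[of A G] insert.prems insert.hyps by auto
    then show ?thesis using True by (intro exI[of _ c]) auto
  next
    case False
    then obtain a0 where a0: "a0 \<in> A" "G a0 b \<noteq> 0" by auto
    \<comment> \<open>The equation \<open>b\<close> is solved for the unknown \<open>a0\<close> and
      substituted into the other equations.\<close>
    define H where "H a b' = G a b' - G a b / G a0 b * G a0 b'" for a b'
    have "card B < card (A - {a0})" using insert a0 by simp
    then obtain c where c: "\<exists>a\<in>A - {a0}. c a \<noteq> 0" "\<forall>b\<in>B. (\<Sum>a\<in>A - {a0}. c a * H a b) = 0"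
      using insert.IH[of "A - {a0}" H] insert.prems by auto
    define k where "k = (\<Sum>a\<in>A - {a0}. c a * G a b / G a0 b)"
    let ?c = "c(a0 := - k)"
    have *: "(\<Sum>a\<in>A. ?c a * G a b') = (\<Sum>a\<in>A - {a0}. c a * H a b')" for b'
    proof -
      have "(\<Sum>a\<in>A. ?c a * G a b') = - k * G a0 b' + (\<Sum>a\<in>A - {a0}. c a * G a b')"
        using a0 insert.prems by (subst sum.remove[of _ a0]) auto
      also have "\<dots> = (\<Sum>a\<in>A - {a0}. c a * H a b')"
      proof -
        have "c a * H a b' = c a * G a b' - c a * G a b / G a0 b * G a0 b'" for a
          by (simp add: H_def right_diff_distrib)
        then show ?thesis by (simp add: k_def sum_subtractf sum_distrib_right)
      qed
      finally show ?thesis .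
    qed
    have "H a b = 0" for a using a0 by (simp add: H_def)
    then have "(\<Sum>a\<in>A. ?c a * G a b) = 0" unfolding * by simp
    moreover have "\<forall>b'\<in>B. (\<Sum>a\<in>A. ?c a * G a b') = 0" unfolding * by (rule c)
    moreover have "\<exists>a\<in>A. ?c a \<noteq> 0" using c(1) by auto
    ultimately show ?thesis by (intro exI[of _ ?c]) blast
  qed
qed

definition lin_closed :: "('k \<Rightarrow> 'f::comm_ring_1) set \<Rightarrow> bool" where
  "lin_closed V \<longleftrightarrow> (\<lambda>_. 0) \<in> V \<and> (\<forall>u\<in>V. \<forall>v\<in>V. (\<lambda>a. u a + v a) \<in> V) \<and> (\<forall>c. \<forall>v\<in>V. (\<lambda>a. c * v a) \<in> V)"

lemma lin_closed_add: "lin_closed V \<Longrightarrow> u \<in> V \<Longrightarrow> v \<in> V \<Longrightarrow> (\<lambda>a. u a + v a) \<in> V"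
  by (simp add: lin_closed_def)

lemma lin_closed_scale: "lin_closed V \<Longrightarrow> v \<in> V \<Longrightarrow> (\<lambda>a. c * v a) \<in> V"
  by (simp add: lin_closed_def)

lemma lin_closed_comb:
  assumes "lin_closed V" "\<And>i. i \<in> I \<Longrightarrow> w i \<in> V"
  shows "(\<lambda>a. \<Sum>i\<in>I. c i * w i a) \<in> V"
  using assms(2)
proof (induction I rule: infinite_finite_induct)
  case (insert i I)
  then have "w i \<in> V" "(\<lambda>a. \<Sum>i\<in>I. c i * w i a) \<in> V" by auto
  from lin_closed_add[OF assms(1) lin_closed_scale[OF assms(1) this(1)] this(2)]
  have "(\<lambda>a. c i * w i a + (\<Sum>i\<in>I. c i * w i a)) \<in> V" .
  then show ?case using insert.hyps by simp
qed (use assms(1) in \<open>simp_all add: lin_closed_def\<close>)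

lemma lin_closed_diff:
  assumes "lin_closed V" "u \<in> V" "v \<in> V"
  shows "(\<lambda>a. u a - c * v a) \<in> V"
  using lin_closed_add[OF assms(1,2) lin_closed_scale[OF assms(1,3), of "- c"]] by simp

text \<open>A reduced row echelon family with pivot positions \<open>E\<close>.\<close>

definition dual_family :: "('k \<Rightarrow> 'f::comm_ring_1) set \<Rightarrow> 'k set \<Rightarrow> ('k \<Rightarrow> 'k \<Rightarrow> 'f) \<Rightarrow> bool" where
  "dual_family V E w \<longleftrightarrow> (\<forall>e\<in>E. w e \<in> V \<and> (\<forall>e'\<in>E. w e e' = (if e' = e then 1 else 0)))"

text \<open>A largest set of pivots is taken. A vector of \<open>V\<close> that vanishes at all
  pivots but not on \<open>A\<close> would supply one more.\<close>

lemma maximal_dual_family: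
  fixes V :: "('k \<Rightarrow> 'f::field) set"
  assumes V: "lin_closed V" and A: "finite A"
  obtains E w where "E \<subseteq> A" "dual_family V E w"
    "\<And>v. v \<in> V \<Longrightarrow> (\<And>e. e \<in> E \<Longrightarrow> v e = 0) \<Longrightarrow> (\<forall>a\<in>A. v a = 0)"
proof -
  define P where "P E \<longleftrightarrow> E \<subseteq> A \<and> (\<exists>w. dual_family V E w)" for E
  have "P {}" by (simp add: P_def dual_family_def)
  moreover have "\<forall>E. P E \<longrightarrow> card E \<le> card A" using A by (auto simp: P_def card_mono)
  ultimately obtain E where E: "P E" and max: "\<And>E'. P E' \<Longrightarrow> card E' \<le> card E"
    using ex_has_greatest_nat_lemma[of P "{}" card "card A"]
    by (metis le_eq_less_or_eq ex_has_greatest_nat)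
  obtain w where w: "dual_family V E w" and EA: "E \<subseteq> A" using E by (auto simp: P_def)
  have "\<forall>a\<in>A. v a = 0" if v: "v \<in> V" and v0: "\<And>e. e \<in> E \<Longrightarrow> v e = 0" for v
  proof (rule ccontr)
    assume "\<not> ?thesis"
    then obtain a where a: "a \<in> A" "v a \<noteq> 0" by auto
    have aE: "a \<notin> E" using a v0 by auto
    define v' where "v' = (\<lambda>b. inverse (v a) * v b)"
    have v': "v' \<in> V" "v' a = 1" "\<And>e. e \<in> E \<Longrightarrow> v' e = 0"
      using lin_closed_scale[OF V v] a v0 unfolding v'_def by auto
    \<comment> \<open>The normalized vector \<open>v'\<close> becomes the row of the new pivot, and
      its multiples clear the column \<open>a\<close> in the other rows.\<close>
    define w' where "w' e = (if e = a then v' else (\<lambda>b. w e b - w e a * v' b))" for e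
    have "dual_family V (insert a E) w'"
      unfolding dual_family_def
    proof
      fix e assume e: "e \<in> insert a E"
      show "w' e \<in> V \<and> (\<forall>e'\<in>insert a E. w' e e' = (if e' = e then 1 else 0))"
      proof (cases "e = a")
        case True
        then show ?thesis using v' aE by (auto simp: w'_def)
      next
        case False
        then have "w e \<in> V" using e w by (auto simp: dual_family_def)
        then have "w' e \<in> V" using False lin_closed_diff[OF V _ v'(1)] by (simp add: w'_def)
        then show ?thesis using False e v' w aE by (auto simp: w'_def dual_family_def)
      qed
    qed
    then have "P (insert a E)" using EA a by (auto simp: P_def)
    from max[OF this] show False using aE finite_subset[OF EA A] by simp
  qed
  then show thesis using that EA w by blast
qed

lemma dual_family_expand:
  fixes V :: "('k \<Rightarrow> 'f::field) set"
  assumes V: "lin_closed V" and A: "finite A" "E \<subseteq> A" and w: "dual_family V E w"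
    and max: "\<And>v. v \<in> V \<Longrightarrow> (\<And>e. e \<in> E \<Longrightarrow> v e = 0) \<Longrightarrow> (\<forall>a\<in>A. v a = 0)"
    and v: "v \<in> V" and a: "a \<in> A"
  shows "v a = (\<Sum>e\<in>E. v e * w e a)"
proof -
  have fE: "finite E" using A finite_subset by blast
  let ?s = "\<lambda>a. \<Sum>e\<in>E. v e * w e a"
  have "?s \<in> V" by (rule lin_closed_comb[OF V]) (use w in \<open>auto simp: dual_family_def\<close>)
  then have "(\<lambda>a. v a - 1 * ?s a) \<in> V" by (rule lin_closed_diff[OF V v])
  then have "\<forall>a\<in>A. v a - 1 * ?s a = 0"
  proof (rule max)
    fix e assume e: "e \<in> E"
    have "?s e = (\<Sum>e'\<in>E. if e' = e then v e' else 0)"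
      using w e by (intro sum.cong refl) (auto simp: dual_family_def)
    then show "v e - 1 * ?s e = 0" using e fE by simp
  qed
  then show ?thesis using a by auto
qed

text \<open>If each \<open>y\<close> that annihilates \<open>W\<close> vanishes at
  \<open>e0\<close>, then the unit vector of \<open>e0\<close> annihilates the annihilator of
  \<open>W\<close>, and so lies in \<open>W\<close> up to the values outside
  \<open>A\<close>.\<close>

lemma double_annihilator:
  fixes W :: "('k \<Rightarrow> 'f::field) set"
  assumes W: "lin_closed W" and A: "finite A" and e0: "e0 \<in> A"
    and ann: "\<And>y. (\<forall>w\<in>W. (\<Sum>a\<in>A. w a * y a) = 0) \<Longrightarrow> y e0 = 0"
  shows "\<exists>w\<in>W. \<forall>a\<in>A. w a = (if a = e0 then 1 else 0)"
proof -
  obtain E w where E: "E \<subseteq> A" and w: "dual_family W E w" and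
    max: "\<And>v. v \<in> W \<Longrightarrow> (\<And>e. e \<in> E \<Longrightarrow> v e = 0) \<Longrightarrow> (\<forall>a\<in>A. v a = 0)"
    using maximal_dual_family[OF W A] by blast
  have fE: "finite E" using A E finite_subset by blast
  \<comment> \<open>\<open>y a\<close> is the equation
    \<open>v a = \<Sum>e\<in>E. v e * w e a\<close> of \<open>dual_family_expand\<close>, read as a
    linear form in \<open>v\<close>. That all of these vanish at \<open>e0\<close> says that
    \<open>e0\<close> is a pivot and that its row is a unit vector on \<open>A\<close>.\<close>
  define y where "y a b = (if b = a then 1 else 0) - (if b \<in> E then w b a else 0)" for a b
  have y: "(\<Sum>b\<in>A. v b * y a b) = 0" if v: "v \<in> W" and a: "a \<in> A" for v a
  proof -
    have "(\<Sum>b\<in>A. v b * y a b) = (\<Sum>b\<in>A. if b = a then v b else 0) - (\<Sum>b\<in>A. if b \<in> E then v b * w b a else 0)"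
      unfolding sum_subtractf[symmetric] by (intro sum.cong refl) (auto simp: y_def algebra_simps)
    also have "(\<Sum>b\<in>A. if b = a then v b else 0) = v a" using A a by simp
    also have "(\<Sum>b\<in>A. if b \<in> E then v b * w b a else 0) = (\<Sum>b\<in>E. v b * w b a)"
      using E A by (simp add: sum.inter_restrict[symmetric] Int_absorb1)
    finally show ?thesis using dual_family_expand[OF W A E w max v a] by simp
  qed
  have y0: "y a e0 = 0" if "a \<in> A" for a using ann[of "y a"] y that by auto
  have e0E: "e0 \<in> E" using y0[OF e0] by (auto simp: y_def split: if_splits)
  have "w e0 a = (if a = e0 then 1 else 0)" if "a \<in> A" for a
    using y0[OF that] e0E by (auto simp: y_def split: if_splits)
  then show ?thesis using w e0E unfolding dual_family_def by blast
qed

text \<open>Gaussian elimination with pivots that do not vanish at \<open>x\<close>.\<close>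

lemma nakayama:
  fixes M :: "('k \<Rightarrow> base_poly) set"
  assumes A: "finite A" and M: "lin_closed M"
    and gen: "\<And>a. a \<in> A \<Longrightarrow> \<exists>w\<in>M. \<forall>k\<in>A. pev x (w k) = (if k = a then 1 else 0)"
  shows "\<exists>f. pev x f \<noteq> 0 \<and> (\<forall>a\<in>A. \<exists>w\<in>M. \<forall>k\<in>A. w k = (if k = a then f else 0))"
proof -
  have "\<exists>f. pev x f \<noteq> 0 \<and> (\<forall>a\<in>A. \<exists>w\<in>M. \<forall>k\<in>A.
      (k \<in> E \<longrightarrow> w k = (if k = a then f else 0)) \<and>
      (k \<notin> E \<longrightarrow> pev x (w k) = (if k = a then pev x f else 0)))"
    if "finite E" "E \<subseteq> A" for E
    using that
  proof (induction E rule: finite_induct)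
    case empty
    show ?case using gen by (intro exI[of _ 1]) (simp add: if_distrib cong: if_cong)
  next
    case (insert e E)
    then obtain f where f: "pev x f \<noteq> 0" and "\<forall>a\<in>A. \<exists>w\<in>M. \<forall>k\<in>A.
      (k \<in> E \<longrightarrow> w k = (if k = a then f else 0)) \<and>
      (k \<notin> E \<longrightarrow> pev x (w k) = (if k = a then pev x f else 0))" by auto
    from bchoice[OF this(2)[unfolded Bex_def]] obtain w where w: "\<And>a. a \<in> A \<Longrightarrow> w a \<in> M"
      "\<And>a k. a \<in> A \<Longrightarrow> k \<in> A \<Longrightarrow> k \<in> E \<Longrightarrow> w a k = (if k = a then f else 0)"
      "\<And>a k. a \<in> A \<Longrightarrow> k \<in> A \<Longrightarrow> k \<notin> E \<Longrightarrow> pev x (w a k) = (if k = a then pev x f else 0)"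
      by blast
    have eA: "e \<in> A" using insert by auto
    define g where "g = w e e"
    have g: "pev x g = pev x f" using w(3)[OF eA eA] insert by (simp add: g_def)
    \<comment> \<open>The pivot \<open>g\<close> has the same value at \<open>x\<close> as
      \<open>f\<close>. Cross-multiplication in place of division keeps the entries polynomial and
      changes the common diagonal entry from \<open>f\<close> to \<open>f * g\<close>.\<close>
    define w' where "w' a = (if a = e then (\<lambda>k. f * w e k) else (\<lambda>k. g * w a k - w a e * w e k))" for a
    show ?case
    proof (intro exI conjI ballI)
      show "pev x (f * g) \<noteq> 0" using f g by (simp add: pev_mult)
      fix a assume a: "a \<in> A"
      show "\<exists>w\<in>M. \<forall>k\<in>A. (k \<in> insert e E \<longrightarrow> w k = (if k = a then f * g else 0)) \<and>
          (k \<notin> insert e E \<longrightarrow> pev x (w k) = (if k = a then pev x (f * g) else 0))"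
      proof (rule bexI[of _ "w' a"])
        have "(\<lambda>k. g * w a k) \<in> M" by (rule lin_closed_scale[OF M w(1)[OF a]])
        from lin_closed_diff[OF M this w(1)[OF eA], of "w a e"]
        have "(\<lambda>k. g * w a k - w a e * w e k) \<in> M" .
        moreover have "(\<lambda>k. f * w e k) \<in> M" by (rule lin_closed_scale[OF M w(1)[OF eA]])
        ultimately show "w' a \<in> M" by (simp add: w'_def)
        have ae: "pev x (w a e) = 0" if "a \<noteq> e" using w(3)[OF a eA] insert.hyps that by auto
        show "\<forall>k\<in>A. (k \<in> insert e E \<longrightarrow> w' a k = (if k = a then f * g else 0)) \<and>
          (k \<notin> insert e E \<longrightarrow> pev x (w' a k) = (if k = a then pev x (f * g) else 0))"
        proof (intro ballI conjI impI)
          fix k assume k: "k \<in> A"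
          show "w' a k = (if k = a then f * g else 0)" if "k \<in> insert e E"
            using that k a eA w(2)[OF a k] w(2)[OF eA k] insert.hyps
            by (auto simp: w'_def g_def[symmetric] algebra_simps)
          show "pev x (w' a k) = (if k = a then pev x (f * g) else 0)" if "k \<notin> insert e E"
            using that k a eA w(3)[OF a k] w(3)[OF eA k] insert.hyps ae g
            by (auto simp: w'_def pev_mult pev_diff)
        qed
      qed
    qed
  qed
  from this[OF A order_refl] show ?thesis by auto
qed

section \<open>The graded ring\<close>

lemma UNIV_var: "(UNIV :: ('a, 'b, 'c) var set) = range Alpha \<union> range Beta \<union> range Gamma"
proof -
  have "z \<in> range Alpha \<union> range Beta \<union> range Gamma" for z :: "('a, 'b, 'c) var"
    by (cases z) auto
  then show ?thesis by auto
qed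

instance var :: (finite, finite, finite) finite
  by standard (simp add: UNIV_var)

primrec vdeg :: "('a, 'b, 'c) var \<Rightarrow> degree" where
  "vdeg (Alpha _) = (1, 0, 0)" | "vdeg (Beta _) = (0, 1, 0)" | "vdeg (Gamma _) = (0, 0, 1)"

lemma mdeg_0 [simp]: "mdeg 0 = 0"
  by (simp add: mdeg_def zero_prod_def)

lemma mdeg_add: "mdeg (m + n) = mdeg m + mdeg n"
  by (simp add: mdeg_def lookup_add sum.distrib)

lemma mdeg_single_1 [simp]: "mdeg (single z 1) = vdeg z"
proof -
  have *: "(\<Sum>i\<in>UNIV. int (if x = i then Suc 0 else 0)) = 1" for x :: "'d::finite"
    using sum.delta'[of UNIV x "\<lambda>_. 1 :: int"] by (simp add: if_distrib cong: if_cong)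
  show ?thesis by (cases z) (simp_all add: mdeg_def lookup_single when_def *)
qed

lemma mdeg_nonneg: "0 \<le> mdeg m"
  by (auto simp: mdeg_def less_eq_prod_def zero_prod_def sum_nonneg)

definition Mon :: "degree \<Rightarrow> ('a::finite, 'b::finite, 'c::finite) monom set" where
  "Mon u = {m. mdeg m = u}"

lemma lookup_le_mdeg:
  assumes "mdeg m = (a, b, c)"
  shows "int (lookup m z) \<le> a + b + c"
proof -
  have e: "(\<Sum>i\<in>UNIV. int (lookup m (Alpha i))) = a" "(\<Sum>j\<in>UNIV. int (lookup m (Beta j))) = b"
    "(\<Sum>k\<in>UNIV. int (lookup m (Gamma k))) = c"
    using assms by (auto simp: mdeg_def)
  have s: "int (lookup m (Alpha i)) \<le> a" "int (lookup m (Beta j)) \<le> b" "int (lookup m (Gamma k)) \<le> c" for i j k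
    unfolding e[symmetric] by (rule member_le_sum; simp)+
  have n: "a \<ge> 0" "b \<ge> 0" "c \<ge> 0"
    using mdeg_nonneg[of m] assms by (auto simp: less_eq_prod_def zero_prod_def)
  show ?thesis
  proof (cases z)
    case (Alpha i)
    then show ?thesis using s(1)[of i] n by simp
  next
    case (Beta j)
    then show ?thesis using s(2)[of j] n by simp
  next
    case (Gamma k)
    then show ?thesis using s(3)[of k] n by simp
  qed
qed

lemma finite_Mon [simp]: "finite (Mon u :: ('a::finite, 'b::finite, 'c::finite) monom set)"
proof -
  obtain a b c where u: "u = (a, b, c)" by (cases u)
  have "lookup ` (Mon u :: ('a, 'b, 'c) monom set) \<subseteq> PiE UNIV (\<lambda>_. {..nat (a + b + c)})"
  proof
    fix f assume "f \<in> lookup ` (Mon u :: ('a, 'b, 'c) monom set)"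
    then obtain m :: "('a, 'b, 'c) monom" where m: "mdeg m = (a, b, c)" "f = lookup m"
      by (auto simp: Mon_def u)
    have "lookup m z \<le> nat (a + b + c)" for z using lookup_le_mdeg[OF m(1), of z] by linarith
    then show "f \<in> PiE UNIV (\<lambda>_. {..nat (a + b + c)})" by (auto simp: m PiE_def)
  qed
  then have "finite (lookup ` (Mon u :: ('a, 'b, 'c) monom set))" by (rule finite_subset) (auto intro: finite_PiE)
  then show ?thesis by (rule finite_imageD) (metis inj_onI poly_mapping_eq_iff)
qed

lemma piece_iff: "f \<in> piece u \<longleftrightarrow> keys f \<subseteq> Mon u"
  by (auto simp: piece_def Mon_def)

lemma piece_expand: "f \<in> piece u \<Longrightarrow> f = (\<Sum>m\<in>Mon u. single m (lookup f m))"
  by (rule poly_expand_superset) (auto simp: piece_iff)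

lemma single_piece: "m \<in> Mon u \<Longrightarrow> single m c \<in> piece u"
  by (auto simp: piece_iff)

lemma piece_0 [simp]: "0 \<in> piece u"
  by (simp add: piece_def)

lemma piece_add: "f \<in> piece u \<Longrightarrow> g \<in> piece u \<Longrightarrow> f + g \<in> piece u"
  using Poly_Mapping.keys_add[of f g] by (auto simp: piece_iff)

lemma keys_diff': "keys (f - g) \<subseteq> keys f \<union> keys (g :: _ \<Rightarrow>\<^sub>0 'r::ab_group_add)"
  by (auto simp: in_keys_iff lookup_minus)

lemma piece_diff: "f \<in> piece u \<Longrightarrow> g \<in> piece u \<Longrightarrow> f - g \<in> piece u"
  for f :: "('a::finite, 'b::finite, 'c::finite, 'r::ab_group_add) cox"
  using keys_diff'[of f g] by (auto simp: piece_iff)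

lemma piece_const: "f \<in> piece u \<Longrightarrow> const_poly c * f \<in> piece u"
  for f :: "('a::finite, 'b::finite, 'c::finite, 'r::comm_ring_1) cox"
  using keys_const_poly_mult[of c f] by (auto simp: piece_iff)

lemma piece_sum: "(\<And>i. i \<in> A \<Longrightarrow> f i \<in> piece u) \<Longrightarrow> sum f A \<in> piece u"
  by (induction A rule: infinite_finite_induct) (auto intro: piece_add)

lemma piece_mult: "f \<in> piece u \<Longrightarrow> g \<in> piece v \<Longrightarrow> f * g \<in> piece (u + v)"
  for f :: "('a::finite, 'b::finite, 'c::finite, 'r::comm_ring_1) cox"
  using keys_mult[of f g] by (fastforce simp: piece_def mdeg_add)

definition hcomp :: "degree \<Rightarrow> ('a::finite, 'b::finite, 'c::finite, 'r::zero) cox \<Rightarrow> ('a, 'b, 'c, 'r) cox" where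
  "hcomp u f = Poly_Mapping.mapp (\<lambda>m c. if mdeg m = u then c else 0) f"

lemma lookup_hcomp: "lookup (hcomp u f) m = (if mdeg m = u then lookup f m else 0)"
  by (auto simp: hcomp_def lookup_mapp when_def in_keys_iff)

lemma hcomp_piece [simp]: "hcomp u f \<in> piece u"
  by (auto simp: piece_def in_keys_iff lookup_hcomp split: if_splits)

lemma hcomp_0 [simp]: "hcomp u 0 = 0"
  by (rule poly_mapping_eqI) (simp add: lookup_hcomp)

lemma hcomp_add: "hcomp u (f + g) = hcomp u f + hcomp u g"
  by (rule poly_mapping_eqI) (simp add: lookup_hcomp lookup_add)

lemma hcomp_diff: "hcomp u (f - g) = hcomp u f - hcomp u g"
  for f :: "('a::finite, 'b::finite, 'c::finite, 'r::ab_group_add) cox"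
  by (rule poly_mapping_eqI) (simp add: lookup_hcomp lookup_minus)

lemma hcomp_sum: "hcomp u (sum f A) = (\<Sum>a\<in>A. hcomp u (f a))"
  by (induction A rule: infinite_finite_induct) (auto simp: hcomp_add)

lemma hcomp_const: "hcomp u (const_poly c * f) = const_poly c * hcomp u f"
  for f :: "('a::finite, 'b::finite, 'c::finite, 'r::comm_ring_1) cox"
  by (rule poly_mapping_eqI) (simp add: lookup_hcomp)

lemma hcomp_of_piece: "f \<in> piece v \<Longrightarrow> hcomp u f = (if u = v then f else 0)"
  by (rule poly_mapping_eqI) (auto simp: lookup_hcomp piece_def in_keys_iff)

lemma hcomp_spec: "hcomp u (spec x F) = spec x (hcomp u F)"
  by (rule poly_mapping_eqI) (simp add: lookup_hcomp)

lemma hcomp_decompose: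
  fixes f :: "('a::finite, 'b::finite, 'c::finite, 'r::comm_monoid_add) cox"
  shows "f = (\<Sum>u\<in>mdeg ` keys f. hcomp u f)"
proof (rule poly_mapping_eqI)
  fix m
  have "lookup (\<Sum>u\<in>mdeg ` keys f. hcomp u f) m = (\<Sum>u\<in>mdeg ` keys f. if u = mdeg m then lookup f m else 0)"
    unfolding lookup_sum by (intro sum.cong refl) (auto simp: lookup_hcomp)
  also have "\<dots> = lookup f m" by (auto simp: sum.delta in_keys_iff image_iff)
  finally show "lookup f m = lookup (\<Sum>u\<in>mdeg ` keys f. hcomp u f) m" by simp
qed

lemma hcomp_mult_piece:
  fixes g :: "('a::finite, 'b::finite, 'c::finite, 'r::comm_ring_1) cox"
  assumes g: "g \<in> piece v"
  shows "hcomp u (f * g) = hcomp (u - v) f * g"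
proof -
  have *: "hcomp u (hcomp w f * g) = (if w = u - v then hcomp w f * g else 0)" for w
    using hcomp_of_piece[OF piece_mult[OF hcomp_piece g], of u w f]
    by (auto simp: diff_eq_eq eq_diff_eq)
  have "hcomp u (f * g) = hcomp u ((\<Sum>w\<in>mdeg ` keys f. hcomp w f) * g)"
    by (subst hcomp_decompose[of f]) simp
  also have "\<dots> = (\<Sum>w\<in>mdeg ` keys f. if w = u - v then hcomp w f * g else 0)"
    unfolding sum_distrib_right hcomp_sum * ..
  also have "\<dots> = hcomp (u - v) f * g"
  proof (cases "u - v \<in> mdeg ` keys f")
    case False
    then have "hcomp (u - v) f = 0"
      by (intro poly_mapping_eqI) (metis image_eqI in_keys_iff lookup_hcomp lookup_zero)
    then show ?thesis by (auto intro!: sum.neutral)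
  qed simp
  finally show ?thesis .
qed

lemma homogeneous_ideal_subspace: "homogeneous_ideal I \<Longrightarrow> ideal.subspace I"
  by (auto simp: homogeneous_ideal_def)

lemma homogeneous_ideal_hcomp:
  assumes "homogeneous_ideal I" "f \<in> I"
  shows "hcomp u f \<in> I"
proof -
  obtain G where G: "\<And>g. g \<in> G \<Longrightarrow> \<exists>u. g \<in> piece u" "I = ideal.span G"
    using assms(1) unfolding homogeneous_ideal_def by blast
  have "f \<in> ideal.span G" using assms(2) G by simp
  then have "hcomp u f \<in> ideal.span G"
  proof (induction rule: ideal.span_induct_alt)
    case base
    then show ?case by (simp add: ideal.span_zero)
  next
    case (step c x y)
    obtain v where "x \<in> piece v" using G(1) step by blast
    then have "hcomp u (c * x) \<in> ideal.span G"
      using step by (simp add: hcomp_mult_piece ideal.span_scale ideal.span_base)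
    then show ?case using step by (simp add: hcomp_add ideal.span_add)
  qed
  then show ?thesis using G by simp
qed

lemma homogeneous_idealI:
  assumes "ideal.subspace I" "\<And>f u. f \<in> I \<Longrightarrow> hcomp u f \<in> I"
  shows "homogeneous_ideal I"
  unfolding homogeneous_ideal_def
proof (intro exI[of _ "{g\<in>I. \<exists>u. g \<in> piece u}"] conjI)
  show "I = ideal.span {g \<in> I. \<exists>u. g \<in> piece u}"
  proof
    show "I \<subseteq> ideal.span {g \<in> I. \<exists>u. g \<in> piece u}"
    proof
      fix f assume f: "f \<in> I"
      have "(\<Sum>u\<in>mdeg ` keys f. hcomp u f) \<in> ideal.span {g \<in> I. \<exists>u. g \<in> piece u}"
        by (intro ideal.span_sum ideal.span_base) (use assms(2)[OF f] hcomp_piece in blast)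
      then show "f \<in> ideal.span {g \<in> I. \<exists>u. g \<in> piece u}" using hcomp_decompose[of f] by simp
    qed
    show "ideal.span {g \<in> I. \<exists>u. g \<in> piece u} \<subseteq> I" by (rule ideal.span_minimal) (use assms in auto)
  qed
qed auto

lemma homogeneous_ideal_subsetI:
  assumes "homogeneous_ideal I" "ideal.subspace J" "\<And>u f. f \<in> I \<Longrightarrow> f \<in> piece u \<Longrightarrow> f \<in> J"
  shows "I \<subseteq> J"
proof
  fix f assume f: "f \<in> I"
  have "(\<Sum>u\<in>mdeg ` keys f. hcomp u f) \<in> J"
    by (intro ideal.subspace_sum assms(2)) (rule assms(3)[OF homogeneous_ideal_hcomp[OF assms(1) f] hcomp_piece])
  then show "f \<in> J" using hcomp_decompose[of f] by simp
qed

lemma dim_piece: "cox.dim (piece u :: ('a::finite, 'b::finite, 'c::finite) coxC set) = card (Mon u :: ('a, 'b, 'c) monom set)"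
proof (rule cox.dim_unique)
  let ?B = "(mono :: _ \<Rightarrow> ('a, 'b, 'c) coxC) ` Mon u"
  have inj: "inj_on (mono :: _ \<Rightarrow> ('a, 'b, 'c) coxC) (Mon u)"
    by (auto simp: inj_on_def) (metis lookup_single_eq lookup_single_not_eq zero_neq_one)
  show "?B \<subseteq> piece u" by (auto intro: single_piece)
  show "piece u \<subseteq> cox.span ?B"
  proof
    fix f :: "('a, 'b, 'c) coxC" assume "f \<in> piece u"
    then have "f = (\<Sum>m\<in>Mon u. cox_scale (lookup f m) (mono m))"
      using piece_expand by (simp add: cox_scale_def)
    also have "\<dots> \<in> cox.span ?B"
      by (intro cox.span_sum cox.span_scale cox.span_base) auto
    finally show "f \<in> cox.span ?B" .
  qed
  show "cox.independent ?B"
  proof (rule cox.independent_if_scalars_zero)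
    fix f x assume s: "(\<Sum>x\<in>?B. cox_scale (f x) x) = 0" and x: "x \<in> ?B"
    then obtain m where m: "m \<in> Mon u" "x = mono m" by auto
    have "lookup (\<Sum>x\<in>?B. cox_scale (f x) x) m = (\<Sum>n\<in>Mon u. if n = m then f (mono n) else 0)"
      unfolding sum.reindex[OF inj] by (simp add: lookup_sum cox_scale_def lookup_single when_def)
    then show "f x = 0" using s m by simp
  qed auto
  show "card ?B = card (Mon u :: ('a, 'b, 'c) monom set)" by (rule card_image[OF inj])
qed

section \<open>Hilbert functions\<close>

definition spans_mod :: "'i set \<Rightarrow> ('i \<Rightarrow> ('a::finite, 'b::finite, 'c::finite) coxC) \<Rightarrow> ('a, 'b, 'c) coxC set \<Rightarrow> degree \<Rightarrow> bool" where
  "spans_mod B q I u \<longleftrightarrow> (\<forall>f\<in>piece u. \<exists>c. f - (\<Sum>b\<in>B. const_poly (c b) * q b) \<in> I)"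

definition indep_mod :: "'i set \<Rightarrow> ('i \<Rightarrow> ('a::finite, 'b::finite, 'c::finite) coxC) \<Rightarrow> ('a, 'b, 'c) coxC set \<Rightarrow> bool" where
  "indep_mod B q I \<longleftrightarrow> (\<forall>c. (\<Sum>b\<in>B. const_poly (c b) * q b) \<in> I \<longrightarrow> (\<forall>b\<in>B. c b = 0))"

lemma ideal_lincomb:
  fixes q :: "'b \<Rightarrow> 'm::comm_monoid_add \<Rightarrow>\<^sub>0 'r::comm_ring_1"
  assumes I: "ideal.subspace I" and G: "\<forall>i\<in>A. v i - (\<Sum>b\<in>B. const_poly (G i b) * q b) \<in> I"
  shows "(\<Sum>i\<in>A. const_poly (a i) * v i) - (\<Sum>b\<in>B. const_poly (\<Sum>i\<in>A. a i * G i b) * q b) \<in> I"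
proof -
  have "(\<Sum>i\<in>A. const_poly (a i) * (v i - (\<Sum>b\<in>B. const_poly (G i b) * q b))) \<in> I"
    by (intro ideal.subspace_sum[OF I] ideal.subspace_scale[OF I]) (use G in blast)
  also have "(\<Sum>i\<in>A. const_poly (a i) * (v i - (\<Sum>b\<in>B. const_poly (G i b) * q b))) =
      (\<Sum>i\<in>A. const_poly (a i) * v i) - (\<Sum>i\<in>A. \<Sum>b\<in>B. const_poly (a i * G i b) * q b)"
    by (simp only: right_diff_distrib sum_subtractf sum_distrib_left const_poly_mult mult.assoc)
  also have "(\<Sum>i\<in>A. \<Sum>b\<in>B. const_poly (a i * G i b) * q b) =
      (\<Sum>b\<in>B. const_poly (\<Sum>i\<in>A. a i * G i b) * q b)"
    by (subst sum.swap) (simp only: const_poly_sum sum_distrib_right)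
  finally show ?thesis .
qed

lemma dim_quotient_ge:
  assumes T: "finite T" and v: "\<And>t. t \<in> T \<Longrightarrow> v t \<in> V"
    and ind: "\<And>c. (\<Sum>t\<in>T. scale (c t) (v t)) \<in> W \<Longrightarrow> (\<forall>t\<in>T. c t = 0)"
  shows "enat (card T) \<le> dim_quotient scale V W"
proof -
  obtain g where g: "bij_betw g {..<card T} T"
    using ex_bij_betw_nat_finite[OF T] by (auto simp: atLeast0LessThan)
  have "\<forall>i<card T. v (g i) \<in> V" using g v by (auto simp: bij_betw_def)
  moreover have "\<forall>c. (\<Sum>i<card T. scale (c i) (v (g i))) \<in> W \<longrightarrow> (\<forall>i<card T. c i = 0)"
  proof (intro allI impI)
    fix c i assume I: "(\<Sum>i<card T. scale (c i) (v (g i))) \<in> W" and i: "i < card T"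
    let ?h = "the_inv_into {..<card T} g"
    have h: "?h (g j) = j" if "j < card T" for j
      using g that by (simp add: bij_betw_def the_inv_into_f_f)
    have "(\<Sum>t\<in>T. scale (c (?h t)) (v t)) = (\<Sum>i<card T. scale (c i) (v (g i)))"
      unfolding sum.reindex_bij_betw[OF g, symmetric] by (intro sum.cong) (auto simp: h)
    then have "(\<Sum>t\<in>T. scale (c (?h t)) (v t)) \<in> W" using I by simp
    from ind[OF this] have "c (?h (g i)) = 0" using g i by (auto simp: bij_betw_def)
    then show "c i = 0" using h[OF i] by simp
  qed
  ultimately show ?thesis
    unfolding dim_quotient_def
    by (intro Sup_upper CollectI exI[of _ "card T"] conjI refl exI[of _ "\<lambda>i. v (g i)"])
qed

lemma hilbert_function_ge:
  fixes I :: "('a::finite, 'b::finite, 'c::finite) coxC set"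
  assumes "finite B" "\<And>b. b \<in> B \<Longrightarrow> q b \<in> piece u" "indep_mod B q I"
  shows "enat (card B) \<le> hilbert_function I u"
  unfolding hilbert_function_def
  by (rule dim_quotient_ge[OF assms(1,2)]) (use assms(3) in \<open>auto simp: indep_mod_def cox_scale_def\<close>)

lemma hilbert_function_le:
  fixes I :: "('a::finite, 'b::finite, 'c::finite) coxC set"
  assumes "finite B" "spans_mod B q I u" and I: "ideal.subspace I"
  shows "hilbert_function I u \<le> enat (card B)"
  unfolding hilbert_function_def dim_quotient_def
proof (rule Sup_least, clarsimp)
  fix n :: nat and v
  assume v: "\<forall>i<n. v i \<in> piece u"
    and ind: "\<forall>c. (\<Sum>i<n. cox_scale (c i) (v i)) \<in> I \<longrightarrow> (\<forall>i<n. c i = 0)"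
  have "\<forall>i\<in>{..<n}. \<exists>c. v i - (\<Sum>b\<in>B. const_poly (c b) * q b) \<in> I"
    using v assms(2) by (auto simp: spans_mod_def)
  from bchoice[OF this] obtain G
    where G: "\<forall>i\<in>{..<n}. v i - (\<Sum>b\<in>B. const_poly (G i b) * q b) \<in> I" ..
  show "n \<le> card B"
  proof (rule ccontr)
    assume "\<not> n \<le> card B"
    then obtain c where c: "\<exists>i<n. c i \<noteq> 0" "\<forall>b\<in>B. (\<Sum>i<n. c i * G i b) = 0"
      using homogeneous_system[of B "{..<n}" G] assms(1) by auto
    have "(\<Sum>i<n. const_poly (c i) * v i) - (\<Sum>b\<in>B. const_poly (\<Sum>i<n. c i * G i b) * q b) \<in> I"
      by (rule ideal_lincomb[OF I G])
    also have "(\<Sum>b\<in>B. const_poly (\<Sum>i<n. c i * G i b) * q b) = 0" using c(2) by simp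
    also have "(\<Sum>i<n. const_poly (c i) * v i) - 0 = (\<Sum>i<n. cox_scale (c i) (v i))"
      by (simp add: cox_scale_def)
    finally show False using ind c(1) by auto
  qed
qed

text \<open>A dependent spanning family could lose a member, and the rest would span with fewer
  elements than the Hilbert function allows.\<close>

lemma spans_mod_card:
  fixes I :: "('a::finite, 'b::finite, 'c::finite) coxC set"
  assumes "finite B" "spans_mod B q I u" "ideal.subspace I" "\<And>b. b \<in> B \<Longrightarrow> q b \<in> piece u"
    and hf: "hilbert_function I u = enat (card B)"
  shows "indep_mod B q I"
  unfolding indep_mod_def
proof (intro allI impI, rule ccontr)
  fix c assume c: "(\<Sum>b\<in>B. const_poly (c b) * q b) \<in> I" and "\<not> (\<forall>b\<in>B. c b = 0)"
  then obtain b0 where b0: "b0 \<in> B" "c b0 \<noteq> 0" by auto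
  let ?B = "B - {b0}"
  have s: "(\<Sum>b\<in>B. F b) = F b0 + (\<Sum>b\<in>?B. F b)" for F :: "_ \<Rightarrow> _"
    using b0 assms(1) by (simp add: sum.remove)
  have "spans_mod ?B q I u"
    unfolding spans_mod_def
  proof
    fix f :: "('a, 'b, 'c) coxC" assume "f \<in> piece u"
    then obtain d where d: "f - (\<Sum>b\<in>B. const_poly (d b) * q b) \<in> I"
      using assms(2) by (auto simp: spans_mod_def)
    let ?k = "d b0 / c b0"
    have "f - (\<Sum>b\<in>B. const_poly (d b) * q b) + const_poly ?k * (\<Sum>b\<in>B. const_poly (c b) * q b) \<in> I"
      using ideal.subspace_add[OF assms(3) d ideal.subspace_scale[OF assms(3) c]] .
    also have "f - (\<Sum>b\<in>B. const_poly (d b) * q b) + const_poly ?k * (\<Sum>b\<in>B. const_poly (c b) * q b) =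
        f - (\<Sum>b\<in>B. const_poly (d b - ?k * c b) * q b)"
      by (simp only: sum_distrib_left const_poly_diff left_diff_distrib sum_subtractf const_poly_mult
          mult.assoc diff_diff_eq2 diff_add_eq)
    also have "(\<Sum>b\<in>B. const_poly (d b - ?k * c b) * q b) = (\<Sum>b\<in>?B. const_poly (d b - ?k * c b) * q b)"
      using b0 by (subst s) simp
    finally show "\<exists>c. f - (\<Sum>b\<in>?B. const_poly (c b) * q b) \<in> I"
      by (rule exI[where x = "\<lambda>b. d b - ?k * c b"])
  qed
  from hilbert_function_le[OF _ this assms(3)] assms(1) hf have "card B \<le> card ?B" by auto
  then show False using b0 assms(1) by (metis card_Diff1_less not_le)
qed

lemma hilbert_function_eq:
  assumes "finite B" "spans_mod B q I u" "ideal.subspace I" "\<And>b. b \<in> B \<Longrightarrow> q b \<in> piece u" "indep_mod B q I"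
  shows "hilbert_function I u = enat (card B)"
  using hilbert_function_le[OF assms(1-3)] hilbert_function_ge[OF assms(1,4,5)] by (rule antisym)

lemma spans_mod_monoI:
  fixes I :: "('a::finite, 'b::finite, 'c::finite) coxC set"
  assumes I: "ideal.subspace I" and "\<And>m. m \<in> Mon u \<Longrightarrow> \<exists>c. mono m - (\<Sum>b\<in>B. const_poly (c b) * q b) \<in> I"
  shows "spans_mod B q I u"
  unfolding spans_mod_def
proof
  fix f :: "('a, 'b, 'c) coxC" assume f: "f \<in> piece u"
  have "\<forall>m\<in>Mon u. \<exists>c. mono m - (\<Sum>b\<in>B. const_poly (c b) * q b) \<in> I" using assms(2) by blast
  from bchoice[OF this] obtain G
    where G: "\<forall>m\<in>Mon u. mono m - (\<Sum>b\<in>B. const_poly (G m b) * q b) \<in> I" ..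
  have "(\<Sum>m\<in>Mon u. const_poly (lookup f m) * mono m)
      - (\<Sum>b\<in>B. const_poly (\<Sum>m\<in>Mon u. lookup f m * G m b) * q b) \<in> I"
    by (rule ideal_lincomb[OF I G])
  also have "(\<Sum>m\<in>Mon u. const_poly (lookup f m) * mono m) = f" using piece_expand[OF f] by simp
  finally show "\<exists>c. f - (\<Sum>b\<in>B. const_poly (c b) * q b) \<in> I"
    by (rule exI[where x = "\<lambda>b. \<Sum>m\<in>Mon u. lookup f m * G m b"])
qed

section \<open>Standard monomials\<close>

text \<open>Numbering the variables transports the linear order on
  \<open>nat \<Rightarrow>\<^sub>0 nat\<close>, which is compatible with addition, to the monomials:
  a monomial order.\<close>

definition order_key :: "('a::finite, 'b::finite, 'c::finite) monom \<Rightarrow> nat \<Rightarrow>\<^sub>0 nat" where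
  "order_key m = (\<Sum>z\<in>UNIV. single (to_nat_on UNIV z) (lookup m z))"

lemma order_key_add: "order_key (m + n) = order_key m + order_key n"
  by (simp add: order_key_def lookup_add single_add sum.distrib)

lemma order_key_inj: "order_key m = order_key n \<Longrightarrow> m = n"
proof (rule poly_mapping_eqI)
  fix z :: "('a, 'b, 'c) var"
  have inj: "to_nat_on UNIV y = to_nat_on UNIV z \<longleftrightarrow> y = z" for y z :: "('a, 'b, 'c) var"
    by (rule to_nat_on_inj) (auto intro: countable_finite)
  have *: "lookup (order_key m) (to_nat_on UNIV z) = lookup m z" for m :: "('a, 'b, 'c) monom"
  proof -
    have "lookup (order_key m) (to_nat_on UNIV z) = (\<Sum>y\<in>UNIV. if y = z then lookup m y else 0)"
      unfolding order_key_def lookup_sum by (intro sum.cong refl) (simp add: lookup_single when_def inj)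
    then show ?thesis by simp
  qed
  assume "order_key m = order_key n"
  then show "lookup m z = lookup n z" using *[of m] *[of n] by simp
qed

text \<open>The monomials that are not leading monomials of homogeneous elements of
  \<open>I\<close>.\<close>

definition standard :: "('a::finite, 'b::finite, 'c::finite) coxC set \<Rightarrow> ('a, 'b, 'c) monom set" where
  "standard I = {m. \<not> (\<exists>f\<in>I. f \<in> piece (mdeg m) \<and> lookup f m = 1 \<and> (\<forall>k\<in>keys f. order_key k \<le> order_key m))}"

lemma lookup_mono_mult: "lookup (mono n * f) (n + k) = lookup f k"
  for f :: "('v \<Rightarrow>\<^sub>0 nat) \<Rightarrow>\<^sub>0 'r::comm_ring_1"
proof -
  have "mono n * f = (\<Sum>m\<in>keys f. single (n + m) (lookup f m))"
    by (subst poly_expand[of f]) (simp add: sum_distrib_left mult_single)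
  also have "lookup \<dots> (n + k) = (\<Sum>m\<in>keys f. if m = k then lookup f m else 0)"
    unfolding lookup_sum by (intro sum.cong refl) (simp add: lookup_single when_def)
  also have "\<dots> = lookup f k" by (simp add: in_keys_iff)
  finally show ?thesis .
qed

lemma keys_mono_mult: "k \<in> keys (mono n * f) \<Longrightarrow> \<exists>j\<in>keys f. k = n + j"
  for f :: "('v \<Rightarrow>\<^sub>0 nat) \<Rightarrow>\<^sub>0 'r::comm_ring_1"
  using keys_mult[of "mono n" f] by auto

lemma standard_divisor:
  assumes I: "ideal.subspace I" and "n + m \<in> standard I"
  shows "m \<in> standard I"
proof (rule ccontr)
  assume "m \<notin> standard I"
  then obtain f where f: "f \<in> I" "f \<in> piece (mdeg m)" "lookup f m = 1"
    "\<And>k. k \<in> keys f \<Longrightarrow> order_key k \<le> order_key m"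
    by (auto simp: standard_def)
  have "mono n * f \<in> I" using f(1) by (rule ideal.subspace_scale[OF I])
  moreover have "mono n * f \<in> piece (mdeg (n + m))"
    unfolding mdeg_add by (intro piece_mult single_piece f(2)) (simp add: Mon_def)
  moreover have "lookup (mono n * f) (n + m) = 1" using f(3) by (simp add: lookup_mono_mult)
  moreover have "\<forall>k\<in>keys (mono n * f). order_key k \<le> order_key (n + m)"
    using f(4) keys_mono_mult by (fastforce simp: order_key_add intro: add_left_mono)
  ultimately show False using assms(2) by (auto simp: standard_def)
qed

text \<open>Macaulay's basis theorem. The largest monomial in a relation between standard monomials
  would be a leading monomial; a monomial that is not standard is rewritten by smaller ones of its
  degree.\<close>

lemma standard_basis:
  fixes I :: "('a::finite, 'b::finite, 'c::finite) coxC set"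
  assumes I: "ideal.subspace I"
  shows "indep_mod (standard I \<inter> Mon u) mono I" "spans_mod (standard I \<inter> Mon u) mono I u"
proof -
  let ?B = "standard I \<inter> Mon u"
  have fin: "finite ?B" by simp
  show "indep_mod ?B mono I"
    unfolding indep_mod_def
  proof (intro allI impI, rule ccontr)
    fix c assume c: "(\<Sum>b\<in>?B. const_poly (c b) * mono b) \<in> I" (is "?f \<in> I")
      and n: "\<not> (\<forall>b\<in>?B. c b = 0)"
    let ?C = "{b\<in>?B. c b \<noteq> 0}"
    have "finite (order_key ` ?C)" "order_key ` ?C \<noteq> {}" using n by auto
    then have "Max (order_key ` ?C) \<in> order_key ` ?C" by (rule Max_in)
    then obtain m where m: "m \<in> ?C" "Max (order_key ` ?C) = order_key m" by auto
    have le: "order_key b \<le> order_key m" if "b \<in> ?C" for b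
      using that m(2) Max_ge[of "order_key ` ?C" "order_key b"] by auto
    have look: "lookup ?f k = (if k \<in> ?B then c k else 0)" for k
      by (simp add: lookup_sum lookup_single when_def)
    let ?g = "const_poly (inverse (c m)) * ?f"
    have "?g \<in> I" using c by (rule ideal.subspace_scale[OF I])
    moreover have "?g \<in> piece (mdeg m)"
      using m(1) by (intro piece_const piece_sum) (auto simp: Mon_def intro!: single_piece)
    moreover have "lookup ?g m = 1" using m(1) by (simp only: lookup_const_poly_mult look) auto
    moreover have "\<forall>k\<in>keys ?g. order_key k \<le> order_key m"
    proof
      fix k assume "k \<in> keys ?g"
      then have "lookup ?f k \<noteq> 0" by (simp only: in_keys_iff lookup_const_poly_mult) auto
      then have "k \<in> ?C" by (simp only: look split: if_splits) auto
      then show "order_key k \<le> order_key m" by (rule le)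
    qed
    ultimately have "m \<notin> standard I" unfolding standard_def by blast
    then show False using m(1) by auto
  qed
  show "spans_mod ?B mono I u"
  proof (rule spans_mod_monoI[OF I])
    fix m :: "('a, 'b, 'c) monom" assume "m \<in> Mon u"
    then show "\<exists>c. mono m - (\<Sum>b\<in>?B. const_poly (c b) * mono b) \<in> I"
    \<comment> \<open>There are only finitely many monomials in one degree, so the number of smaller
      ones can serve as the measure of the rewriting.\<close>
    proof (induction "card {k\<in>Mon u :: ('a, 'b, 'c) monom set. order_key k < order_key m}" arbitrary: m rule: less_induct)
      case less
      show ?case
      proof (cases "m \<in> standard I")
        case True
        then have "(\<Sum>b\<in>?B. const_poly (if b = m then 1 else 0) * mono b) = (mono m :: ('a, 'b, 'c) coxC)"
          using less.prems by (subst sum.remove[of _ m]) auto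
        then show ?thesis using I by (intro exI[of _ "\<lambda>b. if b = m then 1 else 0"]) (simp add: ideal.subspace_0)
      next
        case False
        then obtain f where f: "f \<in> I" "f \<in> piece u" "lookup f m = 1"
          "\<And>k. k \<in> keys f \<Longrightarrow> order_key k \<le> order_key m"
          using less.prems by (auto simp: standard_def Mon_def)
        let ?K = "keys f - {m}"
        have lt: "order_key k < order_key m" if "k \<in> ?K" for k
          using f(4)[of k] order_key_inj[of k m] that by (auto simp: order.strict_iff_order)
        have K: "k \<in> Mon u" if "k \<in> ?K" for k using f(2) that by (auto simp: piece_iff)
        have "\<exists>c. mono k - (\<Sum>b\<in>?B. const_poly (c b) * mono b) \<in> I" if k: "k \<in> ?K" for k
        proof (rule less.hyps)
          show "card {j\<in>Mon u :: ('a, 'b, 'c) monom set. order_key j < order_key k}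
              < card {j\<in>Mon u :: ('a, 'b, 'c) monom set. order_key j < order_key m}"
            using lt[OF k] K[OF k] by (intro psubset_card_mono) auto
        qed (use K k in auto)
        then have "\<forall>k\<in>?K. \<exists>c. mono k - (\<Sum>b\<in>?B. const_poly (c b) * mono b) \<in> I" by blast
        from bchoice[OF this] obtain G
          where G: "\<forall>k\<in>?K. mono k - (\<Sum>b\<in>?B. const_poly (G k b) * mono b) \<in> I" ..
        have mk: "m \<in> keys f" using f(3) by (auto simp: in_keys_iff)
        have fe: "f = mono m + (\<Sum>k\<in>?K. single k (lookup f k))"
          by (subst poly_expand[of f], subst sum.remove[OF _ mk]) (auto simp: f(3))
        have "f - ((\<Sum>k\<in>?K. const_poly (lookup f k) * mono k)
            - (\<Sum>b\<in>?B. const_poly (\<Sum>k\<in>?K. lookup f k * G k b) * mono b)) \<in> I"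
          by (intro ideal.subspace_diff[OF I] f(1) ideal_lincomb[OF I G])
        also have "f - ((\<Sum>k\<in>?K. const_poly (lookup f k) * mono k)
            - (\<Sum>b\<in>?B. const_poly (\<Sum>k\<in>?K. lookup f k * G k b) * mono b)) =
            mono m - (\<Sum>b\<in>?B. const_poly (- (\<Sum>k\<in>?K. lookup f k * G k b)) * mono b)"
          by (subst fe) (simp only: const_poly_uminus mult_minus_left sum_negf const_poly_mult_single mult_1_right, simp)
        finally show ?thesis by (rule exI[where x = "\<lambda>b. - (\<Sum>k\<in>?K. lookup f k * G k b)"])
      qed
    qed
  qed
qed

lemma hilbert_function_standard:
  assumes "ideal.subspace I"
  shows "hilbert_function I u = enat (card (standard I \<inter> Mon u))"
  by (rule hilbert_function_eq[OF _ standard_basis(2)[OF assms] assms _ standard_basis(1)[OF assms]])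
    (auto intro: single_piece)

section \<open>Growth of order ideals of monomials\<close>

definition dmul :: "nat \<Rightarrow> degree \<Rightarrow> degree" where
  "dmul k = (\<lambda>(a, b, c). (int k * a, int k * b, int k * c))"

lemma mdeg_single: "mdeg (single z k) = dmul k (vdeg z)"
proof (induction k)
  case 0
  then show ?case by (simp add: dmul_def zero_prod_def split: prod.splits)
next
  case (Suc k)
  have "single z (Suc k) = single z 1 + single z k" by (simp add: single_add[symmetric])
  then show ?case using Suc by (cases z) (simp_all add: mdeg_add dmul_def del: One_nat_def)
qed

text \<open>Dividing by a variable of large exponent is injective on the degree-\<open>u\<close> part of an order
  ideal \<open>Q\<close> of monomials: two different preimages of \<open>w\<close> give \<open>w\<close> two large exponents, and
  hence too many divisors in a lower degree.\<close>

lemma order_ideal_step: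
  fixes Q :: "('a::finite, 'b::finite, 'c::finite) monom set"
  assumes Q: "\<And>n m. n + m \<in> Q \<Longrightarrow> m \<in> Q"
    and Z: "\<And>z. z \<in> Z \<Longrightarrow> vdeg z = e"
    and large: "\<And>m. m \<in> Q \<inter> Mon u \<Longrightarrow> (\<Sum>z\<in>Z. lookup m z) > card Z * (r + 1)"
    and small: "card (Q \<inter> Mon (u - dmul (Suc r) e)) \<le> r"
  shows "card (Q \<inter> Mon u) \<le> card (Q \<inter> Mon (u - e))"
proof -
  have "\<exists>z\<in>Z. lookup m z \<ge> r + 2" if m: "m \<in> Q \<inter> Mon u" for m
  proof (rule ccontr)
    assume "\<not> ?thesis"
    then have "(\<Sum>z\<in>Z. lookup m z) \<le> (\<Sum>z\<in>Z. r + 1)" by (intro sum_mono) auto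
    then show False using large[OF m] by simp
  qed
  then obtain \<zeta> where \<zeta>: "\<And>m. m \<in> Q \<inter> Mon u \<Longrightarrow> \<zeta> m \<in> Z" "\<And>m. m \<in> Q \<inter> Mon u \<Longrightarrow> lookup m (\<zeta> m) \<ge> r + 2"
    by metis
  define \<phi> where "\<phi> m = m - single (\<zeta> m) 1" for m
  have dec: "m = single (\<zeta> m) 1 + \<phi> m" if m: "m \<in> Q \<inter> Mon u" for m
    using \<zeta>(2)[OF m]
    by (intro poly_mapping_eqI) (auto simp: \<phi>_def lookup_add lookup_minus lookup_single when_def)
  have \<phi>: "\<phi> m \<in> Q \<inter> Mon (u - e)" if m: "m \<in> Q \<inter> Mon u" for m
  proof -
    have "mdeg m = e + mdeg (\<phi> m)" using arg_cong[OF dec[OF m], of mdeg] Z[OF \<zeta>(1)[OF m]]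
      by (simp only: mdeg_add mdeg_single_1)
    then have "\<phi> m \<in> Mon (u - e)" using m by (auto simp: Mon_def algebra_simps)
    moreover have "\<phi> m \<in> Q" using Q dec[OF m] m by (metis IntD1)
    ultimately show ?thesis by simp
  qed
  have "inj_on \<phi> (Q \<inter> Mon u)"
  proof (rule inj_onI, rule ccontr)
    fix m m' assume m: "m \<in> Q \<inter> Mon u" and m': "m' \<in> Q \<inter> Mon u" and eq: "\<phi> m = \<phi> m'" and ne: "m \<noteq> m'"
    define w where "w = \<phi> m"
    let ?z = "\<zeta> m" and ?z' = "\<zeta> m'"
    have zz: "?z \<noteq> ?z'" using dec[OF m] dec[OF m'] eq ne by metis
    have wz: "lookup w ?z \<ge> r + 1" using \<zeta>(2)[OF m]
      by (simp add: w_def \<phi>_def lookup_minus lookup_single)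
    have wz': "lookup w ?z' \<ge> r + 1" using \<zeta>(2)[OF m']
      unfolding w_def eq by (simp add: \<phi>_def lookup_minus lookup_single)
    \<comment> \<open>Of the factors of \<open>w\<close>, \<open>k\<close> copies of one variable
      and \<open>r - k\<close> of the other are removed. The results for
      \<open>k = 0, ..., r\<close> are different and all have degree
      \<open>u - e - r e\<close>.\<close>
    define D where "D k = w - (single ?z k + single ?z' (r - k))" for k
    have D: "w = (single ?z k + single ?z' (r - k)) + D k" if "k \<le> r" for k
      using that wz wz' zz by (intro poly_mapping_eqI)
        (auto simp: D_def lookup_add lookup_minus lookup_single when_def)
    have "D k \<in> Q \<inter> Mon (u - dmul (Suc r) e)" if k: "k \<le> r" for k
    proof -
      have "D k \<in> Q" using Q D[OF k] \<phi>[OF m] by (metis IntD1 w_def)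
      moreover have "mdeg w = u - e" using \<phi>[OF m] by (simp add: w_def Mon_def)
      moreover have "mdeg w = dmul k e + dmul (r - k) e + mdeg (D k)"
        using arg_cong[OF D[OF k], of mdeg] Z[OF \<zeta>(1)[OF m]] Z[OF \<zeta>(1)[OF m']]
        by (simp only: mdeg_add mdeg_single)
      moreover have "dmul k e + dmul (r - k) e + e = dmul (Suc r) e"
        using k by (cases e) (simp add: dmul_def algebra_simps of_nat_diff)
      ultimately have "mdeg (D k) = u - dmul (Suc r) e" "D k \<in> Q" by (auto simp: algebra_simps)
      then show ?thesis by (simp add: Mon_def)
    qed
    then have "D ` {..r} \<subseteq> Q \<inter> Mon (u - dmul (Suc r) e)" by auto
    moreover have "inj_on D {..r}"
    proof (rule inj_onI)
      fix i j assume ij: "i \<in> {..r}" "j \<in> {..r}" "D i = D j"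
      have "lookup (D k) ?z = lookup w ?z - k" for k
        using zz by (simp add: D_def lookup_minus lookup_add lookup_single when_def)
      then have "lookup w ?z - i = lookup w ?z - j" using ij(3) by metis
      then show "i = j" using wz ij(1,2) by auto
    qed
    ultimately have "card {..r} \<le> card (Q \<inter> Mon (u - dmul (Suc r) e))"
      using card_inj_on_le[of D "{..r}"] by auto
    then show False using small by simp
  qed
  moreover have "\<phi> ` (Q \<inter> Mon u) \<subseteq> Q \<inter> Mon (u - e)" using \<phi> by auto
  ultimately show ?thesis by (intro card_inj_on_le) auto
qed

definition trunc :: "nat \<Rightarrow> degree \<Rightarrow> degree" where
  "trunc N = (\<lambda>(a, b, c). (min a (int N), min b (int N), min c (int N)))"

lemma mdeg_eq_sum:
  "mdeg m = (a, b, c) \<Longrightarrow> int (\<Sum>z\<in>range Alpha. lookup m z) = a \<and>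
    int (\<Sum>z\<in>range Beta. lookup m z) = b \<and> int (\<Sum>z\<in>range Gamma. lookup m z) = c"
  by (subst (1 2 3) sum.reindex) (auto simp: mdeg_def inj_on_def)

text \<open>A persistence theorem in the manner of Gotzmann. \<open>N\<close> is so large that an
  entry of \<open>u\<close> above \<open>N\<close> forces each monomial to contain a variable of
  that group with exponent at least \<open>r + 2\<close>, and still leaves room to subtract
  \<open>r + 1\<close>. Then \<open>order_ideal_step\<close> lowers this entry by one, without
  changing the truncation. This bound is why finitely many degrees suffice for charts and for
  configurations of points.\<close>

lemma order_ideal_bound:
  fixes Q :: "('a::finite, 'b::finite, 'c::finite) monom set"
  assumes Q: "\<And>n m. n + m \<in> Q \<Longrightarrow> m \<in> Q"
    and N: "N = (CARD('a) + CARD('b) + CARD('c)) * (r + 1)"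
    and "0 \<le> u" "\<And>v. 0 \<le> v \<Longrightarrow> v \<le> trunc N u \<Longrightarrow> card (Q \<inter> Mon v) \<le> r"
  shows "card (Q \<inter> Mon u) \<le> card (Q \<inter> Mon (trunc N u))"
  using assms(3,4)
proof (induction "nat (fst u + fst (snd u) + snd (snd u))" arbitrary: u rule: less_induct)
  case less
  obtain a b c where u: "u = (a, b, c)" by (cases u)
  have pos: "a \<ge> 0" "b \<ge> 0" "c \<ge> 0" using less.prems(1) by (auto simp: u less_eq_prod_def zero_prod_def)
  have Nge: "int N \<ge> int r + 1" "int N \<ge> int (CARD('a) * (r + 1))" "int N \<ge> int (CARD('b) * (r + 1))"
    "int N \<ge> int (CARD('c) * (r + 1))"
  proof -
    have "1 * (r + 1) \<le> N" unfolding N by (rule mult_right_mono) (auto simp: Suc_le_eq)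
    then show "int N \<ge> int r + 1" by simp
    show "int N \<ge> int (CARD('a) * (r + 1))" "int N \<ge> int (CARD('b) * (r + 1))"
      "int N \<ge> int (CARD('c) * (r + 1))"
      unfolding N by (intro of_nat_mono mult_right_mono; simp)+
  qed
  have step: ?case if e: "\<And>z. z \<in> Z \<Longrightarrow> vdeg z = e"
    and big: "\<And>m. m \<in> Mon u \<Longrightarrow> (\<Sum>z\<in>Z. lookup m z) > card Z * (r + 1)"
    and d: "e \<in> {(1, 0, 0), (0, 1, 0), (0, 0, 1)}"
    and nn: "0 \<le> u - dmul (Suc r) e" "trunc N (u - e) = trunc N u"
    for e and Z :: "('a, 'b, 'c) var set"
  proof -
    \<comment> \<open>The induction hypothesis is used twice: in degree \<open>u - e\<close> to
      continue the descent, and in degree \<open>u - dmul (Suc r) e\<close> to obtain the bound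
      \<open>r\<close> that \<open>order_ideal_step\<close> requires.\<close>
    have IH: "card (Q \<inter> Mon v) \<le> card (Q \<inter> Mon (trunc N v))" if v: "v \<in> {u - e, u - dmul (Suc r) e}" for v
    proof (rule less.hyps)
      show "nat (fst v + fst (snd v) + snd (snd v)) < nat (fst u + fst (snd u) + snd (snd u))"
        using v d nn by (auto simp: u dmul_def less_eq_prod_def zero_prod_def)
      show "0 \<le> v" using v d nn by (auto simp: u dmul_def less_eq_prod_def zero_prod_def)
      have "trunc N v \<le> trunc N u"
        using v d by (auto simp: u dmul_def less_eq_prod_def trunc_def)
      then show "card (Q \<inter> Mon w) \<le> r" if "0 \<le> w" "w \<le> trunc N v" for w
        using less.prems(2)[of w] that by (meson order_trans)
    qed
    let ?v = "u - dmul (Suc r) e"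
    have "0 \<le> trunc N ?v" "trunc N ?v \<le> trunc N u"
      using d nn by (auto simp: u dmul_def less_eq_prod_def trunc_def zero_prod_def)
    then have "card (Q \<inter> Mon (trunc N ?v)) \<le> r" by (rule less.prems(2))
    then have c: "card (Q \<inter> Mon ?v) \<le> r" using IH[of ?v] by simp
    have "card (Q \<inter> Mon u) \<le> card (Q \<inter> Mon (u - e))"
    proof (rule order_ideal_step[where Z = Z and r = r])
      show "m \<in> Q" if "n + m \<in> Q" for n m using Q that .
    qed (use e big c in auto)
    also have "\<dots> \<le> card (Q \<inter> Mon (trunc N u))" using IH[of "u - e"] nn by simp
    finally show ?thesis .
  qed
  have cards: "card (range (Alpha :: 'a \<Rightarrow> ('a, 'b, 'c) var)) = CARD('a)"
    "card (range (Beta :: 'b \<Rightarrow> ('a, 'b, 'c) var)) = CARD('b)"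
    "card (range (Gamma :: 'c \<Rightarrow> ('a, 'b, 'c) var)) = CARD('c)"
    by (auto intro: card_image simp: inj_on_def)
  consider "a > int N" | "b > int N" | "c > int N" | "a \<le> int N" "b \<le> int N" "c \<le> int N" by linarith
  then show ?case
  proof cases
    case 1
    show ?thesis
    proof (rule step[of "range Alpha" "(1, 0, 0)"])
      fix m :: "('a, 'b, 'c) monom" assume "m \<in> Mon u"
      then have "int (\<Sum>z\<in>range Alpha. lookup m z) = a" using mdeg_eq_sum[of m a b c] by (simp add: Mon_def u)
      then have "int (card (range (Alpha :: 'a \<Rightarrow> ('a, 'b, 'c) var)) * (r + 1)) < int (\<Sum>z\<in>range Alpha. lookup m z)"
        unfolding cards using 1 Nge(2) by linarith
      then show "card (range (Alpha :: 'a \<Rightarrow> ('a, 'b, 'c) var)) * (r + 1) < (\<Sum>z\<in>range Alpha. lookup m z)"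
        by (simp only: of_nat_less_iff)
    qed (use 1 pos Nge in \<open>auto simp: u dmul_def less_eq_prod_def zero_prod_def trunc_def\<close>)
  next
    case 2
    show ?thesis
    proof (rule step[of "range Beta" "(0, 1, 0)"])
      fix m :: "('a, 'b, 'c) monom" assume "m \<in> Mon u"
      then have "int (\<Sum>z\<in>range Beta. lookup m z) = b" using mdeg_eq_sum[of m a b c] by (simp add: Mon_def u)
      then have "int (card (range (Beta :: 'b \<Rightarrow> ('a, 'b, 'c) var)) * (r + 1)) < int (\<Sum>z\<in>range Beta. lookup m z)"
        unfolding cards using 2 Nge(3) by linarith
      then show "card (range (Beta :: 'b \<Rightarrow> ('a, 'b, 'c) var)) * (r + 1) < (\<Sum>z\<in>range Beta. lookup m z)"
        by (simp only: of_nat_less_iff)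
    qed (use 2 pos Nge in \<open>auto simp: u dmul_def less_eq_prod_def zero_prod_def trunc_def\<close>)
  next
    case 3
    show ?thesis
    proof (rule step[of "range Gamma" "(0, 0, 1)"])
      fix m :: "('a, 'b, 'c) monom" assume "m \<in> Mon u"
      then have "int (\<Sum>z\<in>range Gamma. lookup m z) = c" using mdeg_eq_sum[of m a b c] by (simp add: Mon_def u)
      then have "int (card (range (Gamma :: 'c \<Rightarrow> ('a, 'b, 'c) var)) * (r + 1)) < int (\<Sum>z\<in>range Gamma. lookup m z)"
        unfolding cards using 3 Nge(4) by linarith
      then show "card (range (Gamma :: 'c \<Rightarrow> ('a, 'b, 'c) var)) * (r + 1) < (\<Sum>z\<in>range Gamma. lookup m z)"
        by (simp only: of_nat_less_iff)
    qed (use 3 pos Nge in \<open>auto simp: u dmul_def less_eq_prod_def zero_prod_def trunc_def\<close>)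
  next
    case 4
    then have "trunc N u = u" by (simp add: u trunc_def)
    then show ?thesis by simp
  qed
qed

section \<open>The Nullstellensatz\<close>

lemma countable_monomials:
  assumes "countable (UNIV :: 'v set)"
  shows "countable (UNIV :: ('v \<Rightarrow>\<^sub>0 nat) set)"
proof -
  define g where "g m = (\<lambda>v. (v, lookup m v)) ` keys m" for m :: "'v \<Rightarrow>\<^sub>0 nat"
  have "inj g"
  proof (rule injI, rule poly_mapping_eqI)
    fix m n v assume "g m = g n"
    moreover have "(v, i) \<in> g k \<longleftrightarrow> lookup k v \<noteq> 0 \<and> i = lookup k v" for k i
      by (auto simp: g_def in_keys_iff)
    then have "lookup k v = (if \<exists>i. (v, i) \<in> g k then THE i. (v, i) \<in> g k else 0)" for k
      by simp
    ultimately show "lookup m v = lookup n v" by metis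
  qed
  moreover have "countable (UNIV :: ('v \<times> nat) set)"
    using countable_SIGMA[OF assms, of "\<lambda>_. UNIV :: nat set"] by (simp add: UNIV_Times_UNIV[symmetric] del: UNIV_Times_UNIV)
  then have "countable {A :: ('v \<times> nat) set. finite A \<and> A \<subseteq> UNIV}" by (rule countable_Collect_finite_subset)
  then have "countable (range g)" by (rule countable_subset[rotated]) (auto simp: g_def)
  ultimately show ?thesis by (meson countable_image_inj_on)
qed

definition subst_poly :: "'r::comm_ring_1 \<Rightarrow> (complex \<Rightarrow> 'r) \<Rightarrow> complex poly \<Rightarrow> 'r" where
  "subst_poly t c q = (\<Sum>k\<le>degree q. c (coeff q k) * t ^ k)"

context
  fixes t :: "'m::comm_monoid_add \<Rightarrow>\<^sub>0 complex"
begin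

abbreviation "sp \<equiv> subst_poly t const_poly"

lemma sp_eq: "degree q \<le> n \<Longrightarrow> sp q = (\<Sum>k\<le>n. const_poly (coeff q k) * t ^ k)"
  unfolding subst_poly_def by (rule sum.mono_neutral_left) (auto simp: coeff_eq_0)

lemma sp_add: "sp (p + q) = sp p + sp q"
proof -
  define n where "n = max (degree p) (degree q)"
  have "degree p \<le> n" "degree q \<le> n" "degree (p + q) \<le> n"
    by (auto simp: n_def degree_add_le_max)
  then show ?thesis by (simp add: sp_eq const_poly_add distrib_right sum.distrib)
qed

lemma sp_0 [simp]: "sp 0 = 0" by (simp add: subst_poly_def)

lemma sp_smult: "sp (smult a q) = const_poly a * sp q"
proof -
  have "sp (smult a q) = (\<Sum>k\<le>degree q. const_poly (coeff (smult a q) k) * t ^ k)"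
    by (rule sp_eq) (rule degree_smult_le)
  also have "\<dots> = const_poly a * sp q"
    unfolding subst_poly_def sum_distrib_left
    by (intro sum.cong refl) (simp only: coeff_smult const_poly_mult mult.assoc)
  finally show ?thesis .
qed

lemma sp_pCons: "sp (pCons a q) = const_poly a + t * sp q"
proof -
  have "sp (pCons a q) = (\<Sum>k\<le>Suc (degree q). const_poly (coeff (pCons a q) k) * t ^ k)"
    by (rule sp_eq) (rule degree_pCons_le)
  also have "\<dots> = const_poly a + (\<Sum>k\<le>degree q. const_poly (coeff q k) * (t * t ^ k))"
    by (subst sum.atMost_Suc_shift) simp
  also have "(\<Sum>k\<le>degree q. const_poly (coeff q k) * (t * t ^ k)) = t * sp q"
    unfolding subst_poly_def sum_distrib_left by (intro sum.cong refl) (simp only: mult.left_commute)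
  finally show ?thesis .
qed

lemma sp_mult: "sp (p * q) = sp p * sp q"
proof (induction p)
  case (pCons a p)
  have "sp (pCons a p * q) = sp (smult a q) + sp (pCons 0 (p * q))"
    by (simp only: mult_pCons_left sp_add)
  then show ?case
    by (simp only: sp_smult sp_pCons pCons.IH distrib_right mult.assoc const_poly_0 add_0)
qed simp

lemma sp_sum: "sp (sum f A) = (\<Sum>a\<in>A. sp (f a))"
  by (induction A rule: infinite_finite_induct) (simp_all add: sp_add)

lemma sp_prod: "sp (prod f A) = (\<Prod>a\<in>A. sp (f a))"
proof -
  have "sp 1 = 1" using sp_pCons[of 1 0] by (simp add: one_pCons)
  then show ?thesis by (induction A rule: infinite_finite_induct) (simp_all add: sp_mult)
qed

lemma sp_linear: "sp [:- c, 1:] = t - const_poly c"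
  by (simp add: sp_pCons const_poly_uminus)

end

definition prime_avoid :: "'r::comm_ring_1 set \<Rightarrow> bool" where
  "prime_avoid Q \<longleftrightarrow> ideal.subspace Q \<and> (\<forall>a b. a * b \<in> Q \<longrightarrow> a \<in> Q \<or> b \<in> Q)"

text \<open>Over the complex numbers \<open>q\<close> splits into linear factors; by primality one
  of them, evaluated at \<open>t\<close>, lies in \<open>Q\<close>.\<close>

lemma prime_univariate:
  fixes Q :: "('m::comm_monoid_add \<Rightarrow>\<^sub>0 complex) set"
  assumes Q: "prime_avoid Q" "1 \<notin> Q" and q: "q \<noteq> 0" "subst_poly t const_poly q \<in> Q"
  shows "\<exists>c. t - const_poly c \<in> Q"
  using q
proof (induction "degree q" arbitrary: q rule: less_induct)
  case less
  show ?case
  proof (cases "degree q = 0")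
    case True
    then obtain a where a: "q = [:a:]" "a \<noteq> 0" using less.prems by (metis degree_eq_zeroE pCons_0_0)
    then have "const_poly a \<in> Q" using less.prems(2) by (simp add: sp_pCons)
    then have "const_poly (inverse a) * const_poly a \<in> Q"
      using Q(1) by (auto simp: prime_avoid_def intro: ideal.subspace_scale)
    then show ?thesis using a Q(2) by (simp add: const_poly_mult[symmetric])
  next
    case False
    then have "\<not> constant (poly q)" by (simp add: constant_degree)
    then obtain z where "poly q z = 0" using fundamental_theorem_of_algebra by blast
    then obtain p where p: "q = [:- z, 1:] * p" by (metis dvdE poly_eq_0_iff_dvd)
    have "subst_poly t const_poly q = (t - const_poly z) * subst_poly t const_poly p"
      unfolding p sp_mult sp_linear ..
    then have "t - const_poly z \<in> Q \<or> subst_poly t const_poly p \<in> Q"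
      using Q(1) less.prems(2) unfolding prime_avoid_def by metis
    moreover have "p \<noteq> 0" using less.prems(1) p by auto
    then have "degree p < degree q" unfolding p by (subst degree_mult_eq) auto
    ultimately show ?thesis using less.hyps[of p] \<open>p \<noteq> 0\<close> by blast
  qed
qed

text \<open>Zorn's lemma gives an ideal \<open>Q\<close> that is maximal among those containing
  \<open>I\<close> and avoiding the powers of \<open>f\<close>. For \<open>a\<close> outside
  \<open>Q\<close> the ideal generated by \<open>Q\<close> and \<open>a\<close> contains a power of
  \<open>f\<close>; this is the last property, and it says that inverting \<open>f\<close> turns the
  quotient by \<open>Q\<close> into a field.\<close>

lemma prime_avoiding_powers:
  fixes I :: "'r::comm_ring_1 set"
  assumes I: "ideal.subspace I" and f: "\<And>n. f ^ n \<notin> I"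
  obtains Q where "prime_avoid Q" "I \<subseteq> Q" "\<And>n. f ^ n \<notin> Q"
    "\<And>a. a \<notin> Q \<Longrightarrow> \<exists>g n. a * g - f ^ n \<in> Q"
proof -
  define A where "A = {Q. ideal.subspace Q \<and> I \<subseteq> Q \<and> (\<forall>n. f ^ n \<notin> Q)}"
  have "\<exists>Q\<in>A. \<forall>X\<in>A. Q \<subseteq> X \<longrightarrow> X = Q"
  proof (rule subset_Zorn)
    fix C assume C: "subset.chain A C"
    show "\<exists>U\<in>A. \<forall>X\<in>C. X \<subseteq> U"
    proof (cases "C = {}")
      case True
      then show ?thesis using I f by (auto simp: A_def)
    next
      case False
      have CA: "C \<subseteq> A" using C by (auto simp: subset.chain_def)
      have "ideal.subspace (\<Union>C)"
      proof (rule ideal.subspaceI)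
        obtain X where "X \<in> C" using False by auto
        then show "0 \<in> \<Union>C" using CA ideal.subspace_0[of X] by (auto simp: A_def)
        show "x + y \<in> \<Union>C" if xy: "x \<in> \<Union>C" "y \<in> \<Union>C" for x y
        proof -
          obtain X Y where XY: "X \<in> C" "Y \<in> C" "x \<in> X" "y \<in> Y" using xy by auto
          then have "X \<subseteq> Y \<or> Y \<subseteq> X" using C by (auto simp: subset.chain_def)
          then obtain W where W: "W \<in> C" "x \<in> W" "y \<in> W" using XY by blast
          then have "ideal.subspace W" using CA by (auto simp: A_def)
          then show ?thesis using W ideal.subspace_add by blast
        qed
        show "c * x \<in> \<Union>C" if x: "x \<in> \<Union>C" for c x
        proof -
          obtain W where W: "W \<in> C" "x \<in> W" using x by auto
          then have "ideal.subspace W" using CA by (auto simp: A_def)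
          then show ?thesis using W ideal.subspace_scale by blast
        qed
      qed
      then have "\<Union>C \<in> A" using False CA unfolding A_def by blast
      then show ?thesis by auto
    qed
  qed
  then obtain Q where QA: "Q \<in> A" and max: "\<And>X. X \<in> A \<Longrightarrow> Q \<subseteq> X \<Longrightarrow> X = Q" by blast
  have Q: "ideal.subspace Q" "I \<subseteq> Q" "\<And>n. f ^ n \<notin> Q" using QA by (auto simp: A_def)
  have inv: "\<exists>g n. a * g - f ^ n \<in> Q" if a: "a \<notin> Q" for a
  proof -
    define X where "X = {x. \<exists>g. x - a * g \<in> Q}"
    have "ideal.subspace X"
    proof (rule ideal.subspaceI)
      show "0 \<in> X" using Q(1) by (auto simp: X_def ideal.subspace_0 intro!: exI[of _ 0])
      show "x + y \<in> X" if xy: "x \<in> X" "y \<in> X" for x y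
      proof -
        obtain g h where "x - a * g \<in> Q" "y - a * h \<in> Q" using xy by (auto simp: X_def)
        from ideal.subspace_add[OF Q(1) this] have "(x - a * g) + (y - a * h) \<in> Q" .
        also have "(x - a * g) + (y - a * h) = x + y - a * (g + h)" by (simp add: distrib_left)
        finally have "x + y - a * (g + h) \<in> Q" .
        then show ?thesis by (auto simp: X_def)
      qed
      show "c * x \<in> X" if xX: "x \<in> X" for c x
      proof -
        obtain g where "x - a * g \<in> Q" using xX by (auto simp: X_def)
        from ideal.subspace_scale[OF Q(1) this] have "c * (x - a * g) \<in> Q" .
        also have "c * (x - a * g) = c * x - a * (c * g)" by (simp only: right_diff_distrib mult_ac)
        finally show ?thesis unfolding X_def by blast
      qed
    qed
    moreover have QX: "Q \<subseteq> X" by (auto simp: X_def intro!: exI[of _ 0])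
    moreover have "a \<in> X" using Q(1) by (auto simp: X_def ideal.subspace_0 intro!: exI[of _ 1])
    then have "X \<noteq> Q" using a by auto
    then have "X \<notin> A" using max QX by blast
    ultimately obtain n where "f ^ n \<in> X" using Q(2) by (auto simp: A_def)
    then obtain g where "f ^ n - a * g \<in> Q" by (auto simp: X_def)
    from ideal.subspace_neg[OF Q(1) this] show ?thesis by (auto intro!: exI[of _ g] exI[of _ n])
  qed
  have "a \<in> Q \<or> b \<in> Q" if ab: "a * b \<in> Q" for a b
  proof (rule ccontr)
    assume "\<not> ?thesis"
    then obtain g n h k where g: "a * g - f ^ n \<in> Q" and h: "b * h - f ^ k \<in> Q" using inv by metis
    \<comment> \<open>Modulo \<open>Q\<close>, \<open>a * g\<close> is \<open>f ^ n\<close> and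
      \<open>b * h\<close> is \<open>f ^ k\<close>, so a multiple of \<open>a * b\<close> is
      \<open>f ^ (n + k)\<close>.\<close>
    have "(g * h) * (a * b) - (b * h) * (a * g - f ^ n) - f ^ n * (b * h - f ^ k) \<in> Q"
      by (intro ideal.subspace_diff[OF Q(1)] ideal.subspace_scale[OF Q(1)] ab g h)
    also have "(g * h) * (a * b) - (b * h) * (a * g - f ^ n) - f ^ n * (b * h - f ^ k) = f ^ (n + k)"
    proof -
      have "x - (x - y) - (y - z) = z" for x y z :: 'r by simp
      then show ?thesis by (simp only: right_diff_distrib power_add mult_ac)
    qed
    finally show False using Q(3) by blast
  qed
  then have "prime_avoid Q" using Q(1) by (auto simp: prime_avoid_def)
  then show thesis using that Q inv by blast
qed

text \<open>The field of fractions of \<open>\<complex>[x] / Q\<close> has countable dimension over \<open>\<complex>\<close>, so the elements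
  \<open>1 / (t - c)\<close> cannot all exist and be linearly independent.\<close>

lemma nullstellensatz:
  fixes I :: "(('v \<Rightarrow>\<^sub>0 nat) \<Rightarrow>\<^sub>0 complex) set"
  assumes cnt: "countable (UNIV :: 'v set)"
    and I: "ideal.subspace I" and f: "\<And>n. f ^ n \<notin> I"
  shows "\<exists>p. (\<forall>g\<in>I. pev p g = 0) \<and> pev p f \<noteq> 0"
proof -
  obtain Q where Q: "prime_avoid Q" "I \<subseteq> Q" "\<And>n. f ^ n \<notin> Q"
    and inv: "\<And>a. a \<notin> Q \<Longrightarrow> \<exists>g n. a * g - f ^ n \<in> Q"
    using prime_avoiding_powers[OF I f] by blast
  have Qi: "ideal.subspace Q" and Qp: "\<And>a b. a * b \<in> Q \<Longrightarrow> a \<in> Q \<or> b \<in> Q"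
    using Q(1) by (auto simp: prime_avoid_def)
  have "1 \<notin> Q" using Q(3)[of 0] by simp
  have ex: "\<exists>c. t - const_poly c \<in> Q" for t
  proof (rule ccontr)
    assume no: "\<not> ?thesis"
    then have "\<exists>g n. (t - const_poly c) * g - f ^ n \<in> Q" for c using inv by blast
    then obtain g n where gn: "\<And>c. (t - const_poly c) * g c - f ^ n c \<in> Q" by metis
    define F where "F c = (n c, keys (g c))" for c
    have "countable {A :: ('v \<Rightarrow>\<^sub>0 nat) set. finite A \<and> A \<subseteq> UNIV}"
      by (intro countable_Collect_finite_subset countable_monomials cnt)
    then have "countable ((UNIV :: nat set) \<times> {A :: ('v \<Rightarrow>\<^sub>0 nat) set. finite A \<and> A \<subseteq> UNIV})"
      by (intro countable_SIGMA) auto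
    then have "countable (range F)" by (rule countable_subset[rotated]) (auto simp: F_def)
    \<comment> \<open>There are uncountably many \<open>c\<close> but only countably many pairs of
      an exponent and a finite support. Hence infinitely many \<open>g c\<close> share both, and
      \<open>card A + 1\<close> of them are linearly dependent.\<close>
    have "\<exists>y\<in>range F. infinite {c. F c = y}"
    proof (rule ccontr)
      assume "\<not> ?thesis"
      then have "countable (\<Union>y\<in>range F. {c. F c = y})"
        using \<open>countable (range F)\<close> by (intro countable_UN) (auto intro: countable_finite)
      moreover have "(\<Union>y\<in>range F. {c. F c = y}) = UNIV" by auto
      ultimately have "countable (complex_of_real ` UNIV)" by (metis countable_subset subset_UNIV)
      then show False using uncountable_UNIV_real
        by (metis countable_image_inj_on inj_of_real)
    qed
    then obtain N A where inf: "infinite {c. F c = (N, A)}" by (metis surj_pair)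
    then have "{c. F c = (N, A)} \<noteq> {}" by (metis finite.emptyI)
    then have finA: "finite A" by (auto simp: F_def)
    obtain C where C: "C \<subseteq> {c. F c = (N, A)}" "finite C" "card C = Suc (card A)"
      using infinite_arbitrarily_large[OF inf] by blast
    obtain a where a: "\<exists>c\<in>C. a c \<noteq> 0" "\<forall>m\<in>A. (\<Sum>c\<in>C. a c * lookup (g c) m) = 0"
      using homogeneous_system[OF finA C(2), of "\<lambda>c. lookup (g c)"] C(3) by auto
    have sum0: "(\<Sum>c\<in>C. const_poly (a c) * g c) = 0"
    proof (rule poly_mapping_eqI)
      fix m
      have "lookup (\<Sum>c\<in>C. const_poly (a c) * g c) m = (\<Sum>c\<in>C. a c * lookup (g c) m)"
        by (simp add: lookup_sum)
      also have "\<dots> = 0"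
      proof (cases "m \<in> A")
        case False
        then have "lookup (g c) m = 0" if "c \<in> C" for c
          using that C(1) by (auto simp: F_def in_keys_iff)
        then show ?thesis by simp
      qed (use a in auto)
      finally show "lookup (\<Sum>c\<in>C. const_poly (a c) * g c) m = lookup 0 m" by simp
    qed
    \<comment> \<open>Up to the factor \<open>f ^ N\<close>, \<open>g c\<close> is
      \<open>1 / (t - c)\<close> modulo \<open>Q\<close>. Multiplying the linear relation between
      these by all the \<open>t - d\<close> leaves the polynomial \<open>q\<close> in
      \<open>t\<close>; at \<open>c0\<close> only the summand of \<open>c0\<close> survives, so
      \<open>q\<close> is not zero.\<close>
    define q where "q = (\<Sum>c\<in>C. smult (a c) (\<Prod>d\<in>C - {c}. [:- d, 1:]))"
    let ?P = "\<lambda>c. \<Prod>d\<in>C - {c}. t - const_poly d"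
    have spq: "subst_poly t const_poly q = (\<Sum>c\<in>C. const_poly (a c) * ?P c)"
      by (simp add: q_def sp_sum sp_smult sp_prod sp_linear)
    obtain c0 where c0: "c0 \<in> C" "a c0 \<noteq> 0" using a(1) by auto
    have "poly q c0 = (\<Sum>c\<in>C. if c = c0 then a c0 * (\<Prod>d\<in>C - {c0}. c0 - d) else 0)"
      unfolding q_def poly_sum
      by (intro sum.cong refl) (use c0 C(2) in \<open>auto simp: poly_prod prod_zero_iff\<close>)
    also have "\<dots> \<noteq> 0" using c0 C(2) by (auto simp: prod_zero_iff)
    finally have "q \<noteq> 0" by auto
    have alg: "(x * P) * (T * y - F) = (T * P) * (x * y) - F * (x * P)"
      for x P T y F :: "('v \<Rightarrow>\<^sub>0 nat) \<Rightarrow>\<^sub>0 complex"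
      by (simp only: right_diff_distrib mult_ac)
    have "(\<Sum>c\<in>C. (const_poly (a c) * ?P c) * ((t - const_poly c) * g c - f ^ N)) \<in> Q"
    proof (intro ideal.subspace_sum[OF Qi] ideal.subspace_scale[OF Qi])
      fix c assume "c \<in> C"
      then have "n c = N" using C(1) by (auto simp: F_def)
      then show "(t - const_poly c) * g c - f ^ N \<in> Q" using gn[of c] by simp
    qed
    also have "(\<Sum>c\<in>C. (const_poly (a c) * ?P c) * ((t - const_poly c) * g c - f ^ N)) =
        (\<Sum>c\<in>C. (\<Prod>d\<in>C. t - const_poly d) * (const_poly (a c) * g c)) - f ^ N * subst_poly t const_poly q"
      unfolding spq sum_distrib_left sum_subtractf[symmetric]
    proof (rule sum.cong[OF refl])
      fix c assume "c \<in> C"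
      then have "(\<Prod>d\<in>C. t - const_poly d) = (t - const_poly c) * ?P c" using C(2) by (simp add: prod.remove)
      then show "(const_poly (a c) * ?P c) * ((t - const_poly c) * g c - f ^ N) =
          (\<Prod>d\<in>C. t - const_poly d) * (const_poly (a c) * g c) - f ^ N * (const_poly (a c) * ?P c)"
        by (simp only: alg)
    qed
    also have "(\<Sum>c\<in>C. (\<Prod>d\<in>C. t - const_poly d) * (const_poly (a c) * g c)) = 0"
      unfolding sum_distrib_left[symmetric] sum0 by simp
    finally have "f ^ N * subst_poly t const_poly q \<in> Q"
      using ideal.subspace_neg[OF Qi] by fastforce
    then have "subst_poly t const_poly q \<in> Q" using Qp Q(3) by blast
    from prime_univariate[OF Q(1) \<open>1 \<notin> Q\<close> \<open>q \<noteq> 0\<close> this] show False using no by blast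
  qed
  \<comment> \<open>Every element is congruent to a constant modulo \<open>Q\<close>; the constants
    of the variables are the coordinates of the required point.\<close>
  then have "\<forall>v. \<exists>c. mono (single v 1) - const_poly c \<in> Q" by blast
  then obtain p where p: "\<And>v. mono (single v 1) - const_poly (p v) \<in> Q" by metis
  have mono: "mono m - const_poly (mon_ev p m) \<in> Q" for m
  proof (induction m rule: monom_induct)
    case zero
    then show ?case using Qi by (simp add: const_poly_def ideal.subspace_0 del: single_one)
  next
    case (add m v)
    have "mono m * (mono (single v 1) - const_poly (p v)) + const_poly (p v) * (mono m - const_poly (mon_ev p m)) \<in> Q"
      by (intro ideal.subspace_add[OF Qi] ideal.subspace_scale[OF Qi] p add)
    also have "mono m * (mono (single v 1) - const_poly (p v)) + const_poly (p v) * (mono m - const_poly (mon_ev p m)) =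
        mono m * mono (single v 1) - const_poly (p v) * const_poly (mon_ev p m)"
      by (simp only: right_diff_distrib) (simp only: mult.commute diff_add_cancel add_diff_eq)
    also have "\<dots> = mono (single v 1 + m) - const_poly (mon_ev p (single v 1 + m))"
      by (simp only: mono_add mon_ev_add mon_ev_single const_poly_mult power_one_right mult.commute)
    finally show ?case .
  qed
  have ev: "g - const_poly (pev p g) \<in> Q" for g
  proof -
    have "(\<Sum>m\<in>keys g. const_poly (lookup g m) * (mono m - const_poly (mon_ev p m))) \<in> Q"
      by (intro ideal.subspace_sum[OF Qi] ideal.subspace_scale[OF Qi] mono)
    also have "(\<Sum>m\<in>keys g. const_poly (lookup g m) * (mono m - const_poly (mon_ev p m))) =
        (\<Sum>m\<in>keys g. single m (lookup g m)) - const_poly (pev p g)"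
      by (simp add: right_diff_distrib sum_subtractf const_poly_mult[symmetric] pev_def const_poly_sum)
    finally show ?thesis using poly_expand[of g] by simp
  qed
  have "pev p g = 0" if g: "g \<in> I" for g
  proof (rule ccontr)
    assume ne: "pev p g \<noteq> 0"
    have "g - (g - const_poly (pev p g)) \<in> Q"
      using g Q(2) by (intro ideal.subspace_diff[OF Qi _ ev]) auto
    then have "const_poly (inverse (pev p g)) * const_poly (pev p g) \<in> Q"
      by (intro ideal.subspace_scale[OF Qi]) simp
    then show False using \<open>1 \<notin> Q\<close> ne by (simp add: const_poly_mult[symmetric])
  qed
  moreover have "pev p f \<noteq> 0" using ev[of f] Q(3)[of 1] by auto
  ultimately show ?thesis by blast
qed

section \<open>Families of ideals\<close>

text \<open>A pointwise substitute for flatness: it lets a family of points of the Hilbert scheme over a closed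
  set be recognized as a value of the Hilbert functor.\<close>

definition liftable :: "(nat \<Rightarrow> complex) set \<Rightarrow> ((nat \<Rightarrow> complex) \<Rightarrow> ('a::finite, 'b::finite, 'c::finite) coxC set) \<Rightarrow> bool" where
  "liftable Z I \<longleftrightarrow> (\<forall>x0\<in>Z. \<forall>v\<in>I x0. \<exists>F. (\<forall>x\<in>Z. spec x F \<in> I x) \<and> spec x0 F = v)"

lemma liftable_subset: "liftable Z I \<Longrightarrow> Z' \<subseteq> Z \<Longrightarrow> liftable Z' I"
  unfolding liftable_def by blast

definition MonS :: "degree set \<Rightarrow> ('a::finite, 'b::finite, 'c::finite) monom set" where
  "MonS D = (\<Union>u\<in>D. Mon u)"

lemma finite_MonS [simp]: "finite D \<Longrightarrow> finite (MonS D)"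
  by (simp add: MonS_def)

lemma lookup_sum_hcomp:
  fixes f :: "('a::finite, 'b::finite, 'c::finite, 'r::comm_monoid_add) cox"
  assumes "finite D"
  shows "lookup (\<Sum>u\<in>D. hcomp u f) m = (if mdeg m \<in> D then lookup f m else 0)"
proof -
  have "lookup (\<Sum>u\<in>D. hcomp u f) m = (\<Sum>u\<in>D. if u = mdeg m then lookup f m else 0)"
    unfolding lookup_sum by (intro sum.cong refl) (auto simp: lookup_hcomp)
  then show ?thesis using assms by simp
qed

lemma hilb_homogeneous: "I \<in> hilb h \<Longrightarrow> homogeneous_ideal I"
  by (simp add: hilb_def)

lemma hilb_subspace: "I \<in> hilb h \<Longrightarrow> ideal.subspace I"
  by (simp add: hilb_def homogeneous_ideal_subspace)

lemma hilb_hf: "I \<in> hilb h \<Longrightarrow> hilbert_function I u = enat (h u)"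
  unfolding hilb_def by blast

text \<open>The coefficient vectors of polynomials that can be expressed by the \<open>q b\<close>
  modulo \<open>I x\<close>, with coefficients polynomial in \<open>x\<close> and for all
  \<open>x\<close> in \<open>Z\<close> at once, form a module over the base ring. Liftability
  provides vectors of this module that specialize to the unit vectors at \<open>x0\<close>, so
  \<open>nakayama\<close> applies. The factor \<open>f\<close> is the common denominator.\<close>

lemma liftable_nakayama:
  fixes I :: "(nat \<Rightarrow> complex) \<Rightarrow> ('a::finite, 'b::finite, 'c::finite) coxC set"
  assumes lift: "liftable Z I" and hom: "\<And>x. x \<in> Z \<Longrightarrow> homogeneous_ideal (I x)"
    and x0: "x0 \<in> Z" and D: "finite D" and B: "finite B"
    and q: "\<And>b. b \<in> B \<Longrightarrow> keys (q b) \<subseteq> MonS D"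
    and gen: "\<And>m. m \<in> MonS D \<Longrightarrow> \<exists>c. mono m - (\<Sum>b\<in>B. const_poly (c b) * q b) \<in> I x0"
  shows "\<exists>f C. pev x0 f \<noteq> 0 \<and> (\<forall>m\<in>MonS D. \<forall>x\<in>Z.
    const_poly (pev x f) * mono m - (\<Sum>b\<in>B. const_poly (pev x (C m b)) * q b) \<in> I x)"
proof -
  let ?A = "MonS D :: ('a, 'b, 'c) monom set"
  have sub: "ideal.subspace (I x)" if "x \<in> Z" for x using hom[OF that] by (rule homogeneous_ideal_subspace)
  define M where "M = {w. \<exists>C. \<forall>x\<in>Z. spec x (\<Sum>m\<in>?A. single m (w m)) - (\<Sum>b\<in>B. const_poly (pev x (C b)) * q b) \<in> I x}"
  have M: "lin_closed M"
    unfolding lin_closed_def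
  proof (intro conjI ballI allI)
    show "(\<lambda>_. 0) \<in> M" unfolding M_def using sub
      by (intro CollectI exI[of _ "\<lambda>_. 0"]) (simp add: ideal.subspace_0)
  next
    fix w w' assume "w \<in> M" "w' \<in> M"
    then obtain C C' where C: "\<And>x. x \<in> Z \<Longrightarrow> spec x (\<Sum>m\<in>?A. single m (w m)) - (\<Sum>b\<in>B. const_poly (pev x (C b)) * q b) \<in> I x"
      "\<And>x. x \<in> Z \<Longrightarrow> spec x (\<Sum>m\<in>?A. single m (w' m)) - (\<Sum>b\<in>B. const_poly (pev x (C' b)) * q b) \<in> I x"
      unfolding M_def by blast
    show "(\<lambda>a. w a + w' a) \<in> M"
      unfolding M_def
    proof (intro CollectI exI[of _ "\<lambda>b. C b + C' b"] ballI)
      fix x assume x: "x \<in> Z"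
      have e: "spec x (\<Sum>m\<in>?A. single m (w m + w' m)) - (\<Sum>b\<in>B. const_poly (pev x (C b + C' b)) * q b)
        = (spec x (\<Sum>m\<in>?A. single m (w m)) - (\<Sum>b\<in>B. const_poly (pev x (C b)) * q b))
        + (spec x (\<Sum>m\<in>?A. single m (w' m)) - (\<Sum>b\<in>B. const_poly (pev x (C' b)) * q b))"
        by (simp only: single_add sum.distrib spec_add pev_add const_poly_add distrib_right add_diff_add)
      show "spec x (\<Sum>m\<in>?A. single m (w m + w' m)) - (\<Sum>b\<in>B. const_poly (pev x (C b + C' b)) * q b) \<in> I x"
        unfolding e by (rule ideal.subspace_add[OF sub[OF x] C(1)[OF x] C(2)[OF x]])
    qed
  next
    fix c w assume "w \<in> M"
    then obtain C where C: "\<And>x. x \<in> Z \<Longrightarrow> spec x (\<Sum>m\<in>?A. single m (w m)) - (\<Sum>b\<in>B. const_poly (pev x (C b)) * q b) \<in> I x"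
      unfolding M_def by blast
    show "(\<lambda>a. c * w a) \<in> M"
      unfolding M_def
    proof (intro CollectI exI[of _ "\<lambda>b. c * C b"] ballI)
      fix x assume x: "x \<in> Z"
      have e1: "spec x (\<Sum>m\<in>?A. single m (c * w m)) = const_poly (pev x c) * spec x (\<Sum>m\<in>?A. single m (w m))"
        by (simp add: spec_sum sum_distrib_left pev_mult)
      have e2: "(\<Sum>b\<in>B. const_poly (pev x (c * C b)) * q b) = const_poly (pev x c) * (\<Sum>b\<in>B. const_poly (pev x (C b)) * q b)"
        by (simp only: sum_distrib_left pev_mult const_poly_mult mult.assoc)
      show "spec x (\<Sum>m\<in>?A. single m (c * w m)) - (\<Sum>b\<in>B. const_poly (pev x (c * C b)) * q b) \<in> I x"
        unfolding e1 e2 right_diff_distrib[symmetric] by (rule ideal.subspace_scale[OF sub[OF x] C[OF x]])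
    qed
  qed
  have "\<exists>w\<in>M. \<forall>k\<in>?A. pev x0 (w k) = (if k = m then 1 else 0)" if m: "m \<in> ?A" for m
  proof -
    obtain c where c: "mono m - (\<Sum>b\<in>B. const_poly (c b) * q b) \<in> I x0" using gen[OF m] by blast
    let ?v = "mono m - (\<Sum>b\<in>B. const_poly (c b) * q b)"
    obtain F where F: "\<And>x. x \<in> Z \<Longrightarrow> spec x F \<in> I x" "spec x0 F = ?v"
      using lift x0 c unfolding liftable_def by blast
    \<comment> \<open>The lift may have components in foreign degrees; they are cut off, which
      homogeneity of the ideals permits.\<close>
    define F' where "F' = (\<Sum>u\<in>D. hcomp u F)"
    have F': "spec x F' \<in> I x" if "x \<in> Z" for x
      unfolding F'_def spec_sum hcomp_spec[symmetric]
      by (intro ideal.subspace_sum[OF sub[OF that]] homogeneous_ideal_hcomp[OF hom[OF that] F(1)[OF that]])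
    have kF': "keys F' \<subseteq> ?A"
      using lookup_sum_hcomp[OF D, of F] by (auto simp: F'_def in_keys_iff MonS_def Mon_def split: if_splits)
    \<comment> \<open>Putting the terms of \<open>B\<close> back with constant coefficients makes
      \<open>w\<close> specialize at \<open>x0\<close> to the unit vector of
      \<open>m\<close>.\<close>
    define w where "w k = lookup (F' + (\<Sum>b\<in>B. lift_const (const_poly (c b) * q b))) k" for k
    have kw: "(\<Sum>k\<in>?A. single k (w k)) = F' + (\<Sum>b\<in>B. lift_const (const_poly (c b) * q b))"
      unfolding w_def
    proof (rule poly_expand_superset[symmetric])
      have "keys (lift_const (const_poly (c b) * q b)) \<subseteq> ?A" if "b \<in> B" for b
        by (rule order_trans[OF keys_lift_const order_trans[OF keys_const_poly_mult q[OF that]]])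
      then have "keys (\<Sum>b\<in>B. lift_const (const_poly (c b) * q b)) \<subseteq> ?A"
        by (intro order_trans[OF Poly_Mapping.keys_sum] UN_least)
      then show "keys (F' + (\<Sum>b\<in>B. lift_const (const_poly (c b) * q b))) \<subseteq> ?A"
        by (intro order_trans[OF Poly_Mapping.keys_add] Un_least kF')
    qed (use D in simp)
    have "w \<in> M"
      unfolding M_def
    proof (intro CollectI exI[of _ "\<lambda>b. const_poly (c b)"] ballI)
      fix x assume x: "x \<in> Z"
      show "spec x (\<Sum>m\<in>?A. single m (w m)) - (\<Sum>b\<in>B. const_poly (pev x (const_poly (c b))) * q b) \<in> I x"
        unfolding kw spec_add spec_sum using F'[OF x] by simp
    qed
    moreover have "pev x0 (w k) = (if k = m then 1 else 0)" if k: "k \<in> ?A" for k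
    proof -
      have "lookup F' k = lookup F k"
        using k by (simp add: F'_def lookup_sum_hcomp[OF D] MonS_def Mon_def)
      then have "lookup (spec x0 F') k = lookup ?v k"
        unfolding F(2)[symmetric] by simp
      then show ?thesis
        by (simp add: w_def lookup_add pev_add lookup_sum pev_sum lookup_minus lookup_single when_def)
    qed
    ultimately show ?thesis by blast
  qed
  from nakayama[OF _ M this] D obtain f where f: "pev x0 f \<noteq> 0"
    "\<forall>a\<in>?A. \<exists>w\<in>M. \<forall>k\<in>?A. w k = (if k = a then f else 0)" by auto
  have "\<forall>m\<in>?A. \<exists>C. \<forall>x\<in>Z. const_poly (pev x f) * mono m - (\<Sum>b\<in>B. const_poly (pev x (C b)) * q b) \<in> I x"
  proof
    fix a assume a: "a \<in> ?A"
    then obtain w where w: "w \<in> M" "\<And>k. k \<in> ?A \<Longrightarrow> w k = (if k = a then f else 0)" using f(2) by blast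
    have "(\<Sum>m\<in>?A. single m (w m)) = (\<Sum>m\<in>?A. if m = a then single a f else 0)"
      by (intro sum.cong refl) (simp add: w(2))
    then have e: "(\<Sum>m\<in>?A. single m (w m)) = single a f" using D a by simp
    show "\<exists>C. \<forall>x\<in>Z. const_poly (pev x f) * mono a - (\<Sum>b\<in>B. const_poly (pev x (C b)) * q b) \<in> I x"
      using w(1) unfolding M_def by (simp only: mem_Collect_eq e spec_single) simp
  qed
  from bchoice[OF this] f(1) show ?thesis by blast
qed

lemma scale_back:
  fixes v :: "'m::comm_monoid_add \<Rightarrow>\<^sub>0 'r::field"
  assumes I: "ideal.subspace I" and "k \<noteq> 0" "const_poly k * v - (\<Sum>b\<in>B. const_poly (c b) * q b) \<in> I"
  shows "v - (\<Sum>b\<in>B. const_poly (c b / k) * q b) \<in> I"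
proof -
  have "const_poly (inverse k) * (const_poly k * v - (\<Sum>b\<in>B. const_poly (c b) * q b)) \<in> I"
    by (rule ideal.subspace_scale[OF I assms(3)])
  also have "const_poly (inverse k) * (const_poly k * v - (\<Sum>b\<in>B. const_poly (c b) * q b)) =
      const_poly (inverse k * k) * v - (\<Sum>b\<in>B. const_poly (inverse k * c b) * q b)"
    by (simp only: right_diff_distrib sum_distrib_left const_poly_mult mult.assoc)
  finally show ?thesis using assms(2) by (simp add: divide_inverse mult.commute[of "inverse k"])
qed

lemma liftable_spans_mod:
  fixes I :: "(nat \<Rightarrow> complex) \<Rightarrow> ('a::finite, 'b::finite, 'c::finite) coxC set"
  assumes lift: "liftable Z I" and hom: "\<And>x. x \<in> Z \<Longrightarrow> homogeneous_ideal (I x)"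
    and x0: "x0 \<in> Z" and B: "finite B" and q: "\<And>b. b \<in> B \<Longrightarrow> q b \<in> piece u"
    and sp: "spans_mod B q (I x0) u"
  shows "\<exists>f. pev x0 f \<noteq> 0 \<and> (\<forall>x\<in>Z. pev x f \<noteq> 0 \<longrightarrow> spans_mod B q (I x) u)"
proof -
  have "\<exists>f C. pev x0 f \<noteq> 0 \<and> (\<forall>m\<in>MonS {u}. \<forall>x\<in>Z.
      const_poly (pev x f) * mono m - (\<Sum>b\<in>B. const_poly (pev x (C m b)) * q b) \<in> I x)"
    using sp q by (intro liftable_nakayama[OF lift hom x0 _ B]) (auto simp: MonS_def piece_iff spans_mod_def single_piece)
  then obtain f C where f: "pev x0 f \<noteq> 0" and C: "\<And>m x. m \<in> MonS {u} \<Longrightarrow> x \<in> Z \<Longrightarrow>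
      const_poly (pev x f) * mono m - (\<Sum>b\<in>B. const_poly (pev x (C m b)) * q b) \<in> I x" by blast
  have "spans_mod B q (I x) u" if x: "x \<in> Z" "pev x f \<noteq> 0" for x
  proof (rule spans_mod_monoI)
    show s: "ideal.subspace (I x)" using hom[OF x(1)] by (rule homogeneous_ideal_subspace)
    fix m :: "('a, 'b, 'c) monom" assume "m \<in> Mon u"
    then show "\<exists>c. mono m - (\<Sum>b\<in>B. const_poly (c b) * q b) \<in> I x"
      using scale_back[OF s x(2) C[OF _ x(1), of m]] by (auto simp: MonS_def)
  qed
  then show ?thesis using f by blast
qed

lemma hilb_basis:
  fixes I :: "('a::finite, 'b::finite, 'c::finite) coxC set"
  assumes "I \<in> hilb h"
  obtains g where "inj_on g {..<h u}" "\<And>j. j < h u \<Longrightarrow> g j \<in> Mon u" "spans_mod {..<h u} (\<lambda>j. mono (g j)) I u"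
proof -
  have I: "ideal.subspace I" using assms by (rule hilb_subspace)
  let ?B = "standard I \<inter> Mon u"
  have "card ?B = h u" using hilbert_function_standard[OF I, of u] hilb_hf[OF assms, of u] by simp
  then obtain g where g: "bij_betw g {..<h u} ?B"
    using ex_bij_betw_nat_finite[of ?B] by (auto simp: atLeast0LessThan)
  have inj: "inj_on g {..<h u}" using g by (simp add: bij_betw_def)
  have "spans_mod {..<h u} (\<lambda>j. mono (g j)) I u"
    unfolding spans_mod_def
  proof
    fix f :: "('a, 'b, 'c) coxC" assume "f \<in> piece u"
    then obtain c where "f - (\<Sum>b\<in>?B. const_poly (c b) * mono b) \<in> I"
      using standard_basis(2)[OF I, of u] by (auto simp: spans_mod_def)
    then have "f - (\<Sum>j<h u. const_poly (c (g j)) * mono (g j)) \<in> I"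
      by (simp add: sum.reindex_bij_betw[OF g, symmetric])
    then show "\<exists>c. f - (\<Sum>j<h u. const_poly (c j) * mono (g j)) \<in> I"
      by (rule exI[where x = "\<lambda>j. c (g j)"])
  qed
  moreover have "g j \<in> Mon u" if "j < h u" for j using g that by (auto simp: bij_betw_def)
  ultimately show thesis using that inj by blast
qed

text \<open>The base is \<open>Z\<close> with its reduced structure, so an equation in the base ring
  may be checked at the points of \<open>Z\<close>. If the open sets of local freeness did not
  cover, there would be a point \<open>x0\<close> of \<open>Z\<close> outside all of them; but a
  monomial basis at \<open>x0\<close> still spans in a neighbourhood, and constancy of the Hilbert
  function makes it independent there.\<close>

lemma family_of_liftable:
  fixes I :: "(nat \<Rightarrow> complex) \<Rightarrow> ('a::finite, 'b::finite, 'c::finite) coxC set"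
  assumes Z: "Z = {x. \<forall>g\<in>G0. pev x g = 0}" and N: "\<forall>x\<in>Z. \<forall>i\<ge>N. x i = 0"
    and Ih: "\<forall>x\<in>Z. I x \<in> hilb h" and lift: "liftable Z I"
  defines "J \<equiv> {g. \<forall>x\<in>Z. pev x g = 0}" and "FF \<equiv> {F. \<forall>x\<in>Z. spec x F \<in> I x}"
  shows "base_ideal J" "hilb_family h J FF" "base_points J = Z" "\<And>x. x \<in> Z \<Longrightarrow> fibre FF x = I x"
proof -
  have hom: "homogeneous_ideal (I x)" if "x \<in> Z" for x using Ih[rule_format, OF that] by (rule hilb_homogeneous)
  have sub: "ideal.subspace (I x)" if "x \<in> Z" for x using Ih[rule_format, OF that] by (rule hilb_subspace)
  have subJ: "ideal.subspace J" by (rule ideal.subspaceI) (auto simp: J_def pev_add pev_mult)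
  show "base_ideal J"
    unfolding base_ideal_def using subJ N by (auto simp: J_def intro!: exI[of _ N])
  show bp: "base_points J = Z"
  proof
    show "Z \<subseteq> base_points J" by (auto simp: base_points_def J_def poly_eval_eq_pev)
    show "base_points J \<subseteq> Z"
    proof
      fix x assume x: "x \<in> base_points J"
      have "G0 \<subseteq> J" by (auto simp: J_def Z)
      then show "x \<in> Z" using x by (auto simp: base_points_def Z poly_eval_eq_pev)
    qed
  qed
  show "fibre FF x = I x" if x: "x \<in> Z" for x
    using x lift unfolding fibre_eq_spec FF_def liftable_def by (auto simp: image_iff) metis
  have subF: "ideal.subspace FF"
    by (rule ideal.subspaceI) (auto simp: FF_def spec_add spec_mult ideal.subspace_0 sub
        ideal.subspace_add ideal.subspace_scale)
  have homF: "homogeneous_ideal FF"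
    by (rule homogeneous_idealI[OF subF])
      (auto simp: FF_def hcomp_spec[symmetric] intro: homogeneous_ideal_hcomp hom)
  have JF: "const_poly ` J \<subseteq> FF" by (auto simp: FF_def J_def ideal.subspace_0 sub)
  have "locally_free J FF u (h u)" for u
    unfolding locally_free_def
  proof (rule ccontr)
    let ?S = "ideal.span (J \<union> {f. free_after_localization J FF u (h u) f})"
    assume "?S \<noteq> UNIV"
    then have "1 \<notin> ?S" using ideal.span_scale[of 1 "J \<union> {f. free_after_localization J FF u (h u) f}"] by auto
    then have "\<And>n. 1 ^ n \<notin> ?S" by simp
    from nullstellensatz[OF _ ideal.subspace_span this] obtain x0 where
      x0: "\<And>g. g \<in> ?S \<Longrightarrow> pev x0 g = 0" by auto
    have "pev x0 g = 0" if "g \<in> J" for g using that by (intro x0 ideal.span_base) simp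
    then have "x0 \<in> Z" unfolding bp[symmetric] by (auto simp: base_points_def poly_eval_eq_pev)
    obtain g where g: "inj_on g {..<h u}" "\<And>j. j < h u \<Longrightarrow> g j \<in> Mon u"
      "spans_mod {..<h u} (\<lambda>j. mono (g j)) (I x0) u"
      using hilb_basis[OF Ih[rule_format, OF \<open>x0 \<in> Z\<close>]] by blast
    have "\<exists>f C. pev x0 f \<noteq> 0 \<and> (\<forall>m\<in>MonS {u}. \<forall>x\<in>Z.
      const_poly (pev x f) * mono m - (\<Sum>b<h u. const_poly (pev x (C m b)) * mono (g b)) \<in> I x)"
      using g by (intro liftable_nakayama[OF lift hom \<open>x0 \<in> Z\<close>])
        (auto simp: MonS_def spans_mod_def single_piece)
    then obtain f C where f: "pev x0 f \<noteq> 0" and C: "\<And>m x. m \<in> Mon u \<Longrightarrow> x \<in> Z \<Longrightarrow>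
      const_poly (pev x f) * mono m - (\<Sum>b<h u. const_poly (pev x (C m b)) * mono (g b)) \<in> I x"
      by (auto simp: MonS_def)
    have "free_after_localization J FF u (h u) f"
      unfolding free_after_localization_def
    proof (intro exI[of _ "\<lambda>j. mono (g j)"] conjI allI impI ballI)
      show "mono (g j) \<in> piece u" if "j < h u" for j using g(2)[OF that] by (rule single_piece)
    next
      fix v :: "('a, 'b, 'c, base_poly) cox" assume v: "v \<in> piece u"
      define c where "c j = (\<Sum>m\<in>Mon u. lookup v m * C m j)" for j
      have "const_poly (f ^ 1) * v - (\<Sum>j<h u. const_poly (c j) * mono (g j)) \<in> FF"
        unfolding FF_def
      proof (intro CollectI ballI)
        fix x assume x: "x \<in> Z"
        have "(\<Sum>m\<in>Mon u. const_poly (pev x (lookup v m)) * (const_poly (pev x f) * mono m))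
            - (\<Sum>b<h u. const_poly (\<Sum>m\<in>Mon u. pev x (lookup v m) * pev x (C m b)) * mono (g b)) \<in> I x"
          by (rule ideal_lincomb[OF sub[OF x]]) (use C x in blast)
        also have "(\<Sum>m\<in>Mon u. const_poly (pev x (lookup v m)) * (const_poly (pev x f) * mono m))
            = spec x (const_poly f * (\<Sum>m\<in>Mon u. single m (lookup v m)))"
          by (simp add: sum_distrib_left spec_sum pev_mult mult.commute[of "pev x f"])
        also have "(\<Sum>m\<in>Mon u. single m (lookup v m)) = v" by (rule piece_expand[OF v, symmetric])
        finally show "spec x (const_poly (f ^ 1) * v - (\<Sum>j<h u. const_poly (c j) * mono (g j))) \<in> I x"
          by (simp add: spec_diff spec_sum c_def pev_sum pev_mult)
      qed
      then show "\<exists>k c. const_poly (f ^ k) * v - (\<Sum>j<h u. const_poly (c j) * mono (g j)) \<in> FF" by blast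
    next
      fix c j assume c: "(\<Sum>j<h u. const_poly (c j) * mono (g j)) \<in> FF" and j: "j < h u"
      \<comment> \<open>Where \<open>f\<close> vanishes nothing is to be shown. Elsewhere the
        \<open>h u\<close> monomials span a quotient of dimension \<open>h u\<close> and are a
        basis, so the coefficients of a relation vanish.\<close>
      have "pev x (f ^ 1 * c j) = 0" if x: "x \<in> Z" for x
      proof (cases "pev x f = 0")
        case False
        have "spans_mod {..<h u} (\<lambda>j. mono (g j)) (I x) u"
        proof (rule spans_mod_monoI[OF sub[OF x]])
          fix m :: "('a, 'b, 'c) monom" assume "m \<in> Mon u"
          from scale_back[OF sub[OF x] False C[OF this x]]
          show "\<exists>c. mono m - (\<Sum>b<h u. const_poly (c b) * mono (g b)) \<in> I x"
            by (rule exI[where x = "\<lambda>b. pev x (C m b) / pev x f"])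
        qed
        from spans_mod_card[OF _ this sub[OF x]] have "indep_mod {..<h u} (\<lambda>j. mono (g j)) (I x)"
          using g(2) hilb_hf[OF Ih[rule_format, OF x]] by (simp add: single_piece)
        moreover have "(\<Sum>j<h u. const_poly (pev x (c j)) * mono (g j)) \<in> I x"
          using c x by (simp add: FF_def spec_sum)
        ultimately have "pev x (c j) = 0"
          using j unfolding indep_mod_def by (auto dest: spec[of _ "\<lambda>j. pev x (c j)"])
        then show ?thesis by (simp add: pev_mult)
      qed (simp add: pev_mult)
      then show "\<exists>k. f ^ k * c j \<in> J" unfolding J_def by blast
    qed
    then have "pev x0 f = 0" by (intro x0 ideal.span_base) simp
    then show False using f by simp
  qed
  then show "hilb_family h J FF" using homF JF by (simp add: hilb_family_def)
qed

section \<open>Fibres of arbitrary families\<close>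

lemma fibre_ideal:
  assumes FF: "ideal.subspace FF"
  shows "ideal.subspace (fibre FF x)"
proof (rule ideal.subspaceI)
  show "0 \<in> fibre FF x" unfolding fibre_eq_spec using ideal.subspace_0[OF FF] by (auto intro: image_eqI[of _ _ 0])
  show "f + g \<in> fibre FF x" if "f \<in> fibre FF x" "g \<in> fibre FF x" for f g
    using that ideal.subspace_add[OF FF] unfolding fibre_eq_spec by (auto simp: spec_add[symmetric])
  show "c * f \<in> fibre FF x" if f: "f \<in> fibre FF x" for c f
  proof -
    obtain F where F: "F \<in> FF" "f = spec x F" using f by (auto simp: fibre_eq_spec)
    then have "c * f = spec x (lift_const c * F)" by (simp add: spec_mult)
    then show ?thesis using ideal.subspace_scale[OF FF F(1)] by (auto simp: fibre_eq_spec)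
  qed
qed

lemma fibre_homogeneous:
  assumes FF: "homogeneous_ideal FF"
  shows "homogeneous_ideal (fibre FF x)"
proof (rule homogeneous_idealI)
  show "ideal.subspace (fibre FF x)" using FF by (intro fibre_ideal homogeneous_ideal_subspace)
  show "hcomp u f \<in> fibre FF x" if f: "f \<in> fibre FF x" for f u
  proof -
    obtain F where "F \<in> FF" "f = spec x F" using f by (auto simp: fibre_eq_spec)
    then show ?thesis using homogeneous_ideal_hcomp[OF FF] unfolding fibre_eq_spec
      by (metis hcomp_spec imageI)
  qed
qed

text \<open>A local basis around \<open>x\<close> specializes to a spanning family of the fibre. Its
  independence is the delicate part: an element of the fibre ideal lifts to an element of
  \<open>FF\<close>, but a linear combination of the \<open>q j\<close> lifting it lies in
  \<open>FF\<close> only up to terms that vanish at \<open>x\<close>.\<close>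

lemma fibre_in_hilb:
  fixes FF :: "('a::finite, 'b::finite, 'c::finite, base_poly) cox set"
  assumes fam: "hilb_family h J FF" and x: "x \<in> base_points J"
  shows "fibre FF x \<in> hilb h"
proof -
  have hom: "homogeneous_ideal FF" using fam by (simp add: hilb_family_def)
  have FF: "ideal.subspace FF" using hom by (rule homogeneous_ideal_subspace)
  note sub = fibre_ideal[OF FF, of x]
  have "hilbert_function (fibre FF x) u = enat (h u)" for u
  proof -
    have "\<exists>f. free_after_localization J FF u (h u) f \<and> pev x f \<noteq> 0"
    proof (rule ccontr)
      assume no: "\<not> ?thesis"
      have "ideal.span (J \<union> {f. free_after_localization J FF u (h u) f}) \<subseteq> {g. pev x g = 0}"
        using no x by (intro ideal.span_minimal ideal.subspaceI)
          (auto simp: base_points_def poly_eval_eq_pev pev_add pev_mult)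
      then have "(1 :: base_poly) \<in> {g. pev x g = 0}"
        using fam unfolding hilb_family_def locally_free_def by blast
      then show False by simp
    qed
    then obtain f where fx: "pev x f \<noteq> 0" and "free_after_localization J FF u (h u) f" by blast
    then obtain q where q: "\<And>j. j < h u \<Longrightarrow> q j \<in> piece u"
      and span: "\<And>v. v \<in> piece u \<Longrightarrow> \<exists>k c. const_poly (f ^ k) * v - (\<Sum>j<h u. const_poly (c j) * q j) \<in> FF"
      and ind: "\<And>c. (\<Sum>j<h u. const_poly (c j) * q j) \<in> FF \<Longrightarrow> (\<forall>j<h u. \<exists>k. f ^ k * c j \<in> J)"
      unfolding free_after_localization_def by blast
    let ?q = "\<lambda>j. spec x (q j)"
    have qp: "?q j \<in> piece u" if "j < h u" for j
      using q[OF that] keys_spec[of x "q j"] by (auto simp: piece_iff)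
    have sp: "spans_mod {..<h u} ?q (fibre FF x) u"
      unfolding spans_mod_def
    proof
      fix v :: "('a, 'b, 'c) coxC" assume "v \<in> piece u"
      then have "lift_const v \<in> piece u" using keys_lift_const[of v] by (auto simp: piece_iff)
      then obtain k c where kc: "const_poly (f ^ k) * lift_const v - (\<Sum>j<h u. const_poly (c j) * q j) \<in> FF"
        using span by blast
      then have "spec x (const_poly (f ^ k) * lift_const v - (\<Sum>j<h u. const_poly (c j) * q j)) \<in> fibre FF x"
        by (simp add: fibre_eq_spec)
      then have "const_poly (pev x f ^ k) * v - (\<Sum>j<h u. const_poly (pev x (c j)) * ?q j) \<in> fibre FF x"
        by (simp add: spec_diff spec_mult spec_sum pev_power)
      from scale_back[OF sub _ this] fx
      show "\<exists>c. v - (\<Sum>j<h u. const_poly (c j) * ?q j) \<in> fibre FF x" by auto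
    qed
    have "indep_mod {..<h u} ?q (fibre FF x)"
      unfolding indep_mod_def
    proof (intro allI impI ballI)
      fix c j assume "(\<Sum>j<h u. const_poly (c j) * ?q j) \<in> fibre FF x" and j: "j \<in> {..<h u}"
      then obtain g where g: "g \<in> FF" "spec x g = (\<Sum>j<h u. const_poly (c j) * ?q j)"
        by (auto simp: fibre_eq_spec)
      \<comment> \<open>\<open>F0\<close> lifts the relation, \<open>hcomp u g\<close> lies in
        \<open>FF\<close>, and the coefficients of their difference \<open>F\<close> vanish at
        \<open>x\<close>. Expanding \<open>F\<close> in the \<open>q j\<close> corrects
        \<open>F0\<close> to a relation in \<open>FF\<close>.\<close>
      define F0 where "F0 = (\<Sum>j<h u. const_poly (const_poly (c j)) * q j)"
      define F where "F = F0 - hcomp u g"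
      have F0p: "F0 \<in> piece u" unfolding F0_def by (intro piece_sum piece_const q) auto
      have Fp: "F \<in> piece u" unfolding F_def by (intro piece_diff F0p hcomp_piece)
      have "spec x F0 = spec x g" by (simp add: F0_def spec_sum spec_mult g(2))
      moreover have "spec x (hcomp u g) = hcomp u (spec x F0)" by (simp add: hcomp_spec calculation)
      moreover have "hcomp u (spec x F0) = spec x F0"
        using hcomp_of_piece[of "spec x F0" u u] F0p keys_spec[of x F0] by (auto simp: piece_iff)
      ultimately have "spec x F = 0" by (simp add: F_def spec_diff)
      then have F0x: "pev x (lookup F m) = 0" for m by (metis lookup_spec lookup_zero)
      have "\<forall>m\<in>Mon u. \<exists>k c. const_poly (f ^ k) * mono m - (\<Sum>j<h u. const_poly (c j) * q j) \<in> FF"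
        using span single_piece by blast
      from bchoice[OF this] obtain k where
        "\<forall>m\<in>Mon u. \<exists>c. const_poly (f ^ k m) * mono m - (\<Sum>j<h u. const_poly (c j) * q j) \<in> FF" ..
      from bchoice[OF this] obtain e where
        e: "\<forall>m\<in>Mon u. const_poly (f ^ k m) * mono m - (\<Sum>j<h u. const_poly (e m j) * q j) \<in> FF" ..
      \<comment> \<open>A sum of the exponents serves as an exponent for all monomials at
        once.\<close>
      define K where "K = (\<Sum>m\<in>(Mon u :: ('a, 'b, 'c) monom set). k m)"
      define G where "G m j = f ^ (K - k m) * e m j" for m j
      have "\<forall>m\<in>Mon u. const_poly (f ^ K) * mono m - (\<Sum>j<h u. const_poly (G m j) * q j) \<in> FF"
      proof
        fix m :: "('a, 'b, 'c) monom" assume m: "m \<in> Mon u"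
        then have "k m \<le> K" unfolding K_def by (intro member_le_sum) auto
        then have fK: "f ^ K = f ^ (K - k m) * f ^ k m" by (simp flip: power_add)
        have "const_poly (f ^ (K - k m)) * (const_poly (f ^ k m) * mono m - (\<Sum>j<h u. const_poly (e m j) * q j)) \<in> FF"
          using e m by (intro ideal.subspace_scale[OF FF]) blast
        also have "const_poly (f ^ (K - k m)) * (const_poly (f ^ k m) * mono m - (\<Sum>j<h u. const_poly (e m j) * q j)) =
            const_poly (f ^ K) * mono m - (\<Sum>j<h u. const_poly (G m j) * q j)"
          unfolding G_def fK const_poly_mult right_diff_distrib sum_distrib_left by (simp only: mult.assoc)
        finally show "const_poly (f ^ K) * mono m - (\<Sum>j<h u. const_poly (G m j) * q j) \<in> FF" .
      qed
      from ideal_lincomb[OF FF this, of "lookup F"]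
      have "(\<Sum>m\<in>Mon u. const_poly (lookup F m) * (const_poly (f ^ K) * mono m))
          - (\<Sum>j<h u. const_poly (\<Sum>m\<in>Mon u. lookup F m * G m j) * q j) \<in> FF" .
      also have "(\<Sum>m\<in>Mon u. const_poly (lookup F m) * (const_poly (f ^ K) * mono m)) =
          const_poly (f ^ K) * (\<Sum>m\<in>Mon u. single m (lookup F m))"
        by (simp add: sum_distrib_left mult.commute[of "f ^ K"])
      also have "(\<Sum>m\<in>Mon u. single m (lookup F m)) = F" by (rule piece_expand[OF Fp, symmetric])
      finally have 1: "const_poly (f ^ K) * F - (\<Sum>j<h u. const_poly (\<Sum>m\<in>Mon u. lookup F m * G m j) * q j) \<in> FF" .
      have 2: "const_poly (f ^ K) * hcomp u g \<in> FF"
        by (intro ideal.subspace_scale[OF FF] homogeneous_ideal_hcomp[OF hom g(1)])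
      \<comment> \<open>The corrected relation has the coefficients \<open>d j\<close>. The
        correction is a combination of the coefficients of \<open>F\<close>, so at \<open>x\<close>
        the value of \<open>d j\<close> is \<open>pev x f ^ K * c j\<close>.\<close>
      define d where "d j = f ^ K * const_poly (c j) - (\<Sum>m\<in>Mon u. lookup F m * G m j)" for j
      have "(\<Sum>j<h u. const_poly (d j) * q j) = const_poly (f ^ K) * F0
          - (\<Sum>j<h u. const_poly (\<Sum>m\<in>Mon u. lookup F m * G m j) * q j)"
        unfolding d_def F0_def const_poly_diff const_poly_mult left_diff_distrib sum_subtractf sum_distrib_left
        by (simp only: mult.assoc)
      also have "\<dots> = (const_poly (f ^ K) * F - (\<Sum>j<h u. const_poly (\<Sum>m\<in>Mon u. lookup F m * G m j) * q j))
          + const_poly (f ^ K) * hcomp u g"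
        unfolding F_def by (simp add: right_diff_distrib)
      also have "\<dots> \<in> FF" by (rule ideal.subspace_add[OF FF 1 2])
      finally have "\<exists>k. f ^ k * d j \<in> J" using ind j by blast
      then obtain k where "f ^ k * d j \<in> J" ..
      then have "pev x (f ^ k * d j) = 0" using x by (auto simp: base_points_def poly_eval_eq_pev)
      then have "pev x (d j) = 0" using fx by (simp add: pev_mult pev_power)
      then show "c j = 0" using fx F0x by (simp add: d_def pev_diff pev_mult pev_power pev_sum)
    qed
    from hilbert_function_eq[OF _ sp sub _ this] qp show ?thesis by auto
  qed
  then show ?thesis using fibre_homogeneous[OF hom] by (simp add: hilb_def)
qed

lemma topspace_hilb:
  "topspace (hilb_topology h) = (hilb h :: ('a::finite, 'b::finite, 'c::finite) coxC set set)"
proof -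
  have "hilb_open h (hilb h :: ('a, 'b, 'c) coxC set set)"
    unfolding hilb_open_def
  proof (intro conjI allI impI exI[of _ "{1}"])
    fix J and I :: "('a, 'b, 'c, base_poly) cox set"
    assume "base_ideal J \<and> hilb_family h J I"
    then show "{x \<in> base_points J. fibre I x \<in> hilb h} = {x \<in> base_points J. \<exists>g\<in>{1}. poly_eval x g \<noteq> 0}"
      using fibre_in_hilb by (auto simp: poly_eval_eq_pev)
  qed simp
  moreover have "U \<subseteq> hilb h" if "hilb_open h U" for U :: "('a, 'b, 'c) coxC set set" using that by (simp add: hilb_open_def)
  ultimately show ?thesis unfolding topspace_def openin_hilb_topology by blast
qed

text \<open>Continuity of the map from \<open>Z\<close> to the Hilbert scheme given by a liftable
  family.\<close>

lemma closed_pullback: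
  fixes I :: "(nat \<Rightarrow> complex) \<Rightarrow> ('a::finite, 'b::finite, 'c::finite) coxC set"
  assumes Z: "Z = {x. \<forall>g\<in>G0. pev x g = 0}" and N: "\<forall>x\<in>Z. \<forall>i\<ge>N. x i = 0"
    and Ih: "\<forall>x\<in>Z. I x \<in> hilb h" and lift: "liftable Z I"
    and T: "closedin (hilb_topology h) T"
  shows "\<exists>G. \<forall>x\<in>Z. I x \<in> T \<longleftrightarrow> (\<forall>g\<in>G. pev x g = 0)"
proof -
  let ?J = "{g. \<forall>x\<in>Z. pev x g = 0}" and ?FF = "{F. \<forall>x\<in>Z. spec x F \<in> I x}"
  note f = family_of_liftable[OF Z N Ih lift]
  have "hilb_open h (hilb h - T)"
    using T by (simp add: closedin_def topspace_hilb openin_hilb_topology)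
  then obtain G where G: "{x \<in> base_points ?J. fibre ?FF x \<in> hilb h - T} = {x \<in> base_points ?J. \<exists>g\<in>G. poly_eval x g \<noteq> 0}"
    using f(1,2) unfolding hilb_open_def by blast
  have "I x \<in> T \<longleftrightarrow> (\<forall>g\<in>G. pev x g = 0)" if x: "x \<in> Z" for x
  proof -
    have "I x \<notin> T \<longleftrightarrow> x \<in> {x \<in> base_points ?J. fibre ?FF x \<in> hilb h - T}"
      using x f(3,4) Ih[rule_format, OF x] by auto
    also have "\<dots> \<longleftrightarrow> (\<exists>g\<in>G. pev x g \<noteq> 0)" unfolding G using x f(3) by (auto simp: poly_eval_eq_pev)
    finally show ?thesis by blast
  qed
  then show ?thesis by blast
qed

text \<open>The fibres of any value of the functor form a liftable family, by the very definition of
  fibres; so openness may be tested locally on such families, without reference to local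
  freeness.\<close>

lemma hilb_openI:
  fixes U :: "('a::finite, 'b::finite, 'c::finite) coxC set set"
  assumes U: "U \<subseteq> hilb h"
    and loc: "\<And>Z (I :: _ \<Rightarrow> ('a, 'b, 'c) coxC set) y0. liftable Z I \<Longrightarrow> (\<And>x. x \<in> Z \<Longrightarrow> I x \<in> hilb h) \<Longrightarrow> y0 \<in> Z \<Longrightarrow> I y0 \<in> U \<Longrightarrow>
      \<exists>g. pev y0 g \<noteq> 0 \<and> (\<forall>y\<in>Z. pev y g \<noteq> 0 \<longrightarrow> I y \<in> U)"
  shows "openin (hilb_topology h) U"
  unfolding openin_hilb_topology hilb_open_def
proof (intro conjI allI impI U)
  fix J and FF :: "('a, 'b, 'c, base_poly) cox set"
  assume JF: "base_ideal J \<and> hilb_family h J FF"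
  let ?Z = "base_points J"
  have lift: "liftable ?Z (fibre FF)"
    unfolding liftable_def
  proof (intro ballI)
    fix x0 v assume "v \<in> fibre FF x0"
    then obtain F where "F \<in> FF" "v = spec x0 F" by (auto simp: fibre_eq_spec)
    then show "\<exists>F. (\<forall>x\<in>?Z. spec x F \<in> fibre FF x) \<and> spec x0 F = v" by (auto simp: fibre_eq_spec)
  qed
  let ?G = "{g. \<forall>y\<in>?Z. pev y g \<noteq> 0 \<longrightarrow> fibre FF y \<in> U}"
  show "\<exists>G. {x \<in> ?Z. fibre FF x \<in> U} = {x \<in> ?Z. \<exists>g\<in>G. poly_eval x g \<noteq> 0}"
  proof (intro exI[of _ ?G] equalityI subsetI)
    fix x assume "x \<in> {x \<in> ?Z. fibre FF x \<in> U}"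
    then have "\<exists>g. pev x g \<noteq> 0 \<and> (\<forall>y\<in>?Z. pev y g \<noteq> 0 \<longrightarrow> fibre FF y \<in> U)"
      by (intro loc[OF lift]) (use JF fibre_in_hilb in auto)
    then show "x \<in> {x \<in> ?Z. \<exists>g\<in>?G. poly_eval x g \<noteq> 0}"
      using \<open>x \<in> {x \<in> ?Z. fibre FF x \<in> U}\<close> by (auto simp: poly_eval_eq_pev)
  qed (auto simp: poly_eval_eq_pev)
qed

section \<open>Charts of the Hilbert scheme\<close>

lemma generic_hf_eq:
  "generic_hf TYPE(('a::finite, 'b::finite, 'c::finite) var) r u = min r (card (Mon u :: ('a, 'b, 'c) monom set))"
  by (simp add: generic_hf_def dim_piece)

lemma Mon_neg: "\<not> 0 \<le> u \<Longrightarrow> Mon u = {}"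
  using mdeg_nonneg by (auto simp: Mon_def)

definition box :: "nat \<Rightarrow> degree set" where
  "box N = {u. 0 \<le> u \<and> u \<le> (int N, int N, int N)}"

lemma finite_box [simp]: "finite (box N)"
proof -
  have "box N \<subseteq> {0..int N} \<times> {0..int N} \<times> {0..int N}"
    by (auto simp: box_def less_eq_prod_def zero_prod_def)
  then show ?thesis by (rule finite_subset) auto
qed

lemma trunc_box: "0 \<le> u \<Longrightarrow> trunc N u \<in> box N"
  by (auto simp: box_def trunc_def less_eq_prod_def zero_prod_def split: prod.splits)

lemma below_trunc_box: "0 \<le> v \<Longrightarrow> v \<le> trunc N u \<Longrightarrow> v \<in> box N"
  by (auto simp: box_def trunc_def less_eq_prod_def zero_prod_def split: prod.splits)

lemma spans_mod_superset: "I \<subseteq> I' \<Longrightarrow> spans_mod B q I u \<Longrightarrow> spans_mod B q I' u"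
  unfolding spans_mod_def by (meson subsetD)

text \<open>\<open>B\<close> is the common monomial basis, and \<open>enc\<close> numbers the
  coordinates because points of the base are sequences. The box is computed from \<open>r'\<close>
  instead of \<open>r\<close>, so that it can be enlarged to contain all degrees below
  \<open>(s, t, u)\<close>.\<close>

locale chart =
  fixes r r' N :: nat and h :: "degree \<Rightarrow> nat" and B :: "('a::finite, 'b::finite, 'c::finite) monom set"
    and enc :: "('a, 'b, 'c) monom \<times> ('a, 'b, 'c) monom \<Rightarrow> nat"
  assumes h: "h = generic_hf TYPE(('a, 'b, 'c) var) r"
    and N: "N = (CARD('a) + CARD('b) + CARD('c)) * (r' + 1)"
    and rr': "r \<le> r'"
    and B_sub: "B \<subseteq> MonS (box N)"
    and B_card: "\<And>u. u \<in> box N \<Longrightarrow> card (B \<inter> Mon u) = h u"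
    and enc_inj: "inj_on enc {(m, b). m \<in> MonS (box N) \<and> b \<in> B \<inter> Mon (mdeg m)}"
begin

abbreviation "D \<equiv> box N"
abbreviation "BM m \<equiv> B \<inter> Mon (mdeg m)"

lemma h_eq: "h u = min r (card (Mon u :: ('a, 'b, 'c) monom set))"
  by (simp add: h generic_hf_eq)

definition "idx = {(m, b). m \<in> MonS D \<and> b \<in> BM m}"

definition rel :: "(nat \<Rightarrow> complex) \<Rightarrow> ('a, 'b, 'c) monom \<Rightarrow> ('a, 'b, 'c) coxC" where
  "rel x m = mono m - (\<Sum>b\<in>BM m. const_poly (x (enc (m, b))) * mono b)"

definition Ix :: "(nat \<Rightarrow> complex) \<Rightarrow> ('a, 'b, 'c) coxC set" where
  "Ix x = ideal.span (rel x ` MonS D)"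

definition pts :: "(nat \<Rightarrow> complex) set" where
  "pts = {x. (\<forall>i. i \<notin> enc ` idx \<longrightarrow> x i = 0) \<and> Ix x \<in> hilb h}"

lemma finite_B [simp]: "finite B"
  using B_sub by (rule finite_subset) simp

lemma finite_idx [simp]: "finite idx"
proof -
  have "idx \<subseteq> MonS D \<times> B" by (auto simp: idx_def)
  then show ?thesis by (rule finite_subset) simp
qed

lemma enc_inj': "inj_on enc idx"
  using enc_inj by (simp add: idx_def)

lemma rel_piece: "rel x m \<in> piece (mdeg m)"
  unfolding rel_def by (intro piece_diff piece_sum piece_const single_piece) (auto simp: Mon_def)

lemma sub_Ix: "ideal.subspace (Ix x)"
  by (simp add: Ix_def)

lemma hom_Ix: "homogeneous_ideal (Ix x)"
  unfolding homogeneous_ideal_def Ix_def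
  by (intro exI[of _ "rel x ` MonS D"] conjI refl ballI) (use rel_piece in blast)

lemma rel_in_Ix: "m \<in> MonS D \<Longrightarrow> rel x m \<in> Ix x"
  unfolding Ix_def by (intro ideal.span_base) auto

lemma spans_of_rel:
  assumes I: "ideal.subspace I" and rel: "rel x ` MonS D \<subseteq> I" and u: "u \<in> D"
  shows "spans_mod (B \<inter> Mon u) mono I u"
proof (rule spans_mod_monoI[OF I])
  fix m :: "('a, 'b, 'c) monom" assume m: "m \<in> Mon u"
  then have "m \<in> MonS D" using u by (auto simp: MonS_def)
  then have "rel x m \<in> I" using rel by auto
  then show "\<exists>c. mono m - (\<Sum>b\<in>B \<inter> Mon u. const_poly (c b) * mono b) \<in> I"
    using m unfolding rel_def Mon_def by (intro exI[of _ "\<lambda>b. x (enc (m, b))"]) simp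
qed

text \<open>In the box the quotient is spanned by \<open>B\<close>. Elsewhere the standard monomials
  are bounded by those in the truncated degree, so the finitely many relations control all
  degrees.\<close>

lemma hf_le:
  assumes I: "ideal.subspace I" and rel: "rel x ` MonS D \<subseteq> I"
  shows "hilbert_function I u \<le> enat (h u)"
proof (cases "0 \<le> u")
  case False
  then show ?thesis unfolding hilbert_function_standard[OF I] by (simp add: Mon_neg)
next
  case True
  have box: "card (standard I \<inter> Mon v) \<le> r" if v: "v \<in> D" for v
  proof -
    have "enat (card (standard I \<inter> Mon v)) \<le> enat (card (B \<inter> Mon v))"
      unfolding hilbert_function_standard[OF I, symmetric]
      by (rule hilbert_function_le[OF _ spans_of_rel[OF I rel v] I]) simp
    then show ?thesis using B_card[OF v] by (simp add: h_eq)
  qed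
  have "card (standard I \<inter> Mon u) \<le> card (standard I \<inter> Mon (trunc N u))"
  proof (rule order_ideal_bound[OF _ N True])
    show "m \<in> standard I" if "n + m \<in> standard I" for n m using standard_divisor[OF I that] .
    show "card (standard I \<inter> Mon v) \<le> r'" if "0 \<le> v" "v \<le> trunc N u" for v
      using box[OF below_trunc_box[OF that]] rr' by simp
  qed
  also have "\<dots> \<le> r" by (rule box[OF trunc_box[OF True]])
  finally have "card (standard I \<inter> Mon u) \<le> r" .
  moreover have "card (standard I \<inter> Mon u) \<le> card (Mon u :: ('a, 'b, 'c) monom set)" by (intro card_mono) auto
  ultimately show ?thesis unfolding hilbert_function_standard[OF I] by (simp add: h_eq)
qed

text \<open>By \<open>hf_le\<close> there are at most \<open>h u\<close> standard monomials of
  \<open>Ix x\<close> in degree \<open>u\<close>. They span modulo the larger ideal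
  \<open>I\<close>, whose Hilbert function is \<open>h\<close>, so they are independent modulo
  \<open>I\<close>, and \<open>I\<close> has no room to be strictly larger.\<close>

lemma Ix_eq:
  assumes Ih: "I \<in> hilb h" and rel: "rel x ` MonS D \<subseteq> I"
  shows "Ix x = I"
proof
  have I: "ideal.subspace I" using Ih by (rule hilb_subspace)
  show sub: "Ix x \<subseteq> I" unfolding Ix_def by (rule ideal.span_minimal[OF rel I])
  show "I \<subseteq> Ix x"
  proof (rule homogeneous_ideal_subsetI[OF hilb_homogeneous[OF Ih] sub_Ix])
    fix u f assume f: "f \<in> I" "f \<in> piece u"
    let ?B = "standard (Ix x) \<inter> Mon u"
    have sp: "spans_mod ?B mono (Ix x) u" by (rule standard_basis[OF sub_Ix])
    then have spI: "spans_mod ?B mono I u" by (rule spans_mod_superset[OF sub])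
    have "rel x ` MonS D \<subseteq> Ix x" using rel_in_Ix by auto
    from hf_le[OF sub_Ix this, of u] have "card ?B \<le> h u"
      by (simp add: hilbert_function_standard[OF sub_Ix])
    moreover have "enat (h u) \<le> enat (card ?B)"
      unfolding hilb_hf[OF Ih, symmetric] by (rule hilbert_function_le[OF _ spI I]) simp
    ultimately have "hilbert_function I u = enat (card ?B)" unfolding hilb_hf[OF Ih] by simp
    from spans_mod_card[OF _ spI I _ this] have ind: "indep_mod ?B mono I" by (auto intro: single_piece)
    obtain c where c: "f - (\<Sum>b\<in>?B. const_poly (c b) * mono b) \<in> Ix x"
      using sp[unfolded spans_mod_def, rule_format, OF f(2)] ..
    have "f - (f - (\<Sum>b\<in>?B. const_poly (c b) * mono b)) \<in> I"
      by (rule ideal.subspace_diff[OF I f(1) subsetD[OF sub c]])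
    then have "(\<Sum>b\<in>?B. const_poly (c b) * mono b) \<in> I" by (simp only: diff_diff_eq2 add_diff_cancel_left')
    then have "\<forall>b\<in>?B. c b = 0" using ind[unfolded indep_mod_def, THEN spec, of c] by simp
    then show "f \<in> Ix x" using c by simp
  qed
qed

lemma ptsI:
  assumes "\<And>i. i \<notin> enc ` idx \<Longrightarrow> x i = 0" "I \<in> hilb h" "rel x ` MonS D \<subseteq> I"
  shows "x \<in> pts" "Ix x = I"
  using Ix_eq[OF assms(2,3)] assms(1,2) by (auto simp: pts_def)

lemma pts_hilb: "x \<in> pts \<Longrightarrow> Ix x \<in> hilb h"
  by (simp add: pts_def)

lemma indep_pts:
  assumes "x \<in> pts" "u \<in> D"
  shows "indep_mod (B \<inter> Mon u) mono (Ix x)"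
proof (rule spans_mod_card)
  show "spans_mod (B \<inter> Mon u) mono (Ix x) u"
    by (rule spans_of_rel[OF sub_Ix _ assms(2)]) (use rel_in_Ix in auto)
  show "hilbert_function (Ix x) u = enat (card (B \<inter> Mon u))"
    using hilb_hf[OF pts_hilb[OF assms(1)]] B_card[OF assms(2)] by simp
qed (auto intro: single_piece sub_Ix)

lemma pts_inj:
  assumes x: "x \<in> pts" and y: "y \<in> pts" and eq: "Ix x = Ix y"
  shows "x = y"
proof
  fix i
  show "x i = y i"
  proof (cases "i \<in> enc ` idx")
    case False
    then show ?thesis using x y by (simp add: pts_def)
  next
    case True
    then obtain m b where mb: "m \<in> MonS D" "b \<in> BM m" "i = enc (m, b)" by (auto simp: idx_def)
    have "rel y m - rel x m \<in> Ix x"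
      using rel_in_Ix[OF mb(1)] eq by (intro ideal.subspace_diff[OF sub_Ix]) auto
    also have "rel y m - rel x m = (\<Sum>b\<in>BM m. const_poly (x (enc (m, b)) - y (enc (m, b))) * mono b)"
      by (simp add: rel_def const_poly_diff left_diff_distrib sum_subtractf del: const_poly_mult_single)
    finally have "(\<Sum>b\<in>BM m. const_poly (x (enc (m, b)) - y (enc (m, b))) * mono b) \<in> Ix x" .
    moreover have "mdeg m \<in> D" using mb(1) by (auto simp: MonS_def Mon_def)
    ultimately have "\<forall>b\<in>BM m. x (enc (m, b)) - y (enc (m, b)) = 0"
      using indep_pts[OF x, of "mdeg m", unfolded indep_mod_def, THEN spec, of "\<lambda>b. x (enc (m, b)) - y (enc (m, b))"] by simp
    then show ?thesis using mb by auto
  qed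
qed

text \<open>The relations with indeterminate coefficients are lifts of the generators. This holds at
  every coordinate vector, also at those outside \<open>pts\<close>, which \<open>pts_closed\<close>
  relies on.\<close>

lemma liftable_Ix: "liftable UNIV Ix"
  unfolding liftable_def
proof (intro ballI)
  fix x0 v assume "v \<in> Ix x0"
  define Rel :: "_ \<Rightarrow> ('a, 'b, 'c, base_poly) cox" where
    "Rel m = mono m - (\<Sum>b\<in>BM m. const_poly (base_var (enc (m, b))) * mono b)" for m
  have Rel: "spec x (Rel m) = rel x m" for x m
    by (simp add: Rel_def rel_def spec_diff spec_sum)
  have "v \<in> ideal.span (rel x0 ` MonS D)" using \<open>v \<in> Ix x0\<close> by (simp add: Ix_def)
  then show "\<exists>F. (\<forall>x\<in>UNIV. spec x F \<in> Ix x) \<and> spec x0 F = v"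
  proof (induction rule: ideal.span_induct_alt)
    case base
    then show ?case by (intro exI[of _ 0]) (simp add: ideal.subspace_0[OF sub_Ix])
  next
    case (step c w y)
    then obtain F where F: "\<forall>x\<in>UNIV. spec x F \<in> Ix x" "spec x0 F = y" by blast
    obtain m where m: "m \<in> MonS D" "w = rel x0 m" using step by auto
    have "spec x (lift_const c * Rel m + F) \<in> Ix x" for x
      using F(1) rel_in_Ix[OF m(1)] by (simp add: spec_add spec_mult Rel
          ideal.subspace_add[OF sub_Ix] ideal.subspace_scale[OF sub_Ix])
    moreover have "spec x0 (lift_const c * Rel m + F) = c * w + y"
      by (simp add: spec_add spec_mult Rel F(2) m(2))
    ultimately show ?case by blast
  qed
qed

text \<open>By \<open>hf_le\<close> the Hilbert function can fail only by being too small, and this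
  is an open condition, since a spanning family still spans nearby.\<close>

lemma pts_closed: "pts = {x. \<forall>g\<in>{g. \<forall>x\<in>pts. pev x g = 0}. pev x g = 0}"
proof (intro equalityI subsetI)
  fix x assume x: "x \<in> {x. \<forall>g\<in>{g. \<forall>x\<in>pts. pev x g = 0}. pev x g = 0}"
  show "x \<in> pts"
  proof (rule ccontr)
    assume np: "x \<notin> pts"
    have "\<exists>g. (\<forall>y\<in>pts. pev y g = 0) \<and> pev x g \<noteq> 0"
    proof (cases "\<forall>i. i \<notin> enc ` idx \<longrightarrow> x i = 0")
      case False
      then obtain i where "i \<notin> enc ` idx" "x i \<noteq> 0" by blast
      then show ?thesis by (intro exI[of _ "base_var i"]) (auto simp: pts_def)
    next
      case True
      then have "Ix x \<notin> hilb h" using np by (simp add: pts_def)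
      then obtain u where u: "hilbert_function (Ix x) u \<noteq> enat (h u)"
        using hom_Ix unfolding hilb_def by blast
      have "rel x ` MonS D \<subseteq> Ix x" using rel_in_Ix by auto
      from hf_le[OF sub_Ix this, of u] u have lt: "card (standard (Ix x) \<inter> Mon u) < h u"
        by (simp add: hilbert_function_standard[OF sub_Ix])
      let ?B = "standard (Ix x) \<inter> Mon u"
      have "\<exists>f. pev x f \<noteq> 0 \<and> (\<forall>y\<in>UNIV. pev y f \<noteq> 0 \<longrightarrow> spans_mod ?B mono (Ix y) u)"
        by (rule liftable_spans_mod[OF liftable_Ix hom_Ix _ _ _ standard_basis(2)[OF sub_Ix]])
          (auto intro: single_piece)
      then obtain f where f: "pev x f \<noteq> 0" "\<And>y. pev y f \<noteq> 0 \<Longrightarrow> spans_mod ?B mono (Ix y) u" by blast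
      have "pev y f = 0" if y: "y \<in> pts" for y
      proof (rule ccontr)
        assume "pev y f \<noteq> 0"
        from hilbert_function_le[OF _ f(2)[OF this] sub_Ix] have "h u \<le> card ?B"
          using hilb_hf[OF pts_hilb[OF y], of u] by simp
        then show False using lt by simp
      qed
      then show ?thesis using f(1) by blast
    qed
    then show False using x by auto
  qed
qed auto

lemma chart_closed_pullback:
  assumes "closedin (hilb_topology h) T"
  shows "\<exists>G. \<forall>x\<in>pts. Ix x \<in> T \<longleftrightarrow> (\<forall>g\<in>G. pev x g = 0)"
proof (rule closed_pullback[OF pts_closed _ _ _ assms])
  show "\<forall>x\<in>pts. \<forall>i\<ge>Suc (Max (enc ` idx)). x i = 0"
  proof (intro ballI allI impI)
    fix x i assume "x \<in> pts" and i: "Suc (Max (enc ` idx)) \<le> i"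
    have "i \<notin> enc ` idx"
    proof
      assume "i \<in> enc ` idx"
      then have "i \<le> Max (enc ` idx)" by (intro Max_ge) auto
      then show False using i by simp
    qed
    then show "x i = 0" using \<open>x \<in> pts\<close> by (simp add: pts_def)
  qed
  show "liftable pts Ix" using liftable_subset[OF liftable_Ix] by simp
qed (simp add: pts_def)

text \<open>All monomials of the box are expanded simultaneously by
  \<open>liftable_nakayama\<close>, so the chart coordinates of the members of a family are
  fractions with one common denominator.\<close>

lemma local_coordinates:
  fixes I :: "(nat \<Rightarrow> complex) \<Rightarrow> ('a, 'b, 'c) coxC set"
  assumes lift: "liftable Z I" and Ih: "\<And>x. x \<in> Z \<Longrightarrow> I x \<in> hilb h"
    and y0: "y0 \<in> Z" and x0: "x0 \<in> pts" "I y0 = Ix x0"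
  shows "\<exists>f c. pev y0 f \<noteq> 0 \<and> (\<forall>y\<in>Z. pev y f \<noteq> 0 \<longrightarrow>
    (\<lambda>i. pev y (c i) / pev y f) \<in> pts \<and> Ix (\<lambda>i. pev y (c i) / pev y f) = I y)"
proof -
  have sub: "ideal.subspace (I y)" if "y \<in> Z" for y using Ih[OF that] by (rule hilb_subspace)
  have hom: "homogeneous_ideal (I y)" if "y \<in> Z" for y using Ih[OF that] by (rule hilb_homogeneous)
  have "\<exists>f C. pev y0 f \<noteq> 0 \<and> (\<forall>m\<in>MonS D. \<forall>x\<in>Z.
    const_poly (pev x f) * mono m - (\<Sum>b\<in>B. const_poly (pev x (C m b)) * mono b) \<in> I x)"
  proof (rule liftable_nakayama[OF lift hom y0])
    fix m :: "('a, 'b, 'c) monom" assume m: "m \<in> MonS D"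
    have "(\<Sum>b\<in>B. const_poly (if b \<in> Mon (mdeg m) then x0 (enc (m, b)) else 0) * mono b) =
      (\<Sum>b\<in>BM m. const_poly (x0 (enc (m, b))) * (mono b :: ('a, 'b, 'c) coxC))"
      unfolding sum.inter_restrict[OF finite_B] by (intro sum.cong refl) auto
    then have "mono m - (\<Sum>b\<in>B. const_poly (if b \<in> Mon (mdeg m) then x0 (enc (m, b)) else 0) * mono b) \<in> I y0"
      using rel_in_Ix[OF m, of x0] x0(2) by (simp only: rel_def)
    then show "\<exists>c. mono m - (\<Sum>b\<in>B. const_poly (c b) * mono b) \<in> I y0"
      by (rule exI[where x = "\<lambda>b. if b \<in> Mon (mdeg m) then x0 (enc (m, b)) else 0"])
  qed (use B_sub in auto)
  then obtain f C where f: "pev y0 f \<noteq> 0" and C: "\<And>m y. m \<in> MonS D \<Longrightarrow> y \<in> Z \<Longrightarrow>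
    const_poly (pev y f) * mono m - (\<Sum>b\<in>B. const_poly (pev y (C m b)) * mono b) \<in> I y" by blast
  define c where "c i = (if i \<in> enc ` idx then case inv_into idx enc i of (m, b) \<Rightarrow> C m b else 0)" for i
  have c: "c (enc (m, b)) = C m b" if "(m, b) \<in> idx" for m b
    using that by (simp add: c_def inv_into_f_f[OF enc_inj'])
  have "(\<lambda>i. pev y (c i) / pev y f) \<in> pts \<and> Ix (\<lambda>i. pev y (c i) / pev y f) = I y"
    if y: "y \<in> Z" "pev y f \<noteq> 0" for y
  proof -
    let ?x = "\<lambda>i. pev y (c i) / pev y f"
    have "rel ?x m \<in> I y" if m: "m \<in> MonS D" for m
    proof -
      \<comment> \<open>The expansion runs over all of \<open>B\<close>; taking the component of
        degree \<open>mdeg m\<close> leaves the basis monomials of that degree.\<close>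
      have "hcomp (mdeg m) (const_poly (pev y f) * mono m - (\<Sum>b\<in>B. const_poly (pev y (C m b)) * mono b)) \<in> I y"
        by (rule homogeneous_ideal_hcomp[OF hom[OF y(1)] C[OF m y(1)]])
      also have "hcomp (mdeg m) (const_poly (pev y f) * mono m - (\<Sum>b\<in>B. const_poly (pev y (C m b)) * mono b)) =
        const_poly (pev y f) * mono m - (\<Sum>b\<in>BM m. const_poly (pev y (c (enc (m, b)))) * mono b)"
      proof -
        have h1: "hcomp (mdeg m) (mono b) = (if b \<in> Mon (mdeg m) then mono b else (0 :: ('a, 'b, 'c) coxC))" for b
          using hcomp_of_piece[OF single_piece, of b "mdeg b" "mdeg m"] by (auto simp: Mon_def)
        have "hcomp (mdeg m) (\<Sum>b\<in>B. const_poly (pev y (C m b)) * mono b) =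
          (\<Sum>b\<in>BM m. const_poly (pev y (C m b)) * (mono b :: ('a, 'b, 'c) coxC))"
          unfolding sum.inter_restrict[OF finite_B] hcomp_sum hcomp_const h1 by (intro sum.cong refl) auto
        also have "\<dots> = (\<Sum>b\<in>BM m. const_poly (pev y (c (enc (m, b)))) * mono b)"
          using m by (intro sum.cong refl) (auto simp: c idx_def)
        finally show ?thesis
          by (simp only: hcomp_diff hcomp_const h1) (simp add: Mon_def)
      qed
      finally have "const_poly (pev y f) * mono m - (\<Sum>b\<in>BM m. const_poly (pev y (c (enc (m, b)))) * mono b) \<in> I y" .
      from scale_back[OF sub[OF y(1)] y(2) this] show ?thesis by (simp only: rel_def)
    qed
    then have "rel ?x ` MonS D \<subseteq> I y" by auto
    from ptsI[OF _ Ih[OF y(1)] this] show ?thesis by (auto simp: c_def)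
  qed
  then show ?thesis using f by blast
qed

text \<open>Near a point where \<open>g\<close> does not vanish, \<open>g\<close> in the local
  coordinates is a fraction, and its numerator defines the neighbourhood. The choice
  \<open>g = 1\<close> gives the chart itself.\<close>

lemma chart_open: "openin (hilb_topology h) {I. \<exists>x\<in>pts. I = Ix x \<and> pev x g \<noteq> 0}"
proof (rule hilb_openI)
  show "{I. \<exists>x\<in>pts. I = Ix x \<and> pev x g \<noteq> 0} \<subseteq> hilb h" using pts_hilb by auto
  fix Z and I :: "(nat \<Rightarrow> complex) \<Rightarrow> ('a, 'b, 'c) coxC set" and y0
  assume lift: "liftable Z I" and Ih: "\<And>x. x \<in> Z \<Longrightarrow> I x \<in> hilb h" and y0: "y0 \<in> Z"
    and "I y0 \<in> {I. \<exists>x\<in>pts. I = Ix x \<and> pev x g \<noteq> 0}"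
  then obtain x0 where x0: "x0 \<in> pts" "I y0 = Ix x0" "pev x0 g \<noteq> 0" by auto
  from local_coordinates[OF lift Ih y0 x0(1,2)] obtain f c where f: "pev y0 f \<noteq> 0"
    and c: "\<And>y. y \<in> Z \<Longrightarrow> pev y f \<noteq> 0 \<Longrightarrow> (\<lambda>i. pev y (c i) / pev y f) \<in> pts \<and> Ix (\<lambda>i. pev y (c i) / pev y f) = I y"
    by blast
  have "(\<lambda>i. pev y0 (c i) / pev y0 f) = x0" using c[OF y0 f] x0 by (intro pts_inj) auto
  moreover obtain k g' where g': "\<And>y. pev y f \<noteq> 0 \<Longrightarrow> pev (\<lambda>i. pev y (c i) / pev y f) g * pev y f ^ k = pev y g'"
    using poly_subst_frac[of f c g] by blast
  ultimately have "pev y0 g' \<noteq> 0" using f x0(3) by (metis mult_eq_0_iff power_eq_0_iff)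
  then have "pev y0 (f * g') \<noteq> 0" using f by (simp add: pev_mult)
  moreover have "I y \<in> {I. \<exists>x\<in>pts. I = Ix x \<and> pev x g \<noteq> 0}" if y: "y \<in> Z" "pev y (f * g') \<noteq> 0" for y
  proof -
    have fy: "pev y f \<noteq> 0" "pev y g' \<noteq> 0" using y(2) by (auto simp: pev_mult)
    then have "pev (\<lambda>i. pev y (c i) / pev y f) g \<noteq> 0" using g'[OF fy(1)] by auto
    then show ?thesis using c[OF y(1) fy(1)] by blast
  qed
  ultimately show "\<exists>g'. pev y0 g' \<noteq> 0 \<and> (\<forall>y\<in>Z. pev y g' \<noteq> 0 \<longrightarrow> I y \<in> {I. \<exists>x\<in>pts. I = Ix x \<and> pev x g \<noteq> 0})"
    by blast
qed

end

text \<open>The standard monomials of \<open>I\<close> in the box serve as the basis of a chart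
  around \<open>I\<close>.\<close>

lemma chart_exists:
  fixes I :: "('a::finite, 'b::finite, 'c::finite) coxC set"
  assumes I: "I \<in> hilb (generic_hf TYPE(('a, 'b, 'c) var) r)" and rr': "r \<le> r'"
    and N: "N = (CARD('a) + CARD('b) + CARD('c)) * (r' + 1)"
    and h: "h = generic_hf TYPE(('a, 'b, 'c) var) r"
  obtains B :: "('a, 'b, 'c) monom set" and enc :: "('a, 'b, 'c) monom \<times> ('a, 'b, 'c) monom \<Rightarrow> nat" and x where
    "chart r r' N h B enc" "x \<in> chart.pts N h B enc" "chart.Ix N B enc x = I"
proof -
  let ?D = "box N"
  let ?B = "standard I \<inter> MonS ?D"
  have sub: "ideal.subspace I" using I by (rule hilb_subspace)
  let ?idx = "{(m :: ('a, 'b, 'c) monom, b). m \<in> MonS ?D \<and> b \<in> ?B \<inter> Mon (mdeg m)}"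
  have fin: "finite ?idx"
    by (rule finite_subset[of _ "MonS ?D \<times> MonS ?D"]) auto
  obtain enc :: "_ \<Rightarrow> nat" where enc: "inj_on enc ?idx"
    using finite_imp_inj_to_nat_seg[OF fin] by blast
  have Bu: "?B \<inter> Mon u = standard I \<inter> Mon u" if "u \<in> ?D" for u
    using that by (auto simp: MonS_def)
  interpret chart r r' N h ?B enc
  proof
    show "card (?B \<inter> Mon u) = h u" if "u \<in> ?D" for u
      unfolding Bu[OF that] using hilb_hf[OF I, of u] h hilbert_function_standard[OF sub, of u] by simp
  qed (use rr' enc N h in auto)
  have "\<forall>m\<in>MonS ?D. \<exists>c. mono m - (\<Sum>b\<in>BM m. const_poly (c b) * mono b) \<in> I"
  proof
    fix m :: "('a, 'b, 'c) monom" assume "m \<in> MonS ?D"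
    then have "mdeg m \<in> ?D" by (auto simp: MonS_def Mon_def)
    moreover have "mono m \<in> (piece (mdeg m) :: ('a, 'b, 'c) coxC set)" by (rule single_piece) (simp add: Mon_def)
    ultimately show "\<exists>c. mono m - (\<Sum>b\<in>BM m. const_poly (c b) * mono b) \<in> I"
      using standard_basis(2)[OF sub, of "mdeg m"] unfolding spans_mod_def Bu[OF \<open>mdeg m \<in> ?D\<close>] by blast
  qed
  from bchoice[OF this] obtain c
    where c: "\<forall>m\<in>MonS ?D. mono m - (\<Sum>b\<in>BM m. const_poly (c m b) * mono b) \<in> I" ..
  define x where "x i = (if i \<in> enc ` idx then case inv_into idx enc i of (m, b) \<Rightarrow> c m b else 0)" for i
  have x: "x (enc (m, b)) = c m b" if "(m, b) \<in> idx" for m b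
    using that by (simp add: x_def inv_into_f_f[OF enc_inj'])
  have "rel x m \<in> I" if m: "m \<in> MonS ?D" for m
  proof -
    have "(\<Sum>b\<in>BM m. const_poly (x (enc (m, b))) * mono b) = (\<Sum>b\<in>BM m. const_poly (c m b) * (mono b :: ('a, 'b, 'c) coxC))"
      using m by (intro sum.cong refl) (auto simp: x idx_def)
    then show ?thesis using c m by (simp only: rel_def)
  qed
  then have "rel x ` MonS ?D \<subseteq> I" by auto
  from ptsI[OF _ I[folded h] this] have "x \<in> pts" "Ix x = I" by (auto simp: x_def)
  then show thesis using that chart_axioms by blast
qed

section \<open>Ideals of points\<close>

declare split_paired_All [simp del] split_paired_Ex [simp del]

primrec tw :: "complex \<times> complex \<times> complex \<Rightarrow> ('a, 'b, 'c) var \<Rightarrow> complex" where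
  "tw s (Alpha _) = fst s" | "tw s (Beta _) = fst (snd s)" | "tw s (Gamma _) = snd (snd s)"

definition torus :: "(complex \<times> complex \<times> complex) set" where
  "torus = {(a, b, c). a \<noteq> 0 \<and> b \<noteq> 0 \<and> c \<noteq> 0}"

text \<open>The character of the torus by which it acts on forms of degree \<open>u\<close>.
  Truncation by \<open>nat\<close> does no harm, as degrees of monomials are nonnegative.\<close>

definition chi :: "degree \<Rightarrow> complex \<times> complex \<times> complex \<Rightarrow> complex" where
  "chi u s = fst s ^ nat (fst u) * fst (snd s) ^ nat (fst (snd u)) * snd (snd s) ^ nat (snd (snd u))"

text \<open>A point of \<open>X\<close> is a torus orbit of Cox coordinates. Vanishing is asked on
  the whole orbit, which makes the ideal homogeneous without any reference to gradings.\<close>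

definition pideal :: "nat \<Rightarrow> (nat \<Rightarrow> ('a::finite, 'b::finite, 'c::finite) var \<Rightarrow> complex) \<Rightarrow> ('a, 'b, 'c) coxC set" where
  "pideal r p = {f. \<forall>i<r. \<forall>s\<in>torus. pev (\<lambda>v. tw s v * p i v) f = 0}"

lemma mon_ev_tw: "mon_ev (\<lambda>v. tw s v * q v) m = chi (mdeg m) s * mon_ev q m"
  for m :: "('a::finite, 'b::finite, 'c::finite) monom"
proof -
  have "mon_ev (tw s) m = (\<Prod>v\<in>range Alpha \<union> range Beta \<union> range Gamma. tw s v ^ lookup m v)"
    unfolding mon_ev_UNIV UNIV_var ..
  also have "\<dots> = (\<Prod>v\<in>range Alpha. tw s v ^ lookup m v) * (\<Prod>v\<in>range Beta. tw s v ^ lookup m v)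
      * (\<Prod>v\<in>range Gamma. tw s v ^ lookup m v)"
    by (subst prod.union_disjoint; (subst prod.union_disjoint)?) auto
  also have "\<dots> = fst s ^ (\<Sum>v\<in>range Alpha. lookup m v) * fst (snd s) ^ (\<Sum>v\<in>range Beta. lookup m v)
      * snd (snd s) ^ (\<Sum>v\<in>range Gamma. lookup m v)"
    unfolding power_sum by (intro arg_cong2[where f = "(*)"] prod.cong refl) auto
  also have "\<dots> = chi (mdeg m) s"
  proof -
    have "nat (fst (mdeg m)) = (\<Sum>v\<in>range Alpha. lookup m v)"
      "nat (fst (snd (mdeg m))) = (\<Sum>v\<in>range Beta. lookup m v)"
      "nat (snd (snd (mdeg m))) = (\<Sum>v\<in>range Gamma. lookup m v)"
      using mdeg_eq_sum[of m "fst (mdeg m)" "fst (snd (mdeg m))" "snd (snd (mdeg m))"]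
      by (metis nat_int prod.collapse)+
    then show ?thesis by (simp add: chi_def)
  qed
  finally show ?thesis by (simp add: mon_ev_mult)
qed

lemma pev_tw_piece: "f \<in> piece u \<Longrightarrow> pev (\<lambda>v. tw s v * q v) f = chi u s * pev q f"
  unfolding pev_def sum_distrib_left
  by (intro sum.cong refl) (auto simp: mon_ev_tw piece_def)

text \<open>The values of \<open>f\<close> on an orbit are combinations of the characters
  \<open>chi u\<close>, with the values of the homogeneous components as coefficients.\<close>

lemma torus_vanish:
  fixes f :: "('a::finite, 'b::finite, 'c::finite) coxC"
  assumes "\<And>s. s \<in> torus \<Longrightarrow> pev (\<lambda>v. tw s v * q v) f = 0"
  shows "pev q (hcomp u f) = 0"
proof -
  let ?F = "mdeg ` keys f"
  let ?op = "\<lambda>(a, b, c) (a', b', c'). (a * a', b * b', c * (c' :: complex))"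
  have "\<forall>u\<in>?F. pev q (hcomp u f) = 0"
  proof (rule characters_independent[where S = torus and op = "\<lambda>s t. (fst s * fst t, fst (snd s) * fst (snd t), snd (snd s) * snd (snd t))"
        and e = "(1, 1, 1)" and \<chi> = chi])
    fix s assume s: "s \<in> torus"
    have "0 = pev (\<lambda>v. tw s v * q v) (\<Sum>u\<in>?F. hcomp u f)"
      using assms[OF s] hcomp_decompose[of f] by simp
    then show "(\<Sum>u\<in>?F. pev q (hcomp u f) * chi u s) = 0"
      by (simp add: pev_sum pev_tw_piece[OF hcomp_piece] mult.commute[of "pev q g" for g])
  next
    fix u v assume uv: "u \<in> ?F" "v \<in> ?F" "u \<noteq> v"
    have nn: "0 \<le> u" "0 \<le> v" using uv mdeg_nonneg by auto
    have inj: "(2::complex) ^ k = 2 ^ l \<longleftrightarrow> k = l" for k l :: nat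
    proof
      assume "(2::complex) ^ k = 2 ^ l"
      then have "norm ((2::complex) ^ k) = norm ((2::complex) ^ l)" by simp
      then have "(2::real) ^ k = 2 ^ l" by (simp add: norm_power)
      then show "k = l" by simp
    qed simp
    obtain a b c where u: "u = (a, b, c)" by (cases u)
    obtain a' b' c' where v: "v = (a', b', c')" by (cases v)
    have "chi u (2, 1, 1) \<noteq> chi v (2, 1, 1) \<or> chi u (1, 2, 1) \<noteq> chi v (1, 2, 1) \<or> chi u (1, 1, 2) \<noteq> chi v (1, 1, 2)"
      using uv(3) nn by (auto simp: u v chi_def inj less_eq_prod_def zero_prod_def)
    moreover have "(2, 1, 1) \<in> torus" "(1, 2, 1) \<in> torus" "(1, 1, 2) \<in> torus" by (auto simp: torus_def)
    ultimately show "\<exists>s\<in>torus. chi u s \<noteq> chi v s" by blast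
  qed (auto simp: torus_def chi_def power_mult_distrib)
  moreover have "hcomp u f = 0" if "u \<notin> ?F"
    using that by (intro poly_mapping_eqI) (metis image_eqI in_keys_iff lookup_hcomp lookup_zero)
  ultimately show ?thesis by force
qed

lemma pideal_iff: "f \<in> pideal r p \<longleftrightarrow> (\<forall>i<r. \<forall>u. pev (p i) (hcomp u f) = 0)"
proof
  assume "f \<in> pideal r p"
  then show "\<forall>i<r. \<forall>u. pev (p i) (hcomp u f) = 0" unfolding pideal_def using torus_vanish by blast
next
  assume f: "\<forall>i<r. \<forall>u. pev (p i) (hcomp u f) = 0"
  have "pev (\<lambda>v. tw s v * p i v) (\<Sum>u\<in>mdeg ` keys f. hcomp u f) = 0" if "i < r" for i s
    unfolding pev_sum pev_tw_piece[OF hcomp_piece] using f that by (intro sum.neutral) simp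
  then show "f \<in> pideal r p" using hcomp_decompose[of f] by (simp add: pideal_def)
qed

lemma pideal_piece_iff: "f \<in> piece u \<Longrightarrow> f \<in> pideal r p \<longleftrightarrow> (\<forall>i<r. pev (p i) f = 0)"
  by (auto simp: pideal_iff hcomp_of_piece)

lemma pideal_subspace: "ideal.subspace (pideal r p)"
  by (rule ideal.subspaceI) (auto simp: pideal_def pev_add pev_mult)

lemma pideal_homogeneous: "homogeneous_ideal (pideal r p)"
proof (rule homogeneous_idealI[OF pideal_subspace])
  fix f u assume "f \<in> pideal r p"
  then show "hcomp u f \<in> pideal r p" using pideal_piece_iff[OF hcomp_piece, of u f r p] by (simp add: pideal_iff)
qed

lemma pideal_radical: "radical_ideal (pideal r p)"
  unfolding radical_ideal_def using pideal_subspace by (auto simp: pideal_def pev_power)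

lemma pideal_cong: "(\<And>i. i < r \<Longrightarrow> p i = q i) \<Longrightarrow> pideal r p = pideal r q"
  by (simp add: pideal_def)

text \<open>Lying outside the zero set of the irrelevant ideal, that is, representing a point of
  \<open>X\<close>.\<close>

definition nondeg :: "(('a, 'b, 'c) var \<Rightarrow> complex) \<Rightarrow> bool" where
  "nondeg q \<longleftrightarrow> (\<exists>a. q (Alpha a) \<noteq> 0) \<and> (\<exists>b. q (Beta b) \<noteq> 0) \<and> (\<exists>c. q (Gamma c) \<noteq> 0)"

lemma monomial_exists:
  assumes "0 \<le> u" "nondeg q"
  shows "\<exists>m\<in>Mon u. mon_ev q m \<noteq> 0"
proof -
  obtain a b c where q: "q (Alpha a) \<noteq> 0" "q (Beta b) \<noteq> 0" "q (Gamma c) \<noteq> 0"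
    using assms(2) by (auto simp: nondeg_def)
  obtain i j k where u: "u = (i, j, k)" by (cases u)
  let ?m = "single (Alpha a) (nat i) + single (Beta b) (nat j) + single (Gamma c) (nat k)"
  have "?m \<in> Mon u"
    using assms(1) by (simp add: Mon_def mdeg_add mdeg_single dmul_def u less_eq_prod_def zero_prod_def)
  moreover have "mon_ev q ?m \<noteq> 0" using q by (simp add: mon_ev_add)
  ultimately show ?thesis by blast
qed

lemma Mon_nonempty: "0 \<le> u \<Longrightarrow> Mon u \<noteq> {}"
  using monomial_exists[of u "\<lambda>_. 1"] by (auto simp: nondeg_def)

lemma card_Mon_mono:
  assumes "0 \<le> v" "v \<le> u"
  shows "card (Mon v :: ('a::finite, 'b::finite, 'c::finite) monom set) \<le> card (Mon u :: ('a, 'b, 'c) monom set)"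
proof -
  have "0 \<le> u - v" using assms by (auto simp: less_eq_prod_def zero_prod_def)
  then obtain n :: "('a, 'b, 'c) monom" where n: "mdeg n = u - v" using Mon_nonempty[of "u - v"] by (auto simp: Mon_def)
  show ?thesis
    by (rule card_inj_on_le[OF _ _ finite_Mon, of "\<lambda>m. n + m"]) (auto simp: inj_on_def Mon_def mdeg_add n)
qed

lemma saturatedI:
  assumes "\<And>i. i < r \<Longrightarrow> nondeg (p i)"
  shows "saturated (pideal r p)"
  unfolding saturated_def
proof
  show "pideal r p \<subseteq> ideal_colon (pideal r p) irrelevant_ideal"
    using ideal.subspace_scale[OF pideal_subspace] by (auto simp: ideal_colon_def mult.commute)
  show "ideal_colon (pideal r p) irrelevant_ideal \<subseteq> pideal r p"
    unfolding pideal_def[of r p]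
  proof (intro subsetI CollectI allI impI ballI)
    fix f i s assume f: "f \<in> ideal_colon {f. \<forall>i<r. \<forall>s\<in>torus. pev (\<lambda>v. tw s v * p i v) f = 0} irrelevant_ideal"
      and i: "i < r" and s: "s \<in> torus"
    have "nondeg (\<lambda>v. tw s v * p i v)"
      using assms[OF i] s by (auto simp: nondeg_def torus_def)
    then obtain m where m: "m \<in> Mon (1, 1, 1)" "mon_ev (\<lambda>v. tw s v * p i v) m \<noteq> 0"
      using monomial_exists[of "(1, 1, 1)" "\<lambda>v. tw s v * p i v"] by (auto simp: less_eq_prod_def zero_prod_def)
    have "mono m \<in> irrelevant_ideal"
      unfolding irrelevant_ideal_def by (intro ideal.span_base single_piece m)
    then have "f * mono m \<in> {f. \<forall>i<r. \<forall>s\<in>torus. pev (\<lambda>v. tw s v * p i v) f = 0}"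
      using f by (auto simp: ideal_colon_def)
    then have "pev (\<lambda>v. tw s v * p i v) (f * mono m) = 0" using i s by blast
    then show "pev (\<lambda>v. tw s v * p i v) f = 0" using m(2) by (simp add: pev_mult)
  qed
qed

text \<open>Such a family exists iff the functionals are linearly independent on the forms of degree
  \<open>u\<close>. With evaluations at points (\<open>sep\<close>) it says that forms of this
  degree separate the points.\<close>

definition dual_forms :: "'k set \<Rightarrow> ('k \<Rightarrow> ('a::finite, 'b::finite, 'c::finite) coxC \<Rightarrow> complex) \<Rightarrow> degree \<Rightarrow>
    ('k \<Rightarrow> ('a, 'b, 'c) coxC) \<Rightarrow> bool" where
  "dual_forms K \<phi> u g \<longleftrightarrow> (\<forall>k\<in>K. g k \<in> piece u \<and> (\<forall>k'\<in>K. \<phi> k' (g k) = (if k' = k then 1 else 0)))"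

definition functional :: "(('a, 'b, 'c) coxC \<Rightarrow> complex) \<Rightarrow> bool" where
  "functional \<phi> \<longleftrightarrow> (\<forall>f g. \<phi> (f + g) = \<phi> f + \<phi> g) \<and> (\<forall>c f. \<phi> (const_poly c * f) = c * \<phi> f)"

lemma functional_pev [simp]: "functional (pev q)"
  by (simp add: functional_def pev_add pev_mult)

lemma functional_0: "functional \<phi> \<Longrightarrow> \<phi> 0 = 0"
  unfolding functional_def by (metis add_cancel_right_left add_0)

lemma functional_diff: "functional \<phi> \<Longrightarrow> \<phi> (f - const_poly c * g) = \<phi> f - c * \<phi> g"
proof -
  assume \<phi>: "functional \<phi>"
  have "f - const_poly c * g = f + const_poly (- c) * g" by (simp add: const_poly_uminus)
  then show ?thesis using \<phi> by (simp only: functional_def) simp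
qed

lemma functional_sum: "functional \<phi> \<Longrightarrow> \<phi> (\<Sum>i\<in>A. const_poly (c i) * f i) = (\<Sum>i\<in>A. c i * \<phi> (f i))"
  by (induction A rule: infinite_finite_induct) (auto simp: functional_0, auto simp: functional_def)

lemma dual_forms_extend:
  assumes g: "dual_forms K \<phi> u g" and lin: "\<And>k. k \<in> K \<Longrightarrow> functional (\<phi> k)"
    and f: "f \<in> piece u" "\<And>k. k \<in> K \<Longrightarrow> \<phi> k f = 0" "pev q f \<noteq> 0" and k0: "k0 \<notin> K"
  shows "\<exists>g'. dual_forms (insert k0 K) (\<phi>(k0 := pev q)) u g'"
proof -
  define e where "e = const_poly (inverse (pev q f)) * f"
  have e: "e \<in> piece u" "pev q e = 1" "\<phi> k e = 0" if "k \<in> K" for k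
    using f lin[OF that] that by (auto simp: e_def piece_const pev_mult functional_def)
  have e': "e \<in> piece u" "pev q e = 1" using f by (auto simp: e_def piece_const pev_mult)
  define g' where "g' k = (if k = k0 then e else g k - const_poly (pev q (g k)) * e)" for k
  have "dual_forms (insert k0 K) (\<phi>(k0 := pev q)) u g'"
    unfolding dual_forms_def
  proof (intro ballI conjI)
    fix k assume k: "k \<in> insert k0 K"
    show "g' k \<in> piece u"
      using k g e' by (auto simp: g'_def dual_forms_def intro!: piece_diff piece_const)
    fix k' assume k': "k' \<in> insert k0 K"
    show "(\<phi>(k0 := pev q)) k' (g' k) = (if k' = k then 1 else 0)"
    proof (cases "k = k0")
      case True
      then show ?thesis using k' e e' k0 by (auto simp: g'_def)
    next
      case False
      then have kK: "k \<in> K" using k by simp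
      show ?thesis
      proof (cases "k' = k0")
        case True
        then show ?thesis using False e' by (simp add: g'_def pev_diff pev_mult)
      next
        case k'0: False
        then have "k' \<in> K" using k' by simp
        then show ?thesis
          using False k'0 kK e(3) g functional_diff[OF lin] by (simp add: g'_def dual_forms_def)
      qed
    qed
  qed
  then show ?thesis by blast
qed

text \<open>With fewer functionals than monomials some nonzero form is killed by all of them; a
  point where it does not vanish supplies the next functional.\<close>

lemma dual_forms_greedy:
  fixes \<phi> :: "'k \<Rightarrow> ('a::finite, 'b::finite, 'c::finite) coxC \<Rightarrow> complex"
  assumes K: "finite K" "card K < card (Mon u :: ('a, 'b, 'c) monom set)"
    and g: "dual_forms K \<phi> u g" and lin: "\<And>k. k \<in> K \<Longrightarrow> functional (\<phi> k)" and k0: "k0 \<notin> K"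
  shows "\<exists>q g'. dual_forms (insert k0 K) (\<phi>(k0 := pev q)) u g'"
proof -
  obtain c where c: "\<exists>m\<in>Mon u. c m \<noteq> 0" "\<forall>k\<in>K. (\<Sum>m\<in>Mon u. c m * \<phi> k (mono m)) = 0"
    using homogeneous_system[OF K(1) finite_Mon K(2), of "\<lambda>m k. \<phi> k (mono m)"] by blast
  define f where "f = (\<Sum>m\<in>Mon u. const_poly (c m) * mono m)"
  have fp: "f \<in> piece u" unfolding f_def by (intro piece_sum piece_const single_piece)
  have fk: "\<phi> k f = 0" if "k \<in> K" for k
    unfolding f_def functional_sum[OF lin[OF that]] using c(2) that by blast
  have "lookup f m = c m" if "m \<in> Mon u" for m
    using that by (simp add: f_def lookup_sum lookup_single when_def)
  then have "f \<noteq> 0" using c(1) by force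
  then obtain q where "pev q f \<noteq> 0" using pev_eq_0_imp by blast
  from dual_forms_extend[OF g lin fp fk this k0] show ?thesis by blast
qed

abbreviation sep :: "degree \<Rightarrow> nat set \<Rightarrow> (nat \<Rightarrow> ('a::finite, 'b::finite, 'c::finite) var \<Rightarrow> complex) \<Rightarrow> bool" where
  "sep u X p \<equiv> \<exists>g. dual_forms X (\<lambda>i. pev (p i)) u g"

lemma sep_maximal:
  fixes p :: "nat \<Rightarrow> ('a::finite, 'b::finite, 'c::finite) var \<Rightarrow> complex"
  obtains X where "X \<subseteq> {..<r}" "sep u X p" "\<And>f. f \<in> piece u \<Longrightarrow> (\<forall>i\<in>X. pev (p i) f = 0) \<Longrightarrow> \<forall>i<r. pev (p i) f = 0"
proof -
  define V where "V = {(\<lambda>i. pev (p i) f) |f. f \<in> piece u}"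
  have V: "lin_closed V"
    unfolding lin_closed_def V_def
  proof (safe)
    show "\<exists>f. (\<lambda>_. 0) = (\<lambda>i. pev (p i) f) \<and> f \<in> piece u" by (intro exI[of _ 0]) simp
    show "\<exists>k. (\<lambda>a. pev (p a) f + pev (p a) g) = (\<lambda>i. pev (p i) k) \<and> k \<in> piece u"
      if "f \<in> piece u" "g \<in> piece u" for f g
      using that by (intro exI[of _ "f + g"]) (simp add: pev_add piece_add)
    show "\<exists>k. (\<lambda>a. c * pev (p a) f) = (\<lambda>i. pev (p i) k) \<and> k \<in> piece u"
      if "f \<in> piece u" for f c
      using that by (intro exI[of _ "const_poly c * f"]) (simp add: pev_mult piece_const)
  qed
  obtain X w where X: "X \<subseteq> {..<r}" "dual_family V X w"
    "\<And>v. v \<in> V \<Longrightarrow> (\<And>e. e \<in> X \<Longrightarrow> v e = 0) \<Longrightarrow> (\<forall>a\<in>{..<r}. v a = 0)"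
    using maximal_dual_family[OF V, of "{..<r}"] by blast
  have "\<forall>e\<in>X. \<exists>f. f \<in> piece u \<and> w e = (\<lambda>i. pev (p i) f)"
    using X(2) unfolding dual_family_def V_def by blast
  from bchoice[OF this] obtain g where g: "\<forall>e\<in>X. g e \<in> piece u \<and> w e = (\<lambda>i. pev (p i) (g e))" ..
  have "dual_forms X (\<lambda>i. pev (p i)) u g"
    unfolding dual_forms_def
  proof (intro ballI conjI)
    fix e assume e: "e \<in> X"
    then show "g e \<in> piece u" using g by blast
    fix e' assume "e' \<in> X"
    then have "w e e' = (if e' = e then 1 else 0)" using X(2) e unfolding dual_family_def by blast
    moreover have "w e e' = pev (p e') (g e)" using g e by simp
    ultimately show "pev (p e') (g e) = (if e' = e then 1 else 0)" by simp
  qed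
  moreover have "\<forall>i<r. pev (p i) f = 0" if "f \<in> piece u" "\<forall>i\<in>X. pev (p i) f = 0" for f
    using X(3)[of "\<lambda>i. pev (p i) f"] that unfolding V_def by blast
  ultimately show thesis using that X(1) by blast
qed

lemma dual_forms_indep:
  assumes "finite X" "dual_forms X \<phi> u g" "\<And>k. k \<in> X \<Longrightarrow> functional (\<phi> k)" "\<And>f k. f \<in> I \<Longrightarrow> f \<in> piece u \<Longrightarrow> k \<in> X \<Longrightarrow> \<phi> k f = 0"
  shows "indep_mod X g I"
  unfolding indep_mod_def
proof (intro allI impI ballI)
  fix c k assume c: "(\<Sum>b\<in>X. const_poly (c b) * g b) \<in> I" and k: "k \<in> X"
  have "(\<Sum>b\<in>X. const_poly (c b) * g b) \<in> piece u"
    using assms(2) by (intro piece_sum piece_const) (auto simp: dual_forms_def)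
  then have "0 = \<phi> k (\<Sum>b\<in>X. const_poly (c b) * g b)" using assms(4)[OF c _ k] by simp
  also have "\<dots> = (\<Sum>b\<in>X. c b * \<phi> k (g b))" by (rule functional_sum[OF assms(3)[OF k]])
  also have "\<dots> = (\<Sum>b\<in>X. if b = k then c b else 0)"
    using assms(2) k by (intro sum.cong refl) (auto simp: dual_forms_def)
  finally show "c k = 0" using k assms(1) by simp
qed

lemma sep_hf_ge:
  assumes "X \<subseteq> {..<r}" "sep u X p"
  shows "enat (card X) \<le> hilbert_function (pideal r p) u"
proof -
  have fX: "finite X" using assms(1) finite_subset by blast
  obtain g where g: "dual_forms X (\<lambda>i. pev (p i)) u g" using assms(2) by blast
  show ?thesis
  proof (rule hilbert_function_ge[OF fX])
    show "g b \<in> piece u" if "b \<in> X" for b using g that by (simp add: dual_forms_def)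
    show "indep_mod X g (pideal r p)"
    proof (rule dual_forms_indep[OF fX g])
      show "pev (p k) f = 0" if "f \<in> pideal r p" "f \<in> piece u" "k \<in> X" for f k
        using pideal_piece_iff[OF that(2)] that(1,3) assms(1) by auto
    qed simp
  qed
qed

text \<open>The Hilbert function is the rank of the evaluation map: a maximal separated subset
  \<open>X\<close> of the points decides vanishing at all of them, and its dual forms are a basis of
  the quotient.\<close>

lemma pideal_hf:
  fixes p :: "nat \<Rightarrow> ('a::finite, 'b::finite, 'c::finite) var \<Rightarrow> complex"
  obtains X where "X \<subseteq> {..<r}" "sep u X p" "hilbert_function (pideal r p) u = enat (card X)"
proof -
  obtain X where X: "X \<subseteq> {..<r}" "sep u X p" and
    max: "\<And>f. f \<in> piece u \<Longrightarrow> (\<forall>i\<in>X. pev (p i) f = 0) \<Longrightarrow> \<forall>i<r. pev (p i) f = 0"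
    using sep_maximal[where r = r and u = u and p = p] by blast
  have fX: "finite X" using X(1) finite_subset by blast
  obtain g where g: "dual_forms X (\<lambda>i. pev (p i)) u g" using X(2) by blast
  have "spans_mod X g (pideal r p) u"
    unfolding spans_mod_def
  proof
    fix f :: "('a, 'b, 'c) coxC" assume f: "f \<in> piece u"
    let ?f = "f - (\<Sum>i\<in>X. const_poly (pev (p i) f) * g i)"
    have fp: "?f \<in> piece u" using f g by (intro piece_diff piece_sum piece_const) (auto simp: dual_forms_def)
    have "pev (p j) ?f = 0" if j: "j \<in> X" for j
    proof -
      have "pev (p j) (\<Sum>i\<in>X. const_poly (pev (p i) f) * g i) = (\<Sum>i\<in>X. if i = j then pev (p i) f else 0)"
        unfolding pev_sum using g j by (intro sum.cong refl) (auto simp: pev_mult dual_forms_def)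
      then show ?thesis using j fX by (simp add: pev_diff)
    qed
    then have "?f \<in> pideal r p" using max[OF fp] pideal_piece_iff[OF fp] by blast
    then show "\<exists>c. f - (\<Sum>b\<in>X. const_poly (c b) * g b) \<in> pideal r p"
      by (rule exI[where x = "\<lambda>i. pev (p i) f"])
  qed
  from hilbert_function_le[OF fX this pideal_subspace] sep_hf_ge[OF X]
  have "hilbert_function (pideal r p) u = enat (card X)" by simp
  then show thesis using that X by blast
qed

lemma pideal_hf_le:
  fixes p :: "nat \<Rightarrow> ('a::finite, 'b::finite, 'c::finite) var \<Rightarrow> complex"
  shows "hilbert_function (pideal r p) u \<le> enat (generic_hf TYPE(('a, 'b, 'c) var) r u)"
proof -
  obtain X where X: "X \<subseteq> {..<r}" "hilbert_function (pideal r p) u = enat (card X)"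
    using pideal_hf[where r = r and u = u and p = p] by blast
  have "card X \<le> r" using card_mono[OF _ X(1)] by simp
  moreover have "hilbert_function (pideal r p) u \<le> enat (card (Mon u :: ('a, 'b, 'c) monom set))"
    unfolding hilbert_function_standard[OF pideal_subspace] by (simp add: card_mono)
  ultimately show ?thesis using X(2) by (simp add: generic_hf_eq)
qed

lemma hf_full_zero:
  fixes I :: "('a::finite, 'b::finite, 'c::finite) coxC set"
  assumes I: "ideal.subspace I" and hf: "hilbert_function I u = enat (card (Mon u :: ('a, 'b, 'c) monom set))"
    and f: "f \<in> I" "f \<in> piece u"
  shows "f = 0"
proof -
  have "spans_mod (Mon u) mono I u"
  proof (rule spans_mod_monoI[OF I])
    fix m :: "('a, 'b, 'c) monom" assume m: "m \<in> Mon u"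
    have "(\<Sum>b\<in>Mon u. const_poly (if b = m then 1 else 0) * mono b) = (mono m :: ('a, 'b, 'c) coxC)"
      using m by (subst sum.remove[of _ m]) auto
    then show "\<exists>c. mono m - (\<Sum>b\<in>Mon u. const_poly (c b) * mono b) \<in> I"
      using I by (intro exI[of _ "\<lambda>b. if b = m then 1 else 0"]) (simp add: ideal.subspace_0)
  qed
  from spans_mod_card[OF _ this I _ hf] have ind: "indep_mod (Mon u) mono I" by (auto intro: single_piece)
  have "(\<Sum>b\<in>Mon u. const_poly (lookup f b) * mono b) = f" using piece_expand[OF f(2)] by simp
  then have "\<forall>b\<in>Mon u. lookup f b = 0" using ind[unfolded indep_mod_def, THEN spec, of "lookup f"] f(1) by simp
  then show ?thesis using f(2) by (metis in_keys_iff piece_iff poly_mapping_eqI lookup_zero subsetD)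
qed

text \<open>Each dual form is multiplied by a monomial that does not vanish at its own point; at the
  other points the product vanishes anyway.\<close>

lemma sep_multiply:
  assumes X: "sep u X p" and u: "u \<le> v" and nd: "\<And>i. i \<in> X \<Longrightarrow> nondeg (p i)"
  shows "sep v X p"
proof -
  obtain g where g: "dual_forms X (\<lambda>i. pev (p i)) u g" using X by blast
  have "0 \<le> v - u" using u by (auto simp: less_eq_prod_def zero_prod_def)
  then have "\<forall>i\<in>X. \<exists>m. m \<in> Mon (v - u) \<and> mon_ev (p i) m \<noteq> 0" using monomial_exists nd by blast
  from bchoice[OF this] obtain m where m: "\<forall>i\<in>X. m i \<in> Mon (v - u) \<and> mon_ev (p i) (m i) \<noteq> 0" ..
  define g' where "g' i = single (m i) (inverse (mon_ev (p i) (m i))) * g i" for i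
  have "g' i \<in> piece v" if "i \<in> X" for i
    using piece_mult[OF single_piece, of "m i" "v - u" "g i" u] g m that by (simp add: g'_def dual_forms_def)
  then have "dual_forms X (\<lambda>i. pev (p i)) v g'"
    using g m by (auto simp: dual_forms_def g'_def pev_mult)
  then show ?thesis by blast
qed

text \<open>Separation is inherited by larger degrees, so it reaches from the box to all degrees.
  This is what makes general position a condition in finitely many degrees.\<close>

lemma pideal_in_hilbI:
  fixes p :: "nat \<Rightarrow> ('a::finite, 'b::finite, 'c::finite) var \<Rightarrow> complex"
  assumes h: "h = generic_hf TYPE(('a, 'b, 'c) var) r"
    and N: "N = (CARD('a) + CARD('b) + CARD('c)) * (r + 1)"
    and nd: "\<And>i. i < r \<Longrightarrow> nondeg (p i)"
    and sep: "\<And>u. u \<in> box N \<Longrightarrow> \<exists>X\<subseteq>{..<r}. card X = h u \<and> sep u X p"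
  shows "pideal r p \<in> hilb h"
proof -
  have "hilbert_function (pideal r p) u = enat (h u)" for u
  proof (cases "0 \<le> u")
    case False
    then show ?thesis
      unfolding hilbert_function_standard[OF pideal_subspace] by (simp add: Mon_neg h generic_hf_eq)
  next
    case True
    let ?u = "trunc N u"
    obtain X where X: "X \<subseteq> {..<r}" "card X = h ?u" "sep ?u X p" using sep[OF trunc_box[OF True]] by blast
    have "?u \<le> u" by (auto simp: trunc_def less_eq_prod_def split: prod.splits)
    then have "sep u X p" using nd X(1) by (intro sep_multiply[OF X(3)]) auto
    from sep_hf_ge[OF X(1) this] have 1: "enat (h ?u) \<le> hilbert_function (pideal r p) u" by (simp add: X(2))
    \<comment> \<open>Either \<open>r\<close> is attained in the truncated degree, or that degree
      has at most \<open>r\<close> monomials and \<open>order_ideal_bound\<close>, applied to the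
      set of all monomials, shows that degree \<open>u\<close> has no more.\<close>
    have "h u \<le> h ?u"
    proof (cases "card (Mon ?u :: ('a, 'b, 'c) monom set) \<le> r")
      case False
      then show ?thesis by (simp add: h generic_hf_eq)
    next
      case le: True
      have "card ((UNIV :: ('a, 'b, 'c) monom set) \<inter> Mon u) \<le> card ((UNIV :: ('a, 'b, 'c) monom set) \<inter> Mon ?u)"
      proof (rule order_ideal_bound[OF _ N True])
        fix v assume v: "0 \<le> v" "v \<le> ?u"
        show "card ((UNIV :: ('a, 'b, 'c) monom set) \<inter> Mon v) \<le> r"
          using card_Mon_mono[OF v, where ?'a = 'a and ?'b = 'b and ?'c = 'c] le by simp
      qed simp
      then show ?thesis by (simp add: h generic_hf_eq min.coboundedI2)
    qed
    then show ?thesis using 1 pideal_hf_le[of r p u, folded h] by (metis antisym enat_ord_simps(1) order_trans)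
  qed
  then show ?thesis using pideal_homogeneous by (auto simp: hilb_def)
qed

lemma sep_of_hilb:
  fixes p :: "nat \<Rightarrow> ('a::finite, 'b::finite, 'c::finite) var \<Rightarrow> complex"
  assumes "pideal r p \<in> hilb h"
  obtains X where "X \<subseteq> {..<r}" "card X = h u" "sep u X p"
  using pideal_hf[where r = r and u = u and p = p] hilb_hf[OF assms, of u] by (metis enat.inject)

text \<open>Among the zeros of \<open>I\<close> in \<open>X\<close>, a largest set that some degree
  separates is chosen; the Hilbert function bounds its size by \<open>r\<close>. Its ideal is
  \<open>I\<close>, because a form outside \<open>I\<close> that vanishes on it would allow one more
  point to be separated.\<close>

lemma reduced_points:
  fixes I :: "('a::finite, 'b::finite, 'c::finite) coxC set"
  assumes I: "I \<in> hilb (generic_hf TYPE(('a, 'b, 'c) var) r)" and r: "r > 0"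
    and rad: "radical_ideal I" and sat: "saturated I"
  shows "\<exists>p. (\<forall>i<r. nondeg (p i)) \<and> pideal r p = I"
proof -
  have sub: "ideal.subspace I" using I by (rule hilb_subspace)
  define V where "V = {q. nondeg q \<and> (\<forall>g\<in>I. pev q g = 0)}"
  have cnt: "countable (UNIV :: ('a, 'b, 'c) var set)" by (simp add: countable_finite)
  \<comment> \<open>Saturation gives \<open>b\<close> in the irrelevant ideal with
    \<open>f * b\<close> outside \<open>I\<close>, and radicality keeps its powers outside. The zero
    from the Nullstellensatz is nondegenerate because \<open>b\<close> does not vanish
    there.\<close>
  have A: "\<exists>q\<in>V. pev q f \<noteq> 0" if f: "f \<notin> I" for f
  proof -
    have "f \<notin> ideal_colon I irrelevant_ideal" using f sat by (simp add: saturated_def)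
    then obtain b where b: "b \<in> irrelevant_ideal" "f * b \<notin> I" by (auto simp: ideal_colon_def)
    have "(f * b) ^ n \<notin> I" for n using rad b(2) unfolding radical_ideal_def by blast
    from nullstellensatz[OF cnt sub this] obtain q where q: "\<forall>g\<in>I. pev q g = 0" "pev q (f * b) \<noteq> 0" by blast
    have "nondeg q"
    proof (rule ccontr)
      assume nd: "\<not> nondeg q"
      have "mon_ev q m = 0" if m: "m \<in> Mon (1, 1, 1)" for m
      proof -
        have "(\<Sum>i\<in>UNIV. int (lookup m (Alpha i))) = 1" "(\<Sum>i\<in>UNIV. int (lookup m (Beta i))) = 1"
          "(\<Sum>i\<in>UNIV. int (lookup m (Gamma i))) = 1" using m by (auto simp: Mon_def mdeg_def)
        then obtain a b c where "lookup m (Alpha a) \<noteq> 0" "lookup m (Beta b) \<noteq> 0" "lookup m (Gamma c) \<noteq> 0"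
          by (metis (mono_tags, lifting) of_nat_0 sum.neutral zero_neq_one)
        moreover have "q (Alpha a) = 0 \<or> q (Beta b) = 0 \<or> q (Gamma c) = 0" using nd by (auto simp: nondeg_def)
        ultimately show ?thesis unfolding mon_ev_UNIV by (intro prod_zero) auto
      qed
      then have "pev q g = 0" if "g \<in> piece (1, 1, 1)" for g
        using that unfolding pev_def by (intro sum.neutral) (auto simp: piece_iff)
      then have "irrelevant_ideal \<subseteq> {g. pev q g = 0}"
        unfolding irrelevant_ideal_def
        by (intro ideal.span_minimal ideal.subspaceI) (auto simp: pev_add pev_mult)
      then show False using b(1) q(2) by (auto simp: pev_mult)
    qed
    then show ?thesis using q by (auto simp: V_def pev_mult)
  qed
  define P where "P k \<longleftrightarrow> (\<exists>q u. (\<forall>i<k. q i \<in> V) \<and> 0 \<le> u \<and> sep u {..<k} q)" for k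
  have "dual_forms {} (\<lambda>i. pev (q i)) 0 (\<lambda>_. 0)" for q :: "nat \<Rightarrow> ('a, 'b, 'c) var \<Rightarrow> complex"
    by (simp add: dual_forms_def)
  then have P0: "P 0" unfolding P_def by auto
  have Pr: "k \<le> r" if Pk: "P k" for k
  proof -
    obtain q u g where q: "\<forall>i<k. q i \<in> V" and g: "dual_forms {..<k} (\<lambda>i. pev (q i)) u g"
      using Pk unfolding P_def by blast
    have "indep_mod {..<k} g I" by (rule dual_forms_indep[OF _ g]) (use q in \<open>auto simp: V_def\<close>)
    from hilbert_function_ge[OF _ _ this, of u] have "enat k \<le> hilbert_function I u"
      using g by (auto simp: dual_forms_def)
    then show ?thesis using hilb_hf[OF I, of u] by (simp add: generic_hf_eq)
  qed
  obtain k where k: "P k" "\<And>l. P l \<Longrightarrow> l \<le> k"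
    using ex_has_greatest_nat[of P 0 "\<lambda>k. k" "Suc r"] P0 Pr by (metis le_imp_less_Suc)
  obtain q u g where q: "\<And>i. i < k \<Longrightarrow> q i \<in> V" and u: "0 \<le> u" and g: "dual_forms {..<k} (\<lambda>i. pev (q i)) u g"
    using k(1) unfolding P_def by blast
  have Iq: "pideal k q = I"
  proof
    show "I \<subseteq> pideal k q"
    proof
      fix f assume "f \<in> I"
      then have "hcomp u f \<in> I" for u by (rule homogeneous_ideal_hcomp[OF hilb_homogeneous[OF I]])
      then show "f \<in> pideal k q" using q by (auto simp: pideal_iff V_def)
    qed
    show "pideal k q \<subseteq> I"
    proof (rule homogeneous_ideal_subsetI[OF pideal_homogeneous sub], rule ccontr)
      fix v f assume f: "f \<in> pideal k q" "f \<in> piece v" and fI: "f \<notin> I"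
      obtain q' where q': "q' \<in> V" "pev q' f \<noteq> 0" using A[OF fI] by blast
      have "f \<noteq> 0" using q'(2) by auto
      then have v: "0 \<le> v" using f(2) mdeg_nonneg unfolding piece_def
        by (metis (mono_tags, lifting) ex_in_conv keys_eq_empty mem_Collect_eq)
      \<comment> \<open>Multiplication by a monomial of degree \<open>u\<close> that does not vanish
        at \<open>q'\<close> brings \<open>f\<close> into degree \<open>u + v\<close>, where the old
        points are still separated.\<close>
      obtain n where n: "n \<in> Mon u" "mon_ev q' n \<noteq> 0" using monomial_exists[OF u] q'(1) by (auto simp: V_def)
      have uv: "u \<le> u + v" using v by (auto simp: less_eq_prod_def zero_prod_def)
      have "sep (u + v) {..<k} q"
        using g q by (intro sep_multiply[OF _ uv]) (auto simp: V_def)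
      then obtain g' where g': "dual_forms {..<k} (\<lambda>i. pev (q i)) (u + v) g'" by blast
      have "\<exists>g''. dual_forms (insert k {..<k}) ((\<lambda>i. pev (q i))(k := pev q')) (u + v) g''"
      proof (rule dual_forms_extend[OF g'])
        show "mono n * f \<in> piece (u + v)" by (rule piece_mult[OF single_piece[OF n(1)] f(2)])
        show "pev (q i) (mono n * f) = 0" if "i \<in> {..<k}" for i
          using that f(1) pideal_piece_iff[OF f(2)] by (auto simp: pev_mult)
        show "pev q' (mono n * f) \<noteq> 0" using n q' by (simp add: pev_mult)
      qed auto
      moreover have "(\<lambda>i. pev (q i))(k := pev q') = (\<lambda>i. pev ((q(k := q')) i))" by auto
      ultimately have "P (Suc k)"
        unfolding P_def using q q'(1) u v
        by (intro exI[of _ "q(k := q')"] exI[of _ "u + v"])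
          (auto simp: lessThan_Suc less_Suc_eq less_eq_prod_def zero_prod_def)
      from k(2)[OF this] show False by simp
    qed
  qed
  have kr: "k \<le> r" using Pr[OF k(1)] .
  have k0: "k > 0"
  proof (rule ccontr)
    assume "\<not> k > 0"
    then have "I = UNIV" using Iq by (simp add: pideal_def)
    then have "hilbert_function I 0 \<le> enat (card ({} :: nat set))"
      by (intro hilbert_function_le) (auto simp: spans_mod_def)
    moreover have "card (Mon 0 :: ('a, 'b, 'c) monom set) > 0" using Mon_nonempty[of 0] by (simp add: card_gt_0_iff)
    ultimately show False using hilb_hf[OF I, of 0] r by (simp add: generic_hf_eq zero_enat_def)
  qed
  \<comment> \<open>A shortfall \<open>k < r\<close> is filled by repeating the first point, which
    leaves the ideal unchanged.\<close>
  define p where "p i = q (if i < k then i else 0)" for i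
  have "pideal r p = pideal k q"
    using kr k0 by (auto simp: pideal_def p_def)
  moreover have "nondeg (p i)" for i using q[of i] q[of 0] k0 by (auto simp: p_def V_def)
  ultimately show ?thesis using Iq by blast
qed

section \<open>The family of point configurations\<close>

text \<open>The \<open>\<Phi> k\<close> are functionals with values in the base ring that specialize
  to the \<open>\<phi> x k\<close>; both evaluations at points and derivatives are instances. Dual
  forms at one point extend, up to the denominator \<open>f\<close>, to dual forms with polynomial
  coefficients.\<close>

lemma open_dual_forms:
  fixes \<Phi> :: "'k \<Rightarrow> ('a::finite, 'b::finite, 'c::finite, base_poly) cox \<Rightarrow> base_poly"
    and \<phi> :: "(nat \<Rightarrow> complex) \<Rightarrow> 'k \<Rightarrow> ('a, 'b, 'c) coxC \<Rightarrow> complex"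
  assumes K: "finite K"
    and add: "\<And>k F G. \<Phi> k (F + G) = \<Phi> k F + \<Phi> k G" and scale: "\<And>k c F. \<Phi> k (const_poly c * F) = c * \<Phi> k F"
    and sp: "\<And>x k F. pev x (\<Phi> k F) = \<phi> x k (spec x F)"
    and g: "dual_forms K (\<phi> x1) u g"
  shows "\<exists>f G. pev x1 f \<noteq> 0 \<and> (\<forall>k\<in>K. G k \<in> piece u \<and> (\<forall>k'\<in>K. \<Phi> k' (G k) = (if k' = k then f else 0)))"
proof -
  define M where "M = {w. \<exists>F\<in>piece u. \<forall>k\<in>K. w k = \<Phi> k F}"
  have M: "lin_closed M"
    unfolding lin_closed_def M_def
  proof (safe)
    have "\<Phi> k 0 = 0" for k using scale[of k 0 0] by simp
    then show "\<exists>F\<in>piece u. \<forall>k\<in>K. 0 = \<Phi> k F" by (intro bexI[of _ 0]) auto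
    show "\<exists>F''\<in>piece u. \<forall>k\<in>K. w k + w' k = \<Phi> k F''"
      if "F \<in> piece u" "\<forall>k\<in>K. w k = \<Phi> k F" "F' \<in> piece u" "\<forall>k\<in>K. w' k = \<Phi> k F'" for w w' F F'
      using that by (intro bexI[of _ "F + F'"]) (auto simp: add piece_add)
    show "\<exists>F'\<in>piece u. \<forall>k\<in>K. c * w k = \<Phi> k F'"
      if "F \<in> piece u" "\<forall>k\<in>K. w k = \<Phi> k F" for w c F
      using that by (intro bexI[of _ "const_poly c * F"]) (auto simp: scale piece_const)
  qed
  have "\<exists>w\<in>M. \<forall>k\<in>K. pev x1 (w k) = (if k = a then 1 else 0)" if a: "a \<in> K" for a
  proof (rule bexI[of _ "\<lambda>k. \<Phi> k (lift_const (g a))"])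
    show "(\<lambda>k. \<Phi> k (lift_const (g a))) \<in> M"
      unfolding M_def
    proof (intro CollectI bexI[of _ "lift_const (g a)"] ballI refl)
      show "lift_const (g a) \<in> piece u"
        using g a keys_lift_const[of "g a"] by (auto simp: dual_forms_def piece_iff)
    qed
    show "\<forall>k\<in>K. pev x1 (\<Phi> k (lift_const (g a))) = (if k = a then 1 else 0)"
      using g a by (auto simp: sp dual_forms_def)
  qed
  from nakayama[OF K M this] obtain f where f: "pev x1 f \<noteq> 0"
    and w: "\<forall>a\<in>K. \<exists>w\<in>M. \<forall>k\<in>K. w k = (if k = a then f else 0)" by blast
  have "\<forall>a\<in>K. \<exists>G. G \<in> piece u \<and> (\<forall>k'\<in>K. \<Phi> k' G = (if k' = a then f else 0))"
  proof
    fix a assume "a \<in> K"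
    then obtain w where "w \<in> M" and w': "\<forall>k\<in>K. w k = (if k = a then f else 0)" using w by blast
    then obtain F where "F \<in> piece u" "\<forall>k\<in>K. w k = \<Phi> k F" unfolding M_def by blast
    then show "\<exists>G. G \<in> piece u \<and> (\<forall>k'\<in>K. \<Phi> k' G = (if k' = a then f else 0))"
      using w' by (intro exI[of _ F]) metis
  qed
  from bchoice[OF this] f show ?thesis by blast
qed

lemma dual_forms_specialize:
  fixes \<phi> :: "(nat \<Rightarrow> complex) \<Rightarrow> 'k \<Rightarrow> ('a::finite, 'b::finite, 'c::finite) coxC \<Rightarrow> complex"
  assumes sp: "\<And>x k F. pev x (\<Phi> k F) = \<phi> x k (spec x F)" and lin: "\<And>k. functional (\<phi> x k)"
    and G: "\<forall>k\<in>K. G k \<in> piece u \<and> (\<forall>k'\<in>K. \<Phi> k' (G k) = (if k' = k then f else 0))"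
    and f: "pev x f \<noteq> 0"
  shows "dual_forms K (\<phi> x) u (\<lambda>k. const_poly (inverse (pev x f)) * spec x (G k))"
  unfolding dual_forms_def
proof (intro ballI conjI)
  fix k assume k: "k \<in> K"
  then have "spec x (G k) \<in> piece u" using G keys_spec[of x "G k"] by (auto simp: piece_iff)
  then show "const_poly (inverse (pev x f)) * spec x (G k) \<in> piece u" by (rule piece_const)
  fix k' assume k': "k' \<in> K"
  have "\<phi> x k' (const_poly (inverse (pev x f)) * spec x (G k)) = inverse (pev x f) * pev x (\<Phi> k' (G k))"
    using lin[of k'] by (simp add: functional_def sp)
  also have "\<dots> = (if k' = k then 1 else 0)" using G k k' f by auto
  finally show "\<phi> x k' (const_poly (inverse (pev x f)) * spec x (G k)) = (if k' = k then 1 else 0)" .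
qed

text \<open>A configuration is stored as one sequence, via \<open>enc\<close>. The indices
  \<open>a0\<close>, \<open>b0\<close>, \<open>c0\<close> select the coordinates that are set to 1
  on the affine chart of \<open>X\<close>.\<close>

locale config =
  fixes r :: nat and h :: "degree \<Rightarrow> nat" and enc :: "nat \<times> ('a::finite, 'b::finite, 'c::finite) var \<Rightarrow> nat"
    and a0 :: 'a and b0 :: 'b and c0 :: 'c
  assumes r_pos: "r > 0" and h: "h = generic_hf TYPE(('a, 'b, 'c) var) r"
    and enc_inj: "inj_on enc ({..<r} \<times> UNIV)"
begin

definition cfg :: "(nat \<Rightarrow> complex) \<Rightarrow> nat \<Rightarrow> ('a, 'b, 'c) var \<Rightarrow> complex" where
  "cfg x i v = x (enc (i, v))"

text \<open>The universal configuration: the \<open>i\<close>-th point with the coordinate functions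
  themselves as coordinates.\<close>

definition cfgP :: "nat \<Rightarrow> ('a, 'b, 'c) var \<Rightarrow> base_poly" where
  "cfgP i v = base_var (enc (i, v))"

abbreviation "\<I> x \<equiv> pideal r (cfg x)"

definition E where "E = enc ` ({..<r} \<times> UNIV)"

definition supp where "supp = {x :: nat \<Rightarrow> complex. \<forall>i. i \<notin> E \<longrightarrow> x i = 0}"

definition good where "good x \<longleftrightarrow> (\<forall>i<r. nondeg (cfg x i)) \<and> \<I> x \<in> hilb h"

definition mk :: "(nat \<Rightarrow> ('a, 'b, 'c) var \<Rightarrow> complex) \<Rightarrow> nat \<Rightarrow> complex" where
  "mk p j = (if j \<in> E then case inv_into ({..<r} \<times> UNIV) enc j of (i, v) \<Rightarrow> p i v else 0)"

lemma finite_E [simp]: "finite E" by (simp add: E_def)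

lemma mk_enc: "i < r \<Longrightarrow> mk p (enc (i, v)) = p i v"
  by (simp add: mk_def E_def inv_into_f_f[OF enc_inj])

lemma cfg_mk: "i < r \<Longrightarrow> cfg (mk p) i = p i"
  by (simp add: cfg_def mk_enc fun_eq_iff)

lemma mk_supp: "mk p \<in> supp"
  by (simp add: supp_def mk_def)

lemma h_le: "h u \<le> r" by (simp add: h generic_hf_eq)

lemma pev_cfgP: "pev x (pev (cfgP i) F) = pev (cfg x i) (spec x F)"
proof -
  have "pev (cfg x i) (spec x F) = (\<Sum>m\<in>keys F. lookup (spec x F) m * mon_ev (cfg x i) m)"
    by (rule pev_superset[OF finite_keys keys_spec])
  then show ?thesis
    by (simp add: pev_def[of "cfgP i"] pev_sum pev_mult pev_mon_ev) (simp add: cfgP_def cfg_def[abs_def])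
qed

lemma cfgP_linear: "pev (cfgP k) (F + G) = pev (cfgP k) F + pev (cfgP k) G"
  "pev (cfgP k) (const_poly c * F) = c * pev (cfgP k) F"
  by (simp_all add: pev_add pev_mult)

lemma open_sep:
  assumes X: "X \<subseteq> {..<r}" and sep: "sep u X (cfg x1)"
  shows "\<exists>f. pev x1 f \<noteq> 0 \<and> (\<forall>x. pev x f \<noteq> 0 \<longrightarrow> sep u X (cfg x)) \<and> (\<exists>G. \<forall>k\<in>X. G k \<in> piece u \<and>
    (\<forall>k'\<in>X. pev (cfgP k') (G k) = (if k' = k then f else 0)))"
proof -
  have fX: "finite X" using X finite_subset by blast
  obtain g where g: "dual_forms X (\<lambda>i. pev (cfg x1 i)) u g" using sep by blast
  obtain f G where fG: "pev x1 f \<noteq> 0"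
    "\<forall>k\<in>X. G k \<in> piece u \<and> (\<forall>k'\<in>X. pev (cfgP k') (G k) = (if k' = k then f else 0))"
    using open_dual_forms[OF fX, where \<Phi> = "\<lambda>i. pev (cfgP i)" and \<phi> = "\<lambda>x i. pev (cfg x i)", OF cfgP_linear pev_cfgP g]
    by blast
  have "sep u X (cfg x)" if "pev x f \<noteq> 0" for x
    using dual_forms_specialize[where \<Phi> = "\<lambda>i. pev (cfgP i)" and \<phi> = "\<lambda>x i. pev (cfg x i)", OF pev_cfgP _ fG(2) that]
    by auto
  then have "\<forall>x. pev x f \<noteq> 0 \<longrightarrow> sep u X (cfg x)" by blast
  with fG show ?thesis by (intro exI[of _ f] conjI exI[of _ G])
qed

lemma good_open:
  assumes "good x1"
  shows "\<exists>\<Delta>. pev x1 \<Delta> \<noteq> 0 \<and> (\<forall>x. pev x \<Delta> \<noteq> 0 \<longrightarrow> good x)"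
proof -
  define N where "N = (CARD('a) + CARD('b) + CARD('c)) * (r + 1)"
  have "\<forall>u\<in>box N. \<exists>f. pev x1 f \<noteq> 0 \<and> (\<forall>x. pev x f \<noteq> 0 \<longrightarrow> (\<exists>X\<subseteq>{..<r}. card X = h u \<and> sep u X (cfg x)))"
  proof
    fix u
    obtain X where X: "X \<subseteq> {..<r}" "card X = h u" "sep u X (cfg x1)"
      using sep_of_hilb[of r "cfg x1" h u] assms unfolding good_def by blast
    from open_sep[OF X(1,3)] obtain f where f: "pev x1 f \<noteq> 0"
      and fs: "\<forall>x. pev x f \<noteq> 0 \<longrightarrow> sep u X (cfg x)" by (elim exE conjE) (rule that)
    have "\<exists>X\<subseteq>{..<r}. card X = h u \<and> sep u X (cfg x)" if "pev x f \<noteq> 0" for x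
      using X(1,2) fs[rule_format, OF that] by (intro exI[of _ X] conjI)
    with f show "\<exists>f. pev x1 f \<noteq> 0 \<and> (\<forall>x. pev x f \<noteq> 0 \<longrightarrow> (\<exists>X\<subseteq>{..<r}. card X = h u \<and> sep u X (cfg x)))"
      by (intro exI[of _ f]) simp
  qed
  from bchoice[OF this] obtain f where f: "\<forall>u\<in>box N. pev x1 (f u) \<noteq> 0 \<and>
    (\<forall>x. pev x (f u) \<noteq> 0 \<longrightarrow> (\<exists>X\<subseteq>{..<r}. card X = h u \<and> sep u X (cfg x)))" ..
  have "\<forall>i\<in>{..<r}. \<exists>g. pev x1 g \<noteq> 0 \<and> (\<forall>x. pev x g \<noteq> 0 \<longrightarrow> nondeg (cfg x i))"
  proof
    fix i assume "i \<in> {..<r}"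
    then obtain a b c where abc: "cfg x1 i (Alpha a) \<noteq> 0" "cfg x1 i (Beta b) \<noteq> 0" "cfg x1 i (Gamma c) \<noteq> 0"
      using assms by (auto simp: good_def nondeg_def)
    show "\<exists>g. pev x1 g \<noteq> 0 \<and> (\<forall>x. pev x g \<noteq> 0 \<longrightarrow> nondeg (cfg x i))"
      by (rule exI[of _ "base_var (enc (i, Alpha a)) * base_var (enc (i, Beta b)) * base_var (enc (i, Gamma c))"])
        (use abc in \<open>auto simp: pev_mult cfg_def nondeg_def\<close>)
  qed
  from bchoice[OF this] obtain g where
    g: "\<forall>i\<in>{..<r}. pev x1 (g i) \<noteq> 0 \<and> (\<forall>x. pev x (g i) \<noteq> 0 \<longrightarrow> nondeg (cfg x i))" ..
  define \<Delta> where "\<Delta> = (\<Prod>u\<in>box N. f u) * (\<Prod>i<r. g i)"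
  have "pev x1 \<Delta> \<noteq> 0" using f g by (simp add: \<Delta>_def pev_mult pev_prod)
  moreover have "good x" if x: "pev x \<Delta> \<noteq> 0" for x
  proof -
    have 1: "pev x (f u) \<noteq> 0" if "u \<in> box N" for u using x that by (auto simp: \<Delta>_def pev_mult pev_prod)
    have 2: "nondeg (cfg x i)" if "i < r" for i using x g that by (auto simp: \<Delta>_def pev_mult pev_prod)
    have "\<I> x \<in> hilb h" by (rule pideal_in_hilbI[OF h N_def 2]) (use f 1 in auto)
    then show ?thesis using 2 by (simp add: good_def)
  qed
  ultimately show ?thesis by blast
qed

text \<open>In each degree of the box, \<open>dual_forms_greedy\<close> finds points that are
  separated as well as the number of monomials allows. These are finitely many nonempty open
  conditions on an affine space, so they can be met together and inside a prescribed nonempty open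
  set.\<close>

lemma good_exists:
  assumes "x0 \<in> supp" "pev x0 q \<noteq> 0"
  shows "\<exists>x\<in>supp. pev x q \<noteq> 0 \<and> good x"
proof -
  define N where "N = (CARD('a) + CARD('b) + CARD('c)) * (r + 1)"
  have ex: "\<exists>p. sep u {..<k} (p :: nat \<Rightarrow> ('a, 'b, 'c) var \<Rightarrow> complex)" if "k \<le> h u" for u k
    using that
  proof (induction k)
    case 0
    have "dual_forms {..<0 :: nat} (\<lambda>i. pev (\<lambda>_ :: ('a, 'b, 'c) var. 0)) u (\<lambda>_. 0)" by (simp add: dual_forms_def)
    then show ?case by (intro exI[of _ "\<lambda>_ _. 0"]) blast
  next
    case (Suc k)
    then obtain p g where g: "dual_forms {..<k} (\<lambda>i. pev (p i :: ('a, 'b, 'c) var \<Rightarrow> complex)) u g" by auto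
    have "\<exists>q g'. dual_forms (insert k {..<k}) ((\<lambda>i. pev (p i))(k := pev q)) u g'"
      by (rule dual_forms_greedy[OF _ _ g]) (use Suc.prems in \<open>auto simp: h generic_hf_eq\<close>)
    then obtain q g' where "dual_forms (insert k {..<k}) ((\<lambda>i. pev (p i))(k := pev q)) u g'" by blast
    moreover have "(\<lambda>i. pev (p i))(k := pev q) = (\<lambda>i. pev ((p(k := q)) i))" by auto
    ultimately show ?case by (intro exI[of _ "p(k := q)"]) (auto simp: lessThan_Suc)
  qed
  have "\<forall>u\<in>box N. \<exists>f. (\<exists>y. pev y f \<noteq> 0 \<and> (\<forall>i\<in>- E. y i = 0)) \<and> (\<forall>x. pev x f \<noteq> 0 \<longrightarrow> (\<exists>X\<subseteq>{..<r}. card X = h u \<and> sep u X (cfg x)))"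
  proof
    fix u
    obtain p g where "dual_forms {..<h u} (\<lambda>i. pev (p i :: ('a, 'b, 'c) var \<Rightarrow> complex)) u g" using ex[of "h u" u] by blast
    then have "dual_forms {..<h u} (\<lambda>i. pev (cfg (mk p) i)) u g"
      using h_le[of u] by (auto simp: dual_forms_def cfg_mk)
    then have sep: "sep u {..<h u} (cfg (mk p))" by blast
    have sub: "{..<h u} \<subseteq> {..<r}" using h_le[of u] by auto
    from open_sep[OF sub sep] obtain f where f: "pev (mk p) f \<noteq> 0"
      and f2: "\<forall>x. pev x f \<noteq> 0 \<longrightarrow> sep u {..<h u} (cfg x)" by (elim exE conjE) (rule that)
    have "\<exists>X\<subseteq>{..<r}. card X = h u \<and> sep u X (cfg x)" if "pev x f \<noteq> 0" for x
      using f2[rule_format, OF that] sub by (intro exI[of _ "{..<h u}"] conjI card_lessThan)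
    then show "\<exists>f. (\<exists>y. pev y f \<noteq> 0 \<and> (\<forall>i\<in>- E. y i = 0)) \<and> (\<forall>x. pev x f \<noteq> 0 \<longrightarrow> (\<exists>X\<subseteq>{..<r}. card X = h u \<and> sep u X (cfg x)))"
      using f mk_supp[of p] unfolding supp_def by (intro exI[of _ f] conjI exI[of _ "mk p"]) auto
  qed
  from bchoice[OF this] obtain f where f: "\<forall>u\<in>box N. (\<exists>y. pev y (f u) \<noteq> 0 \<and> (\<forall>i\<in>- E. y i = 0)) \<and>
    (\<forall>x. pev x (f u) \<noteq> 0 \<longrightarrow> (\<exists>X\<subseteq>{..<r}. card X = h u \<and> sep u X (cfg x)))" ..
  obtain y where y: "\<forall>u\<in>box N. pev y (f u) \<noteq> 0" "\<forall>i\<in>- E. y i = 0"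
    using common_nonzero_finite[of "box N" f "- E" "\<lambda>_. 0"] f by auto
  have y': "pev y (\<Prod>u\<in>box N. f u) \<noteq> 0" using y(1) by (simp add: pev_prod)
  obtain z where z: "pev z (\<Prod>u\<in>box N. f u) \<noteq> 0" "pev z q \<noteq> 0" "\<forall>v. y v = x0 v \<longrightarrow> z v = y v"
    using common_nonzero[OF y' assms(2)] by blast
  have z0: "\<forall>i\<in>- E. z i = 0" using z(3) y(2) assms(1) by (auto simp: supp_def)
  \<comment> \<open>The configuration of all ones witnesses that the coordinates can all be nonzero,
    which makes every point nondegenerate.\<close>
  let ?w = "\<lambda>i. if i \<in> E then 1 else (0 :: complex)"
  have z': "pev z ((\<Prod>u\<in>box N. f u) * q) \<noteq> 0" using z by (simp add: pev_mult)
  have w': "pev ?w (\<Prod>i\<in>E. base_var i) \<noteq> 0" by (simp add: pev_prod)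
  obtain x where x: "pev x ((\<Prod>u\<in>box N. f u) * q) \<noteq> 0" "pev x (\<Prod>i\<in>E. base_var i) \<noteq> 0" "\<forall>v. z v = ?w v \<longrightarrow> x v = z v"
    using common_nonzero[OF z' w'] by blast
  have "x \<in> supp" using x(3) z0 by (auto simp: supp_def)
  moreover have "pev x q \<noteq> 0" using x(1) by (auto simp: pev_mult)
  moreover have "good x"
  proof -
    have nz: "cfg x i v \<noteq> 0" if "i < r" for i v
      using x(2) that by (auto simp: pev_prod cfg_def E_def)
    then have nd: "nondeg (cfg x i)" if "i < r" for i using that by (auto simp: nondeg_def)
    have "pev x (f u) \<noteq> 0" if "u \<in> box N" for u using x(1) that by (auto simp: pev_mult pev_prod)
    then have "\<I> x \<in> hilb h" using f by (intro pideal_in_hilbI[OF h N_def nd]) auto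
    then show ?thesis using nd by (simp add: good_def)
  qed
  ultimately show ?thesis by blast
qed

text \<open>Degree by degree: where \<open>h u < r\<close> the ideals contain no nonzero form, and
  where \<open>h u = r\<close> all points are separated, so that the values of an arbitrary form can
  be subtracted by interpolation.\<close>

lemma liftable_points:
  assumes Z: "\<And>x. x \<in> Z \<Longrightarrow> \<I> x \<in> hilb h"
  shows "liftable Z \<I>"
  unfolding liftable_def
proof (intro ballI)
  fix x0 v assume x0: "x0 \<in> Z" and v: "v \<in> \<I> x0"
  have "\<exists>F. (\<forall>x\<in>Z. spec x F \<in> \<I> x) \<and> spec x0 F = hcomp u v" for u
  proof (cases "h u = r")
    case False
    then have "h u = card (Mon u :: ('a, 'b, 'c) monom set)" by (auto simp: h generic_hf_eq min_def split: if_splits)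
    then have "hcomp u v = 0"
      using hf_full_zero[OF pideal_subspace _ homogeneous_ideal_hcomp[OF pideal_homogeneous v] hcomp_piece]
        hilb_hf[OF Z[OF x0], of u] by simp
    then show ?thesis by (intro exI[of _ 0]) (simp add: ideal.subspace_0[OF pideal_subspace])
  next
    case True
    obtain X where X: "X \<subseteq> {..<r}" "card X = h u" "sep u X (cfg x0)"
      using sep_of_hilb[OF Z[OF x0], of u] by blast
    then have Xr: "X = {..<r}" using True by (metis card_lessThan card_subset_eq finite_lessThan)
    from open_sep[OF X(1,3)] obtain f G where f: "pev x0 f \<noteq> 0" and
      G: "\<forall>k\<in>X. G k \<in> piece u \<and> (\<forall>k'\<in>X. pev (cfgP k') (G k) = (if k' = k then f else 0))"
      by (elim exE conjE) (rule that)
    let ?v = "lift_const (hcomp u v)"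
    \<comment> \<open>Lagrange interpolation over the base ring: the dual forms \<open>G i\<close>
      have the value \<open>f\<close> at their own points, hence the factor \<open>f\<close> in
      front. At \<open>x0\<close> the subtracted terms are zero.\<close>
    define F where "F = const_poly f * ?v - (\<Sum>i<r. const_poly (pev (cfgP i) ?v) * G i)"
    have vp: "?v \<in> piece u" using keys_lift_const[of "hcomp u v"] hcomp_piece[of u v] by (auto simp: piece_iff)
    have Fp: "F \<in> piece u"
      unfolding F_def using G Xr by (intro piece_diff piece_sum piece_const vp) auto
    have Fj: "pev (cfgP j) F = 0" if j: "j < r" for j
    proof -
      have "pev (cfgP j) (\<Sum>i<r. const_poly (pev (cfgP i) ?v) * G i) = (\<Sum>i<r. if i = j then pev (cfgP i) ?v * f else 0)"
        unfolding pev_sum using G Xr j by (intro sum.cong refl) (auto simp: pev_mult)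
      then show ?thesis using j by (simp add: F_def pev_diff pev_mult mult.commute)
    qed
    have Fx: "spec x F \<in> \<I> x" for x
    proof -
      have "spec x F \<in> piece u" using Fp keys_spec[of x F] by (auto simp: piece_iff)
      then show ?thesis using Fj by (simp add: pideal_piece_iff pev_cfgP[symmetric])
    qed
    have "pev (cfg x0 i) (hcomp u v) = 0" if "i < r" for i using v that by (simp add: pideal_iff)
    then have "spec x0 F = const_poly (pev x0 f) * hcomp u v"
      by (simp add: F_def spec_diff spec_mult spec_sum pev_cfgP)
    then have "spec x0 (const_poly (const_poly (inverse (pev x0 f))) * F) = hcomp u v"
      using f by (simp add: spec_mult mult.assoc[symmetric] const_poly_mult[symmetric])
    moreover have "spec x (const_poly (const_poly (inverse (pev x0 f))) * F) \<in> \<I> x" for x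
      using Fx by (simp add: spec_mult ideal.subspace_scale[OF pideal_subspace])
    ultimately show ?thesis by blast
  qed
  then have "\<forall>u. \<exists>F. (\<forall>x\<in>Z. spec x F \<in> \<I> x) \<and> spec x0 F = hcomp u v" by blast
  from choice[OF this] obtain F where F: "\<forall>u. (\<forall>x\<in>Z. spec x (F u) \<in> \<I> x) \<and> spec x0 (F u) = hcomp u v" ..
  have "spec x0 (\<Sum>u\<in>mdeg ` keys v. F u) = v"
    using F hcomp_decompose[of v] by (simp add: spec_sum)
  moreover have "spec x (\<Sum>u\<in>mdeg ` keys v. F u) \<in> \<I> x" if "x \<in> Z" for x
    unfolding spec_sum using F that by (intro ideal.subspace_sum[OF pideal_subspace]) auto
  ultimately show "\<exists>F. (\<forall>x\<in>Z. spec x F \<in> \<I> x) \<and> spec x0 F = v" by blast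
qed

text \<open>The open set where \<open>\<Delta>\<close> is invertible is the closed set \<open>y \<Delta> = 1\<close> with one more variable
  \<open>y\<close>.\<close>

lemma points_closed_pullback:
  assumes \<Delta>: "\<And>x. pev x \<Delta> \<noteq> 0 \<Longrightarrow> good x" and T: "closedin (hilb_topology h) T"
  shows "\<exists>G. \<forall>x\<in>supp. pev x \<Delta> \<noteq> 0 \<longrightarrow> (\<I> x \<in> T \<longleftrightarrow> (\<forall>g\<in>G. pev x g = 0))"
proof -
  define n where "n = Suc (Max (insert 0 E))"
  have En: "i < n" if "i \<in> E" for i using that by (simp add: n_def less_Suc_eq_le)
  \<comment> \<open>\<open>\<Delta>\<close> may involve indices outside \<open>E\<close>. Setting
    them to 0 makes \<open>\<Delta>'\<close> independent of the new variable
    \<open>n\<close>.\<close>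
  define \<tau> where "\<tau> x i = (if i \<in> E then x i else (0 :: complex))" for x i
  obtain \<Delta>' where \<Delta>': "\<And>x. pev x \<Delta>' = pev (\<tau> x) \<Delta>"
  proof -
    obtain g' where "\<And>y. pev y g' = pev (\<lambda>v. pev y (if v \<in> E then base_var v else 0)) \<Delta>"
      using poly_subst[of "\<lambda>v. if v \<in> E then base_var v else 0" \<Delta>] by blast
    moreover have "(\<lambda>v. pev y (if v \<in> E then base_var v else 0)) = \<tau> y" for y
      by (auto simp: \<tau>_def)
    ultimately show thesis using that[of g'] by simp
  qed
  have \<tau>s: "\<tau> x = x" if "x \<in> supp" for x using that by (auto simp: \<tau>_def supp_def)
  have I\<tau>: "\<I> (\<tau> x) = \<I> x" for x
    by (rule pideal_cong) (auto simp: cfg_def \<tau>_def E_def)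
  define Z where "Z = {y. (\<forall>i. i \<notin> insert n E \<longrightarrow> y i = 0) \<and> y n * pev y \<Delta>' = 1}"
  have Z1: "Z = {y. \<forall>g\<in>base_var ` (- insert n E) \<union> {base_var n * \<Delta>' - 1}. pev y g = 0}"
    by (auto simp: Z_def pev_diff pev_mult)
  have Z2: "\<forall>y\<in>Z. \<forall>i\<ge>Suc n. y i = 0" using En by (auto simp: Z_def) (metis Suc_n_not_le_n not_less_eq_eq order_less_imp_le)
  have Z3: "\<I> y \<in> hilb h" if "y \<in> Z" for y
  proof -
    have "pev (\<tau> y) \<Delta> \<noteq> 0" using that by (auto simp: Z_def \<Delta>'[symmetric])
    then show ?thesis using \<Delta>[of "\<tau> y"] I\<tau>[of y] by (simp add: good_def)
  qed
  obtain G where G: "\<And>y. y \<in> Z \<Longrightarrow> \<I> y \<in> T \<longleftrightarrow> (\<forall>g\<in>G. pev y g = 0)"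
    using closed_pullback[OF Z1 Z2 _ liftable_points[OF Z3] T] Z3 by blast
  \<comment> \<open>\<open>Y\<close> embeds the open set into the closed set \<open>Z\<close>. Its
    new coordinate is a fraction, so equations on \<open>Z\<close> pull back to polynomial equations
    after clearing denominators.\<close>
  define Y where "Y x i = (if i = n then 1 / pev x \<Delta> else x i)" for x i
  define c where "c i = (if i = n then 1 else base_var i * \<Delta>)" for i
  have Yc: "Y x = (\<lambda>i. pev x (c i) / pev x \<Delta>)" if "pev x \<Delta> \<noteq> 0" for x
    using that by (auto simp: Y_def c_def pev_mult)
  have nE: "n \<notin> E" using En by blast
  have YZ: "Y x \<in> Z" "\<I> (Y x) = \<I> x" if x: "x \<in> supp" "pev x \<Delta> \<noteq> 0" for x
  proof -
    have \<tau>Y: "\<tau> (Y x) = x" using x(1) nE by (auto simp: \<tau>_def Y_def supp_def fun_eq_iff)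
    have "Y x i = 0" if "i \<notin> insert n E" for i using x(1) that by (simp add: Y_def supp_def)
    then show "Y x \<in> Z" using x(2) \<tau>Y by (simp add: Z_def \<Delta>') (auto simp: Y_def)
    show "\<I> (Y x) = \<I> x" using I\<tau>[of "Y x"] \<tau>Y by simp
  qed
  have "\<forall>g. \<exists>g'. \<forall>x. pev x \<Delta> \<noteq> 0 \<longrightarrow> (pev (Y x) g = 0 \<longleftrightarrow> pev x g' = 0)"
  proof
    fix g
    obtain k g' where "\<And>y. pev y \<Delta> \<noteq> 0 \<Longrightarrow> pev (\<lambda>i. pev y (c i) / pev y \<Delta>) g * pev y \<Delta> ^ k = pev y g'"
      using poly_subst_frac[of \<Delta> c g] by blast
    then have "pev (Y x) g * pev x \<Delta> ^ k = pev x g'" if "pev x \<Delta> \<noteq> 0" for x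
      unfolding Yc[OF that] using that by blast
    then have "pev (Y x) g = 0 \<longleftrightarrow> pev x g' = 0" if "pev x \<Delta> \<noteq> 0" for x
      using that by (metis mult_eq_0_iff power_not_zero)
    then show "\<exists>g'. \<forall>x. pev x \<Delta> \<noteq> 0 \<longrightarrow> (pev (Y x) g = 0 \<longleftrightarrow> pev x g' = 0)" by blast
  qed
  from choice[OF this] obtain t where t: "\<forall>g x. pev x \<Delta> \<noteq> 0 \<longrightarrow> (pev (Y x) g = 0 \<longleftrightarrow> pev x (t g) = 0)" ..
  have "\<I> x \<in> T \<longleftrightarrow> (\<forall>g\<in>t ` G. pev x g = 0)" if x: "x \<in> supp" "pev x \<Delta> \<noteq> 0" for x
    using G[OF YZ(1)[OF x]] YZ(2)[OF x] t x(2) by simp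
  then show ?thesis by blast
qed

lemma slip_eq:
  "(slip r :: ('a, 'b, 'c) coxC set set) = hilb_topology h closure_of {I \<in> hilb h. radical_ideal I \<and> saturated I}"
  by (simp add: slip_def h Let_def)

lemma good_slip: "good x \<Longrightarrow> \<I> x \<in> slip r"
proof -
  assume g: "good x"
  then have "\<I> x \<in> {I \<in> hilb h. radical_ideal I \<and> saturated I}"
    using pideal_radical saturatedI[of r "cfg x"] by (auto simp: good_def)
  moreover have "{I \<in> hilb h. radical_ideal I \<and> saturated I} \<subseteq> hilb_topology h closure_of {I \<in> hilb h. radical_ideal I \<and> saturated (I :: ('a, 'b, 'c) coxC set)}"
    by (rule closure_of_subset) (auto simp: topspace_hilb)
  ultimately show ?thesis unfolding slip_eq by blast
qed

text \<open>A radical and saturated point comes from a good configuration \<open>x1\<close>. If an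
  equation of \<open>T\<close> failed at \<open>x1\<close>, it would fail at some configuration near
  \<open>x1\<close> at which \<open>q\<close> does not vanish, since two nonempty open sets of
  configurations meet.\<close>

lemma slip_subset_closed:
  fixes T :: "('a, 'b, 'c) coxC set set"
  assumes T: "closedin (hilb_topology h) T" and q: "x0 \<in> supp" "pev x0 q \<noteq> 0"
    and sub: "\<And>x. x \<in> supp \<Longrightarrow> pev x q \<noteq> 0 \<Longrightarrow> good x \<Longrightarrow> \<I> x \<in> T"
  shows "slip r \<subseteq> T"
  unfolding slip_eq
proof (rule closure_of_minimal[OF _ T], rule subsetI)
  fix I :: "('a, 'b, 'c) coxC set" assume "I \<in> {I \<in> hilb h. radical_ideal I \<and> saturated I}"
  then obtain p where p: "\<forall>i<r. nondeg (p i)" "pideal r p = I" and I: "I \<in> hilb h"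
    using reduced_points[of I r] r_pos by (auto simp: h)
  define x1 where "x1 = mk p"
  have I1: "\<I> x1 = I" unfolding p(2)[symmetric] by (rule pideal_cong) (simp add: x1_def cfg_mk)
  have x1: "x1 \<in> supp" by (simp add: x1_def mk_supp)
  have "good x1" using p I I1 by (simp add: good_def) (simp add: x1_def cfg_mk)
  then obtain \<Delta> where \<Delta>: "pev x1 \<Delta> \<noteq> 0" "\<And>x. pev x \<Delta> \<noteq> 0 \<Longrightarrow> good x" using good_open by blast
  obtain G where G: "\<And>x. x \<in> supp \<Longrightarrow> pev x \<Delta> \<noteq> 0 \<Longrightarrow> \<I> x \<in> T \<longleftrightarrow> (\<forall>g\<in>G. pev x g = 0)"
    using points_closed_pullback[OF \<Delta>(2) T] by metis
  have "pev x1 g = 0" if g: "g \<in> G" for g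
  proof (rule ccontr)
    assume "pev x1 g \<noteq> 0"
    then have "pev x1 (g * \<Delta>) \<noteq> 0" using \<Delta>(1) by (simp add: pev_mult)
    from common_nonzero[OF this q(2)] obtain z where z: "pev z (g * \<Delta>) \<noteq> 0" "pev z q \<noteq> 0"
      "\<forall>v. x1 v = x0 v \<longrightarrow> z v = x1 v" by blast
    have zs: "z \<in> supp" using z(3) x1 q(1) by (auto simp: supp_def)
    have zd: "pev z g \<noteq> 0" "pev z \<Delta> \<noteq> 0" using z(1) by (auto simp: pev_mult)
    have "\<I> z \<in> T" by (rule sub[OF zs z(2) \<Delta>(2)[OF zd(2)]])
    then show False using G[OF zs zd(2)] g zd(1) by blast
  qed
  then show "I \<in> T" using G[OF x1 \<Delta>(1)] I1 by blast
qed

section \<open>Normalization of the points to affine coordinates\<close>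

primrec spv :: "('a, 'b, 'c) var \<Rightarrow> ('a, 'b, 'c) var" where
  "spv (Alpha _) = Alpha a0" | "spv (Beta _) = Beta b0" | "spv (Gamma _) = Gamma c0"

definition special where "special = {(i, v). i < r \<and> v \<in> {Alpha a0, Beta b0, Gamma c0}}"

lemma finite_special [simp]: "finite special"
  by (rule finite_subset[of _ "{..<r} \<times> UNIV"]) (auto simp: special_def)

definition normal where "normal = {x \<in> supp. \<forall>(i, v)\<in>special. x (enc (i, v)) = 1}"

definition nz :: "(nat \<Rightarrow> complex) \<Rightarrow> nat \<Rightarrow> complex" where
  "nz x = mk (\<lambda>i v. x (enc (i, v)) / x (enc (i, spv v)))"

lemma spv_special: "i < r \<Longrightarrow> (i, spv v) \<in> special"
  by (cases v) (auto simp: special_def)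

lemma nz_props:
  assumes x: "\<forall>e\<in>special. x (enc e) \<noteq> 0"
  shows "nz x \<in> normal" "\<I> (nz x) = \<I> x"
proof -
  show "nz x \<in> normal"
    using x by (auto simp: normal_def nz_def mk_supp) (auto simp: special_def mk_enc)
  show "\<I> (nz x) = \<I> x"
  proof -
    have "f \<in> \<I> (nz x) \<longleftrightarrow> f \<in> \<I> x" for f
    proof -
      have "pev (cfg (nz x) i) (hcomp u f) = 0 \<longleftrightarrow> pev (cfg x i) (hcomp u f) = 0" if i: "i < r" for i u
      proof -
        let ?s = "(1 / x (enc (i, Alpha a0)), 1 / x (enc (i, Beta b0)), 1 / x (enc (i, Gamma c0)))"
        have "cfg (nz x) i = (\<lambda>v. tw ?s v * cfg x i v)"
        proof
          show "cfg (nz x) i v = tw ?s v * cfg x i v" for v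
            unfolding nz_def cfg_mk[OF i] by (cases v) (auto simp: cfg_def)
        qed
        then have "pev (cfg (nz x) i) (hcomp u f) = chi u ?s * pev (cfg x i) (hcomp u f)"
          by (simp only: pev_tw_piece[OF hcomp_piece])
        moreover have "chi u ?s \<noteq> 0" using x i by (auto simp: chi_def special_def)
        ultimately show ?thesis by simp
      qed
      then show ?thesis by (simp add: pideal_iff)
    qed
    then show ?thesis by blast
  qed
qed

lemma nz_normal: "x \<in> normal \<Longrightarrow> nz x = x"
proof
  fix j assume x: "x \<in> normal"
  show "nz x j = x j"
  proof (cases "j \<in> E")
    case True
    then obtain i v where iv: "i < r" "j = enc (i, v)" by (auto simp: E_def)
    then show ?thesis using x spv_special[OF iv(1), of v] by (auto simp: nz_def mk_enc normal_def)
  next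
    case False
    then show ?thesis using x by (simp add: nz_def mk_def normal_def supp_def)
  qed
qed

text \<open>Rescaling by the torus changes neither a point nor the ideal. Normalization is a
  rational map with the product of all special coordinates as denominator, so a nonempty open set of
  normalized configurations pulls back to one of configurations.\<close>

lemma slip_subset_closed_normal:
  fixes T :: "('a, 'b, 'c) coxC set set"
  assumes T: "closedin (hilb_topology h) T" and q: "x0 \<in> normal" "pev x0 q \<noteq> 0"
    and sub: "\<And>x. x \<in> normal \<Longrightarrow> pev x q \<noteq> 0 \<Longrightarrow> good x \<Longrightarrow> \<I> x \<in> T"
  shows "slip r \<subseteq> T"
proof -
  define f where "f = (\<Prod>e\<in>special. base_var (enc e))"
  define c where "c j = (if j \<in> E then case inv_into ({..<r} \<times> UNIV) enc j of (i, v) \<Rightarrow>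
      base_var (enc (i, v)) * (\<Prod>e\<in>special - {(i, spv v)}. base_var (enc e)) else 0)" for j
  have f: "pev x f \<noteq> 0 \<longleftrightarrow> (\<forall>(i, v)\<in>special. x (enc (i, v)) \<noteq> 0)" for x
    by (auto simp: f_def pev_prod)
  have c: "(\<lambda>j. pev x (c j) / pev x f) = nz x" if fx: "pev x f \<noteq> 0" for x
  proof
    fix j
    show "pev x (c j) / pev x f = nz x j"
    proof (cases "j \<in> E")
      case True
      then obtain i v where iv: "i < r" "j = enc (i, v)" by (auto simp: E_def)
      have s: "(i, spv v) \<in> special" by (rule spv_special[OF iv(1)])
      have "c j = base_var (enc (i, v)) * (\<Prod>e\<in>special - {(i, spv v)}. base_var (enc e))"
        using True iv(1) by (simp add: c_def iv(2) inv_into_f_f[OF enc_inj])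
      moreover have "f = base_var (enc (i, spv v)) * (\<Prod>e\<in>special - {(i, spv v)}. base_var (enc e))"
        unfolding f_def by (rule prod.remove[OF finite_special s])
      ultimately show ?thesis using fx iv by (auto simp: nz_def mk_enc pev_mult)
    qed (simp add: c_def nz_def mk_def)
  qed
  obtain k g' where g': "\<And>y. pev y f \<noteq> 0 \<Longrightarrow> pev (nz y) q * pev y f ^ k = pev y g'"
  proof -
    obtain k g' where "\<forall>y. pev y f \<noteq> 0 \<longrightarrow> pev (\<lambda>v. pev y (c v) / pev y f) q * pev y f ^ k = pev y g'"
      using poly_subst_frac[of f c q] by (elim exE) (rule that)
    then have "pev (nz y) q * pev y f ^ k = pev y g'" if "pev y f \<noteq> 0" for y
      using that c[OF that] by metis
    then show thesis by (rule that)
  qed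
  show ?thesis
  proof (rule slip_subset_closed[OF T])
    show "x0 \<in> supp" using q(1) by (simp add: normal_def)
    have f0: "pev x0 f \<noteq> 0" unfolding f using q(1) by (auto simp: normal_def)
    have "pev x0 g' \<noteq> 0" using g'[OF f0] nz_normal[OF q(1)] q(2) f0 by auto
    then show "pev x0 (f * g') \<noteq> 0" using f0 by (simp add: pev_mult)
    fix x assume x: "x \<in> supp" "pev x (f * g') \<noteq> 0" "good x"
    have fx: "pev x f \<noteq> 0" "pev x g' \<noteq> 0" using x(2) by (auto simp: pev_mult)
    have ne: "\<forall>e\<in>special. x (enc e) \<noteq> 0" using fx(1) unfolding f by auto
    note n = nz_props[OF ne]
    have "nondeg (cfg (nz x) i)" if i: "i < r" for i
    proof -
      have "cfg (nz x) i v = 1" if "v \<in> {Alpha a0, Beta b0, Gamma c0}" for v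
      proof -
        have "(i, v) \<in> special" using that i unfolding special_def by blast
        then show ?thesis using n(1) unfolding normal_def cfg_def by blast
      qed
      then have "cfg (nz x) i (Alpha a0) = 1" "cfg (nz x) i (Beta b0) = 1" "cfg (nz x) i (Gamma c0) = 1" by blast+
      then show ?thesis unfolding nondeg_def by (metis zero_neq_one)
    qed
    then have "good (nz x)" using x(3) n(2) by (simp add: good_def)
    moreover have "pev (nz x) q \<noteq> 0" using g'[OF fx(1)] fx by auto
    ultimately have "\<I> (nz x) \<in> T" using sub[OF n(1)] by blast
    then show "\<I> x \<in> T" using n(2) by simp
  qed
qed

end

lemma config_exists:
  assumes "r > 0" "h = generic_hf TYPE(('a::finite, 'b::finite, 'c::finite) var) r"
  obtains enc :: "nat \<times> ('a::finite, 'b::finite, 'c::finite) var \<Rightarrow> nat" where "config r h enc"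
proof -
  have "finite ({..<r} \<times> (UNIV :: ('a, 'b, 'c) var set))" by simp
  then obtain enc :: "nat \<times> ('a, 'b, 'c) var \<Rightarrow> nat" where "inj_on enc ({..<r} \<times> UNIV)"
    using finite_imp_inj_to_nat_seg by blast
  then show thesis using that assms by (auto simp: config_def)
qed

section \<open>Upper bound for the dimension\<close>

lemma poly_split:
  fixes Q :: base_poly
  shows "\<exists>d Qs. \<forall>y. pev y Q = (\<Sum>j<d. y k ^ j * pev (y(k := 1)) (Qs j))"
proof -
  define d where "d = Suc (\<Sum>m\<in>keys Q. lookup m k)"
  define Qs where "Qs j = (\<Sum>m\<in>{m\<in>keys Q. lookup m k = j}. single m (lookup Q m))" for j
  have mon: "mon_ev y m = y k ^ lookup m k * mon_ev (y(k := 1)) m" for y :: "nat \<Rightarrow> complex" and m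
  proof -
    have "mon_ev y m = (\<Prod>v\<in>insert k (keys m). y v ^ lookup m v)" by (rule mon_ev_superset) auto
    also have "\<dots> = y k ^ lookup m k * (\<Prod>v\<in>keys m - {k}. y v ^ lookup m v)"
      by (subst prod.insert_remove) auto
    also have "(\<Prod>v\<in>keys m - {k}. y v ^ lookup m v) = (\<Prod>v\<in>insert k (keys m). (y(k := 1)) v ^ lookup m v)"
      by (subst prod.insert_remove) auto
    also have "\<dots> = mon_ev (y(k := 1)) m" by (rule mon_ev_superset[symmetric]) auto
    finally show ?thesis .
  qed
  have "pev y Q = (\<Sum>j<d. y k ^ j * pev (y(k := 1)) (Qs j))" for y
  proof -
    have lt: "(\<lambda>m. lookup m k) ` keys Q \<subseteq> {..<d}"
    proof safe
      fix m assume "m \<in> keys Q"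
      then have "lookup m k \<le> (\<Sum>m\<in>keys Q. lookup m k)" by (intro member_le_sum) auto
      then show "lookup m k < d" by (simp add: d_def)
    qed
    have "pev y Q = (\<Sum>m\<in>keys Q. lookup Q m * mon_ev y m)" by (simp add: pev_def)
    also have "\<dots> = (\<Sum>j<d. \<Sum>m\<in>{m\<in>keys Q. lookup m k = j}. lookup Q m * mon_ev y m)"
      by (rule sum.group[symmetric]) (use lt in auto)
    also have "\<dots> = (\<Sum>j<d. y k ^ j * pev (y(k := 1)) (Qs j))"
      unfolding Qs_def pev_sum sum_distrib_left
      by (intro sum.cong refl) (auto simp: mon[of y])
    finally show ?thesis .
  qed
  then show ?thesis by blast
qed

text \<open>Functions \<open>f i\<close> that vanish on \<open>A i\<close> but not on
  \<open>A (Suc i)\<close>, for irreducible sets, are algebraically independent: a polynomial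
  \<open>Q\<close> that is zero on them is expanded in powers of the last function, and its
  coefficients are shown to be zero one after another. Variables from \<open>k\<close> on are set to
  1, so that \<open>Q\<close> counts as a polynomial in the first \<open>k\<close>
  variables.\<close>

lemma chain_independent:
  fixes A :: "nat \<Rightarrow> (nat \<Rightarrow> complex) set" and f :: "nat \<Rightarrow> base_poly"
  assumes ne: "A 0 \<noteq> {}" and mono: "\<And>i. i < n \<Longrightarrow> A i \<subseteq> A (Suc i)"
    and prime: "\<And>i g g'. i \<le> n \<Longrightarrow> (\<And>x. x \<in> A i \<Longrightarrow> pev x g * pev x g' = 0) \<Longrightarrow>
      (\<forall>x\<in>A i. pev x g = 0) \<or> (\<forall>x\<in>A i. pev x g' = 0)"
    and f0: "\<And>i x. i < n \<Longrightarrow> x \<in> A i \<Longrightarrow> pev x (f i) = 0"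
    and f1: "\<And>i. i < n \<Longrightarrow> \<exists>x\<in>A (Suc i). pev x (f i) \<noteq> 0"
    and "k \<le> n" "\<And>x. x \<in> A k \<Longrightarrow> pev (\<lambda>j. if j < k then pev x (f j) else 1) Q = 0" "\<And>j. j \<ge> k \<Longrightarrow> y j = 1"
  shows "pev y Q = 0"
  using assms(6-8)
proof (induction k arbitrary: Q y)
  case 0
  then have "y = (\<lambda>_. 1)" by auto
  then show ?case using 0(2) ne by auto
next
  case (Suc k)
  note IHk = Suc.IH and kn = Suc.prems(1)
  define F where "F l x = (\<lambda>j. if j < l then pev x (f j) else 1)" for l x
  have claim: "\<forall>j<D. \<forall>y. (\<forall>j\<ge>k. y j = 1) \<longrightarrow> pev y (Qs j) = 0"
    if "\<And>x. x \<in> A (Suc k) \<Longrightarrow> (\<Sum>j<D. pev x (f k) ^ j * pev (F k x) (Qs j)) = 0" for D Qs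
    using that
  proof (induction D arbitrary: Qs)
    case (Suc D)
    note IHD = Suc.IH and prem = Suc.prems
    have k: "k < n" using kn by simp
    have shift: "(\<Sum>j<Suc D. pev x (f k) ^ j * pev (F k x) (Qs j)) =
        pev (F k x) (Qs 0) + pev x (f k) * (\<Sum>j<D. pev x (f k) ^ j * pev (F k x) (Qs (Suc j)))" for x
      unfolding sum.lessThan_Suc_shift sum_distrib_left by (simp only: power_0 mult_1 power_Suc mult.assoc)
    \<comment> \<open>On \<open>A k\<close> the function \<open>f k\<close> vanishes and only the
      constant coefficient is left; it is zero by the outer induction.\<close>
    have "pev (F k x) (Qs 0) = 0" if "x \<in> A k" for x
      using prem[of x] shift[of x] f0[OF k that] mono[OF k] that by auto
    then have Q0: "pev y (Qs 0) = 0" if "\<And>j. j \<ge> k \<Longrightarrow> y j = 1" for y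
      using IHk[of "Qs 0" y] k that unfolding F_def by simp
    have "\<forall>j. \<exists>g. \<forall>x. pev x g = pev (F k x) (Qs j)"
    proof
      fix j
      obtain g where "\<forall>x. pev x g = pev (\<lambda>i. pev x (if i < k then f i else 1)) (Qs j)"
        using poly_subst[of "\<lambda>i. if i < k then f i else 1" "Qs j"] by blast
      moreover have "(\<lambda>i. pev x (if i < k then f i else 1)) = F k x" for x by (auto simp: F_def)
      ultimately show "\<exists>g. \<forall>x. pev x g = pev (F k x) (Qs j)" by auto
    qed
    from choice[OF this] obtain g where g: "\<forall>j x. pev x (g j) = pev (F k x) (Qs j)" ..
    define G where "G = (\<Sum>j<D. f k ^ j * g (Suc j))"
    have G: "pev x G = (\<Sum>j<D. pev x (f k) ^ j * pev (F k x) (Qs (Suc j)))" for x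
      by (simp add: G_def pev_sum pev_mult pev_power g)
    \<comment> \<open>\<open>f k\<close> is not identically zero on the irreducible set
      \<open>A (Suc k)\<close>, so this factor can be cancelled, and \<open>D\<close>
      decreases.\<close>
    have "pev x (f k) * pev x G = 0" if x: "x \<in> A (Suc k)" for x
      using prem[OF x] shift[of x] Q0[of "F k x"] G[of x] by (simp add: F_def)
    then have "(\<forall>x\<in>A (Suc k). pev x (f k) = 0) \<or> (\<forall>x\<in>A (Suc k). pev x G = 0)"
      using prime[of "Suc k" "f k" G] kn by blast
    then have "\<forall>x\<in>A (Suc k). pev x G = 0" using f1[OF k] by blast
    then have "\<forall>j<D. \<forall>y. (\<forall>j\<ge>k. y j = 1) \<longrightarrow> pev y (Qs (Suc j)) = 0"
      using IHD[of "\<lambda>j. Qs (Suc j)"] G by simp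
    then show ?case using Q0 by (auto simp: less_Suc_eq_0_disj)
  qed simp
  obtain D Qs where Qs: "\<And>y. pev y Q = (\<Sum>j<D. y k ^ j * pev (y(k := 1)) (Qs j))"
    using poly_split[of Q k] by blast
  have "(\<Sum>j<D. pev x (f k) ^ j * pev (F k x) (Qs j)) = 0" if x: "x \<in> A (Suc k)" for x
  proof -
    have "(F (Suc k) x)(k := 1) = F k x" by (auto simp: F_def)
    moreover have "F (Suc k) x k = pev x (f k)" by (simp add: F_def)
    ultimately show ?thesis using Qs[of "F (Suc k) x"] Suc.prems(2)[OF x] by (simp add: F_def)
  qed
  from claim[OF this] have "pev (y(k := 1)) (Qs j) = 0" if "j < D" for j
    using that Suc.prems(3) by auto
  then show ?case unfolding Qs by simp
qed

section \<open>Counting polynomial functions of bounded degree in each variable\<close>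

definition exps :: "nat set \<Rightarrow> nat \<Rightarrow> (nat \<Rightarrow>\<^sub>0 nat) set" where
  "exps X D = {m. keys m \<subseteq> X \<and> (\<forall>i. lookup m i \<le> D)}"

lemma exps_bij:
  assumes "finite X"
  shows "bij_betw (\<lambda>m. restrict (lookup m) X) (exps X D) (PiE X (\<lambda>_. {..D}))"
proof (rule bij_betwI')
  fix m n assume mn: "m \<in> exps X D" "n \<in> exps X D"
  show "(restrict (lookup m) X = restrict (lookup n) X) = (m = n)"
  proof
    assume eq: "restrict (lookup m) X = restrict (lookup n) X"
    show "m = n"
    proof (rule poly_mapping_eqI)
      fix i show "lookup m i = lookup n i"
      proof (cases "i \<in> X")
        case False
        then have "i \<notin> keys m" "i \<notin> keys n" using mn by (auto simp: exps_def)
        then show ?thesis by (simp add: in_keys_iff)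
      qed (use fun_cong[OF eq, of i] in simp)
    qed
  qed simp
next
  fix m assume "m \<in> exps X D"
  then show "restrict (lookup m) X \<in> PiE X (\<lambda>_. {..D})" by (auto simp: exps_def)
next
  fix F assume F: "F \<in> PiE X (\<lambda>_. {..D})"
  define m where "m = (\<Sum>i\<in>X. single i (F i))"
  have m: "lookup m i = (if i \<in> X then F i else 0)" for i
    using assms by (simp add: m_def lookup_sum lookup_single when_def)
  have "m \<in> exps X D" using F by (auto simp: exps_def m in_keys_iff PiE_def Pi_def split: if_splits)
  moreover have "F = restrict (lookup m) X" using F by (auto simp: m restrict_def PiE_def extensional_def)
  ultimately show "\<exists>m\<in>exps X D. F = restrict (lookup m) X" by blast
qed

lemma finite_exps: "finite X \<Longrightarrow> finite (exps X D)"
  using bij_betw_finite[OF exps_bij] by (auto intro: finite_PiE)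

lemma card_exps: "finite X \<Longrightarrow> card (exps X D) = Suc D ^ card X"
  using bij_betw_same_card[OF exps_bij] by (simp add: card_PiE)

definition bdd_poly :: "(nat \<Rightarrow> complex) set \<Rightarrow> nat set \<Rightarrow> nat \<Rightarrow> ((nat \<Rightarrow> complex) \<Rightarrow> complex) \<Rightarrow> bool" where
  "bdd_poly \<Omega> X D F \<longleftrightarrow> (\<exists>c. \<forall>x\<in>\<Omega>. F x = (\<Sum>m\<in>exps X D. c m * mon_ev x m))"

lemma bdd_poly_mono:
  assumes "finite X" "bdd_poly \<Omega> X D F" "D \<le> D'"
  shows "bdd_poly \<Omega> X D' F"
proof -
  obtain c where c: "\<forall>x\<in>\<Omega>. F x = (\<Sum>m\<in>exps X D. c m * mon_ev x m)" using assms(2) by (auto simp: bdd_poly_def)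
  have sub: "exps X D \<subseteq> exps X D'" using assms(3) by (auto simp: exps_def intro: order_trans)
  have "F x = (\<Sum>m\<in>exps X D'. (if m \<in> exps X D then c m else 0) * mon_ev x m)" if "x \<in> \<Omega>" for x
  proof -
    have "F x = (\<Sum>m\<in>exps X D. (if m \<in> exps X D then c m else 0) * mon_ev x m)" using c that by simp
    also have "\<dots> = (\<Sum>m\<in>exps X D'. (if m \<in> exps X D then c m else 0) * mon_ev x m)"
      by (rule sum.mono_neutral_left) (use sub finite_exps[OF assms(1)] in auto)
    finally show ?thesis .
  qed
  then show ?thesis unfolding bdd_poly_def by (intro exI[of _ "\<lambda>m. if m \<in> exps X D then c m else 0"]) blast
qed

lemma bdd_poly_monomial: "finite X \<Longrightarrow> m \<in> exps X D \<Longrightarrow> bdd_poly \<Omega> X D (\<lambda>x. a * mon_ev x m)"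
  unfolding bdd_poly_def
proof (intro exI ballI)
  fix x assume "finite X" "m \<in> exps X D"
  then have "(\<Sum>n\<in>exps X D. (if n = m then a else 0) * mon_ev x n) = (\<Sum>n\<in>exps X D. if n = m then a * mon_ev x n else 0)"
    by (intro sum.cong refl) auto
  also have "\<dots> = a * mon_ev x m" using \<open>m \<in> exps X D\<close> finite_exps[OF \<open>finite X\<close>] by simp
  finally show "a * mon_ev x m = (\<Sum>n\<in>exps X D. (if n = m then a else 0) * mon_ev x n)" by simp
qed

lemma bdd_poly_sum:
  assumes "\<And>i. i \<in> A \<Longrightarrow> bdd_poly \<Omega> X D (F i)"
  shows "bdd_poly \<Omega> X D (\<lambda>x. \<Sum>i\<in>A. F i x)"
proof -
  have "\<forall>i\<in>A. \<exists>c. \<forall>x\<in>\<Omega>. F i x = (\<Sum>m\<in>exps X D. c m * mon_ev x m)"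
    using assms by (auto simp: bdd_poly_def)
  from bchoice[OF this] obtain c where c: "\<forall>i\<in>A. \<forall>x\<in>\<Omega>. F i x = (\<Sum>m\<in>exps X D. c i m * mon_ev x m)" ..
  have "(\<Sum>i\<in>A. F i x) = (\<Sum>m\<in>exps X D. (\<Sum>i\<in>A. c i m) * mon_ev x m)" if "x \<in> \<Omega>" for x
  proof -
    have "(\<Sum>i\<in>A. F i x) = (\<Sum>i\<in>A. \<Sum>m\<in>exps X D. c i m * mon_ev x m)"
      by (rule sum.cong[OF refl]) (use c that in blast)
    also have "\<dots> = (\<Sum>m\<in>exps X D. \<Sum>i\<in>A. c i m * mon_ev x m)" by (rule sum.swap)
    finally show ?thesis by (simp only: sum_distrib_right)
  qed
  then show ?thesis unfolding bdd_poly_def by (intro exI[of _ "\<lambda>m. \<Sum>i\<in>A. c i m"]) blast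
qed

lemma bdd_poly_mult:
  assumes X: "finite X" and F: "bdd_poly \<Omega> X D F" and G: "bdd_poly \<Omega> X D' G"
  shows "bdd_poly \<Omega> X (D + D') (\<lambda>x. F x * G x)"
proof -
  obtain c where c: "\<forall>x\<in>\<Omega>. F x = (\<Sum>m\<in>exps X D. c m * mon_ev x m)" using F by (auto simp: bdd_poly_def)
  obtain e where e: "\<forall>x\<in>\<Omega>. G x = (\<Sum>m\<in>exps X D'. e m * mon_ev x m)" using G by (auto simp: bdd_poly_def)
  have "bdd_poly \<Omega> X (D + D') (\<lambda>x. \<Sum>m\<in>exps X D. \<Sum>n\<in>exps X D'. (c m * e n) * mon_ev x (m + n))"
  proof (intro bdd_poly_sum bdd_poly_monomial X)
    show "m + n \<in> exps X (D + D')" if "m \<in> exps X D" "n \<in> exps X D'" for m n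
      using that Poly_Mapping.keys_add[of m n] by (fastforce simp: exps_def lookup_add intro: add_mono)
  qed
  moreover have "F x * G x = (\<Sum>m\<in>exps X D. \<Sum>n\<in>exps X D'. (c m * e n) * mon_ev x (m + n))" if "x \<in> \<Omega>" for x
  proof -
    have "F x * G x = (\<Sum>m\<in>exps X D. c m * mon_ev x m) * (\<Sum>n\<in>exps X D'. e n * mon_ev x n)"
      using c e that by metis
    also have "\<dots> = (\<Sum>m\<in>exps X D. \<Sum>n\<in>exps X D'. (c m * e n) * mon_ev x (m + n))"
      unfolding sum_product by (intro sum.cong refl) (simp only: mon_ev_add mult_ac)
    finally show ?thesis .
  qed
  ultimately show ?thesis unfolding bdd_poly_def by simp
qed

lemma bdd_poly_const: "finite X \<Longrightarrow> bdd_poly \<Omega> X 0 (\<lambda>_. a)"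
  using bdd_poly_monomial[of X 0 0 \<Omega> a] by (simp add: exps_def)

lemma bdd_poly_power:
  assumes "finite X" "bdd_poly \<Omega> X D F"
  shows "bdd_poly \<Omega> X (k * D) (\<lambda>x. F x ^ k)"
proof (induction k)
  case 0
  then show ?case using bdd_poly_const[OF assms(1)] by simp
next
  case (Suc k)
  then show ?case using bdd_poly_mult[OF assms(1,2) Suc] by simp
qed

lemma bdd_poly_prod:
  assumes "finite X" "\<And>i. i \<in> A \<Longrightarrow> bdd_poly \<Omega> X (D i) (F i)"
  shows "bdd_poly \<Omega> X (\<Sum>i\<in>A. D i) (\<lambda>x. \<Prod>i\<in>A. F i x)"
  using assms(2)
proof (induction A rule: infinite_finite_induct)
  case (insert i A)
  then show ?case using bdd_poly_mult[OF assms(1), of \<Omega> "D i" "F i"] by simp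
qed (auto intro: bdd_poly_const[OF assms(1)])

lemma bdd_poly_pev:
  assumes X: "finite X" and \<Omega>: "\<forall>x\<in>\<Omega>. \<forall>i. i \<notin> X \<longrightarrow> x i = w i"
  shows "\<exists>D. bdd_poly \<Omega> X D (\<lambda>x. pev x g)"
proof -
  have v: "bdd_poly \<Omega> X 1 (\<lambda>x. x i)" for i
  proof (cases "i \<in> X")
    case True
    then have "single i 1 \<in> exps X 1" by (auto simp: exps_def lookup_single when_def)
    from bdd_poly_monomial[OF X this, of \<Omega> 1] show ?thesis by simp
  next
    case False
    have "bdd_poly \<Omega> X 1 (\<lambda>_. w i)" by (rule bdd_poly_mono[OF X bdd_poly_const[OF X]]) simp
    then show ?thesis using \<Omega> False by (simp add: bdd_poly_def)
  qed
  define s where "s m = (\<Sum>i\<in>keys m. lookup m i * 1)" for m :: "nat \<Rightarrow>\<^sub>0 nat"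
  have m: "bdd_poly \<Omega> X (s m) (\<lambda>x. mon_ev x m)" for m
    unfolding mon_ev_def s_def by (intro bdd_poly_prod[OF X] bdd_poly_power[OF X] v)
  define D where "D = (\<Sum>m\<in>keys g. s m)"
  have "bdd_poly \<Omega> X D (\<lambda>x. \<Sum>m\<in>keys g. lookup g m * mon_ev x m)"
  proof (rule bdd_poly_sum)
    fix n assume "n \<in> keys g"
    then have "s n \<le> D" unfolding D_def by (intro member_le_sum) auto
    moreover have "bdd_poly \<Omega> X (0 + s n) (\<lambda>x. lookup g n * mon_ev x n)"
      by (rule bdd_poly_mult[OF X bdd_poly_const[OF X] m])
    ultimately show "bdd_poly \<Omega> X D (\<lambda>x. lookup g n * mon_ev x n)" using bdd_poly_mono[OF X] by simp
  qed
  then show ?thesis unfolding pev_def by blast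
qed

text \<open>For large \<open>e\<close> there are more than \<open>(e + 1)\<^sup>d\<^sup>+\<^sup>1\<close> monomials in the \<open>d + 1\<close> fractions, but the
  numerators lie in a space of dimension \<open>O(e\<^sup>d)\<close>.\<close>

lemma fractions_dependent:
  fixes a :: "nat \<Rightarrow> base_poly" and b :: base_poly
  assumes X: "finite X" "card X = d" and \<Omega>: "\<forall>x\<in>\<Omega>. \<forall>i. i \<notin> X \<longrightarrow> x i = w i"
  shows "\<exists>Q y. (\<forall>j\<ge>Suc d. y j = 1) \<and> pev y Q \<noteq> 0 \<and>
    (\<forall>x\<in>\<Omega>. pev x b \<noteq> 0 \<longrightarrow> pev (\<lambda>j. if j < Suc d then pev x (a j) / pev x b else 1) Q = 0)"
proof -
  have "\<forall>j. \<exists>D. bdd_poly \<Omega> X D (\<lambda>x. pev x (a j))" using bdd_poly_pev[OF X(1) \<Omega>] by blast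
  from choice[OF this] obtain Da where Da: "\<forall>j. bdd_poly \<Omega> X (Da j) (\<lambda>x. pev x (a j))" ..
  obtain Db where Db: "bdd_poly \<Omega> X Db (\<lambda>x. pev x b)" using bdd_poly_pev[OF X(1) \<Omega>] by blast
  define C where "C = Db + (\<Sum>j<Suc d. Da j)"
  have Ca: "bdd_poly \<Omega> X C (\<lambda>x. pev x (a j))" if "j < Suc d" for j
  proof -
    have "Da j \<le> (\<Sum>j<Suc d. Da j)" by (rule member_le_sum) (use that in auto)
    then show ?thesis using bdd_poly_mono[OF X(1) Da[rule_format, of j], of C] by (simp add: C_def)
  qed
  have Cb: "bdd_poly \<Omega> X C (\<lambda>x. pev x b)" by (rule bdd_poly_mono[OF X(1) Db]) (simp add: C_def)
  \<comment> \<open>With \<open>e = L ^ d\<close> the numerators have at most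
    \<open>(L * Suc e) ^ d = e * Suc e ^ d\<close> coefficients, which is less than
    \<open>Suc e ^ Suc d\<close>, the number of monomials in the fractions.\<close>
  define L where "L = Suc d * C + 1"
  define e where "e = L ^ d"
  define M where "M = exps {..<Suc d} e"
  let ?B = "exps X (Suc d * (e * C))"
  \<comment> \<open>The monomial \<open>m\<close> in the fractions, multiplied by
    \<open>pev x b ^ (Suc d * e)\<close> to make it polynomial.\<close>
  define P where "P m x = (\<Prod>j<Suc d. pev x (a j) ^ lookup m j * pev x b ^ (e - lookup m j))"
    for m :: "nat \<Rightarrow>\<^sub>0 nat" and x
  have "bdd_poly \<Omega> X (Suc d * (e * C)) (P m)" if m: "m \<in> M" for m
  proof -
    have "bdd_poly \<Omega> X (\<Sum>j<Suc d. e * C) (\<lambda>x. \<Prod>j<Suc d. pev x (a j) ^ lookup m j * pev x b ^ (e - lookup m j))"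
    proof (rule bdd_poly_prod[OF X(1)])
      fix j assume "j \<in> {..<Suc d}"
      then have "bdd_poly \<Omega> X (lookup m j * C + (e - lookup m j) * C) (\<lambda>x. pev x (a j) ^ lookup m j * pev x b ^ (e - lookup m j))"
        by (intro bdd_poly_mult bdd_poly_power X(1) Ca Cb) auto
      moreover have "lookup m j * C + (e - lookup m j) * C = e * C"
        using m by (simp add: M_def exps_def flip: add_mult_distrib)
      ultimately show "bdd_poly \<Omega> X (e * C) (\<lambda>x. pev x (a j) ^ lookup m j * pev x b ^ (e - lookup m j))" by simp
    qed
    then show ?thesis unfolding P_def by simp
  qed
  then have "\<forall>m\<in>M. \<exists>c. \<forall>x\<in>\<Omega>. P m x = (\<Sum>n\<in>?B. c n * mon_ev x n)" unfolding bdd_poly_def by blast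
  from bchoice[OF this] obtain G where G: "\<forall>m\<in>M. \<forall>x\<in>\<Omega>. P m x = (\<Sum>n\<in>?B. G m n * mon_ev x n)" ..
  have "card ?B = (Suc d * (e * C) + 1) ^ d" using card_exps[OF X(1)] X(2) by simp
  also have "\<dots> \<le> (L * Suc e) ^ d" unfolding L_def by (intro power_mono) (auto simp: algebra_simps)
  also have "\<dots> = e * Suc e ^ d" by (simp only: power_mult_distrib e_def)
  also have "\<dots> < Suc e ^ Suc d" by simp
  also have "\<dots> = card M" unfolding M_def by (subst card_exps) auto
  finally have card: "card ?B < card M" .
  obtain c where c: "\<exists>m\<in>M. c m \<noteq> 0" "\<forall>n\<in>?B. (\<Sum>m\<in>M. c m * G m n) = 0"
    using homogeneous_system[OF finite_exps[OF X(1)] _ card, of G] finite_exps[of "{..<Suc d}" e] unfolding M_def by blast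
  have fM: "finite M" unfolding M_def by (rule finite_exps) simp
  define Q where "Q = (\<Sum>m\<in>M. single m (c m))"
  have lQ: "lookup Q m = (if m \<in> M then c m else 0)" for m
    using fM by (simp add: Q_def lookup_sum lookup_single when_def)
  have "Q \<noteq> 0" using c(1) lQ by (metis lookup_zero)
  then obtain y where y: "pev y Q \<noteq> 0" using pev_eq_0_imp by blast
  define y' where "y' j = (if j < Suc d then y j else 1)" for j
  have "pev y' Q = pev y Q"
  proof (rule pev_cong)
    fix m v assume "m \<in> keys Q" "v \<in> keys m"
    then have "m \<in> M" by (simp add: in_keys_iff lQ split: if_splits)
    then have "v < Suc d" using \<open>v \<in> keys m\<close> by (auto simp: M_def exps_def)
    then show "y' v = y v" by (simp add: y'_def)
  qed
  then have "pev y' Q \<noteq> 0" using y by simp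
  moreover have "\<forall>j\<ge>Suc d. y' j = 1" by (simp add: y'_def)
  moreover have "pev (\<lambda>j. if j < Suc d then pev x (a j) / pev x b else 1) Q = 0" if x: "x \<in> \<Omega>" "pev x b \<noteq> 0" for x
  proof -
    let ?z = "\<lambda>j. if j < Suc d then pev x (a j) / pev x b else 1"
    have mz: "mon_ev ?z m * pev x b ^ (Suc d * e) = P m x" if m: "m \<in> M" for m
    proof -
      have "mon_ev ?z m = (\<Prod>j<Suc d. ?z j ^ lookup m j)"
        by (rule mon_ev_superset) (use m in \<open>auto simp: M_def exps_def\<close>)
      also have "\<dots> * pev x b ^ (Suc d * e) = (\<Prod>j<Suc d. ?z j ^ lookup m j * pev x b ^ e)"
        by (simp only: prod.distrib prod_constant card_lessThan power_mult[symmetric] mult.commute[of e])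
      also have "\<dots> = P m x"
        unfolding P_def
      proof (rule prod.cong[OF refl])
        fix j assume "j \<in> {..<Suc d}"
        moreover have "pev x b ^ e = pev x b ^ lookup m j * pev x b ^ (e - lookup m j)"
          using m by (simp add: M_def exps_def flip: power_add)
        ultimately show "?z j ^ lookup m j * pev x b ^ e = pev x (a j) ^ lookup m j * pev x b ^ (e - lookup m j)"
          using x(2) by (simp add: power_divide)
      qed
      finally show ?thesis .
    qed
    have "pev ?z Q * pev x b ^ (Suc d * e) = (\<Sum>m\<in>M. c m * (mon_ev ?z m * pev x b ^ (Suc d * e)))"
      by (simp only: Q_def pev_sum pev_single sum_distrib_right mult.assoc)
    also have "\<dots> = (\<Sum>m\<in>M. \<Sum>n\<in>?B. c m * G m n * mon_ev x n)"
    proof (rule sum.cong[OF refl])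
      fix m assume m: "m \<in> M"
      then have "mon_ev ?z m * pev x b ^ (Suc d * e) = (\<Sum>n\<in>?B. G m n * mon_ev x n)"
        using mz[OF m] G x(1) by metis
      then show "c m * (mon_ev ?z m * pev x b ^ (Suc d * e)) = (\<Sum>n\<in>?B. c m * G m n * mon_ev x n)"
        by (simp only: sum_distrib_left mult.assoc)
    qed
    also have "\<dots> = (\<Sum>n\<in>?B. (\<Sum>m\<in>M. c m * G m n) * mon_ev x n)"
      by (subst sum.swap) (simp add: sum_distrib_right)
    also have "\<dots> = 0" using c(2) by simp
    finally show ?thesis using x(2) by simp
  qed
  ultimately show ?thesis by (intro exI[of _ Q] exI[of _ y'] conjI ballI impI)
qed

lemma closedin_slip:
  "closedin (slip_topology r) C \<longleftrightarrow>
    closedin (hilb_topology (generic_hf TYPE(('a::finite, 'b::finite, 'c::finite) var) r)) C \<and> C \<subseteq> (slip r :: ('a, 'b, 'c) coxC set set)"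
  unfolding slip_topology_def
  by (rule closedin_closed_subtopology) (simp add: slip_def Let_def)

context config
begin

definition "free_idx = enc ` ({..<r} \<times> UNIV - special)"

lemma card_free_idx: "card free_idx = r * (CARD('a) + CARD('b) + CARD('c) - 3)"
proof -
  have "inj_on enc ({..<r} \<times> UNIV - special)" using enc_inj by (rule inj_on_subset) auto
  then have "card free_idx = card ({..<r} \<times> (UNIV :: ('a, 'b, 'c) var set) - special)"
    unfolding free_idx_def by (rule card_image)
  also have "{..<r} \<times> (UNIV :: ('a, 'b, 'c) var set) - special = {..<r} \<times> (UNIV - {Alpha a0, Beta b0, Gamma c0})"
    by (auto simp: special_def)
  also have "card \<dots> = r * (CARD(('a, 'b, 'c) var) - 3)"
    by (simp add: card_cartesian_product card_Diff_subset numeral_3_eq_3)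
  also have "CARD(('a, 'b, 'c) var) = CARD('a) + CARD('b) + CARD('c)"
  proof -
    have "CARD(('a, 'b, 'c) var) = card (range Alpha :: ('a, 'b, 'c) var set) + card (range Beta :: ('a, 'b, 'c) var set)
        + card (range Gamma :: ('a, 'b, 'c) var set)"
      unfolding UNIV_var by (subst card_Un_disjoint; (subst card_Un_disjoint)?) auto
    then show ?thesis by (simp add: card_image inj_on_def)
  qed
  finally show ?thesis .
qed

lemma normal_fixed: "\<forall>x\<in>normal. \<forall>i. i \<notin> free_idx \<longrightarrow> x i = (if i \<in> enc ` special then 1 else 0)"
proof (intro ballI allI impI)
  fix x i assume x: "x \<in> normal" and i: "i \<notin> free_idx"
  show "x i = (if i \<in> enc ` special then 1 else 0)"
  proof (cases "i \<in> enc ` special")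
    case True
    then show ?thesis using x by (auto simp: normal_def)
  next
    case False
    then have "i \<notin> E" using i by (auto simp: free_idx_def E_def)
    then show ?thesis using x False by (simp add: normal_def supp_def)
  qed
qed

lemma normal_nonempty: "\<exists>x. x \<in> normal"
  using nz_props(1)[of "\<lambda>_. 1"] by auto

text \<open>In a chart that meets all members, a longer chain would give \<open>d + 1\<close>
  algebraically independent functions on member \<open>d + 1\<close>, whereas on the slip component
  any \<open>d + 1\<close> chart functions satisfy an equation, being fractions in the
  \<open>d\<close> affine coordinates of the points.\<close>

lemma irreducible_chain_bound:
  fixes C :: "nat \<Rightarrow> ('a, 'b, 'c) coxC set set"
  assumes irr: "\<And>i. i \<le> n \<Longrightarrow> irreducible_closedin (slip_topology r) (C i)"
    and strict: "\<And>i. i < n \<Longrightarrow> C i \<subset> C (Suc i)"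
  shows "n \<le> card free_idx"
proof (rule ccontr)
  define d where "d = card free_idx"
  assume "\<not> n \<le> card free_idx"
  then have dn: "Suc d \<le> n" by (simp add: d_def)
  have cl: "closedin (hilb_topology h) (C i)" "C i \<subseteq> slip r" if "i \<le> n" for i
    using irr[OF that] by (auto simp: irreducible_closedin_def closedin_slip h)
  \<comment> \<open>A point of the smallest member lies in all of them, so a chart around it meets
    each.\<close>
  obtain I0 where I0: "I0 \<in> C 0" using irr[of 0] by (auto simp: irreducible_closedin_def)
  have I0C: "I0 \<in> C i" if "i \<le> n" for i
    using that
  proof (induction i)
    case (Suc i)
    then show ?case using strict[of i] by auto
  qed (use I0 in simp)
  have I0h: "I0 \<in> hilb h" using cl(1)[of 0] I0 closedin_subset topspace_hilb by blast
  define N where "N = (CARD('a) + CARD('b) + CARD('c)) * (r + 1)"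
  obtain B encc x0 where ch: "chart r r N h B encc"
    and x0: "x0 \<in> chart.pts N h B encc" "chart.Ix N B encc x0 = I0"
    using chart_exists[OF I0h[unfolded h] order_refl N_def h] by blast
  interpret ch: chart r r N h B encc by (rule ch)
  define U where "U g = {I. \<exists>x\<in>ch.pts. I = ch.Ix x \<and> pev x g \<noteq> 0}" for g
  have Uo: "openin (hilb_topology h) (U g)" for g unfolding U_def by (rule ch.chart_open)
  have Uc: "closedin (hilb_topology h) (hilb h - U g)" for g
    using Uo[of g] topspace_hilb[of h] by (metis closedin_def Diff_Diff_Int Diff_subset Int_absorb1 openin_subset)
  have Uiff: "ch.Ix x \<in> U g \<longleftrightarrow> pev x g \<noteq> 0" if "x \<in> ch.pts" for x g
    using that ch.pts_inj[OF that] by (auto simp: U_def)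
  have slipc: "closedin (hilb_topology h) (slip r :: ('a, 'b, 'c) coxC set set)" unfolding slip_eq by simp
  have Usl: "closedin (slip_topology r) (slip r - U g)" for g
  proof -
    have "(slip r - U g) = slip r \<inter> (hilb h - U g)"
      using closedin_subset[OF slipc] topspace_hilb[of h] by auto
    then show ?thesis using closedin_Int[OF slipc Uc[of g]] by (auto simp: closedin_slip h)
  qed
  define A where "A i = {x\<in>ch.pts. ch.Ix x \<in> C i}" for i
  have prime: "(\<forall>x\<in>A i. pev x g = 0) \<or> (\<forall>x\<in>A i. pev x g' = 0)"
    if i: "i \<le> n" and gg: "\<And>x. x \<in> A i \<Longrightarrow> pev x g * pev x g' = 0" for i g g'
  proof -
    have "C i \<subseteq> (slip r - U g) \<union> (slip r - U g')"
    proof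
      fix I assume I: "I \<in> C i"
      have "\<not> (I \<in> U g \<and> I \<in> U g')"
      proof
        assume UU: "I \<in> U g \<and> I \<in> U g'"
        then obtain x where x: "x \<in> ch.pts" "I = ch.Ix x" by (auto simp: U_def)
        then show False using UU Uiff[OF x(1)] gg[of x] I by (auto simp: A_def)
      qed
      then show "I \<in> (slip r - U g) \<union> (slip r - U g')" using cl(2)[OF i] I by blast
    qed
    then have "C i \<subseteq> slip r - U g \<or> C i \<subseteq> slip r - U g'"
      using irr[OF i] Usl[of g] Usl[of g'] unfolding irreducible_closedin_def by blast
    then show ?thesis using Uiff by (auto simp: A_def)
  qed
  have "\<exists>g. (\<forall>x\<in>A i. pev x g = 0) \<and> (\<exists>x\<in>A (Suc i). pev x g \<noteq> 0)" if i: "i < n" for i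
  proof -
    \<comment> \<open>By irreducibility a member that meets the chart is not the union of the
      previous member and its part outside the chart; so the inclusion stays strict inside the
      chart.\<close>
    have "\<not> C (Suc i) \<subseteq> C i \<union> (slip r - U 1)"
    proof
      assume "C (Suc i) \<subseteq> C i \<union> (slip r - U 1)"
      moreover have "closedin (slip_topology r) (C i)" using irr[of i] i by (simp add: irreducible_closedin_def)
      ultimately have "C (Suc i) \<subseteq> C i \<or> C (Suc i) \<subseteq> slip r - U 1"
        using irr[of "Suc i"] i Usl[of 1] unfolding irreducible_closedin_def by auto
      moreover have "I0 \<in> U 1" using Uiff[OF x0(1), of 1] x0(2) by simp
      ultimately show False using strict[OF i] I0C[of "Suc i"] i by auto
    qed
    then obtain I where I: "I \<in> C (Suc i)" "I \<notin> C i" "I \<in> U 1" using cl(2)[of "Suc i"] i by auto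
    then obtain x where x: "x \<in> ch.pts" "I = ch.Ix x" by (auto simp: U_def)
    obtain G where G: "\<forall>x\<in>ch.pts. ch.Ix x \<in> C i \<longleftrightarrow> (\<forall>g\<in>G. pev x g = 0)"
      using ch.chart_closed_pullback[OF cl(1)[of i]] i by auto
    then obtain g where g: "g \<in> G" "pev x g \<noteq> 0" using I(2) x by auto
    have "\<forall>x\<in>A i. pev x g = 0" using G g(1) by (auto simp: A_def)
    moreover have "x \<in> A (Suc i)" using x I(1) by (simp add: A_def)
    ultimately show ?thesis using g(2) by blast
  qed
  then have "\<forall>i. \<exists>g. i < n \<longrightarrow> (\<forall>x\<in>A i. pev x g = 0) \<and> (\<exists>x\<in>A (Suc i). pev x g \<noteq> 0)" by blast
  from choice[OF this] obtain f where f: "\<forall>i<n. (\<forall>x\<in>A i. pev x (f i) = 0) \<and> (\<exists>x\<in>A (Suc i). pev x (f i) \<noteq> 0)" by blast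
  \<comment> \<open>Otherwise the closed complement of the chart would contain all normalized good
    configurations, hence the slip component and with it \<open>I0\<close>.\<close>
  have "\<exists>x\<in>normal. good x \<and> \<I> x \<in> U 1"
  proof (rule ccontr)
    assume no: "\<not> ?thesis"
    obtain z where z: "z \<in> normal" using normal_nonempty by blast
    have "slip r \<subseteq> hilb h - U 1"
      by (rule slip_subset_closed_normal[OF Uc z, of 1]) (use no in \<open>auto simp: good_def\<close>)
    moreover have "I0 \<in> U 1" using Uiff[OF x0(1), of 1] x0(2) by simp
    ultimately show False using I0 cl(2)[of 0] by auto
  qed
  then obtain x1 where x1: "x1 \<in> normal" "good x1" "\<I> x1 \<in> U 1" by blast
  then obtain \<xi>1 where \<xi>1: "\<xi>1 \<in> ch.pts" "\<I> x1 = ch.Ix \<xi>1" by (auto simp: U_def)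
  have gh: "\<I> x \<in> hilb h" if "x \<in> {x. good x}" for x using that by (simp add: good_def)
  obtain b c where b: "pev x1 b \<noteq> 0" and c: "\<forall>x\<in>{x. good x}. pev x b \<noteq> 0 \<longrightarrow>
      (\<lambda>i. pev x (c i) / pev x b) \<in> ch.pts \<and> ch.Ix (\<lambda>i. pev x (c i) / pev x b) = \<I> x"
  proof -
    have "liftable {x. good x} \<I>" by (rule liftable_points) (rule gh)
    then have "\<exists>b c. pev x1 b \<noteq> 0 \<and> (\<forall>x\<in>{x. good x}. pev x b \<noteq> 0 \<longrightarrow>
        (\<lambda>i. pev x (c i) / pev x b) \<in> ch.pts \<and> ch.Ix (\<lambda>i. pev x (c i) / pev x b) = \<I> x)"
      by (rule ch.local_coordinates) (use x1(2) gh \<xi>1 in auto)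
    then show thesis by (elim exE conjE) (rule that)
  qed
  have "\<forall>j. \<exists>k a. \<forall>x. pev x b \<noteq> 0 \<longrightarrow> pev (\<lambda>i. pev x (c i) / pev x b) (f j) * pev x b ^ k = pev x a"
    using poly_subst_frac[of b c] by blast
  from choice[OF this] obtain k where "\<forall>j. \<exists>a. \<forall>x. pev x b \<noteq> 0 \<longrightarrow> pev (\<lambda>i. pev x (c i) / pev x b) (f j) * pev x b ^ k j = pev x a" ..
  from choice[OF this] obtain a where a: "\<forall>j. \<forall>x. pev x b \<noteq> 0 \<longrightarrow> pev (\<lambda>i. pev x (c i) / pev x b) (f j) * pev x b ^ k j = pev x (a j)" ..
  \<comment> \<open>The exponents \<open>k j\<close> differ; a common power of \<open>b\<close> is
    used as the denominator of all \<open>d + 1\<close> fractions.\<close>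
  define K where "K = (\<Sum>j<Suc d. k j)"
  have frac: "pev x (a j * b ^ (K - k j)) / pev x (b ^ K) = pev (\<lambda>i. pev x (c i) / pev x b) (f j)"
    if "pev x b \<noteq> 0" "j < Suc d" for x j
  proof -
    have "k j \<le> K" unfolding K_def by (rule member_le_sum) (use that in auto)
    then have "pev x (b ^ K) = pev x b ^ k j * pev x b ^ (K - k j)" by (simp add: pev_power flip: power_add)
    then show ?thesis using a[rule_format, OF that(1), of j, symmetric] that(1) by (simp add: pev_mult pev_power)
  qed
  have fin: "finite free_idx" by (simp add: free_idx_def)
  obtain Q y where y: "\<forall>j\<ge>Suc d. y j = 1" "pev y Q \<noteq> 0" and
    Q: "\<forall>x\<in>normal. pev x (b ^ K) \<noteq> 0 \<longrightarrow> pev (\<lambda>j. if j < Suc d then pev x (a j * b ^ (K - k j)) / pev x (b ^ K) else 1) Q = 0"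
    using fractions_dependent[where X = free_idx and \<Omega> = normal and a = "\<lambda>j. a j * b ^ (K - k j)" and b = "b ^ K"
        and w = "\<lambda>i. if i \<in> enc ` special then 1 else 0", OF fin d_def[symmetric] normal_fixed]
    by (elim exE conjE) (rule that)
  \<comment> \<open>\<open>G\<close> is \<open>Q\<close> applied to \<open>f 0, ..., f d\<close>, a
    function on the chart. It vanishes at normalized configurations in an open set, hence on the
    whole slip component inside the chart.\<close>
  obtain G where G: "\<forall>\<xi>. pev \<xi> G = pev (\<lambda>j. pev \<xi> (if j < Suc d then f j else 1)) Q"
    using poly_subst[of "\<lambda>j. if j < Suc d then f j else 1" Q] by (elim exE) (rule that)
  have G': "pev \<xi> G = pev (\<lambda>j. if j < Suc d then pev \<xi> (f j) else 1) Q" for \<xi>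
    unfolding G[rule_format] by (rule arg_cong[of _ _ "\<lambda>z. pev z Q"]) auto
  have "slip r \<subseteq> hilb h - U G"
  proof (rule slip_subset_closed_normal[OF Uc x1(1) b])
    fix x assume x: "x \<in> normal" "pev x b \<noteq> 0" "good x"
    let ?\<xi> = "\<lambda>i. pev x (c i) / pev x b"
    have \<xi>: "?\<xi> \<in> ch.pts" "ch.Ix ?\<xi> = \<I> x" using c x by auto
    have "(\<lambda>j. if j < Suc d then pev ?\<xi> (f j) else 1) =
        (\<lambda>j. if j < Suc d then pev x (a j * b ^ (K - k j)) / pev x (b ^ K) else 1)"
      using frac[OF x(2)] by auto
    then have "pev ?\<xi> G = 0" using Q x(1,2) unfolding G' by (simp add: pev_power)
    then show "\<I> x \<in> hilb h - U G" using Uiff[OF \<xi>(1), of G] \<xi>(2) gh[of x] x(3) by auto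
  qed
  then have "pev x G = 0" if "x \<in> A (Suc d)" for x
    using that cl(2)[OF dn] Uiff[of x G] by (auto simp: A_def)
  then have AQ: "pev (\<lambda>j. if j < Suc d then pev x (f j) else 1) Q = 0" if "x \<in> A (Suc d)" for x
    using that G' by simp
  have "pev y Q = 0"
  proof (rule chain_independent[where A = A and f = f and n = n and k = "Suc d" and Q = Q and y = y])
    show "A 0 \<noteq> {}" using x0 I0 by (auto simp: A_def)
    show "A i \<subseteq> A (Suc i)" if "i < n" for i using strict[OF that] by (auto simp: A_def)
    show "(\<forall>x\<in>A i. pev x g = 0) \<or> (\<forall>x\<in>A i. pev x g' = 0)"
      if "i \<le> n" "\<And>x. x \<in> A i \<Longrightarrow> pev x g * pev x g' = 0" for i g g'
      using that by (rule prime)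
  qed (use AQ f dn y(1) in auto)
  then show False using y(2) by simp
qed

end

section \<open>Lower bound for the dimension\<close>

lemma open_spans_mod:
  fixes q :: "'i \<Rightarrow> ('a::finite, 'b::finite, 'c::finite) coxC"
  assumes "finite B" "\<And>b. b \<in> B \<Longrightarrow> q b \<in> piece u"
  shows "openin (hilb_topology h) {I \<in> hilb h. spans_mod B q I u}"
proof (rule hilb_openI)
  fix Z and I :: "(nat \<Rightarrow> complex) \<Rightarrow> ('a, 'b, 'c) coxC set" and y0
  assume lift: "liftable Z I" and Ih: "\<And>x. x \<in> Z \<Longrightarrow> I x \<in> hilb h" and y0: "y0 \<in> Z"
    and "I y0 \<in> {I \<in> hilb h. spans_mod B q I u}"
  then have sp: "spans_mod B q (I y0) u" by simp
  have "\<exists>f. pev y0 f \<noteq> 0 \<and> (\<forall>x\<in>Z. pev x f \<noteq> 0 \<longrightarrow> spans_mod B q (I x) u)"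
    by (rule liftable_spans_mod[OF lift _ y0 assms sp]) (use Ih hilb_homogeneous in blast)
  then show "\<exists>g. pev y0 g \<noteq> 0 \<and> (\<forall>y\<in>Z. pev y g \<noteq> 0 \<longrightarrow> I y \<in> {I \<in> hilb h. spans_mod B q I u})"
    using Ih by blast
qed auto

lemma hilb_closed_compl:
  fixes U :: "('a::finite, 'b::finite, 'c::finite) coxC set set"
  assumes "openin (hilb_topology h) U"
  shows "closedin (hilb_topology h) (hilb h - U)"
  using assms topspace_hilb[of h] by (metis closedin_def Diff_Diff_Int Diff_subset Int_absorb1 openin_subset)

context config
begin

text \<open>The linear form in the variables \<open>v\<close> and \<open>spv v\<close> that vanishes
  at the \<open>k\<close>-th point of \<open>x\<close>; at another point its value is a two by two
  minor of coordinates.\<close>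

definition lin_form :: "(nat \<Rightarrow> complex) \<Rightarrow> nat \<Rightarrow> ('a, 'b, 'c) var \<Rightarrow> ('a, 'b, 'c) coxC" where
  "lin_form x k v = const_poly (x (enc (k, spv v))) * mono (single v 1) - const_poly (x (enc (k, v))) * mono (single (spv v) 1)"

lemma vdeg_spv: "vdeg (spv v) = vdeg v"
  by (cases v) auto

lemma lin_form_piece: "lin_form x k v \<in> piece (vdeg v)"
  unfolding lin_form_def by (intro piece_diff piece_const single_piece) (simp_all only: Mon_def mdeg_single_1 mem_Collect_eq vdeg_spv)

lemma pev_lin_form: "pev (cfg y j) (lin_form x k v) = x (enc (k, spv v)) * y (enc (j, v)) - x (enc (k, v)) * y (enc (j, spv v))"
  by (simp only: lin_form_def pev_diff pev_mult pev_const pev_single mon_ev_single cfg_def power_one_right mult_1)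

lemma good_sep:
  assumes "good x" "h u = r"
  shows "sep u {..<r} (cfg x)"
proof -
  obtain X where "X \<subseteq> {..<r}" "card X = h u" "sep u X (cfg x)"
    using sep_of_hilb[of r "cfg x" h u] assms(1) by (auto simp: good_def)
  then show ?thesis using assms(2) by (metis card_lessThan card_subset_eq finite_lessThan)
qed

text \<open>A form without zeros among the points acts invertibly on the functions on them, and
  degree \<open>w\<close> already realizes all such functions.\<close>

lemma spans_mod_multiples:
  assumes x: "good x" and w: "h w = r" and G: "G \<in> piece e"
    and ne: "\<And>j. j < r \<Longrightarrow> pev (cfg x j) G \<noteq> 0"
  shows "spans_mod (Mon w) (\<lambda>m. G * mono m) (\<I> x) (w + e)"
  unfolding spans_mod_def
proof
  fix f :: "('a, 'b, 'c) coxC" assume f: "f \<in> piece (w + e)"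
  obtain g where g: "dual_forms {..<r} (\<lambda>i. pev (cfg x i)) w g" using good_sep[OF x w] by blast
  define c where "c = (\<Sum>i<r. const_poly (pev (cfg x i) f / pev (cfg x i) G) * g i)"
  have cp: "c \<in> piece w" unfolding c_def using g by (intro piece_sum piece_const) (auto simp: dual_forms_def)
  have cj: "pev (cfg x j) c = pev (cfg x j) f / pev (cfg x j) G" if j: "j < r" for j
  proof -
    have "pev (cfg x j) c = (\<Sum>i<r. if i = j then pev (cfg x i) f / pev (cfg x i) G else 0)"
      unfolding c_def pev_sum using g j by (intro sum.cong refl) (auto simp: pev_mult dual_forms_def)
    then show ?thesis using j by simp
  qed
  have p: "f - G * c \<in> piece (w + e)"
    using piece_mult[OF G cp] by (intro piece_diff f) (simp add: add.commute)
  have "f - G * c \<in> \<I> x"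
    unfolding pideal_piece_iff[OF p] using cj ne by (simp add: pev_diff pev_mult)
  also have "G * c = G * (\<Sum>m\<in>Mon w. single m (lookup c m))" using piece_expand[OF cp] by simp
  also have "\<dots> = (\<Sum>m\<in>Mon w. const_poly (lookup c m) * (G * mono m))"
    unfolding sum_distrib_left by (intro sum.cong refl) (simp only: single_eq_const_mono[of _ "lookup c _"] mult.left_commute)
  finally show "\<exists>c. f - (\<Sum>b\<in>Mon w. const_poly (c b) * (G * mono b)) \<in> \<I> x"
    by (rule exI[where x = "lookup c"])
qed

lemma not_spans_mod_multiples:
  assumes nd: "nondeg (cfg x k)" and k: "k < r" and w: "0 \<le> w + e" and G: "G \<in> piece e" "pev (cfg x k) G = 0"
  shows "\<not> spans_mod (Mon w) (\<lambda>m. G * mono m) (\<I> x) (w + e)"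
proof
  assume sp: "spans_mod (Mon w) (\<lambda>m. G * mono m) (\<I> x) (w + e)"
  obtain m where m: "m \<in> Mon (w + e)" "mon_ev (cfg x k) m \<noteq> 0" using monomial_exists[OF w nd] by blast
  obtain c where c: "mono m - (\<Sum>b\<in>Mon w. const_poly (c b) * (G * mono b)) \<in> \<I> x"
    using sp[unfolded spans_mod_def, rule_format, OF single_piece[OF m(1)]] ..
  have "mono m - (\<Sum>b\<in>Mon w. const_poly (c b) * (G * mono b)) \<in> piece (w + e)"
  proof (intro piece_diff piece_sum piece_const single_piece[OF m(1)])
    fix b :: "('a, 'b, 'c) monom" assume "b \<in> Mon w"
    from piece_mult[OF G(1) single_piece[OF this]] show "G * mono b \<in> piece (w + e)" by (simp add: add.commute)
  qed
  from pideal_piece_iff[OF this] c k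
  have "pev (cfg x k) (mono m - (\<Sum>b\<in>Mon w. const_poly (c b) * (G * mono b))) = 0" by blast
  then show False using m(2) G(2) by (simp add: pev_diff pev_sum pev_mult)
qed

text \<open>In \<open>L n\<close> the first \<open>n\<close> affine coordinates move freely around a
  general \<open>x1\<close>. For strictness let \<open>enc (k, v)\<close> be the next coordinate. As
  long as it is kept, \<open>lin_form x1 k v\<close> vanishes at the \<open>k\<close>-th point and
  its multiples do not span degree \<open>w + vdeg v\<close> modulo the ideal; once it moves, they
  do at a general configuration. Spanning is an open condition, so it separates the
  closures.\<close>

lemma irreducible_chain_exists:
  assumes w: "0 \<le> w" "h w = r"
  shows "\<exists>C. (\<forall>i\<le>card free_idx. irreducible_closedin (slip_topology r) (C i :: ('a, 'b, 'c) coxC set set)) \<and>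
    (\<forall>i<card free_idx. C i \<subset> C (Suc i))"
proof -
  define d where "d = card free_idx"
  have fin: "finite free_idx" by (simp add: free_idx_def)
  obtain \<rho> where \<rho>: "bij_betw \<rho> {..<d} free_idx"
    using ex_bij_betw_nat_finite[OF fin] by (auto simp: d_def atLeast0LessThan)
  define dt where "dt = (\<lambda>(k, j, v). base_var (enc (k, spv v)) * base_var (enc (j, v)) - base_var (enc (k, v)) * base_var (enc (j, spv v)))"
  define P where "P = {(k, j, v). k < r \<and> j < r \<and> j \<noteq> k \<and> spv v \<noteq> v}"
  have fP: "finite P" by (rule finite_subset[of _ "{..<r} \<times> {..<r} \<times> UNIV"]) (auto simp: P_def)
  define q where "q = (\<Prod>e\<in>special. base_var (enc e)) * (\<Prod>t\<in>P. dt t)"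
  have spsp: "spv (spv v) = spv v" for v by (cases v) auto
  \<comment> \<open>All points lie on the affine chart and the \<open>j\<close>-th has its other
    coordinates equal to \<open>j\<close>; then each minor is \<open>j - k\<close>, not zero for
    different points.\<close>
  define p0 where "p0 j v = (if spv v = v then 1 else of_nat j :: complex)" for j :: nat and v
  have dt0: "pev (mk p0) (dt t) \<noteq> 0" if "t \<in> P" for t
    using that by (auto simp: P_def dt_def pev_diff pev_mult mk_enc p0_def spsp)
  have "pev (mk p0) (\<Prod>e\<in>special. base_var (enc e)) \<noteq> 0"
    by (auto simp: pev_prod special_def mk_enc p0_def)
  then have "pev (mk p0) q \<noteq> 0" using dt0 fP by (simp add: q_def pev_mult pev_prod)
  then obtain x1 where x1: "x1 \<in> supp" "pev x1 q \<noteq> 0" "good x1" using good_exists[OF mk_supp] by blast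
  have x1s: "x1 (enc e) \<noteq> 0" if "e \<in> special" for e using x1(2) that by (auto simp: q_def pev_mult pev_prod)
  have x1d: "pev x1 (dt t) \<noteq> 0" if "t \<in> P" for t using x1(2) that fP by (auto simp: q_def pev_mult pev_prod)
  obtain \<Delta> where \<Delta>: "pev x1 \<Delta> \<noteq> 0" "\<And>x. pev x \<Delta> \<noteq> 0 \<Longrightarrow> good x" using good_open[OF x1(3)] by blast
  define L where "L n = {x \<in> supp. pev x \<Delta> \<noteq> 0 \<and> (\<forall>i. i \<notin> \<rho> ` {..<n} \<longrightarrow> x i = x1 i)}" for n
  have x1L: "x1 \<in> L n" for n using x1 \<Delta>(1) by (simp add: L_def)
  have gL: "good x" if "x \<in> L n" for x n using that \<Delta>(2) by (simp add: L_def)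
  \<comment> \<open>Irreducibility of \<open>L n\<close>, in the form that two nonempty open subsets
    meet.\<close>
  have line: "\<exists>z\<in>L n. pev z f \<noteq> 0 \<and> pev z g \<noteq> 0"
    if xy: "x \<in> L n" "y \<in> supp" "\<forall>i. i \<notin> \<rho> ` {..<n} \<longrightarrow> y i = x1 i" "pev x f \<noteq> 0" "pev y g \<noteq> 0" for x y n f g
  proof -
    have "pev x (f * \<Delta>) \<noteq> 0" using xy by (simp add: L_def pev_mult)
    from common_nonzero[OF this xy(5)] obtain z where
      z: "pev z (f * \<Delta>) \<noteq> 0" "pev z g \<noteq> 0" "\<forall>v. x v = y v \<longrightarrow> z v = x v" by blast
    have "z \<in> supp" using z(3) xy(1,2) by (auto simp: L_def supp_def)
    then have "z \<in> L n" using z xy(1,3) by (auto simp: L_def pev_mult)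
    then show ?thesis using z by (auto simp: pev_mult)
  qed
  define C where "C n = hilb_topology h closure_of (\<I> ` L n)" for n
  have clC: "closedin (hilb_topology h) (C n)" for n by (simp add: C_def)
  have ILC: "\<I> ` L n \<subseteq> C n" for n
    unfolding C_def by (rule closure_of_subset) (use gL in \<open>auto simp: topspace_hilb good_def\<close>)
  have slipc: "closedin (hilb_topology h) (slip r :: ('a, 'b, 'c) coxC set set)" unfolding slip_eq by simp
  have Csl: "C n \<subseteq> slip r" for n
    unfolding C_def by (rule closure_of_minimal[OF _ slipc]) (use gL good_slip in blast)
  have irr: "irreducible_closedin (slip_topology r) (C n)" for n
    unfolding irreducible_closedin_def
  proof (intro conjI allI impI)
    show "closedin (slip_topology r) (C n)" using clC Csl by (simp add: closedin_slip h)
    show "C n \<noteq> {}" using ILC[of n] x1L[of n] by blast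
    fix A B assume AB: "closedin (slip_topology r) A \<and> closedin (slip_topology r) B \<and> C n \<subseteq> A \<union> B"
    then have cl: "closedin (hilb_topology h) A" "closedin (hilb_topology h) B" by (auto simp: closedin_slip h)
    obtain GA where GA: "\<forall>x\<in>supp. pev x \<Delta> \<noteq> 0 \<longrightarrow> (\<I> x \<in> A \<longleftrightarrow> (\<forall>g\<in>GA. pev x g = 0))"
      using points_closed_pullback[of \<Delta> A] \<Delta>(2) cl(1) by blast
    obtain GB where GB: "\<forall>x\<in>supp. pev x \<Delta> \<noteq> 0 \<longrightarrow> (\<I> x \<in> B \<longleftrightarrow> (\<forall>g\<in>GB. pev x g = 0))"
      using points_closed_pullback[of \<Delta> B] \<Delta>(2) cl(2) by blast
    have "\<I> ` L n \<subseteq> A \<or> \<I> ` L n \<subseteq> B"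
    proof (rule ccontr)
      assume "\<not> ?thesis"
      then obtain x y where xy: "x \<in> L n" "\<I> x \<notin> A" "y \<in> L n" "\<I> y \<notin> B" by blast
      obtain g where g: "g \<in> GA" "pev x g \<noteq> 0" using GA xy(1,2) by (auto simp: L_def)
      obtain g' where g': "g' \<in> GB" "pev y g' \<noteq> 0" using GB xy(3,4) by (auto simp: L_def)
      obtain z where z: "z \<in> L n" "pev z g \<noteq> 0" "pev z g' \<noteq> 0"
        using line[OF xy(1) _ _ g(2) g'(2)] xy(3) by (auto simp: L_def)
      have "\<I> z \<notin> A" "\<I> z \<notin> B" using GA GB z g(1) g'(1) by (auto simp: L_def)
      moreover have "\<I> z \<in> C n" using ILC z(1) by blast
      ultimately show False using AB by blast
    qed
    then show "C n \<subseteq> A \<or> C n \<subseteq> B" unfolding C_def using cl closure_of_minimal by blast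
  qed
  have strict: "C n \<subset> C (Suc n)" if n: "n < d" for n
  proof -
    have sub: "C n \<subseteq> C (Suc n)"
      unfolding C_def by (intro closure_of_mono image_mono) (auto simp: L_def lessThan_Suc)
    have "\<rho> n \<in> free_idx" using \<rho> n by (auto simp: bij_betw_def)
    then obtain k v where kv: "k < r" "(k, v) \<notin> special" "\<rho> n = enc (k, v)" by (auto simp: free_idx_def)
    have vs: "spv v \<noteq> v" using kv(1,2) by (cases v) (auto simp: special_def)
    have \<rho>n: "enc (k, v) \<notin> \<rho> ` {..<n}"
      using \<rho> n unfolding kv(3)[symmetric] bij_betw_def inj_on_def by force
    have "enc (k, spv v) \<notin> free_idx"
    proof
      assume "enc (k, spv v) \<in> free_idx"
      then obtain e where e: "e \<in> {..<r} \<times> UNIV - special" "enc (k, spv v) = enc e" by (auto simp: free_idx_def)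
      then have "(k, spv v) = e" using enc_inj kv(1) by (auto dest: inj_onD)
      then show False using e(1) spv_special[OF kv(1)] by auto
    qed
    then have \<rho>s: "enc (k, spv v) \<notin> \<rho> ` {..<m}" if "m \<le> d" for m using \<rho> that by (auto simp: bij_betw_def)
    let ?G = "lin_form x1 k v"
    define U where "U = {I \<in> hilb h. spans_mod (Mon w) (\<lambda>m. ?G * mono m) I (w + vdeg v)}"
    have "openin (hilb_topology h) U"
      unfolding U_def
    proof (rule open_spans_mod)
      fix b :: "('a, 'b, 'c) monom" assume "b \<in> Mon w"
      from piece_mult[OF lin_form_piece single_piece[OF this]]
      show "?G * mono b \<in> piece (w + vdeg v)" by (simp add: add.commute)
    qed simp
    then have Uc: "closedin (hilb_topology h) (hilb h - U)" by (rule hilb_closed_compl)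
    have w0: "0 \<le> w + vdeg v" using w(1) by (cases v) (auto simp: less_eq_prod_def zero_prod_def)
    have "\<I> ` L n \<subseteq> hilb h - U"
    proof safe
      fix x assume x: "x \<in> L n"
      then show "\<I> x \<in> hilb h" using gL by (auto simp: good_def)
      assume "\<I> x \<in> U"
      moreover have "x (enc (k, v)) = x1 (enc (k, v))" "x (enc (k, spv v)) = x1 (enc (k, spv v))"
        using x \<rho>n \<rho>s[of n] n by (auto simp: L_def)
      then have "pev (cfg x k) ?G = 0" by (simp add: pev_lin_form)
      moreover have "nondeg (cfg x k)" using gL[OF x] kv(1) by (simp add: good_def)
      ultimately show False
        using not_spans_mod_multiples[OF _ kv(1) w0 lin_form_piece] by (auto simp: U_def)
    qed
    then have CU: "C n \<subseteq> hilb h - U" unfolding C_def by (rule closure_of_minimal[OF _ Uc])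
    define Gj where "Gj j = const_poly (x1 (enc (k, spv v))) * base_var (enc (j, v)) - const_poly (x1 (enc (k, v))) * base_var (enc (j, spv v))" for j
    have Gj: "pev y (Gj j) = pev (cfg y j) ?G" for y j by (simp add: Gj_def pev_lin_form pev_diff pev_mult)
    have "pev x1 (Gj j) \<noteq> 0" if "j < r" "j \<noteq> k" for j
      using x1d[of "(k, j, v)"] that kv(1) vs by (simp add: P_def dt_def Gj_def pev_diff pev_mult)
    then have ne1: "pev x1 (\<Prod>j\<in>{..<r} - {k}. Gj j) \<noteq> 0" by (simp add: pev_prod)
    \<comment> \<open>Only the coordinate \<open>\<rho> n\<close> moves, by 1. This changes the
      value of the linear form at the \<open>k\<close>-th point from 0 to
      \<open>x1 (enc (k, spv v))\<close>. Goodness of \<open>x2\<close> is not claimed;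
      \<open>line\<close> combines it with \<open>x1\<close>.\<close>
    define x2 where "x2 = x1(\<rho> n := x1 (\<rho> n) + 1)"
    have "enc (k, v) \<in> E" using kv(1) by (auto simp: E_def)
    then have x2: "x2 \<in> supp" "\<forall>i. i \<notin> \<rho> ` {..<Suc n} \<longrightarrow> x2 i = x1 i"
    proof -
      have m: "\<rho> n \<in> \<rho> ` {..<Suc n}" by (rule imageI) simp
      show "x2 \<in> supp"
        using x1(1) \<open>enc (k, v) \<in> E\<close> by (auto simp: x2_def supp_def kv(3))
      show "\<forall>i. i \<notin> \<rho> ` {..<Suc n} \<longrightarrow> x2 i = x1 i" using m unfolding x2_def by auto
    qed
    have ks: "enc (k, spv v) \<noteq> enc (k, v)" using enc_inj kv(1) vs by (auto dest: inj_onD)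
    have "pev x2 (Gj k) = x1 (enc (k, spv v))"
      using ks by (simp add: Gj_def pev_diff pev_mult x2_def kv(3) algebra_simps)
    then have ne2: "pev x2 (Gj k) \<noteq> 0" using x1s[OF spv_special[OF kv(1)]] by simp
    obtain z where z: "z \<in> L (Suc n)" "pev z (\<Prod>j\<in>{..<r} - {k}. Gj j) \<noteq> 0" "pev z (Gj k) \<noteq> 0"
      using line[OF x1L x2 ne1 ne2] by blast
    have "pev (cfg z j) ?G \<noteq> 0" if "j < r" for j
      using z(2,3) that by (cases "j = k") (auto simp: Gj[symmetric] pev_prod)
    then have "spans_mod (Mon w) (\<lambda>m. ?G * mono m) (\<I> z) (w + vdeg v)"
      by (intro spans_mod_multiples[OF gL[OF z(1)] w(2) lin_form_piece])
    then have "\<I> z \<in> U" using gL[OF z(1)] by (simp add: U_def good_def)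
    moreover have "\<I> z \<in> C (Suc n)" using ILC z(1) by blast
    ultimately show ?thesis using CU sub by blast
  qed
  show ?thesis using irr strict unfolding d_def[symmetric] by blast
qed

lemma krull_dim_slip:
  assumes w: "0 \<le> w" "h w = r"
  shows "krull_dim (slip_topology r :: ('a, 'b, 'c) coxC set topology) = ereal (real (card free_idx))"
  unfolding krull_dim_def
proof (rule Sup_eqI)
  fix y assume "y \<in> {ereal (real n) |n. \<exists>C :: nat \<Rightarrow> ('a, 'b, 'c) coxC set set.
     (\<forall>i\<le>n. irreducible_closedin (slip_topology r) (C i)) \<and> (\<forall>i<n. C i \<subset> C (Suc i))}"
  then show "y \<le> ereal (real (card free_idx))" using irreducible_chain_bound by fastforce
next
  fix y assume "\<And>z. z \<in> {ereal (real n) |n. \<exists>C :: nat \<Rightarrow> ('a, 'b, 'c) coxC set set.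
     (\<forall>i\<le>n. irreducible_closedin (slip_topology r) (C i)) \<and> (\<forall>i<n. C i \<subset> C (Suc i))} \<Longrightarrow> z \<le> y"
  then show "ereal (real (card free_idx)) \<le> y" using irreducible_chain_exists[OF w] by blast
qed

end

section \<open>Homomorphisms in a chart\<close>

lemma sum_apply: "(\<Sum>t\<in>T. F t) f = (\<Sum>t\<in>T. F t f)"
  by (induction T rule: infinite_finite_induct) auto

context chart
begin

definition pairs :: "degree set \<Rightarrow> (('a, 'b, 'c) monom \<times> ('a, 'b, 'c) monom) set" where
  "pairs Dh = {(m, b). m \<in> MonS Dh \<and> b \<in> BM m}"

text \<open>The linearization at \<open>x\<close> of the equations \<open>x\<^bsub>zm,b'\<^esub> = \<Sum>\<^sub>b x\<^bsub>m,b\<^esub> x\<^bsub>zb,b'\<^esub>\<close> and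
  \<open>x\<^bsub>b,b'\<^esub> = \<delta>\<^bsub>b,b'\<^esub>\<close> between the coordinates.\<close>

definition Sol :: "degree set \<Rightarrow> (nat \<Rightarrow> complex) \<Rightarrow> (('a, 'b, 'c) monom \<times> ('a, 'b, 'c) monom \<Rightarrow> complex) set" where
  "Sol Dh x = {y. (\<forall>m z b'. m \<in> MonS Dh \<longrightarrow> single z 1 + m \<in> MonS Dh \<longrightarrow> b' \<in> BM (single z 1 + m) \<longrightarrow>
      y (single z 1 + m, b') = (\<Sum>b\<in>BM m. x (enc (m, b)) * y (single z 1 + b, b'))
        + (\<Sum>b\<in>BM m. y (m, b) * x (enc (single z 1 + b, b')))) \<and>
    (\<forall>b b'. b \<in> MonS Dh \<longrightarrow> b \<in> B \<longrightarrow> b' \<in> BM b \<longrightarrow> y (b, b') = 0)}"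

lemma lin_closed_Sol: "lin_closed (Sol Dh x)"
  unfolding lin_closed_def Sol_def
proof (intro conjI ballI allI CollectI impI; (elim CollectE conjE)?)
  fix u v :: "('a, 'b, 'c) monom \<times> ('a, 'b, 'c) monom \<Rightarrow> complex" and m b' :: "('a, 'b, 'c) monom" and z
  assume "m \<in> MonS Dh" "single z 1 + m \<in> MonS Dh" "b' \<in> BM (single z 1 + m)"
    and "\<forall>m z b'. m \<in> MonS Dh \<longrightarrow> single z 1 + m \<in> MonS Dh \<longrightarrow> b' \<in> BM (single z 1 + m) \<longrightarrow>
      u (single z 1 + m, b') = (\<Sum>b\<in>BM m. x (enc (m, b)) * u (single z 1 + b, b'))
        + (\<Sum>b\<in>BM m. u (m, b) * x (enc (single z 1 + b, b')))"
    and "\<forall>m z b'. m \<in> MonS Dh \<longrightarrow> single z 1 + m \<in> MonS Dh \<longrightarrow> b' \<in> BM (single z 1 + m) \<longrightarrow>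
      v (single z 1 + m, b') = (\<Sum>b\<in>BM m. x (enc (m, b)) * v (single z 1 + b, b'))
        + (\<Sum>b\<in>BM m. v (m, b) * x (enc (single z 1 + b, b')))"
  then have "u (single z 1 + m, b') = (\<Sum>b\<in>BM m. x (enc (m, b)) * u (single z 1 + b, b'))
        + (\<Sum>b\<in>BM m. u (m, b) * x (enc (single z 1 + b, b')))"
    "v (single z 1 + m, b') = (\<Sum>b\<in>BM m. x (enc (m, b)) * v (single z 1 + b, b'))
        + (\<Sum>b\<in>BM m. v (m, b) * x (enc (single z 1 + b, b')))" by blast+
  then show "u (single z 1 + m, b') + v (single z 1 + m, b') =
      (\<Sum>b\<in>BM m. x (enc (m, b)) * (u (single z 1 + b, b') + v (single z 1 + b, b')))
        + (\<Sum>b\<in>BM m. (u (m, b) + v (m, b)) * x (enc (single z 1 + b, b')))"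
    by (simp only: distrib_left distrib_right sum.distrib add_ac)
next
  fix c and v :: "('a, 'b, 'c) monom \<times> ('a, 'b, 'c) monom \<Rightarrow> complex" and m b' :: "('a, 'b, 'c) monom" and z
  assume "m \<in> MonS Dh" "single z 1 + m \<in> MonS Dh" "b' \<in> BM (single z 1 + m)"
    and "\<forall>m z b'. m \<in> MonS Dh \<longrightarrow> single z 1 + m \<in> MonS Dh \<longrightarrow> b' \<in> BM (single z 1 + m) \<longrightarrow>
      v (single z 1 + m, b') = (\<Sum>b\<in>BM m. x (enc (m, b)) * v (single z 1 + b, b'))
        + (\<Sum>b\<in>BM m. v (m, b) * x (enc (single z 1 + b, b')))"
  then have "v (single z 1 + m, b') = (\<Sum>b\<in>BM m. x (enc (m, b)) * v (single z 1 + b, b'))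
        + (\<Sum>b\<in>BM m. v (m, b) * x (enc (single z 1 + b, b')))" by blast
  then show "c * v (single z 1 + m, b') =
      (\<Sum>b\<in>BM m. x (enc (m, b)) * (c * v (single z 1 + b, b')))
        + (\<Sum>b\<in>BM m. (c * v (m, b)) * x (enc (single z 1 + b, b')))"
    by (simp only: distrib_left sum_distrib_left mult.assoc mult.left_commute[of c])
qed auto

lemma MonS_sub: "Dh \<subseteq> D \<Longrightarrow> m \<in> MonS Dh \<Longrightarrow> m \<in> MonS D"
  by (auto simp: MonS_def)

lemma MonS_iff: "m \<in> MonS Dh \<longleftrightarrow> mdeg m \<in> Dh"
  by (auto simp: MonS_def Mon_def)

lemma comb_in_Ix:
  assumes x: "x \<in> pts" and u: "u \<in> D" and c: "(\<Sum>b\<in>B \<inter> Mon u. const_poly (c b) * mono b) \<in> Ix x"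
    and b: "b \<in> B \<inter> Mon u"
  shows "c b = 0"
  using indep_pts[OF x u, unfolded indep_mod_def, THEN spec, of c] c b by blast

lemma rel_basis:
  assumes x: "x \<in> pts" and b: "b \<in> B"
  shows "rel x b = 0"
proof -
  have bD: "b \<in> MonS D" using b B_sub by auto
  have s: "(\<Sum>b'\<in>BM b. const_poly (if b' = b then 1 else 0) * mono b') = (mono b :: ('a, 'b, 'c) coxC)"
    using b by (subst sum.remove[of _ b]) (auto simp: Mon_def)
  have e: "rel x b = (\<Sum>b'\<in>BM b. const_poly ((if b' = b then 1 else 0) - x (enc (b, b'))) * mono b')"
    unfolding const_poly_diff left_diff_distrib sum_subtractf s rel_def ..
  have "(if b' = b then 1 else 0) - x (enc (b, b')) = 0" if b': "b' \<in> BM b" for b'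
    by (rule comb_in_Ix[OF x _ _ b', where c = "\<lambda>b'. (if b' = b then 1 else 0) - x (enc (b, b'))"])
      (use bD rel_in_Ix[OF bD, of x] in \<open>auto simp only: MonS_iff e\<close>)
  then show ?thesis unfolding e by (intro sum.neutral) auto
qed

text \<open>Rewriting the monomials of \<open>f\<close> by the relations leaves a combination of
  basis monomials in the ideal, whose coefficients vanish by independence.\<close>

lemma piece_rel:
  assumes x: "x \<in> pts" and u: "u \<in> D" and f: "f \<in> Ix x" "f \<in> piece u"
  shows "\<And>b. b \<in> B \<inter> Mon u \<Longrightarrow> (\<Sum>m\<in>Mon u. lookup f m * x (enc (m, b))) = 0"
    and "f = (\<Sum>m\<in>Mon u. const_poly (lookup f m) * rel x m)"
proof -
  have mu: "m \<in> MonS D" if "m \<in> Mon u" for m using that u by (auto simp: MonS_def)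
  have "(\<Sum>m\<in>Mon u. const_poly (lookup f m) * rel x m) = (\<Sum>m\<in>Mon u. const_poly (lookup f m) * mono m)
      - (\<Sum>m\<in>Mon u. \<Sum>b\<in>B \<inter> Mon u. const_poly (lookup f m * x (enc (m, b))) * mono b)"
    unfolding sum_subtractf[symmetric]
  proof (rule sum.cong[OF refl])
    fix m :: "('a, 'b, 'c) monom" assume "m \<in> Mon u"
    then have "mdeg m = u" by (simp add: Mon_def)
    then show "const_poly (lookup f m) * rel x m = const_poly (lookup f m) * mono m
        - (\<Sum>b\<in>B \<inter> Mon u. const_poly (lookup f m * x (enc (m, b))) * mono b)"
      by (simp only: rel_def right_diff_distrib sum_distrib_left const_poly_mult mult.assoc)
  qed
  also have "(\<Sum>m\<in>Mon u. \<Sum>b\<in>B \<inter> Mon u. const_poly (lookup f m * x (enc (m, b))) * mono b) =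
      (\<Sum>b\<in>B \<inter> Mon u. const_poly (\<Sum>m\<in>Mon u. lookup f m * x (enc (m, b))) * (mono b :: ('a, 'b, 'c) coxC))"
    by (subst sum.swap) (simp only: const_poly_sum sum_distrib_right)
  also have "(\<Sum>m\<in>Mon u. const_poly (lookup f m) * mono m) = f" using piece_expand[OF f(2)] by simp
  finally have e: "(\<Sum>m\<in>Mon u. const_poly (lookup f m) * rel x m) =
      f - (\<Sum>b\<in>B \<inter> Mon u. const_poly (\<Sum>m\<in>Mon u. lookup f m * x (enc (m, b))) * mono b)" .
  have "(\<Sum>m\<in>Mon u. const_poly (lookup f m) * rel x m) \<in> Ix x"
    by (intro ideal.subspace_sum[OF sub_Ix] ideal.subspace_scale[OF sub_Ix] rel_in_Ix mu)
  from ideal.subspace_diff[OF sub_Ix f(1) this]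
  have "(\<Sum>b\<in>B \<inter> Mon u. const_poly (\<Sum>m\<in>Mon u. lookup f m * x (enc (m, b))) * mono b) \<in> Ix x"
    unfolding e by (simp only: diff_diff_eq2 add_diff_cancel_left')
  from comb_in_Ix[OF x u this] show z: "\<And>b. b \<in> B \<inter> Mon u \<Longrightarrow> (\<Sum>m\<in>Mon u. lookup f m * x (enc (m, b))) = 0" .
  then show "f = (\<Sum>m\<in>Mon u. const_poly (lookup f m) * rel x m)" unfolding e by simp
qed

definition psim :: "(('a, 'b, 'c) monom \<times> ('a, 'b, 'c) monom \<Rightarrow> complex) \<Rightarrow> ('a, 'b, 'c) monom \<Rightarrow> ('a, 'b, 'c) coxC" where
  "psim y m = (\<Sum>b\<in>BM m. const_poly (y (m, b)) * mono b)"

text \<open>The candidate for a homomorphism is a linear map on the whole polynomial ring: a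
  monomial goes to the first-order change of its expansion in the basis, and degrees outside
  \<open>Dh\<close> go to 0.\<close>

definition psi :: "degree set \<Rightarrow> (('a, 'b, 'c) monom \<times> ('a, 'b, 'c) monom \<Rightarrow> complex) \<Rightarrow> ('a, 'b, 'c) coxC \<Rightarrow> ('a, 'b, 'c) coxC" where
  "psi Dh y f = (\<Sum>m\<in>MonS Dh. const_poly (lookup f m) * psim y m)"

lemma psim_piece: "psim y m \<in> piece (mdeg m)"
  unfolding psim_def by (intro piece_sum piece_const single_piece) auto

lemma psi_add: "psi Dh y (f + g) = psi Dh y f + psi Dh y g"
  by (simp only: psi_def lookup_add const_poly_add distrib_right sum.distrib)

lemma psi_const: "psi Dh y (const_poly c * f) = const_poly c * psi Dh y f"
  by (simp only: psi_def lookup_const_poly_mult const_poly_mult sum_distrib_left mult.assoc)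

lemma psi_0: "psi Dh y 0 = 0"
  by (simp add: psi_def)

lemma psi_sum: "psi Dh y (sum F A) = (\<Sum>a\<in>A. psi Dh y (F a))"
  by (induction A rule: infinite_finite_induct) (simp_all only: psi_0 psi_add sum.infinite sum.empty sum.insert not_False_eq_True)

lemma psi_mono: "finite Dh \<Longrightarrow> psi Dh y (mono m) = (if m \<in> MonS Dh then psim y m else 0)"
proof -
  assume "finite Dh"
  have "psi Dh y (mono m) = (\<Sum>n\<in>MonS Dh. if n = m then psim y m else 0)"
    unfolding psi_def by (intro sum.cong refl) (simp add: lookup_single when_def)
  then show ?thesis using \<open>finite Dh\<close> by simp
qed

lemma psi_piece:
  assumes "finite Dh" "f \<in> piece u"
  shows "psi Dh y f \<in> piece u" "psi Dh y f = (if u \<in> Dh then \<Sum>m\<in>Mon u. const_poly (lookup f m) * psim y m else 0)"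
proof -
  have "psi Dh y f = psi Dh y (\<Sum>m\<in>Mon u. const_poly (lookup f m) * mono m)" using piece_expand[OF assms(2)] by simp
  also have "\<dots> = (\<Sum>m\<in>Mon u. const_poly (lookup f m) * psi Dh y (mono m))" by (simp only: psi_sum psi_const)
  also have "\<dots> = (if u \<in> Dh then \<Sum>m\<in>Mon u. const_poly (lookup f m) * psim y m else 0)"
    by (auto simp: psi_mono[OF assms(1)] MonS_iff Mon_def simp del: const_poly_mult_single intro!: sum.cong sum.neutral)
  finally show e: "psi Dh y f = (if u \<in> Dh then \<Sum>m\<in>Mon u. const_poly (lookup f m) * psim y m else 0)" .
  have "psim y m \<in> piece u" if "m \<in> Mon u" for m using psim_piece[of y m] that by (simp add: Mon_def)
  then show "psi Dh y f \<in> piece u" unfolding e by (auto intro!: piece_sum piece_const)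
qed

text \<open>The linearized equations say that for a monomial \<open>m\<close> the failure to commute
  with the variable, corrected by the terms \<open>x (enc (m, b)) * psim y (single z 1 + b)\<close>,
  is a combination of relations. Summed over the monomials of an element of the ideal, the
  correction cancels.\<close>

lemma psi_variable:
  assumes x: "x \<in> pts" and y: "y \<in> Sol Dh x" and Dh: "finite Dh" "Dh \<subseteq> D"
    and f: "f \<in> Ix x" "f \<in> piece u" and u: "u \<in> Dh" "vdeg z + u \<in> Dh"
  shows "psi Dh y (mono (single z 1) * f) - mono (single z 1) * psi Dh y f \<in> Ix x"
proof -
  let ?z = "single z 1"
  have uD: "u \<in> D" using u Dh by blast
  have deg: "mdeg m = u" "m \<in> MonS Dh" "?z + m \<in> MonS Dh" "mdeg (?z + m) = vdeg z + u" if "m \<in> Mon u" for m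
    using that u by (auto simp: Mon_def MonS_iff mdeg_add simp del: One_nat_def)
  define T where "T m = psim y (?z + m) - mono ?z * psim y m - (\<Sum>b\<in>B \<inter> Mon u. const_poly (x (enc (m, b))) * psim y (?z + b))" for m
  let ?B' = "B \<inter> Mon (vdeg z + u)"
  have T: "T m \<in> Ix x" if m: "m \<in> Mon u" for m
  proof -
    have BMm: "BM m = B \<inter> Mon u" "BM (?z + m) = ?B'" using deg[OF m] by simp_all
    have B: "BM (?z + b) = ?B'" "?z + b \<in> MonS D" if "b \<in> B \<inter> Mon u" for b
      using deg[of b] that Dh by (auto simp: MonS_iff)
    have sol: "y (?z + m, b') = (\<Sum>b\<in>B \<inter> Mon u. x (enc (m, b)) * y (?z + b, b')) + (\<Sum>b\<in>B \<inter> Mon u. y (m, b) * x (enc (?z + b, b')))"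
      if "b' \<in> ?B'" for b'
      using y deg[OF m] that unfolding Sol_def BMm[symmetric] by blast
    have p1: "psim y (?z + m) = (\<Sum>b\<in>B \<inter> Mon u. const_poly (x (enc (m, b))) * psim y (?z + b))
        + (\<Sum>b\<in>B \<inter> Mon u. const_poly (y (m, b)) * (\<Sum>b'\<in>?B'. const_poly (x (enc (?z + b, b'))) * mono b'))"
    proof -
      have "psim y (?z + m) = (\<Sum>b'\<in>?B'. (\<Sum>b\<in>B \<inter> Mon u. const_poly (x (enc (m, b)) * y (?z + b, b')) * mono b')
          + (\<Sum>b\<in>B \<inter> Mon u. const_poly (y (m, b) * x (enc (?z + b, b'))) * mono b'))"
        unfolding psim_def BMm(2)
        by (intro sum.cong refl) (simp only: sol const_poly_add const_poly_sum distrib_right sum_distrib_right)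
      also have "\<dots> = (\<Sum>b\<in>B \<inter> Mon u. \<Sum>b'\<in>?B'. const_poly (x (enc (m, b)) * y (?z + b, b')) * mono b')
          + (\<Sum>b\<in>B \<inter> Mon u. \<Sum>b'\<in>?B'. const_poly (y (m, b) * x (enc (?z + b, b'))) * mono b')"
        unfolding sum.distrib by (intro arg_cong2[where f = "(+)"] sum.swap)
      also have "(\<Sum>b\<in>B \<inter> Mon u. \<Sum>b'\<in>?B'. const_poly (x (enc (m, b)) * y (?z + b, b')) * (mono b' :: ('a, 'b, 'c) coxC)) =
          (\<Sum>b\<in>B \<inter> Mon u. const_poly (x (enc (m, b))) * psim y (?z + b))"
        by (intro sum.cong refl) (simp only: psim_def B(1) sum_distrib_left const_poly_mult mult.assoc)
      also have "(\<Sum>b\<in>B \<inter> Mon u. \<Sum>b'\<in>?B'. const_poly (y (m, b) * x (enc (?z + b, b'))) * (mono b' :: ('a, 'b, 'c) coxC)) =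
          (\<Sum>b\<in>B \<inter> Mon u. const_poly (y (m, b)) * (\<Sum>b'\<in>?B'. const_poly (x (enc (?z + b, b'))) * mono b'))"
        by (intro sum.cong refl) (simp only: sum_distrib_left const_poly_mult mult.assoc)
      finally show ?thesis .
    qed
    have p2: "mono ?z * psim y m = (\<Sum>b\<in>B \<inter> Mon u. const_poly (y (m, b)) * mono (?z + b))"
      unfolding psim_def BMm(1) sum_distrib_left by (intro sum.cong refl) (simp only: mono_add mult.left_commute)
    have "T m = - (\<Sum>b\<in>B \<inter> Mon u. const_poly (y (m, b)) * rel x (?z + b))"
    proof -
      have "(\<Sum>b\<in>B \<inter> Mon u. const_poly (y (m, b)) * rel x (?z + b)) = (\<Sum>b\<in>B \<inter> Mon u. const_poly (y (m, b)) * mono (?z + b))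
          - (\<Sum>b\<in>B \<inter> Mon u. const_poly (y (m, b)) * (\<Sum>b'\<in>?B'. const_poly (x (enc (?z + b, b'))) * mono b'))"
        unfolding sum_subtractf[symmetric] by (intro sum.cong refl) (simp only: rel_def B(1) right_diff_distrib)
      then show ?thesis unfolding T_def p1 p2 by (simp only: minus_diff_eq) simp
    qed
    then show ?thesis
      using B(2) by (auto intro!: ideal.subspace_neg[OF sub_Ix] ideal.subspace_sum[OF sub_Ix] ideal.subspace_scale[OF sub_Ix] rel_in_Ix)
  qed
  have zf: "mono ?z * f \<in> piece (vdeg z + u)"
    by (rule piece_mult[OF single_piece f(2)]) (simp only: Mon_def mdeg_single_1 mem_Collect_eq)
  have "mono ?z * f = (\<Sum>m\<in>Mon u. const_poly (lookup f m) * mono (?z + m))"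
  proof -
    have "mono ?z * f = mono ?z * (\<Sum>m\<in>Mon u. const_poly (lookup f m) * mono m)" using piece_expand[OF f(2)] by simp
    then show ?thesis unfolding sum_distrib_left by (simp only: mono_add mult.left_commute)
  qed
  then have "psi Dh y (mono ?z * f) = (\<Sum>m\<in>Mon u. const_poly (lookup f m) * psi Dh y (mono (?z + m)))"
    by (simp only: psi_sum psi_const)
  also have "\<dots> = (\<Sum>m\<in>Mon u. const_poly (lookup f m) * psim y (?z + m))"
    by (intro sum.cong refl) (simp only: psi_mono[OF Dh(1)] deg if_True)
  finally have e1: "psi Dh y (mono ?z * f) = (\<Sum>m\<in>Mon u. const_poly (lookup f m) * psim y (?z + m))" .
  have e2: "mono ?z * psi Dh y f = (\<Sum>m\<in>Mon u. const_poly (lookup f m) * (mono ?z * psim y m))"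
    using psi_piece(2)[OF Dh(1) f(2)] u(1) by (simp only: if_True sum_distrib_left mult.left_commute)
  \<comment> \<open>The coefficient of each basis monomial is zero by the first part of
    \<open>piece_rel\<close>, as \<open>f\<close> lies in the ideal.\<close>
  have e3: "(\<Sum>m\<in>Mon u. const_poly (lookup f m) * (\<Sum>b\<in>B \<inter> Mon u. const_poly (x (enc (m, b))) * psim y (?z + b))) = 0"
  proof -
    have "(\<Sum>m\<in>Mon u. const_poly (lookup f m) * (\<Sum>b\<in>B \<inter> Mon u. const_poly (x (enc (m, b))) * psim y (?z + b))) =
      (\<Sum>m\<in>Mon u. \<Sum>b\<in>B \<inter> Mon u. const_poly (lookup f m * x (enc (m, b))) * psim y (?z + b))"
      by (simp only: sum_distrib_left const_poly_mult mult.assoc)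
    also have "\<dots> = (\<Sum>b\<in>B \<inter> Mon u. const_poly (\<Sum>m\<in>Mon u. lookup f m * x (enc (m, b))) * psim y (?z + b))"
      by (subst sum.swap) (simp only: const_poly_sum sum_distrib_right)
    also have "\<dots> = 0" using piece_rel(1)[OF x uD f] by (intro sum.neutral ballI) simp
    finally show ?thesis .
  qed
  have "(\<Sum>m\<in>Mon u. const_poly (lookup f m) * T m) \<in> Ix x"
    by (intro ideal.subspace_sum[OF sub_Ix] ideal.subspace_scale[OF sub_Ix] T)
  also have "(\<Sum>m\<in>Mon u. const_poly (lookup f m) * T m) = psi Dh y (mono ?z * f) - mono ?z * psi Dh y f"
    unfolding T_def right_diff_distrib sum_subtractf e3 e1 e2 by simp
  finally show ?thesis .
qed

text \<open>It suffices to multiply homogeneous elements by a variable. If the product has its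
  degree outside \<open>Dh\<close>, everything of that degree is in \<open>K\<close>; otherwise the
  factor has its degree in \<open>Dh\<close> as well, by \<open>down\<close>, and there
  \<open>K\<close> agrees with the ideal of the chart.\<close>

lemma psi_hom:
  assumes x: "x \<in> pts" and y: "y \<in> Sol Dh x" and Dh: "finite Dh" "Dh \<subseteq> D"
    and down: "\<And>(z :: ('a, 'b, 'c) var) u. vdeg z + u \<in> Dh \<Longrightarrow> 0 \<le> u \<Longrightarrow> u \<in> Dh"
    and K: "homogeneous_ideal K" "\<And>u f. u \<in> Dh \<Longrightarrow> f \<in> piece u \<Longrightarrow> f \<in> K \<longleftrightarrow> f \<in> Ix x"
    and K': "\<And>u. u \<notin> Dh \<Longrightarrow> piece u \<subseteq> K"
  shows "psi Dh y \<in> hom0_lifts K"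
proof -
  have sK: "ideal.subspace K" using K(1) by (rule homogeneous_ideal_subspace)
  define H where "H a \<longleftrightarrow> (\<forall>f\<in>K. psi Dh y (a * f) - a * psi Dh y f \<in> K)" for a
  have Hvar: "H (mono (single z 1))" for z
    unfolding H_def
  proof
    fix f assume f: "f \<in> K"
    let ?z = "mono (single z 1) :: ('a, 'b, 'c) coxC"
    have "psi Dh y (?z * hcomp u f) - ?z * psi Dh y (hcomp u f) \<in> K" for u
    proof -
      have fu: "hcomp u f \<in> K" by (rule homogeneous_ideal_hcomp[OF K(1) f])
      have zp: "?z \<in> piece (vdeg z)" by (rule single_piece) (simp only: Mon_def mdeg_single_1 mem_Collect_eq)
      have p: "psi Dh y (?z * hcomp u f) - ?z * psi Dh y (hcomp u f) \<in> piece (vdeg z + u)"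
        by (intro piece_diff psi_piece(1)[OF Dh(1)] piece_mult[OF zp] hcomp_piece)
      show ?thesis
      proof (cases "vdeg z + u \<in> Dh")
        case False
        then show ?thesis using K'[OF False] p by blast
      next
        case True
        show ?thesis
        proof (cases "0 \<le> u")
          case False
          then have "keys (hcomp u f) \<subseteq> {}" using hcomp_piece[of u f] unfolding piece_iff Mon_neg[OF False] by blast
          then have "hcomp u f = 0" by simp
          then show ?thesis by (simp add: psi_0 ideal.subspace_0[OF sK])
        next
          case u0: True
          then have u: "u \<in> Dh" by (rule down[OF True])
          then have "hcomp u f \<in> Ix x" using K(2)[OF u hcomp_piece] fu by blast
          from psi_variable[OF x y Dh this hcomp_piece u True] show ?thesis using K(2)[OF True p] by blast
        qed
      qed
    qed
    then have "(\<Sum>u\<in>mdeg ` keys f. psi Dh y (?z * hcomp u f) - ?z * psi Dh y (hcomp u f)) \<in> K"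
      by (intro ideal.subspace_sum[OF sK])
    also have "(\<Sum>u\<in>mdeg ` keys f. psi Dh y (?z * hcomp u f) - ?z * psi Dh y (hcomp u f)) =
        psi Dh y (?z * (\<Sum>u\<in>mdeg ` keys f. hcomp u f)) - ?z * psi Dh y (\<Sum>u\<in>mdeg ` keys f. hcomp u f)"
      by (simp only: sum_subtractf sum_distrib_left psi_sum)
    also have "(\<Sum>u\<in>mdeg ` keys f. hcomp u f) = f" using hcomp_decompose[of f] ..
    finally show "psi Dh y (?z * f) - ?z * psi Dh y f \<in> K" .
  qed
  have Hmult: "H (a * b)" if a: "H a" and b: "H b" for a b
    unfolding H_def
  proof
    fix f assume f: "f \<in> K"
    have "(psi Dh y (a * (b * f)) - a * psi Dh y (b * f)) + a * (psi Dh y (b * f) - b * psi Dh y f) \<in> K"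
      by (intro ideal.subspace_add[OF sK] ideal.subspace_scale[OF sK]
          a[unfolded H_def, rule_format] b[unfolded H_def, rule_format] f)
    then show "psi Dh y (a * b * f) - a * b * psi Dh y f \<in> K" by (simp only: right_diff_distrib mult.assoc add_diff_eq diff_add_cancel)
  qed
  have Hmono: "H (mono m)" for m
  proof (induction m rule: monom_induct)
    case zero
    then show ?case by (simp add: H_def ideal.subspace_0[OF sK])
  next
    case (add m v)
    then show ?case unfolding mono_add by (intro Hmult Hvar)
  qed
  have Hall: "H a" for a
    unfolding H_def
  proof
    fix f assume f: "f \<in> K"
    have "(\<Sum>m\<in>keys a. const_poly (lookup a m) * (psi Dh y (mono m * f) - mono m * psi Dh y f)) \<in> K"
      using Hmono f unfolding H_def by (intro ideal.subspace_sum[OF sK] ideal.subspace_scale[OF sK]) blast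
    also have "(\<Sum>m\<in>keys a. const_poly (lookup a m) * (psi Dh y (mono m * f) - mono m * psi Dh y f)) =
        psi Dh y ((\<Sum>m\<in>keys a. const_poly (lookup a m) * mono m) * f) - (\<Sum>m\<in>keys a. const_poly (lookup a m) * mono m) * psi Dh y f"
      by (simp only: right_diff_distrib sum_subtractf sum_distrib_right psi_sum psi_const mult.assoc)
    also have "(\<Sum>m\<in>keys a. const_poly (lookup a m) * mono m) = a" using poly_expand[of a] by simp
    finally show "psi Dh y (a * f) - a * psi Dh y f \<in> K" .
  qed
  show ?thesis
    unfolding hom0_lifts_def
  proof (intro CollectI conjI ballI allI)
    show "psi Dh y (f + g) - (psi Dh y f + psi Dh y g) \<in> K" for f g
      by (simp add: psi_add ideal.subspace_0[OF sK])
    show "psi Dh y (a * f) - a * psi Dh y f \<in> K" if "f \<in> K" for a f using Hall that by (auto simp: H_def)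
    show "psi Dh y f \<in> piece u + K" if "f \<in> K \<inter> piece u" for f u
      using set_plus_intro[OF psi_piece(1)[OF Dh(1), of f u y] ideal.subspace_0[OF sK]] that by simp
  qed
qed

definition indep_on :: "degree set \<Rightarrow> 't set \<Rightarrow> ('t \<Rightarrow> ('a, 'b, 'c) monom \<times> ('a, 'b, 'c) monom \<Rightarrow> complex) \<Rightarrow> bool" where
  "indep_on Dh T y \<longleftrightarrow> (\<forall>c. (\<forall>p\<in>pairs Dh. (\<Sum>t\<in>T. c t * y t p) = 0) \<longrightarrow> (\<forall>t\<in>T. c t = 0))"

lemma dim_hom0_ge:
  assumes x: "x \<in> pts" and Dh: "finite Dh" "Dh \<subseteq> D"
    and down: "\<And>(z :: ('a, 'b, 'c) var) u. vdeg z + u \<in> Dh \<Longrightarrow> 0 \<le> u \<Longrightarrow> u \<in> Dh"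
    and K: "homogeneous_ideal K" "\<And>u f. u \<in> Dh \<Longrightarrow> f \<in> piece u \<Longrightarrow> f \<in> K \<longleftrightarrow> f \<in> Ix x"
    and K': "\<And>u. u \<notin> Dh \<Longrightarrow> piece u \<subseteq> K"
    and T: "finite T" "\<And>t. t \<in> T \<Longrightarrow> y t \<in> Sol Dh x" "indep_on Dh T y"
  shows "enat (card T) \<le> dim_hom0 K"
  unfolding dim_hom0_def
proof (rule dim_quotient_ge[OF T(1)])
  show "psi Dh (y t) \<in> hom0_lifts K" if "t \<in> T" for t by (rule psi_hom[OF x T(2)[OF that] Dh down K K'])
  fix c assume c: "(\<Sum>t\<in>T. (\<lambda>f. cox_scale (c t) (psi Dh (y t) f))) \<in> {\<phi>. \<forall>f\<in>K. \<phi> f \<in> K}"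
  have "(\<Sum>t\<in>T. c t * y t p) = 0" if p: "p \<in> pairs Dh" for p
  proof -
    obtain m b where mb: "m \<in> MonS Dh" "b \<in> BM m" "p = (m, b)" using p by (auto simp: pairs_def)
    have mD: "m \<in> MonS D" by (rule MonS_sub[OF Dh(2) mb(1)])
    have u: "mdeg m \<in> Dh" "mdeg m \<in> D" using mb(1) mD by (auto simp: MonS_iff)
    \<comment> \<open>The homomorphisms are told apart by their values on the relations, which have
      the entries of \<open>y t\<close> as coefficients.\<close>
    have "rel x m \<in> K" using K(2)[OF u(1) rel_piece] rel_in_Ix[OF mD] by blast
    then have "(\<Sum>t\<in>T. (\<lambda>f. cox_scale (c t) (psi Dh (y t) f))) (rel x m) \<in> K" using c by blast
    then have inK: "(\<Sum>t\<in>T. const_poly (c t) * psi Dh (y t) (rel x m)) \<in> K"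
      by (simp only: sum_apply cox_scale_def)
    have ps: "psi Dh (y t) (rel x m) = psim (y t) m" if t: "t \<in> T" for t
    proof -
      have "psi Dh (y t) (rel x m) = psi Dh (y t) (mono m) - (\<Sum>b\<in>BM m. const_poly (x (enc (m, b))) * psi Dh (y t) (mono b))"
      proof -
        have "psi Dh (y t) (rel x m) + psi Dh (y t) (\<Sum>b\<in>BM m. const_poly (x (enc (m, b))) * mono b) = psi Dh (y t) (mono m)"
          unfolding psi_add[symmetric] rel_def by (simp only: diff_add_cancel)
        then show ?thesis by (simp only: psi_sum psi_const eq_diff_eq)
      qed
      \<comment> \<open>Solutions vanish on basis monomials, by the second group of
        equations.\<close>
      moreover have "psi Dh (y t) (mono b) = 0" if b: "b \<in> BM m" for b
      proof -
        have "y t (b, b') = 0" if "b' \<in> BM b" for b'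
          using T(2)[OF t] b that mb(1) unfolding Sol_def by (auto simp: MonS_iff Mon_def)
        then show ?thesis unfolding psi_mono[OF Dh(1)] psim_def by (auto intro!: sum.neutral)
      qed
      ultimately show ?thesis using mb(1) by (simp add: psi_mono[OF Dh(1)])
    qed
    have e: "(\<Sum>t\<in>T. const_poly (c t) * psi Dh (y t) (rel x m)) = (\<Sum>b\<in>BM m. const_poly (\<Sum>t\<in>T. c t * y t (m, b)) * mono b)"
    proof -
      have "(\<Sum>t\<in>T. const_poly (c t) * psi Dh (y t) (rel x m)) = (\<Sum>t\<in>T. const_poly (c t) * psim (y t) m)"
        by (intro sum.cong refl) (simp only: ps)
      also have "\<dots> = (\<Sum>t\<in>T. \<Sum>b\<in>BM m. const_poly (c t * y t (m, b)) * mono b)"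
        by (simp only: psim_def sum_distrib_left const_poly_mult mult.assoc)
      also have "\<dots> = (\<Sum>b\<in>BM m. const_poly (\<Sum>t\<in>T. c t * y t (m, b)) * mono b)"
        by (subst sum.swap) (simp only: const_poly_sum sum_distrib_right)
      finally show ?thesis .
    qed
    have "(\<Sum>b\<in>BM m. const_poly (\<Sum>t\<in>T. c t * y t (m, b)) * mono b) \<in> (piece (mdeg m) :: ('a, 'b, 'c) coxC set)"
      by (intro piece_sum piece_const single_piece) auto
    then have "(\<Sum>b\<in>BM m. const_poly (\<Sum>t\<in>T. c t * y t (m, b)) * mono b) \<in> Ix x"
      using inK K(2)[OF u(1)] unfolding e by blast
    from comb_in_Ix[OF x u(2) this mb(2)] show ?thesis by (simp add: mb(3))
  qed
  then show "\<forall>t\<in>T. c t = 0" using T(3) unfolding indep_on_def by blast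
qed

lemma finite_pairs: "finite Dh \<Longrightarrow> finite (pairs Dh)"
  by (rule finite_subset[of _ "MonS Dh \<times> B"]) (auto simp: pairs_def)

text \<open>\<open>E\<close> is a set of pivots of the solution space at \<open>x0\<close>, so a
  solution at \<open>x0\<close> that vanishes on \<open>E\<close> is zero. This is an identity
  between linear forms at \<open>x0\<close>; \<open>nakayama\<close> extends it, with a denominator
  \<open>f\<close>, to all \<open>x\<close> with \<open>pev x f \<noteq> 0\<close>, and there the
  values on \<open>E\<close> determine a solution.\<close>

lemma Sol_semicontinuous:
  assumes Dh: "finite Dh" "Dh \<subseteq> D"
  obtains E :: "(('a, 'b, 'c) monom \<times> ('a, 'b, 'c) monom) set" and w where "finite E" "\<And>t. t \<in> E \<Longrightarrow> w t \<in> Sol Dh x0" "indep_on Dh E w"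
    "\<exists>f. pev x0 f \<noteq> 0 \<and> (\<forall>x. pev x f \<noteq> 0 \<longrightarrow> (\<forall>T :: 't set. \<forall>y. finite T \<longrightarrow> (\<forall>t\<in>T. y t \<in> Sol Dh x) \<longrightarrow>
      indep_on Dh T y \<longrightarrow> card T \<le> card E))"
proof -
  let ?P = "pairs Dh"
  have fP: "finite ?P" using Dh(1) by (rule finite_pairs)
  obtain E w where E: "E \<subseteq> ?P" and w: "dual_family (Sol Dh x0) E w"
    and max: "\<And>v. v \<in> Sol Dh x0 \<Longrightarrow> (\<And>e. e \<in> E \<Longrightarrow> v e = 0) \<Longrightarrow> (\<forall>a\<in>?P. v a = 0)"
    using maximal_dual_family[OF lin_closed_Sol fP] by blast
  have fE: "finite E" using E fP finite_subset by blast
  have indE: "indep_on Dh E w"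
    unfolding indep_on_def
  proof (intro allI impI ballI)
    fix c e assume c: "\<forall>p\<in>?P. (\<Sum>t\<in>E. c t * w t p) = 0" and e: "e \<in> E"
    have "0 = (\<Sum>t\<in>E. c t * w t e)" using c e E by auto
    also have "\<dots> = (\<Sum>t\<in>E. if t = e then c t else 0)"
      using w e by (intro sum.cong refl) (auto simp: dual_family_def)
    finally show "c e = 0" using e fE by simp
  qed
  \<comment> \<open>Rows with polynomial entries that are consequences of the equations and of
    vanishing on \<open>E\<close>. Their values at \<open>x0\<close> have no nonzero common
    annihilator on the pairs, so by \<open>double_annihilator\<close> they contain the unit
    rows.\<close>
  define M where "M = {v :: _ \<Rightarrow> base_poly. \<forall>x. \<forall>y\<in>Sol Dh x. (\<forall>e\<in>E. y e = 0) \<longrightarrow> (\<Sum>p\<in>?P. pev x (v p) * y p) = 0}"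
  have M: "lin_closed M"
    unfolding lin_closed_def M_def
    by (intro conjI ballI allI CollectI impI)
      (simp_all only: mem_Collect_eq pev_0 pev_add pev_mult distrib_right sum.distrib mult.assoc sum_distrib_left[symmetric]
        mult_zero_left mult_zero_right sum.neutral_const add_0)
  define W where "W = {(\<lambda>p. pev x0 (v p)) |v. v \<in> M}"
  have W: "lin_closed W"
    unfolding lin_closed_def
  proof (intro conjI ballI allI)
    show "(\<lambda>_. 0) \<in> W" unfolding W_def by (rule CollectI, rule exI[of _ "\<lambda>_. 0"]) (use M in \<open>simp add: lin_closed_def\<close>)
    fix u v assume "u \<in> W" "v \<in> W"
    then obtain u' v' where uv: "u' \<in> M" "u = (\<lambda>p. pev x0 (u' p))" "v' \<in> M" "v = (\<lambda>p. pev x0 (v' p))"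
      unfolding W_def by blast
    show "(\<lambda>a. u a + v a) \<in> W"
      unfolding W_def uv by (rule CollectI, rule exI[of _ "\<lambda>p. u' p + v' p"]) (use lin_closed_add[OF M uv(1,3)] in \<open>simp add: pev_add\<close>)
  next
    fix c u assume "u \<in> W"
    then obtain u' where u: "u' \<in> M" "u = (\<lambda>p. pev x0 (u' p))" unfolding W_def by blast
    show "(\<lambda>a. c * u a) \<in> W"
      unfolding W_def u by (rule CollectI, rule exI[of _ "\<lambda>p. const_poly c * u' p"]) (use lin_closed_scale[OF M u(1)] in \<open>simp add: pev_mult\<close>)
  qed
  define un where "un q p = (if p = q then 1 else 0 :: base_poly)" for q p :: "('a, 'b, 'c) monom \<times> ('a, 'b, 'c) monom"
  have un: "(\<Sum>p\<in>?P. pev x (c * un q p) * y p) = pev x c * y q" if "q \<in> ?P" for x c q y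
  proof -
    have "(\<Sum>p\<in>?P. pev x (c * un q p) * y p) = (\<Sum>p\<in>?P. if p = q then pev x c * y p else 0)"
      by (intro sum.cong refl) (simp add: un_def)
    then show ?thesis using that fP by simp
  qed
  have WM: "(\<Sum>p\<in>?P. pev x0 (v p) * y p) = 0" if "\<forall>w\<in>W. (\<Sum>a\<in>?P. w a * y a) = 0" "v \<in> M" for v y
    using that(1)[unfolded W_def, THEN bspec, of "\<lambda>p. pev x0 (v p)"] that(2) by auto
  have "\<exists>v\<in>M. \<forall>k\<in>?P. pev x0 (v k) = (if k = a then 1 else 0)" if a: "a \<in> ?P" for a
  proof -
    have "\<exists>w\<in>W. \<forall>k\<in>?P. w k = (if k = a then 1 else 0)"
    proof (rule double_annihilator[OF W fP a])
      fix y assume y: "\<forall>w\<in>W. (\<Sum>a\<in>?P. w a * y a) = 0"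
      have yE: "y e = 0" if e: "e \<in> E" for e
      proof -
        have eP: "e \<in> ?P" using e E by blast
        have "(\<lambda>p. 1 * un e p) \<in> M" using e un[OF eP, of _ 1] by (simp add: M_def)
        from WM[OF y this] un[OF eP, of x0 1 y] show ?thesis by simp
      qed
      have "y \<in> Sol Dh x0"
        unfolding Sol_def
      proof (intro CollectI conjI allI impI)
        fix b b' assume b: "b \<in> MonS Dh" "b \<in> B" "b' \<in> BM b"
        then have bP: "(b, b') \<in> ?P" by (simp add: pairs_def)
        have "(\<lambda>p. 1 * un (b, b') p) \<in> M" unfolding M_def
        proof (intro CollectI allI ballI impI)
          fix x y assume "y \<in> Sol Dh x"
          then have "y (b, b') = 0" using b unfolding Sol_def by blast
          then show "(\<Sum>p\<in>?P. pev x (1 * un (b, b') p) * y p) = 0" unfolding un[OF bP] by simp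
        qed
        from WM[OF y this] un[OF bP, of x0 1 y] show "y (b, b') = 0" by simp
      next
        fix m b' :: "('a, 'b, 'c) monom" and z assume m: "m \<in> MonS Dh" "single z 1 + m \<in> MonS Dh" "b' \<in> BM (single z 1 + m)"
        \<comment> \<open>The row of one linearized equation, with the coordinates as indeterminate
          coefficients.\<close>
        define R where "R p = 1 * un (single z 1 + m, b') p
            - (\<Sum>b\<in>BM m. base_var (enc (m, b)) * un (single z 1 + b, b') p)
            - (\<Sum>b\<in>BM m. base_var (enc (single z 1 + b, b')) * un (m, b) p)" for p
        have P0: "(single z 1 + m, b') \<in> ?P" using m by (simp add: pairs_def)
        have P1: "(single z 1 + b, b') \<in> ?P" "(m, b) \<in> ?P" if "b \<in> BM m" for b
          using that m by (auto simp: pairs_def MonS_iff Mon_def mdeg_add simp del: One_nat_def)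
        have R: "(\<Sum>p\<in>?P. pev x (R p) * y p) = y (single z 1 + m, b')
            - ((\<Sum>b\<in>BM m. x (enc (m, b)) * y (single z 1 + b, b')) + (\<Sum>b\<in>BM m. y (m, b) * x (enc (single z 1 + b, b'))))" for x y
        proof -
          have s1: "(\<Sum>p\<in>?P. pev x (\<Sum>b\<in>BM m. base_var (enc (m, b)) * un (single z 1 + b, b') p) * y p) =
              (\<Sum>b\<in>BM m. x (enc (m, b)) * y (single z 1 + b, b'))"
            unfolding pev_sum sum_distrib_right
            by (subst sum.swap) (intro sum.cong refl, simp only: un[OF P1(1)] pev_base_var)
          have s2: "(\<Sum>p\<in>?P. pev x (\<Sum>b\<in>BM m. base_var (enc (single z 1 + b, b')) * un (m, b) p) * y p) =
              (\<Sum>b\<in>BM m. y (m, b) * x (enc (single z 1 + b, b')))"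
            unfolding pev_sum sum_distrib_right
            by (subst sum.swap) (intro sum.cong refl, simp only: un[OF P1(2)] pev_base_var, rule mult.commute)
          show ?thesis
            unfolding R_def pev_diff left_diff_distrib sum_subtractf s1 s2 un[OF P0] by simp
        qed
        have "R \<in> M"
          unfolding M_def
        proof (intro CollectI allI ballI impI)
          fix x y assume "y \<in> Sol Dh x"
          then have "y (single z 1 + m, b') = (\<Sum>b\<in>BM m. x (enc (m, b)) * y (single z 1 + b, b'))
              + (\<Sum>b\<in>BM m. y (m, b) * x (enc (single z 1 + b, b')))" using m unfolding Sol_def by blast
          then show "(\<Sum>p\<in>?P. pev x (R p) * y p) = 0" unfolding R by simp
        qed
        from WM[OF y this] show "y (single z 1 + m, b') = (\<Sum>b\<in>BM m. x0 (enc (m, b)) * y (single z 1 + b, b'))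
            + (\<Sum>b\<in>BM m. y (m, b) * x0 (enc (single z 1 + b, b')))" unfolding R by simp
      qed
      from max[OF this yE] a show "y a = 0" by blast
    qed
    then show ?thesis unfolding W_def by blast
  qed
  from nakayama[OF fP M this] obtain f where f: "pev x0 f \<noteq> 0"
    and fM: "\<forall>a\<in>?P. \<exists>v\<in>M. \<forall>k\<in>?P. v k = (if k = a then f else 0)" by blast
  have bound: "card T \<le> card E"
    if x: "pev x f \<noteq> 0" and T: "finite T" "\<forall>t\<in>T. y t \<in> Sol Dh x" and ind: "indep_on Dh T y" for x y and T :: "'t set"
  proof (rule ccontr)
    assume "\<not> card T \<le> card E"
    then obtain c where c: "\<exists>t\<in>T. c t \<noteq> 0" "\<forall>e\<in>E. (\<Sum>t\<in>T. c t * y t e) = 0"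
      using homogeneous_system[OF fE T(1), of y] by auto
    let ?y = "\<lambda>p. \<Sum>t\<in>T. c t * y t p"
    have yS: "?y \<in> Sol Dh x" by (rule lin_closed_comb[OF lin_closed_Sol]) (use T(2) in blast)
    have "?y a = 0" if a: "a \<in> ?P" for a
    proof -
      obtain v where v: "v \<in> M" "\<forall>k\<in>?P. v k = (if k = a then f else 0)" using fM a by blast
      have "0 = (\<Sum>p\<in>?P. pev x (v p) * ?y p)" using v(1) yS c(2) unfolding M_def by auto
      also have "\<dots> = (\<Sum>p\<in>?P. if p = a then pev x f * ?y p else 0)"
        using v(2) by (intro sum.cong refl) auto
      also have "\<dots> = pev x f * ?y a" using a fP by simp
      finally show ?thesis using x by simp
    qed
    then show False using ind c(1) unfolding indep_on_def by blast
  qed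
  show thesis
    by (rule that[OF fE _ indE]) (use w f bound in \<open>auto simp: dual_family_def\<close>)
qed

end

section \<open>Tangent vectors at configurations of points\<close>

text \<open>The value at \<open>p\<close> of the partial derivative in the variable
  \<open>l\<close>; when \<open>l\<close> does not occur, the factor \<open>of_nat 0\<close> hides
  the truncated exponent.\<close>

definition partial_mon :: "'v::finite \<Rightarrow> ('v \<Rightarrow> 'r::comm_ring_1) \<Rightarrow> ('v \<Rightarrow>\<^sub>0 nat) \<Rightarrow> 'r" where
  "partial_mon l p m = of_nat (lookup m l) * p l ^ (lookup m l - 1) * (\<Prod>v\<in>UNIV - {l}. p v ^ lookup m v)"

definition partial :: "'v::finite \<Rightarrow> ('v \<Rightarrow> 'r::comm_ring_1) \<Rightarrow> (('v \<Rightarrow>\<^sub>0 nat) \<Rightarrow>\<^sub>0 'r) \<Rightarrow> 'r" where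
  "partial l p f = (\<Sum>m\<in>keys f. lookup f m * partial_mon l p m)"

lemma partial_superset:
  assumes "finite A" "keys f \<subseteq> A"
  shows "partial l p f = (\<Sum>m\<in>A. lookup f m * partial_mon l p m)"
  unfolding partial_def by (rule sum.mono_neutral_left) (use assms in \<open>auto simp: in_keys_iff\<close>)

lemma partial_add: "partial l p (f + g) = partial l p f + partial l p g"
proof -
  let ?A = "keys f \<union> keys g"
  have fin: "finite ?A" by simp
  show ?thesis
    unfolding partial_superset[OF fin Poly_Mapping.keys_add]
      partial_superset[OF fin Un_upper1] partial_superset[OF fin Un_upper2]
    by (simp add: lookup_add distrib_right sum.distrib)
qed

lemma partial_const_mult: "partial l p (const_poly c * f) = c * partial l p f"
proof -
  have "partial l p (const_poly c * f) = (\<Sum>m\<in>keys f. lookup (const_poly c * f) m * partial_mon l p m)"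
    by (rule partial_superset[OF finite_keys keys_const_poly_mult])
  then show ?thesis by (simp only: lookup_const_poly_mult sum_distrib_left mult.assoc partial_def)
qed

lemma partial_single: "partial l p (single m c) = c * partial_mon l p m"
  by (simp add: partial_def)

lemma partial_0 [simp]: "partial l p 0 = 0"
  by (simp add: partial_def)

lemma partial_sum: "partial l p (sum F A) = (\<Sum>a\<in>A. partial l p (F a))"
  by (induction A rule: infinite_finite_induct) (simp_all add: partial_add)

lemma partial_diff: "partial l p (f - g) = partial l p f - partial l p g"
  using partial_add[of l p "f - g" g] by (simp add: eq_diff_eq)

lemma partial_mon_add:
  fixes p :: "'v::finite \<Rightarrow> 'r::comm_ring_1"
  shows "partial_mon l p (single z 1 + m) = p z * partial_mon l p m + (if z = l then mon_ev p m else 0)"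
proof (cases "z = l")
  case True
  have e: "(\<Prod>v\<in>UNIV - {l}. p v ^ lookup (single l 1 + m) v) = (\<Prod>v\<in>UNIV - {l}. p v ^ lookup m v)"
    by (intro prod.cong refl) (simp add: lookup_add lookup_single)
  have m: "mon_ev p m = p l ^ lookup m l * (\<Prod>v\<in>UNIV - {l}. p v ^ lookup m v)"
    unfolding mon_ev_UNIV by (rule prod.remove) auto
  have k: "lookup (single l 1 + m) l = Suc (lookup m l)" by (simp add: lookup_add)
  show ?thesis
  proof (cases "lookup m l")
    case 0
    then show ?thesis unfolding True partial_mon_def e m k by simp
  next
    case (Suc j)
    have ring: "(1 + c) * (a * q) * P = a * (c * q * P) + a * q * P" for a c q P :: 'r
      by (simp only: distrib_right distrib_left mult_1_left mult.assoc mult.left_commute[of c] add.commute)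
    show ?thesis
      unfolding True partial_mon_def e m k Suc diff_Suc_1 simp_thms if_True of_nat_Suc[of "Suc j"] power_Suc[of "p l" j] by (rule ring)
  qed
next
  case False
  let ?U = "UNIV - {l}"
  have fU: "finite ?U" by simp
  have z: "z \<in> ?U" using False by simp
  have e: "(\<Prod>v\<in>?U. p v ^ lookup (single z 1 + m) v) = p z * (\<Prod>v\<in>?U. p v ^ lookup m v)"
  proof -
    have "(\<Prod>v\<in>?U - {z}. p v ^ lookup (single z 1 + m) v) = (\<Prod>v\<in>?U - {z}. p v ^ lookup m v)"
      by (intro prod.cong refl) (auto simp: lookup_add lookup_single when_def)
    moreover have "lookup (single z 1 + m) z = Suc (lookup m z)" by (simp add: lookup_add)
    ultimately show ?thesis
      by (simp only: prod.remove[OF fU z] power_Suc mult.assoc)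
  qed
  have k: "lookup (single z 1 + m) l = lookup m l" using False by (simp add: lookup_add lookup_single)
  show ?thesis unfolding partial_mon_def e k using False by (simp only: if_False add_0_right mult.left_commute)
qed

lemma partial_mult_variable:
  "partial l p (mono (single z 1) * f) = p z * partial l p f + (if z = l then pev p f else 0)"
proof -
  have "mono (single z 1) * f = (\<Sum>m\<in>keys f. mono (single z 1) * single m (lookup f m))"
    by (simp only: sum_distrib_left[symmetric] poly_expand[symmetric])
  also have "\<dots> = (\<Sum>m\<in>keys f. single (single z 1 + m) (lookup f m))"
    by (simp only: mult_single mult_1)
  finally have "partial l p (mono (single z 1) * f) = (\<Sum>m\<in>keys f. lookup f m * partial_mon l p (single z 1 + m))"
    by (simp only: partial_sum partial_single)
  also have "\<dots> = (\<Sum>m\<in>keys f. p z * (lookup f m * partial_mon l p m) + (if z = l then lookup f m * mon_ev p m else 0))"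
    unfolding partial_mon_add by (intro sum.cong refl) (simp add: distrib_left mult.left_commute)
  also have "\<dots> = p z * partial l p f + (if z = l then pev p f else 0)"
    by (simp add: sum.distrib sum_distrib_left partial_def pev_def)
  finally show ?thesis .
qed

lemma functional_partial [simp]: "functional (partial l p)"
  by (simp only: functional_def partial_add partial_const_mult simp_thms)

lemma pev_of_nat: "pev x (of_nat n) = of_nat n"
  by (induction n) (simp_all add: pev_add)

lemma pev_partial_mon: "pev x (partial_mon l P m) = partial_mon l (\<lambda>v. pev x (P v)) m"
  by (simp add: partial_mon_def pev_mult pev_of_nat pev_power pev_prod)

text \<open>The first-order data of a form: its values at all points and its derivatives at the
  \<open>k\<close>-th point.\<close>

definition tang :: "(nat \<Rightarrow> 'v::finite \<Rightarrow> 'r::comm_ring_1) \<Rightarrow> nat \<Rightarrow> nat + 'v \<Rightarrow> (('v \<Rightarrow>\<^sub>0 nat) \<Rightarrow>\<^sub>0 'r) \<Rightarrow> 'r" where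
  "tang p k = (\<lambda>e. case e of Inl i \<Rightarrow> pev (p i) | Inr l \<Rightarrow> partial l (p k))"

lemma tang_simps [simp]: "tang p k (Inl i) = pev (p i)" "tang p k (Inr l) = partial l (p k)"
  by (simp_all add: tang_def)

lemma functional_tang [simp]: "functional (tang p k e)"
  by (cases e) auto

context chart
begin

text \<open>\<open>\<gamma> k u\<close> lists the coordinates, in the monomial basis, of a form of
  degree \<open>u\<close> that is 1 at the \<open>k\<close>-th point and 0 at the others.\<close>

lemma dual_coordinates:
  assumes x: "x \<in> pts" "Ix x = pideal r p"
  obtains \<gamma> where "\<And>k u i. k < r \<Longrightarrow> u \<in> D \<Longrightarrow> h u = r \<Longrightarrow> i < r \<Longrightarrow>
    (\<Sum>b\<in>B \<inter> Mon u. \<gamma> k u b * mon_ev (p i) b) = (if i = k then 1 else 0)"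
proof -
  have "\<forall>ku\<in>{..<r} \<times> {u \<in> D. h u = r}. \<exists>c. \<forall>i<r.
      (\<Sum>b\<in>B \<inter> Mon (snd ku). c b * mon_ev (p i) b) = (if i = fst ku then 1 else 0)"
  proof
    fix ku assume "ku \<in> {..<r} \<times> {u \<in> D. h u = r}"
    then obtain k u where ku: "ku = (k, u)" "k < r" "u \<in> D" "h u = r" by auto
    obtain X where X: "X \<subseteq> {..<r}" "card X = h u" "sep u X p"
      using sep_of_hilb[of r p h u] pts_hilb[OF x(1)] x(2) by auto
    have "X = {..<r}" using X(1,2) ku(4) by (simp add: card_subset_eq)
    with X(3) obtain g where g: "dual_forms {..<r} (\<lambda>i. pev (p i)) u g" by blast
    have gk: "g k \<in> piece u" "\<And>i. i < r \<Longrightarrow> pev (p i) (g k) = (if i = k then 1 else 0)"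
      using g ku(2) by (auto simp: dual_forms_def)
    have "spans_mod (B \<inter> Mon u) mono (Ix x) u"
      by (rule spans_of_rel[OF sub_Ix _ ku(3)]) (use rel_in_Ix in auto)
    then obtain c where c: "g k - (\<Sum>b\<in>B \<inter> Mon u. const_poly (c b) * mono b) \<in> Ix x"
      using gk(1) unfolding spans_mod_def by blast
    have "g k - (\<Sum>b\<in>B \<inter> Mon u. const_poly (c b) * mono b) \<in> piece u"
      by (intro piece_diff piece_sum piece_const single_piece gk) auto
    from pideal_piece_iff[OF this] c
    have "pev (p i) (g k - (\<Sum>b\<in>B \<inter> Mon u. const_poly (c b) * mono b)) = 0" if "i < r" for i
      using that unfolding x(2) by blast
    then have "(\<Sum>b\<in>B \<inter> Mon u. c b * mon_ev (p i) b) = (if i = k then 1 else 0)" if "i < r" for i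
      using that gk(2) by (simp add: pev_diff pev_sum pev_mult)
    then show "\<exists>c. \<forall>i<r. (\<Sum>b\<in>B \<inter> Mon (snd ku). c b * mon_ev (p i) b) = (if i = fst ku then 1 else 0)"
      unfolding ku(1) fst_conv snd_conv by (intro exI[of _ c]) blast
  qed
  from bchoice[OF this] obtain \<gamma> where \<gamma>: "\<forall>ku\<in>{..<r} \<times> {u \<in> D. h u = r}. \<forall>i<r.
      (\<Sum>b\<in>B \<inter> Mon (snd ku). \<gamma> ku b * mon_ev (p i) b) = (if i = fst ku then 1 else 0)" ..
  show thesis
  proof (rule that[of "\<lambda>k u. \<gamma> (k, u)"])
    fix k u i assume "k < r" "u \<in> D" "h u = r" "i < r"
    then show "(\<Sum>b\<in>B \<inter> Mon u. \<gamma> (k, u) b * mon_ev (p i) b) = (if i = k then 1 else 0)"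
      using bspec[OF \<gamma>, of "(k, u)"] by simp
  qed
qed

text \<open>Both sides have the same monomials outside the basis. Their difference is a combination
  of basis monomials in the ideal, hence zero; this is the equation between the coordinates whose
  linearization is \<open>Sol\<close>.\<close>

lemma variable_mult_rel:
  assumes x: "x \<in> pts" and mD: "m \<in> MonS D" and m: "single z 1 + m \<in> MonS D"
  shows "mono (single z 1) * rel x m = rel x (single z 1 + m) - (\<Sum>b\<in>BM m. const_poly (x (enc (m, b))) * rel x (single z 1 + b))"
proof -
  let ?z = "single z 1 :: ('a, 'b, 'c) monom"
  define c where "c b' = x (enc (?z + m, b')) - (\<Sum>b\<in>BM m. x (enc (m, b)) * x (enc (?z + b, b')))" for b'
  have BMz: "BM (?z + b) = BM (?z + m)" if "b \<in> BM m" for b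
    using that by (simp add: Mon_def mdeg_add del: One_nat_def)
  have "(\<Sum>b\<in>BM m. const_poly (x (enc (m, b))) * rel x (?z + b)) =
      (\<Sum>b\<in>BM m. const_poly (x (enc (m, b))) * mono (?z + b)) -
      (\<Sum>b\<in>BM m. \<Sum>b'\<in>BM (?z + m). const_poly (x (enc (m, b)) * x (enc (?z + b, b'))) * mono b')"
    unfolding sum_subtractf[symmetric]
  proof (rule sum.cong[OF refl])
    fix b assume "b \<in> BM m"
    show "const_poly (x (enc (m, b))) * rel x (?z + b) = const_poly (x (enc (m, b))) * mono (?z + b) -
        (\<Sum>b'\<in>BM (?z + m). const_poly (x (enc (m, b)) * x (enc (?z + b, b'))) * mono b')"
      unfolding rel_def BMz[OF \<open>b \<in> BM m\<close>] by (simp only: right_diff_distrib sum_distrib_left const_poly_mult mult.assoc)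
  qed
  also have "(\<Sum>b\<in>BM m. \<Sum>b'\<in>BM (?z + m). const_poly (x (enc (m, b)) * x (enc (?z + b, b'))) * mono b') =
      (\<Sum>b'\<in>BM (?z + m). const_poly (\<Sum>b\<in>BM m. x (enc (m, b)) * x (enc (?z + b, b'))) * (mono b' :: ('a, 'b, 'c) coxC))"
    by (subst sum.swap) (simp only: const_poly_sum sum_distrib_right)
  finally have e1: "(\<Sum>b\<in>BM m. const_poly (x (enc (m, b))) * rel x (?z + b)) =
      (\<Sum>b\<in>BM m. const_poly (x (enc (m, b))) * mono (?z + b)) -
      (\<Sum>b'\<in>BM (?z + m). const_poly (\<Sum>b\<in>BM m. x (enc (m, b)) * x (enc (?z + b, b'))) * mono b')" .
  have e2: "mono ?z * rel x m = mono (?z + m) - (\<Sum>b\<in>BM m. const_poly (x (enc (m, b))) * mono (?z + b))"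
    unfolding rel_def by (simp only: right_diff_distrib sum_distrib_left mono_add mult.left_commute[of "mono ?z"])
  have e3: "(\<Sum>b'\<in>BM (?z + m). const_poly (c b') * mono b') =
      (\<Sum>b'\<in>BM (?z + m). const_poly (x (enc (?z + m, b'))) * mono b') -
      (\<Sum>b'\<in>BM (?z + m). const_poly (\<Sum>b\<in>BM m. x (enc (m, b)) * x (enc (?z + b, b'))) * (mono b' :: ('a, 'b, 'c) coxC))"
    unfolding c_def const_poly_diff left_diff_distrib sum_subtractf ..
  have e: "(\<Sum>b'\<in>BM (?z + m). const_poly (c b') * mono b') =
      mono ?z * rel x m - (rel x (?z + m) - (\<Sum>b\<in>BM m. const_poly (x (enc (m, b))) * rel x (?z + b)))"
    unfolding e1 e2 e3 rel_def[of x "?z + m"] by simp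
  have "mono ?z * rel x m - (rel x (?z + m) - (\<Sum>b\<in>BM m. const_poly (x (enc (m, b))) * rel x (?z + b))) \<in> Ix x"
  proof (intro ideal.subspace_diff[OF sub_Ix] ideal.subspace_scale[OF sub_Ix] ideal.subspace_sum[OF sub_Ix] rel_in_Ix mD m)
    fix b assume "b \<in> BM m"
    then have "mdeg (?z + b) = mdeg (?z + m)" by (simp add: Mon_def mdeg_add del: One_nat_def)
    then show "?z + b \<in> MonS D" using m by (simp only: MonS_iff)
  qed
  then have "(\<Sum>b'\<in>BM (?z + m). const_poly (c b') * mono b') \<in> Ix x" unfolding e .
  from comb_in_Ix[OF x _ this] m have "c b' = 0" if "b' \<in> BM (?z + m)" for b' using that by (auto simp: MonS_iff)
  then have "(\<Sum>b'\<in>BM (?z + m). const_poly (c b') * mono b') = (0 :: ('a, 'b, 'c) coxC)" by (intro sum.neutral) simp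
  then show ?thesis unfolding e by (simp only: right_minus_eq)
qed

text \<open>Differentiating \<open>pev (p i) (rel x m) = 0\<close> while the \<open>k\<close>-th
  point moves along \<open>l\<close> shows that the change of the expansion of \<open>m\<close> has
  the value \<open>partial l (p k) (rel x m)\<close> at the \<open>k\<close>-th point and 0 at the
  others. In the monomial basis this is the derivative times \<open>\<gamma>\<close>.\<close>

lemma tangent_Sol:
  assumes x: "x \<in> pts" "Ix x = pideal r p" and Dh: "Dh \<subseteq> D" and k: "k < r"
    and \<gamma>: "\<And>u i. u \<in> D \<Longrightarrow> h u = r \<Longrightarrow> i < r \<Longrightarrow>
      (\<Sum>b\<in>B \<inter> Mon u. \<gamma> u b * mon_ev (p i) b) = (if i = k then 1 else 0)"
  shows "(\<lambda>(m, b). partial l (p k) (rel x m) * \<gamma> (mdeg m) b) \<in> Sol Dh x"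
  unfolding Sol_def
proof (intro CollectI conjI allI impI)
  fix b b' :: "('a, 'b, 'c) monom" assume "b \<in> B"
  then show "(\<lambda>(m, b). partial l (p k) (rel x m) * \<gamma> (mdeg m) b) (b, b') = 0"
    using rel_basis[OF x(1)] by simp
next
  fix m b' :: "('a, 'b, 'c) monom" and z
  let ?z = "single z 1 :: ('a, 'b, 'c) monom"
  let ?d = "\<lambda>m. partial l (p k) (rel x m)"
  assume m: "m \<in> MonS Dh" "?z + m \<in> MonS Dh" and b': "b' \<in> BM (?z + m)"
  have mD: "m \<in> MonS D" "?z + m \<in> MonS D" using m MonS_sub[OF Dh] by auto
  have dz: "mdeg (?z + b) = mdeg (?z + m)" if "b \<in> BM m" for b
    using that by (simp add: Mon_def mdeg_add del: One_nat_def)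
  have zb: "?z + b \<in> MonS D" if "b \<in> BM m" for b using dz[OF that] mD(2) by (simp only: MonS_iff)
  have rel0: "pev (p i) (rel x n) = 0" if "n \<in> MonS D" "i < r" for n i
    using rel_in_Ix[OF that(1), of x] pideal_piece_iff[OF rel_piece, of x n r p] that(2) x(2) by blast
  have D1: "p k z * ?d m = ?d (?z + m) - (\<Sum>b\<in>BM m. x (enc (m, b)) * ?d (?z + b))"
    using arg_cong[OF variable_mult_rel[OF x(1) mD], of "partial l (p k)"] rel0[OF mD(1) k]
    by (simp only: partial_mult_variable partial_diff partial_sum partial_const_mult if_cancel add_0_right)
  \<comment> \<open>Where \<open>h (mdeg m) < r\<close> the relation itself is zero. Otherwise the
    brackets are coordinates of two forms with the same values at all points: the variable times the
    dual form, and a multiple of the dual form in the next degree.\<close>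
  have D2: "?d m * (p k z * \<gamma> (mdeg (?z + m)) b') = ?d m * (\<Sum>b\<in>BM m. \<gamma> (mdeg m) b * x (enc (?z + b, b')))"
  proof (cases "h (mdeg m) = r")
    case False
    then have "h (mdeg m) = card (Mon (mdeg m) :: ('a, 'b, 'c) monom set)" by (auto simp: h_eq min_def split: if_splits)
    then have "rel x m = 0"
      using hf_full_zero[OF sub_Ix _ rel_in_Ix[OF mD(1)] rel_piece] hilb_hf[OF pts_hilb[OF x(1)], of "mdeg m"] by simp
    then show ?thesis by simp
  next
    case True
    let ?v = "mdeg (?z + m)"
    have "mdeg m \<le> ?v"
      unfolding mdeg_add mdeg_single_1 by (cases z) (auto simp: less_eq_prod_def)
    then have "h (mdeg m) \<le> h ?v" 
      using card_Mon_mono[OF mdeg_nonneg, of m ?v, where ?'a = 'a and ?'b = 'b and ?'c = 'c] unfolding h_eq by (intro min.mono order_refl)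
    moreover have "h ?v \<le> r" by (simp add: h_eq)
    ultimately have hv: "h ?v = r" using True by simp
    have uD: "mdeg m \<in> D" "?v \<in> D" using mD by (auto simp: MonS_iff)
    define c where "c b' = (\<Sum>b\<in>BM m. \<gamma> (mdeg m) b * x (enc (?z + b, b'))) - p k z * \<gamma> ?v b'" for b'
    let ?f = "\<Sum>b'\<in>BM (?z + m). const_poly (c b') * mono b' :: ('a, 'b, 'c) coxC"
    have "?f \<in> piece ?v" by (intro piece_sum piece_const single_piece) auto
    moreover have "pev (p i) ?f = 0" if i: "i < r" for i
    proof -
      have ev: "(\<Sum>b'\<in>BM (?z + m). x (enc (?z + b, b')) * mon_ev (p i) b') = p i z * mon_ev (p i) b" if b: "b \<in> BM m" for b
      proof -
        have "0 = pev (p i) (rel x (?z + b))" using rel0[OF zb[OF b] i] by simp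
        also have "\<dots> = mon_ev (p i) (?z + b) - (\<Sum>b'\<in>BM (?z + b). x (enc (?z + b, b')) * mon_ev (p i) b')"
          by (simp only: rel_def pev_diff pev_sum pev_mult pev_const pev_single mult_1)
        also have "\<dots> = p i z * mon_ev (p i) b - (\<Sum>b'\<in>BM (?z + m). x (enc (?z + b, b')) * mon_ev (p i) b')"
          by (simp only: mon_ev_add mon_ev_single power_one_right dz[OF b])
        finally show ?thesis by simp
      qed
      have "pev (p i) ?f = (\<Sum>b'\<in>BM (?z + m). (\<Sum>b\<in>BM m. \<gamma> (mdeg m) b * (x (enc (?z + b, b')) * mon_ev (p i) b'))) -
          p k z * (\<Sum>b'\<in>BM (?z + m). \<gamma> ?v b' * mon_ev (p i) b')"
        by (simp only: pev_sum pev_mult pev_const pev_single mult_1 c_def left_diff_distrib sum_subtractf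
            sum_distrib_right sum_distrib_left mult.assoc)
      also have "(\<Sum>b'\<in>BM (?z + m). (\<Sum>b\<in>BM m. \<gamma> (mdeg m) b * (x (enc (?z + b, b')) * mon_ev (p i) b'))) =
          (\<Sum>b\<in>BM m. \<gamma> (mdeg m) b * (p i z * mon_ev (p i) b))"
        by (subst sum.swap) (intro sum.cong refl, simp only: sum_distrib_left[symmetric] ev)
      also have "\<dots> = p i z * (\<Sum>b\<in>BM m. \<gamma> (mdeg m) b * mon_ev (p i) b)"
        by (simp only: sum_distrib_left mult.left_commute)
      finally show ?thesis using \<gamma>[OF uD(1) True i] \<gamma>[OF uD(2) hv i] by simp
    qed
    ultimately have "?f \<in> Ix x" unfolding x(2) using pideal_piece_iff by blast
    from comb_in_Ix[OF x(1) uD(2) this b'] show ?thesis by (simp add: c_def)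
  qed
  have "?d (?z + m) = (\<Sum>b\<in>BM m. x (enc (m, b)) * ?d (?z + b)) + p k z * ?d m" using D1 by simp
  then have "?d (?z + m) * \<gamma> (mdeg (?z + m)) b' =
      (\<Sum>b\<in>BM m. x (enc (m, b)) * (?d (?z + b) * \<gamma> (mdeg (?z + m)) b')) + ?d m * (p k z * \<gamma> (mdeg (?z + m)) b')"
    by (simp only: distrib_right sum_distrib_right mult.assoc mult.left_commute[of "p k z"])
  also have "(\<Sum>b\<in>BM m. x (enc (m, b)) * (?d (?z + b) * \<gamma> (mdeg (?z + m)) b')) =
      (\<Sum>b\<in>BM m. x (enc (m, b)) * (?d (?z + b) * \<gamma> (mdeg (?z + b)) b'))"
    by (intro sum.cong refl) (simp only: dz)
  also note D2
  also have "?d m * (\<Sum>b\<in>BM m. \<gamma> (mdeg m) b * x (enc (?z + b, b'))) = (\<Sum>b\<in>BM m. ?d m * \<gamma> (mdeg m) b * x (enc (?z + b, b')))"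
    by (simp only: sum_distrib_left mult.assoc)
  finally show "(\<lambda>(m, b). ?d m * \<gamma> (mdeg m) b) (?z + m, b') =
      (\<Sum>b\<in>BM m. x (enc (m, b)) * (\<lambda>(m, b). ?d m * \<gamma> (mdeg m) b) (?z + b, b'))
        + (\<Sum>b\<in>BM m. (\<lambda>(m, b). ?d m * \<gamma> (mdeg m) b) (m, b) * x (enc (?z + b, b')))"
    by (simp only: prod.case)
qed

text \<open>A relation between the tangent vectors is tested on a form of degree \<open>w\<close>
  that vanishes at all points and has a single nonzero derivative among the chosen ones at the
  \<open>k\<close>-th point.\<close>

lemma tangent_vectors:
  assumes x: "x \<in> pts" "Ix x = pideal r p" and Dh: "Dh \<subseteq> D"
    and w: "w \<in> Dh" "h w = r" and L: "finite L"
    and dual: "\<And>k. k < r \<Longrightarrow> \<exists>g. dual_forms (Inl ` {..<r} \<union> Inr ` L) (tang p k) w g"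
  shows "\<exists>y. (\<forall>t\<in>{..<r} \<times> L. y t \<in> Sol Dh x) \<and> indep_on Dh ({..<r} \<times> L) y"
proof -
  obtain \<gamma> where \<gamma>: "\<And>k u i. k < r \<Longrightarrow> u \<in> D \<Longrightarrow> h u = r \<Longrightarrow> i < r \<Longrightarrow>
    (\<Sum>b\<in>B \<inter> Mon u. \<gamma> k u b * mon_ev (p i) b) = (if i = k then 1 else 0)"
    using dual_coordinates[OF x] by blast
  define y where "y = (\<lambda>(k, l). \<lambda>(m, b). partial l (p k) (rel x m) * \<gamma> k (mdeg m) b)"
  have wD: "w \<in> D" using w Dh by blast
  have "\<forall>t\<in>{..<r} \<times> L. y t \<in> Sol Dh x"
  proof
    fix t assume "t \<in> {..<r} \<times> L"
    then obtain k l where t: "t = (k, l)" "k < r" by auto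
    show "y t \<in> Sol Dh x" unfolding t y_def prod.case by (rule tangent_Sol[OF x Dh t(2) \<gamma>[OF t(2)]])
  qed
  moreover have "indep_on Dh ({..<r} \<times> L) y"
    unfolding indep_on_def
  proof (intro allI impI ballI)
    fix c t assume c: "\<forall>q\<in>pairs Dh. (\<Sum>t\<in>{..<r} \<times> L. c t * y t q) = 0" and "t \<in> {..<r} \<times> L"
    then obtain k l where t: "t = (k, l)" "k < r" "l \<in> L" by auto
    \<comment> \<open>The member \<open>G (Inr l)\<close> of the dual family lies in the ideal, so
      it is a combination of relations and the entries of \<open>y\<close> can be combined to its
      derivatives.\<close>
    obtain G where G: "dual_forms (Inl ` {..<r} \<union> Inr ` L) (tang p k) w G" using dual[OF t(2)] by blast
    define g where "g = G (Inr l)"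
    have gp: "g \<in> piece w" and g0: "\<And>i. i < r \<Longrightarrow> pev (p i) g = 0"
      and gd: "\<And>l'. l' \<in> L \<Longrightarrow> partial l' (p k) g = (if l' = l then 1 else 0)"
    proof -
      have G': "G (Inr l) \<in> piece w" "\<forall>e\<in>Inl ` {..<r} \<union> Inr ` L. tang p k e (G (Inr l)) = (if e = Inr l then 1 else 0)"
        using G t(3) unfolding dual_forms_def by blast+
      show "g \<in> piece w" unfolding g_def by (rule G'(1))
      show "pev (p i) g = 0" if "i < r" for i using bspec[OF G'(2), of "Inl i"] that by (simp add: g_def)
      show "partial l' (p k) g = (if l' = l then 1 else 0)" if "l' \<in> L" for l'
        using bspec[OF G'(2), of "Inr l'"] that by (simp add: g_def)
    qed
    have gI: "g \<in> Ix x" unfolding x(2) using pideal_piece_iff[OF gp] g0 by blast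
    have dg: "partial l' (p k') g = (\<Sum>n\<in>Mon w. lookup g n * partial l' (p k') (rel x n))" for l' k'
      using arg_cong[OF piece_rel(2)[OF x(1) wD gI gp], of "partial l' (p k')"] by (simp only: partial_sum partial_const_mult)
    have s1: "(\<Sum>t\<in>{..<r} \<times> L. c t * (partial (snd t) (p (fst t)) g * \<gamma> (fst t) w b)) = 0" if b: "b \<in> B \<inter> Mon w" for b
    proof -
      have "(\<Sum>t\<in>{..<r} \<times> L. c t * y t (n, b)) = 0" if n: "n \<in> Mon w" for n
        by (rule bspec[OF c]) (use n b w in \<open>auto simp: pairs_def MonS_iff Mon_def\<close>)
      then have "0 = (\<Sum>n\<in>Mon w. lookup g n * (\<Sum>t\<in>{..<r} \<times> L. c t * y t (n, b)))" by simp
      also have "\<dots> = (\<Sum>t\<in>{..<r} \<times> L. \<Sum>n\<in>Mon w. c t * (lookup g n * partial (snd t) (p (fst t)) (rel x n) * \<gamma> (fst t) w b))"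
        unfolding sum_distrib_left
        by (subst sum.swap) (intro sum.cong refl, auto simp: y_def Mon_def split: prod.splits)
      also have "\<dots> = (\<Sum>t\<in>{..<r} \<times> L. c t * (partial (snd t) (p (fst t)) g * \<gamma> (fst t) w b))"
        by (simp only: dg sum_distrib_left sum_distrib_right)
      finally show ?thesis by simp
    qed
    \<comment> \<open>Reading the coordinates as forms and evaluating at the \<open>k\<close>-th
      point removes all vectors that move another point; the derivatives of \<open>g\<close> then
      single out \<open>l\<close>.\<close>
    have "0 = (\<Sum>b\<in>B \<inter> Mon w. (\<Sum>t\<in>{..<r} \<times> L. c t * (partial (snd t) (p (fst t)) g * \<gamma> (fst t) w b)) * mon_ev (p k) b)"
      using s1 by simp
    also have "\<dots> = (\<Sum>t\<in>{..<r} \<times> L. c t * partial (snd t) (p (fst t)) g * (\<Sum>b\<in>B \<inter> Mon w. \<gamma> (fst t) w b * mon_ev (p k) b))"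
      unfolding sum_distrib_right sum_distrib_left by (subst sum.swap) (simp only: mult.assoc)
    also have "\<dots> = (\<Sum>t\<in>{..<r} \<times> L. if t = (k, l) then c t else 0)"
    proof (rule sum.cong[OF refl])
      fix t' assume "t' \<in> {..<r} \<times> L"
      then obtain k' l' where t': "t' = (k', l')" "k' < r" "l' \<in> L" by auto
      show "c t' * partial (snd t') (p (fst t')) g * (\<Sum>b\<in>B \<inter> Mon w. \<gamma> (fst t') w b * mon_ev (p k) b) = (if t' = (k, l) then c t' else 0)"
        using \<gamma>[OF t'(2) wD w(2) t(2)] gd[OF t'(3)] by (cases "k' = k") (auto simp: t' t)
    qed
    also have "\<dots> = c t" using t L by simp
    finally show "c t = 0" by simp
  qed
  ultimately show ?thesis by blast
qed

end

section \<open>Jets of forms of degree \<open>(1, 1, 1)\<close>\<close>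

definition segre :: "'a \<Rightarrow> 'b \<Rightarrow> 'c \<Rightarrow> ('a, 'b, 'c) monom" where
  "segre a b c = single (Alpha a) 1 + (single (Beta b) 1 + (single (Gamma c) 1 + 0))"

lemma segre_Mon: "segre a b c \<in> (Mon (1, 1, 1) :: ('a::finite, 'b::finite, 'c::finite) monom set)"
  by (simp only: segre_def Mon_def mem_Collect_eq mdeg_add mdeg_single_1 mdeg_0 vdeg.simps) (simp add: zero_prod_def)

lemma card_Mon_111:
  "CARD('a) * CARD('b) * CARD('c) \<le> card (Mon (1, 1, 1) :: ('a::finite, 'b::finite, 'c::finite) monom set)"
proof -
  have "card (UNIV :: ('a \<times> 'b \<times> 'c) set) \<le> card (Mon (1, 1, 1) :: ('a, 'b, 'c) monom set)"
  proof (rule card_inj_on_le[OF _ _ finite_Mon, of "\<lambda>(a, b, c). segre a b c"])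
    show "inj_on (\<lambda>(a, b, c). segre a b c) (UNIV :: ('a \<times> 'b \<times> 'c) set)"
    proof (rule inj_onI)
      fix e e' :: "'a \<times> 'b \<times> 'c" assume eq: "(\<lambda>(a, b, c). segre a b c) e = (\<lambda>(a, b, c). segre a b c) e'"
      obtain a b c a' b' c' where e: "e = (a, b, c)" "e' = (a', b', c')" by (metis prod_cases3)
      have "lookup (segre a b c) v = lookup (segre a' b' c') v" for v using eq by (simp add: e)
      from this[of "Alpha a"] this[of "Beta b"] this[of "Gamma c"] show "e = e'"
        by (simp add: e segre_def lookup_add lookup_single when_def split: if_splits)
    qed
  qed (use segre_Mon in auto)
  then show ?thesis by (simp add: card_cartesian_product flip: UNIV_Times_UNIV)
qed

text \<open>If one factor, say \<open>c + 1\<close>, is at least 2, one copy of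
  \<open>(a + 1) * (b + 1)\<close> covers \<open>r\<close> and the remaining \<open>c\<close> copies
  cover \<open>a + b + c\<close>. Each of the three bounds on \<open>r\<close> serves the case in
  which the remaining dimension is positive; for a point the claim is
  \<open>r \<le> 1\<close>.\<close>

lemma dimension_inequality:
  fixes n1 n2 n3 r :: nat
  assumes "r \<le> (n1 + 1) * (n2 + 1)" "r \<le> (n1 + 1) * (n3 + 1)" "r \<le> (n2 + 1) * (n3 + 1)"
  shows "r + (n1 + n2 + n3) \<le> (n1 + 1) * (n2 + 1) * (n3 + 1)"
proof -
  have *: "r + (a + b + c) \<le> (a + 1) * (b + 1) * (c + 1)" if ab: "r \<le> (a + 1) * (b + 1)" and c: "c > 0" for a b c :: nat
  proof -
    obtain d where d: "c = Suc d" using c by (cases c) auto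
    have "(a + 1) * (b + 1) * (c + 1) = (a + 1) * (b + 1) + (a + b + c) + (a * b * c + a * d + b * d)"
      unfolding d by (simp add: algebra_simps)
    then show ?thesis using ab by linarith
  qed
  consider "n3 > 0" | "n2 > 0" | "n1 > 0" | "n1 = 0" "n2 = 0" "n3 = 0" by blast
  then show ?thesis
  proof cases
    case 1
    then show ?thesis using * assms(1) by blast
  next
    case 2
    then show ?thesis using *[OF assms(2), of n2] unfolding mult.assoc mult.commute[of "n3 + 1"] by linarith
  next
    case 3
    then show ?thesis using *[OF assms(3), of n1] unfolding mult.assoc[of "n1 + 1"] mult.commute[of "n1 + 1" "(n2 + 1) * (n3 + 1)"] by linarith
  qed (use assms in simp)
qed

context config
begin

primrec jetm :: "('a, 'b, 'c) var \<Rightarrow> ('a, 'b, 'c) monom" where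
  "jetm (Alpha a) = segre a b0 c0" | "jetm (Beta b) = segre a0 b c0" | "jetm (Gamma c) = segre a0 b0 c"

definition free_vars :: "('a, 'b, 'c) var set" where
  "free_vars = {l. spv l \<noteq> l}"

lemma card_free_vars: "card ({..<r} \<times> free_vars) = card free_idx"
proof -
  have "{..<r} \<times> free_vars = {..<r} \<times> UNIV - special"
  proof -
    have "l \<in> free_vars \<longleftrightarrow> l \<notin> {Alpha a0, Beta b0, Gamma c0}" for l by (cases l) (auto simp: free_vars_def)
    then show ?thesis by (auto simp: special_def)
  qed
  moreover have "inj_on enc ({..<r} \<times> UNIV - special)" using enc_inj by (rule inj_on_subset) auto
  ultimately show ?thesis unfolding free_idx_def by (simp add: card_image)
qed

text \<open>At the coordinate point of \<open>a0\<close>, \<open>b0\<close>, \<open>c0\<close> the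
  multilinear monomials are explicit: the product of the three special variables has value 1, and
  exchanging one of them for a free variable \<open>l\<close> gives value 0 and a single nonzero
  derivative, along \<open>l\<close>.\<close>

lemma dual_forms_jet:
  defines "q \<equiv> (\<lambda>v. if spv v = v then 1 else (0 :: complex))"
  assumes p: "p k = q"
  shows "dual_forms (Inl ` {k} \<union> Inr ` free_vars) (tang p k) (1, 1, 1)
    (\<lambda>e. case e of Inl _ \<Rightarrow> mono (segre a0 b0 c0) | Inr l \<Rightarrow> mono (jetm l))"
proof -
  have q: "q (Alpha a) = (if a = a0 then 1 else 0)" "q (Beta b) = (if b = b0 then 1 else 0)"
    "q (Gamma c) = (if c = c0 then 1 else 0)" for a b c by (auto simp: q_def)
  have z: "partial_mon l q 0 = 0" for l by (simp add: partial_mon_def)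
  have d: "partial_mon l q (segre a b c) = q (Alpha a) * (q (Beta b) * (if Gamma c = l then 1 else 0) + (if Beta b = l then q (Gamma c) else 0))
      + (if Alpha a = l then q (Beta b) * q (Gamma c) else 0)" for l a b c
    unfolding segre_def partial_mon_add z mon_ev_add mon_ev_single mon_ev_0 power_one_right mult_zero_right mult_1_right add_0_left ..
  have e: "mon_ev q (segre a b c) = q (Alpha a) * q (Beta b) * q (Gamma c)" for a b c
    by (simp only: segre_def mon_ev_add mon_ev_single mon_ev_0 power_one_right mult_1_right mult.assoc)
  have free: "Alpha a0 \<notin> free_vars" "Beta b0 \<notin> free_vars" "Gamma c0 \<notin> free_vars" by (auto simp: free_vars_def)
  show ?thesis
    unfolding dual_forms_def
  proof (intro ballI conjI)
    fix i assume i: "i \<in> Inl ` {k} \<union> Inr ` free_vars"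
    show "(case i of Inl _ \<Rightarrow> mono (segre a0 b0 c0) | Inr l \<Rightarrow> mono (jetm l)) \<in> piece (1, 1, 1)"
    proof (cases i)
      case (Inr l)
      then show ?thesis by (cases l) (auto intro: single_piece segre_Mon)
    qed (auto intro: single_piece segre_Mon)
    fix j assume j: "j \<in> Inl ` {k} \<union> Inr ` free_vars"
    show "tang p k j (case i of Inl _ \<Rightarrow> mono (segre a0 b0 c0) | Inr l \<Rightarrow> mono (jetm l)) = (if j = i then 1 else 0)"
    proof (cases i)
      case i': (Inl i')
      show ?thesis
      proof (cases j)
        case (Inr l)
        then have "l \<in> free_vars" using j by auto
        then show ?thesis using i' Inr free by (auto simp: p partial_single d)
      qed (use i i' j in \<open>auto simp: p e q\<close>)
    next
      case i': (Inr l)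
      then have l: "l \<in> free_vars" using i by auto
      show ?thesis
      proof (cases j)
        case (Inl j')
        then have "j' = k" using j by auto
        then show ?thesis using l free i' Inl by (cases l) (auto simp: p e q)
      next
        case (Inr l')
        then have l': "l' \<in> free_vars" using j by auto
        then show ?thesis using l free i' Inr by (cases l) (auto simp: p partial_single d q)
      qed
    qed
  qed
qed

text \<open>The \<open>k\<close>-th point is the coordinate point, where the jets are known; the
  other points are added greedily, which the count of monomials permits up to \<open>r\<close>
  points.\<close>

lemma dual_forms_exists:
  assumes card: "r + card free_vars \<le> card (Mon (1, 1, 1) :: ('a, 'b, 'c) monom set)" and k: "k < r"
  shows "\<exists>x\<in>supp. \<exists>g. dual_forms (Inl ` {..<r} \<union> Inr ` free_vars) (tang (cfg x) k) (1, 1, 1) g"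
proof -
  define q where "q = (\<lambda>v. if spv v = v then 1 else (0 :: complex))"
  have "\<exists>p g. p k = q \<and> dual_forms (Inl ` insert k A \<union> Inr ` free_vars) (tang p k) (1, 1, 1) g"
    if "finite A" "A \<subseteq> {..<r} - {k}" for A
    using that
  proof (induction A rule: finite_induct)
    case empty
    show ?case
      using dual_forms_jet[of "\<lambda>_. q" k] unfolding q_def by (intro exI[of _ "\<lambda>_. q"] exI conjI) (auto simp: q_def)
  next
    case (insert i A)
    then obtain p g where p: "p k = q" and g: "dual_forms (Inl ` insert k A \<union> Inr ` free_vars) (tang p k) (1, 1, 1) g" by auto
    let ?K = "Inl ` insert k A \<union> Inr ` free_vars"
    have "card (insert i (insert k A)) \<le> r" using card_mono[of "{..<r}" "insert i (insert k A)"] insert.prems k by auto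
    moreover have "i \<notin> insert k A" using insert by auto
    ultimately have "card (insert k A) < r" using insert.hyps(1) by simp
    moreover have "card ?K \<le> card (insert k A) + card free_vars"
    proof -
      have "card (Inl ` insert k A :: (nat + ('a, 'b, 'c) var) set) = card (insert k A)"
        "card (Inr ` free_vars :: (nat + ('a, 'b, 'c) var) set) = card free_vars"
        by (simp_all only: card_image inj_Inl inj_Inr)
      then show ?thesis using card_Un_le[of "Inl ` insert k A" "Inr ` free_vars"] by simp
    qed
    ultimately have cK: "card ?K < card (Mon (1, 1, 1) :: ('a, 'b, 'c) monom set)" using card by simp
    have "finite ?K" "Inl i \<notin> ?K" using insert by auto
    then obtain q' g' where g': "dual_forms (insert (Inl i) ?K) ((tang p k)(Inl i := pev q')) (1, 1, 1) g'"
      using dual_forms_greedy[OF _ cK g functional_tang] by blast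
    have "(tang p k)(Inl i := pev q') = tang (p(i := q')) k"
      using insert.prems by (auto simp: fun_eq_iff tang_def split: sum.splits)
    then have "dual_forms (Inl ` insert k (insert i A) \<union> Inr ` free_vars) (tang (p(i := q')) k) (1, 1, 1) g'"
      using g' by (simp add: insert_commute)
    moreover have "(p(i := q')) k = q" using insert.prems p by auto
    ultimately show ?case by blast
  qed
  from this[of "{..<r} - {k}"] obtain p g where g: "dual_forms (Inl ` {..<r} \<union> Inr ` free_vars) (tang p k) (1, 1, 1) g"
    using k by (auto simp: insert_absorb)
  have "tang (cfg (mk p)) k e = tang p k e" if "e \<in> Inl ` {..<r} \<union> Inr ` free_vars" for e
    using that k by (auto simp: cfg_mk)
  then have "dual_forms (Inl ` {..<r} \<union> Inr ` free_vars) (tang (cfg (mk p)) k) (1, 1, 1) g"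
    using g unfolding dual_forms_def by auto
  then show ?thesis using mk_supp by blast
qed

lemma pev_partial_cfgP: "pev x (partial l (cfgP k) F) = partial l (cfg x k) (spec x F)"
proof -
  have "partial l (cfg x k) (spec x F) = (\<Sum>m\<in>keys F. lookup (spec x F) m * partial_mon l (cfg x k) m)"
    by (rule partial_superset[OF finite_keys keys_spec])
  then show ?thesis
    by (simp add: partial_def[of l "cfgP k"] pev_sum pev_mult pev_partial_mon) (simp add: cfgP_def cfg_def[abs_def])
qed

lemma generic_dual_forms:
  assumes card: "r + card free_vars \<le> card (Mon (1, 1, 1) :: ('a, 'b, 'c) monom set)"
  obtains x0 q where "x0 \<in> supp" "pev x0 q \<noteq> 0"
    "\<And>x k. pev x q \<noteq> 0 \<Longrightarrow> k < r \<Longrightarrow> \<exists>g. dual_forms (Inl ` {..<r} \<union> Inr ` free_vars) (tang (cfg x) k) (1, 1, 1) g"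
proof -
  let ?K = "Inl ` {..<r} \<union> Inr ` free_vars :: (nat + ('a, 'b, 'c) var) set"
  have "\<forall>k\<in>{..<r}. \<exists>f. (\<exists>x\<in>supp. pev x f \<noteq> 0) \<and> (\<forall>x. pev x f \<noteq> 0 \<longrightarrow> (\<exists>g. dual_forms ?K (tang (cfg x) k) (1, 1, 1) g))"
  proof
    fix k assume "k \<in> {..<r}"
    then obtain x g where x: "x \<in> supp" and g: "dual_forms ?K (tang (cfg x) k) (1, 1, 1) g"
      using dual_forms_exists[OF card, of k] by auto
    have fK: "finite ?K" by simp
    have add: "tang cfgP k e (F + G) = tang cfgP k e F + tang cfgP k e G" for e F G
      by (cases e) (simp_all add: cfgP_linear partial_add)
    have scale: "tang cfgP k e (const_poly c * F) = c * tang cfgP k e F" for e c F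
      by (cases e) (simp_all add: cfgP_linear partial_const_mult)
    have sp: "pev x (tang cfgP k e F) = tang (cfg x) k e (spec x F)" for x e F
      by (cases e) (simp_all add: pev_cfgP pev_partial_cfgP)
    obtain f G where f: "pev x f \<noteq> 0" and G: "\<forall>e\<in>?K. G e \<in> piece (1, 1, 1) \<and> (\<forall>e'\<in>?K. tang cfgP k e' (G e) = (if e' = e then f else 0))"
      using open_dual_forms[OF fK, where \<Phi> = "tang cfgP k" and \<phi> = "\<lambda>x. tang (cfg x) k", OF add scale sp g] by blast
    have "\<exists>g. dual_forms ?K (tang (cfg x) k) (1, 1, 1) g" if "pev x f \<noteq> 0" for x
      using dual_forms_specialize[where \<Phi> = "tang cfgP k" and \<phi> = "\<lambda>x. tang (cfg x) k", OF sp functional_tang G that] by blast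
    then show "\<exists>f. (\<exists>x\<in>supp. pev x f \<noteq> 0) \<and> (\<forall>x. pev x f \<noteq> 0 \<longrightarrow> (\<exists>g. dual_forms ?K (tang (cfg x) k) (1, 1, 1) g))"
      using x f by (intro exI[of _ f] conjI) blast+
  qed
  from bchoice[OF this] obtain f where f: "\<forall>k\<in>{..<r}. (\<exists>x\<in>supp. pev x (f k) \<noteq> 0) \<and>
      (\<forall>x. pev x (f k) \<noteq> 0 \<longrightarrow> (\<exists>g. dual_forms ?K (tang (cfg x) k) (1, 1, 1) g))" ..
  have "\<exists>x. (\<forall>k\<in>{..<r}. pev x (f k) \<noteq> 0) \<and> (\<forall>v\<in>- E. x v = 0)"
  proof (rule common_nonzero_finite)
    show "\<exists>x. pev x (f k) \<noteq> 0 \<and> (\<forall>v\<in>- E. x v = 0)" if k: "k \<in> {..<r}" for k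
      using bspec[OF f k] by (auto simp: supp_def)
  qed simp
  then obtain x0 where x0: "\<forall>k\<in>{..<r}. pev x0 (f k) \<noteq> 0" "x0 \<in> supp" by (auto simp: supp_def)
  show thesis
  proof (rule that[OF x0(2), of "\<Prod>k<r. f k"])
    show "pev x0 (\<Prod>k<r. f k) \<noteq> 0" using x0(1) by (simp add: pev_prod)
    fix x k assume "pev x (\<Prod>k<r. f k) \<noteq> 0" "k < r"
    then show "\<exists>g. dual_forms ?K (tang (cfg x) k) (1, 1, 1) g" using f by (simp add: pev_prod)
  qed
qed

end

section \<open>Powers of the ideals of the variables\<close>

definition monomial_ideal :: "(degree \<Rightarrow> bool) \<Rightarrow> ('a::finite, 'b::finite, 'c::finite) coxC set" where
  "monomial_ideal P = {f. \<forall>m\<in>keys f. P (mdeg m)}"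

lemma subspace_monomial_ideal:
  assumes "\<And>u v. P u \<Longrightarrow> 0 \<le> v \<Longrightarrow> P (v + u)"
  shows "ideal.subspace (monomial_ideal P)"
proof (rule ideal.subspaceI)
  show "0 \<in> monomial_ideal P" by (simp add: monomial_ideal_def)
  show "f + g \<in> monomial_ideal P" if "f \<in> monomial_ideal P" "g \<in> monomial_ideal P" for f g
    using that Poly_Mapping.keys_add[of f g] by (auto simp: monomial_ideal_def)
  show "a * f \<in> monomial_ideal P" if "f \<in> monomial_ideal P" for a f
    using that keys_mult[of a f] assms mdeg_nonneg by (fastforce simp: monomial_ideal_def mdeg_add)
qed

lemma monomial_ideal_expand:
  assumes A: "ideal.subspace A" and f: "f \<in> monomial_ideal P" and m: "\<And>m. P (mdeg m) \<Longrightarrow> mono m \<in> A"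
  shows "f \<in> A"
proof -
  have "(\<Sum>m\<in>keys f. const_poly (lookup f m) * mono m) \<in> A"
    using f by (intro ideal.subspace_sum[OF A] ideal.subspace_scale[OF A] m) (auto simp: monomial_ideal_def)
  also have "(\<Sum>m\<in>keys f. const_poly (lookup f m) * mono m) = f" using poly_expand[of f] by simp
  finally show ?thesis .
qed

text \<open>\<open>\<pi>\<close> is one of the three components of the degree and \<open>e\<close>
  its unit vector. A monomial with \<open>\<pi>\<close> at least \<open>s\<close> splits off
  \<open>s\<close> variables of degree \<open>e\<close>, and is thus a multiple of a product of
  \<open>s\<close> elements of the ideal.\<close>

lemma ideal_power_piece:
  fixes \<pi> :: "degree \<Rightarrow> int"
  assumes add: "\<And>u v. \<pi> (u + v) = \<pi> u + \<pi> v" and nonneg: "\<And>v. 0 \<le> v \<Longrightarrow> 0 \<le> \<pi> v" and e: "\<pi> e = 1"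
    and factor: "\<And>m :: ('a::finite, 'b::finite, 'c::finite) monom. \<pi> (mdeg m) > 0 \<Longrightarrow> \<exists>z n. m = single z 1 + n \<and> vdeg z = e"
  shows "ideal_power (ideal.span (piece e)) s = (monomial_ideal (\<lambda>u. int s \<le> \<pi> u) :: ('a, 'b, 'c) coxC set)"
proof -
  let ?A = "\<lambda>s. monomial_ideal (\<lambda>u. int s \<le> \<pi> u) :: ('a, 'b, 'c) coxC set"
  let ?J = "ideal.span (piece e) :: ('a, 'b, 'c) coxC set"
  have sub: "ideal.subspace (?A s)" for s
    by (rule subspace_monomial_ideal) (use nonneg add in force)
  have J: "?J \<subseteq> ?A 1"
    by (rule ideal.span_minimal[OF _ sub]) (auto simp: monomial_ideal_def piece_def e)
  have "?J ^ s \<subseteq> ?A s"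
  proof (induction s)
    case 0
    show ?case using mdeg_nonneg nonneg by (auto simp: monomial_ideal_def set_one)
  next
    case (Suc s)
    have "f * g \<in> ?A (Suc s)" if "f \<in> ?A 1" "g \<in> ?A s" for f g
      using that keys_mult[of f g] by (fastforce simp: monomial_ideal_def mdeg_add add)
    then show ?case using Suc J by (auto elim!: set_times_elim)
  qed
  moreover have "\<exists>g\<in>?J ^ s. \<exists>n. mono m = mono n * g" if "int s \<le> \<pi> (mdeg m)" for m
    using that
  proof (induction s arbitrary: m)
    case 0
    show ?case by (rule bexI[of _ 1]) (auto simp: set_one)
  next
    case (Suc s)
    then obtain z m' where m: "m = single z 1 + m'" "vdeg z = e" using factor[of m] by auto
    then have "int s \<le> \<pi> (mdeg m')" using Suc.prems by (simp add: mdeg_add add e del: One_nat_def)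
    from Suc.IH[OF this] obtain g n where g: "g \<in> ?J ^ s" "mono m' = mono n * g" by blast
    have "mono (single z 1) \<in> ?J" using m(2) by (intro ideal.span_base single_piece) (simp add: Mon_def del: One_nat_def)
    then have "mono (single z 1) * g \<in> ?J ^ Suc s" using g(1) by (simp add: set_times_intro)
    moreover have "mono m = mono n * (mono (single z 1) * g)" unfolding m(1) mono_add g(2) by (simp only: mult.left_commute)
    ultimately show ?case by blast
  qed
  ultimately show ?thesis
    unfolding ideal_power_def
  proof (intro subset_antisym ideal.span_minimal[OF _ sub] subsetI)
    fix f assume m: "\<And>m. int s \<le> \<pi> (mdeg m) \<Longrightarrow> \<exists>g\<in>?J ^ s. \<exists>n. mono m = mono n * g" and f: "f \<in> ?A s"
    show "f \<in> ideal.span (?J ^ s)"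
    proof (rule monomial_ideal_expand[OF _ f])
      fix m :: "('a, 'b, 'c) monom" assume "int s \<le> \<pi> (mdeg m)"
      then obtain g n where "g \<in> ?J ^ s" "mono m = mono n * g" using m by blast
      then show "mono m \<in> ideal.span (?J ^ s)" by (auto intro: ideal.span_scale ideal.span_base)
    qed simp
  qed auto
qed

lemma factor_monom: "lookup m z > 0 \<Longrightarrow> \<exists>n. m = single z 1 + n"
  for m :: "'v \<Rightarrow>\<^sub>0 nat"
proof -
  assume "lookup m z > 0"
  then have "m = single z 1 + (m - single z 1)"
    by (intro poly_mapping_eqI) (auto simp: lookup_add lookup_minus lookup_single when_def)
  then show ?thesis ..
qed

lemma sum_eq_span:
  assumes "ideal.subspace A" "ideal.subspace B"
  shows "A + B = ideal.span (A \<union> B)"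
proof -
  have e: "ideal.span A = A" "ideal.span B = B" using assms by simp_all
  show ?thesis unfolding ideal.span_Un e by (auto simp: set_plus_def)
qed

lemma sum_of_powers:
  "ideal_power (ideal.span (piece (1, 0, 0))) s + ideal_power (ideal.span (piece (0, 1, 0))) t
    + ideal_power (ideal.span (piece (0, 0, 1))) u =
    (monomial_ideal (\<lambda>v. int s \<le> fst v \<or> int t \<le> fst (snd v) \<or> int u \<le> snd (snd v)) :: ('a::finite, 'b::finite, 'c::finite) coxC set)"
proof -
  have ex: "\<exists>i\<in>UNIV. f i > 0" if "(\<Sum>i\<in>UNIV. int (f i)) > 0" for f :: "'z::finite \<Rightarrow> nat"
    using that by (metis int_eq_iff less_numeral_extra(3) not_gr_zero sum.neutral of_nat_0)
  have e1: "ideal_power (ideal.span (piece (1, 0, 0))) s = (monomial_ideal (\<lambda>v. int s \<le> fst v) :: ('a, 'b, 'c) coxC set)"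
  proof (rule ideal_power_piece)
    fix m :: "('a, 'b, 'c) monom" assume "fst (mdeg m) > 0"
    then obtain a where "lookup m (Alpha a) > 0" using ex[of "\<lambda>i. lookup m (Alpha i)"] by (auto simp: mdeg_def)
    then show "\<exists>z n. m = single z 1 + n \<and> vdeg z = (1, 0, 0)" using factor_monom[of m "Alpha a"] by (metis vdeg.simps(1))
  qed (auto simp: less_eq_prod_def zero_prod_def)
  have e2: "ideal_power (ideal.span (piece (0, 1, 0))) t = (monomial_ideal (\<lambda>v. int t \<le> fst (snd v)) :: ('a, 'b, 'c) coxC set)"
  proof (rule ideal_power_piece)
    fix m :: "('a, 'b, 'c) monom" assume "fst (snd (mdeg m)) > 0"
    then obtain b where "lookup m (Beta b) > 0" using ex[of "\<lambda>i. lookup m (Beta i)"] by (auto simp: mdeg_def)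
    then show "\<exists>z n. m = single z 1 + n \<and> vdeg z = (0, 1, 0)" using factor_monom[of m "Beta b"] by (metis vdeg.simps(2))
  qed (auto simp: less_eq_prod_def zero_prod_def)
  have e3: "ideal_power (ideal.span (piece (0, 0, 1))) u = (monomial_ideal (\<lambda>v. int u \<le> snd (snd v)) :: ('a, 'b, 'c) coxC set)"
  proof (rule ideal_power_piece)
    fix m :: "('a, 'b, 'c) monom" assume "snd (snd (mdeg m)) > 0"
    then obtain c where "lookup m (Gamma c) > 0" using ex[of "\<lambda>i. lookup m (Gamma i)"] by (auto simp: mdeg_def)
    then show "\<exists>z n. m = single z 1 + n \<and> vdeg z = (0, 0, 1)" using factor_monom[of m "Gamma c"] by (metis vdeg.simps(3))
  qed (auto simp: less_eq_prod_def zero_prod_def)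
  let ?C = "monomial_ideal (\<lambda>v. int s \<le> fst v \<or> int t \<le> fst (snd v) \<or> int u \<le> snd (snd v)) :: ('a, 'b, 'c) coxC set"
  let ?A = "monomial_ideal (\<lambda>v. int s \<le> fst v) :: ('a, 'b, 'c) coxC set"
  let ?B = "monomial_ideal (\<lambda>v. int t \<le> fst (snd v)) :: ('a, 'b, 'c) coxC set"
  let ?G = "monomial_ideal (\<lambda>v. int u \<le> snd (snd v)) :: ('a, 'b, 'c) coxC set"
  have sC: "ideal.subspace ?C" by (rule subspace_monomial_ideal) (auto simp: less_eq_prod_def zero_prod_def)
  have sA: "ideal.subspace ?A" by (rule subspace_monomial_ideal) (auto simp: less_eq_prod_def zero_prod_def)
  have sB: "ideal.subspace ?B" by (rule subspace_monomial_ideal) (auto simp: less_eq_prod_def zero_prod_def)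
  have sG: "ideal.subspace ?G" by (rule subspace_monomial_ideal) (auto simp: less_eq_prod_def zero_prod_def)
  have sS: "?A + ?B + ?G = (ideal.span (ideal.span (?A \<union> ?B) \<union> ?G) :: ('a, 'b, 'c) coxC set)"
    unfolding sum_eq_span[OF sA sB] by (rule sum_eq_span[OF ideal.subspace_span sG])
  have "?A + ?B + ?G = ?C"
  proof
    show "?A + ?B + ?G \<subseteq> ?C"
      by (auto elim!: set_plus_elim intro!: ideal.subspace_add[OF sC]) (auto simp: monomial_ideal_def)
    show "?C \<subseteq> ?A + ?B + ?G"
      unfolding sS
    proof
      fix f assume f: "f \<in> ?C"
      show "f \<in> ideal.span (ideal.span (?A \<union> ?B) \<union> ?G)"
        by (rule monomial_ideal_expand[OF ideal.subspace_span f])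
          (auto intro!: ideal.span_base simp: monomial_ideal_def)
    qed
  qed
  then show ?thesis unfolding e1 e2 e3 .
qed

text \<open>A monomial ideal defined by degrees contains a whole graded piece or nothing of it, so
  adding it changes \<open>I\<close> only by filling the pieces in \<open>P\<close>.\<close>

lemma homogeneous_add_monomial_ideal:
  fixes I :: "('a::finite, 'b::finite, 'c::finite) coxC set"
  assumes I: "homogeneous_ideal I" and P: "\<And>u v. P u \<Longrightarrow> 0 \<le> v \<Longrightarrow> P (v + u)"
  shows "homogeneous_ideal (I + monomial_ideal P)"
    and "\<And>u f. \<not> P u \<Longrightarrow> f \<in> piece u \<Longrightarrow> f \<in> I + monomial_ideal P \<longleftrightarrow> f \<in> I"
    and "\<And>u. P u \<Longrightarrow> piece u \<subseteq> I + monomial_ideal P"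
proof -
  have sI: "ideal.subspace I" using I by (rule homogeneous_ideal_subspace)
  have sM: "ideal.subspace (monomial_ideal P)" by (rule subspace_monomial_ideal) (rule P)
  have hM: "hcomp u f \<in> monomial_ideal P" if "f \<in> monomial_ideal P" for u f
    using that by (auto simp: monomial_ideal_def in_keys_iff lookup_hcomp split: if_splits)
  show "homogeneous_ideal (I + monomial_ideal P)"
  proof (rule homogeneous_idealI)
    show "ideal.subspace (I + monomial_ideal P)"
      unfolding sum_eq_span[OF sI sM] by simp
    show "hcomp u f \<in> I + monomial_ideal P" if "f \<in> I + monomial_ideal P" for f u
      using that by (auto elim!: set_plus_elim simp: hcomp_add intro!: set_plus_intro hM homogeneous_ideal_hcomp[OF I])
  qed
  show "f \<in> I + monomial_ideal P \<longleftrightarrow> f \<in> I" if u: "\<not> P u" and f: "f \<in> piece u" for u f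
  proof
    assume "f \<in> I"
    then show "f \<in> I + monomial_ideal P" using set_plus_intro[of f I 0] ideal.subspace_0[OF sM] by simp
  next
    assume "f \<in> I + monomial_ideal P"
    then obtain a b where ab: "f = a + b" "a \<in> I" "b \<in> monomial_ideal P" by (auto elim: set_plus_elim)
    have "hcomp u b = 0"
      by (rule poly_mapping_eqI) (use ab(3) u in \<open>auto simp: lookup_hcomp monomial_ideal_def in_keys_iff\<close>)
    then have "f = hcomp u a" using hcomp_of_piece[OF f, of u] by (simp add: ab(1) hcomp_add)
    then show "f \<in> I" using homogeneous_ideal_hcomp[OF I ab(2)] by simp
  qed
  show "piece u \<subseteq> I + monomial_ideal P" if "P u" for u
  proof
    fix f :: "('a, 'b, 'c) coxC" assume "f \<in> piece u"
    then have "f \<in> monomial_ideal P" using that by (auto simp: monomial_ideal_def piece_def)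
    then show "f \<in> I + monomial_ideal P" using set_plus_intro[OF ideal.subspace_0[OF sI]] by force
  qed
qed

section \<open>The dimension of the space of homomorphisms\<close>

theorem proposition3p3:
  fixes n1 n2 n3 r s t u :: nat
    and I K :: "('a::finite, 'b::finite, 'c::finite) coxC set"
  assumes n1: "CARD('a) = n1 + 1"
    and n2: "CARD('b) = n2 + 1"
    and n3: "CARD('c) = n3 + 1"
    and r_pos: "r > 0"
    and r_le: "r \<le> Min {(n1 + 1) * (n2 + 1), (n1 + 1) * (n3 + 1), (n2 + 1) * (n3 + 1)}"
    and I_hilb: "I \<in> hilb (generic_hf TYPE(('a, 'b, 'c) var) r)"
    and stu_pos: "s > 0" "t > 0" "u > 0"
    and K: "K = I + ideal_power (ideal.span (piece (1, 0, 0))) s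
                  + ideal_power (ideal.span (piece (0, 1, 0))) t
                  + ideal_power (ideal.span (piece (0, 0, 1))) u"
    and I_slip: "I \<in> slip r"
    and stu_ge: "s \<ge> 2" "t \<ge> 2" "u \<ge> 2"
  shows "ereal_of_enat (dim_hom0 K)
           \<ge> krull_dim (slip_topology r :: ('a, 'b, 'c) coxC set topology) \<and>
         krull_dim (slip_topology r :: ('a, 'b, 'c) coxC set topology)
           = ereal (real (r * (n1 + n2 + n3)))"
proof -
  define h where "h = generic_hf TYPE(('a, 'b, 'c) var) r"
  let ?w = "(1, 1, 1) :: degree"
  have rle: "r \<le> (n1 + 1) * (n2 + 1)" "r \<le> (n1 + 1) * (n3 + 1)" "r \<le> (n2 + 1) * (n3 + 1)"
    using r_le by simp_all
  have card_w: "r + (n1 + n2 + n3) \<le> card (Mon ?w :: ('a, 'b, 'c) monom set)"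
    using dimension_inequality[OF rle] card_Mon_111[where ?'a = 'a and ?'b = 'b and ?'c = 'c]
    unfolding n1 n2 n3 by linarith
  have hw: "h ?w = r" using card_w by (simp add: h_def generic_hf_eq)

  \<comment> \<open>Any reference coordinates will do; they only select an affine chart of each
    factor.\<close>
  fix a0 :: 'a and b0 :: 'b and c0 :: 'c
  obtain enc' :: "nat \<times> ('a, 'b, 'c) var \<Rightarrow> nat" where "config r h enc'"
    using config_exists[OF r_pos h_def] .
  then interpret G: config r h enc' a0 b0 c0 .
  let ?T = "{..<r} \<times> G.free_vars"
  have cT: "card ?T = r * (n1 + n2 + n3)"
    unfolding G.card_free_vars G.card_free_idx n1 n2 n3 by simp
  have dim: "krull_dim (slip_topology r :: ('a, 'b, 'c) coxC set topology) = ereal (real (r * (n1 + n2 + n3)))"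
    using G.krull_dim_slip[OF _ hw] cT by (simp add: G.card_free_vars zero_prod_def less_eq_prod_def)
  have "card G.free_vars = n1 + n2 + n3" using cT r_pos by (simp add: card_cartesian_product)
  then obtain y0 q where q: "y0 \<in> G.supp" "pev y0 q \<noteq> 0"
    and jets: "\<And>x k. pev x q \<noteq> 0 \<Longrightarrow> k < r \<Longrightarrow>
      \<exists>g. dual_forms (Inl ` {..<r} \<union> Inr ` G.free_vars) (tang (G.cfg x) k) ?w g"
    using G.generic_dual_forms card_w by metis

  \<comment> \<open>The summands \<open>s\<close>, \<open>t\<close>, \<open>u\<close> make the box
    of the chart around \<open>I\<close> contain all degrees below \<open>(s, t, u)\<close>.\<close>
  define r' where "r' = r + s + t + u"
  define N where "N = (CARD('a) + CARD('b) + CARD('c)) * (r' + 1)"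
  have r': "r \<le> r'" by (simp add: r'_def)
  obtain B enc x0 where ch: "chart r r' N h B enc" and x0: "x0 \<in> chart.pts N h B enc" "chart.Ix N B enc x0 = I"
    using chart_exists[OF I_hilb r' N_def h_def] .
  interpret C: chart r r' N h B enc by (rule ch)
  define Dh where "Dh = {v :: degree. 0 \<le> v \<and> fst v < int s \<and> fst (snd v) < int t \<and> snd (snd v) < int u}"
  have "r' + 1 \<le> N" unfolding N_def n1 by simp
  then have "int s \<le> int N" "int t \<le> int N" "int u \<le> int N" by (simp_all add: r'_def)
  then have DhD: "Dh \<subseteq> C.D" unfolding Dh_def box_def by (force simp: less_eq_prod_def)
  then have fDh: "finite Dh" by (rule finite_subset) simp
  \<comment> \<open>The degree in which the tangent vectors are seen to be independent survives the
    truncation because \<open>s\<close>, \<open>t\<close>, \<open>u\<close> are at least 2.\<close>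
  have wDh: "?w \<in> Dh" using stu_ge by (simp add: Dh_def less_eq_prod_def zero_prod_def)

  define P where "P v \<longleftrightarrow> int s \<le> fst v \<or> int t \<le> fst (snd v) \<or> int u \<le> snd (snd v)" for v :: degree
  have P: "P (v' + v)" if "P v" "0 \<le> v'" for v v'
    using that by (auto simp: P_def less_eq_prod_def zero_prod_def)
  have K': "K = I + monomial_ideal P"
    unfolding K add.assoc by (simp only: add.assoc[symmetric] sum_of_powers[unfolded add.assoc[symmetric]] P_def[abs_def])
  have I: "homogeneous_ideal I" using I_hilb by (rule hilb_homogeneous)
  have KI: "homogeneous_ideal K"
    unfolding K' by (rule homogeneous_add_monomial_ideal(1)[where P = P, OF I P])
  have KD: "f \<in> K \<longleftrightarrow> f \<in> C.Ix x0" if "v \<in> Dh" "f \<in> piece v" for v f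
  proof -
    have "\<not> P v" using that(1) by (auto simp: Dh_def P_def)
    then show ?thesis
      unfolding K' x0(2) using homogeneous_add_monomial_ideal(2)[where P = P, OF I P _ that(2)] by blast
  qed
  have Kp: "piece v \<subseteq> K" if "v \<notin> Dh" for v
  proof (cases "0 \<le> v")
    case True
    then have "P v" using that by (auto simp: Dh_def P_def)
    then show ?thesis unfolding K' using homogeneous_add_monomial_ideal(3)[where P = P, OF I P] by blast
  next
    case False
    then have "(piece v :: ('a, 'b, 'c) coxC set) = {0}" using Mon_neg[OF False, where ?'a = 'a and ?'b = 'b and ?'c = 'c]
      by (auto simp: piece_iff)
    then show ?thesis using ideal.subspace_0[OF homogeneous_ideal_subspace[OF KI]] by simp
  qed
  have down: "v \<in> Dh" if "vdeg z + v \<in> Dh" "0 \<le> v" for z :: "('a, 'b, 'c) var" and v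
    using that by (cases z) (auto simp: Dh_def less_eq_prod_def zero_prod_def)

  \<comment> \<open>\<open>card E\<close> is attained by independent solutions at \<open>I\<close>
    and bounds their number at all chart points near \<open>I\<close>. It remains to find
    \<open>r * (n1 + n2 + n3)\<close> of them at one such point.\<close>
  obtain E :: "(('a, 'b, 'c) monom \<times> ('a, 'b, 'c) monom) set" and w where E: "finite E" "\<And>e. e \<in> E \<Longrightarrow> w e \<in> C.Sol Dh x0" "C.indep_on Dh E w"
    and ex: "\<exists>f. pev x0 f \<noteq> 0 \<and> (\<forall>x. pev x f \<noteq> 0 \<longrightarrow> (\<forall>T :: (nat \<times> ('a, 'b, 'c) var) set. \<forall>y. finite T \<longrightarrow>
      (\<forall>t\<in>T. y t \<in> C.Sol Dh x) \<longrightarrow> C.indep_on Dh T y \<longrightarrow> card T \<le> card E))"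
    by (rule C.Sol_semicontinuous[OF fDh DhD]) (rule that)
  obtain f where f: "pev x0 f \<noteq> 0" and fT: "\<forall>x. pev x f \<noteq> 0 \<longrightarrow> (\<forall>T :: (nat \<times> ('a, 'b, 'c) var) set. \<forall>y. finite T \<longrightarrow>
      (\<forall>t\<in>T. y t \<in> C.Sol Dh x) \<longrightarrow> C.indep_on Dh T y \<longrightarrow> card T \<le> card E)"
    using ex by (elim exE conjE) (rule that)
  define U where "U = {I. \<exists>x\<in>C.pts. I = C.Ix x \<and> pev x f \<noteq> 0}"
  have IU: "I \<in> U" using x0 f by (auto simp: U_def)
  have closed: "closedin (hilb_topology h) (hilb h - U)"
    unfolding U_def by (rule hilb_closed_compl[OF C.chart_open])
  \<comment> \<open>If no general configuration had its ideal in the neighbourhood \<open>U\<close>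
    of \<open>I\<close>, the closed complement of \<open>U\<close> would contain the slip component,
    and with it \<open>I\<close>.\<close>
  obtain x where x: "pev x q \<noteq> 0" "G.good x" "G.\<I> x \<in> U"
  proof (rule ccontr)
    assume no: "\<not> thesis"
    have "slip r \<subseteq> hilb h - U"
      by (rule G.slip_subset_closed[OF closed q]) (use no that in \<open>auto simp: G.good_def\<close>)
    then show False using I_slip IU by blast
  qed
  obtain \<xi> where \<xi>: "\<xi> \<in> C.pts" "C.Ix \<xi> = G.\<I> x" "pev \<xi> f \<noteq> 0" using x(3) by (auto simp: U_def)
  obtain y where y: "\<forall>t\<in>?T. y t \<in> C.Sol Dh \<xi>" "C.indep_on Dh ?T y"
    using C.tangent_vectors[OF \<xi>(1,2) DhD wDh hw _ jets[OF x(1)]] by auto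
  have "finite ?T" by simp
  then have "card ?T \<le> card E" using fT \<xi>(3) y by blast
  moreover have "enat (card E) \<le> dim_hom0 K"
    by (rule C.dim_hom0_ge[OF x0(1) fDh DhD down KI KD Kp E])
  ultimately have "enat (r * (n1 + n2 + n3)) \<le> dim_hom0 K" unfolding cT by (meson enat_ord_simps(1) order_trans)
  then have "ereal_of_enat (enat (r * (n1 + n2 + n3))) \<le> ereal_of_enat (dim_hom0 K)" by (simp only: ereal_of_enat_le_iff)
  then show ?thesis unfolding dim ereal_of_enat_simps(1) by (rule conjI[OF _ refl])
qed

end
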